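(* Let $I\subseteq[0,\frac{\pi}{4}]$ be an interval of positive length $|I|$, and for $0<\varepsilon<\frac12$ let $\tilde\nu^I_\varepsilon$ and $\nu^I_\varepsilon$ be the probability measures on $[0,\infty)$ defined by $$\tilde\nu^I_\varepsilon(f)=\frac1{|I|}\int_I f\big(\varepsilon\tilde R_\varepsilon(\omega)\big)\,d\omega,\qquad \nu^I_\varepsilon(f)=\frac1{|I|}\int_I f\big(\varepsilon R_\varepsilon(\omega)\big)\,d\omega,\qquad f\in C_c([0,\infty)).$$ There exist probability measures $\tilde\nu^I$ and $\nu^I$ on $[0,\sqrt2]$ such that $$\tilde\nu^I_\varepsilon\to\tilde\nu^I\quad\text{and}\quad\nu^I_\varepsilon\to\nu^I\quad\text{weakly as }\varepsilon\to0^+ .$$ Moreover, for every integer $n\ge1$, the moments of $\tilde\nu^I$ and $\nu^I$ are $$\int_0^\infty t^n\,d\tilde\nu^I(t)=\frac{c_n}{|I|}\int_I(\sin x+\cos x)^n\,dx\qquad\text{and respectively}\qquad\int_0^\infty t^n\,d\nu^I(t)=\frac{c_n}{|I|}\int_I(1+\tan x)^n\,dx,$$ where $$c_n=\frac{12}{\pi^2}\int_0^{1/2}\left( x\big(x^{n-1}+(1-x)^{n-1}\big)+\frac{1-(1-x)^n}{nx(1-x)}-\frac{1-(1-x)^{n+1}}{(n+1)x(1-x)}\right)dx .$$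
   Context: Let $\mathbb{Z}^{2*}=\mathbb{Z}^2\setminus\{(0,0)\}$. For $0<\varepsilon<\frac12$ put $D_\varepsilon=\{(x,y)\in\mathbb{R}^2:x^2+y^2=\varepsilon^2\}$ and $C_\varepsilon=\big(\{0\}\times[-\varepsilon,\varepsilon]\big)\cup\big([-\varepsilon,\varepsilon]\times\{0\}\big)$, and for a direction (angle) $\omega$ let $$\tilde\tau_\varepsilon(\omega)=\inf\{\tau>0:(\tau\cos\omega,\tau\sin\omega)\in D_\varepsilon+\mathbb{Z}^{2*}\},\qquad l_\varepsilon(\omega)=\inf\{\tau>0:(\tau\cos\omega,\tau\sin\omega)\in C_\varepsilon+\mathbb{Z}^{2*}\}.$$ A point-like particle starts at the corner $(0,0)$ of the square billiard table $[0,1]^2$ in direction $\omega$ with unit speed, with specular reflections in the side cushions, and stops when its unfolded (straight) trajectory hits a scatterer, i.e. at time $\tilde\tau_\varepsilon(\omega)$ for circular scatterers (pockets in the form of quarters of a disc of radius $\varepsilon$ at the corners) and at time $l_\varepsilon(\omega)$ for cross-like scatterers. $\tilde R_\varepsilon(\omega)$ (circular scatterers), respectively $R_\varepsilon(\omega)$ (cross-like scatterers), is the number of reflections in the side cushions before the particle stops; in the unfolded picture these reflections are the crossings of the integer vertical and horizontal lines by the straight trajectory. $C_c([0,\infty))$ is the space of compactly supported continuous functions on $[0,\infty)$; measures on $[0,\sqrt2]$ are viewed as measures on $[0,\infty)$ supported there.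
   Formalization: The claim that ν^I (cross-like scatterers) lives on [0,√2] contradicts the stated moments when I reaches past π/8; it is replaced by ν^I on [0,2] for every I, and on [0,√2] whenever I ⊆ [0,π/8]. *)

theory Defs
  imports "HOL-Probability.Probability"
begin

definition lattice_star :: "(real \<times> real) set" where
  "lattice_star = range (\<lambda>(m::int, n::int). (of_int m, of_int n)) - {(0, 0)}"

definition circular_scatterer :: "real \<Rightarrow> (real \<times> real) set" where
  "circular_scatterer \<epsilon> = {(x, y). x\<^sup>2 + y\<^sup>2 = \<epsilon>\<^sup>2}"

definition cross_scatterer :: "real \<Rightarrow> (real \<times> real) set" where
  "cross_scatterer \<epsilon> = ({0} \<times> {-\<epsilon>..\<epsilon>}) \<union> ({-\<epsilon>..\<epsilon>} \<times> {0})"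

text \<open>For the two scatterers and \<open>0 < \<epsilon>\<close> the infimum below is over a nonempty set: by Dirichlet's
  theorem every direction hits a scatterer.\<close>

definition hitting_time :: "(real \<times> real) set \<Rightarrow> real \<Rightarrow> real" where
  "hitting_time K \<omega> =
     Inf {\<tau>. \<tau> > 0 \<and> (\<tau> * cos \<omega>, \<tau> * sin \<omega>) \<in> {p + z |p z. p \<in> K \<and> z \<in> lattice_star}}"

definition circular_time :: "real \<Rightarrow> real \<Rightarrow> real" where
  "circular_time \<epsilon> = hitting_time (circular_scatterer \<epsilon>)"

definition cross_time :: "real \<Rightarrow> real \<Rightarrow> real" where
  "cross_time \<epsilon> = hitting_time (cross_scatterer \<epsilon>)"

text \<open>Number of integer vertical and horizontal lines crossed by the unfolded trajectory strictly
  between the times \<open>0\<close> and \<open>T\<close>. The trajectory starts on the lines \<open>x = 0\<close> and \<open>y = 0\<close> and never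
  crosses them afterwards (it may run inside one of them), whence \<open>k \<noteq> 0\<close>. Every other line is met
  at most once, so counting lines is counting crossings.\<close>

definition reflections :: "real \<Rightarrow> real \<Rightarrow> nat" where
  "reflections T \<omega> =
     card {k::int. k \<noteq> 0 \<and> (\<exists>t. 0 < t \<and> t < T \<and> t * cos \<omega> = of_int k)} +
     card {k::int. k \<noteq> 0 \<and> (\<exists>t. 0 < t \<and> t < T \<and> t * sin \<omega> = of_int k)}"

definition circular_reflections :: "real \<Rightarrow> real \<Rightarrow> nat" where
  "circular_reflections \<epsilon> \<omega> = reflections (circular_time \<epsilon> \<omega>) \<omega>"

definition cross_reflections :: "real \<Rightarrow> real \<Rightarrow> nat" where
  "cross_reflections \<epsilon> \<omega> = reflections (cross_time \<epsilon> \<omega>) \<omega>"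

text \<open>The law of \<open>\<epsilon> R(\<omega>)\<close> for \<open>\<omega>\<close> uniformly distributed on \<open>I\<close>, as a Borel measure on the real line
  (it charges only nonnegative reals). The integral formula characterising it is proved below.\<close>

definition scaled_law :: "real set \<Rightarrow> real \<Rightarrow> (real \<Rightarrow> nat) \<Rightarrow> real measure" where
  "scaled_law I \<epsilon> R = distr (uniform_measure lborel I) borel (\<lambda>\<omega>. \<epsilon> * real (R \<omega>))"

definition circular_law :: "real set \<Rightarrow> real \<Rightarrow> real measure" where
  "circular_law I \<epsilon> = scaled_law I \<epsilon> (circular_reflections \<epsilon>)"

definition cross_law :: "real set \<Rightarrow> real \<Rightarrow> real measure" where
  "cross_law I \<epsilon> = scaled_law I \<epsilon> (cross_reflections \<epsilon>)"

text \<open>Weak convergence along an arbitrary filter; the library's \<open>weak_conv_m\<close> is for sequences only.\<close>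

definition weakly_converges :: "('i \<Rightarrow> real measure) \<Rightarrow> real measure \<Rightarrow> 'i filter \<Rightarrow> bool" where
  "weakly_converges \<mu> \<nu> F \<longleftrightarrow>
     (\<forall>f::real \<Rightarrow> real. continuous_on UNIV f \<and> bounded (range f) \<longrightarrow>
        ((\<lambda>i. integral\<^sup>L (\<mu> i) f) \<longlongrightarrow> integral\<^sup>L \<nu> f) F)"

definition c_moment :: "nat \<Rightarrow> real" where
  "c_moment n = 12 / pi\<^sup>2 *
     (LBINT x:{0..1/2}. x * (x ^ (n - 1) + (1 - x) ^ (n - 1))
        + (1 - (1 - x) ^ n) / (real n * x * (1 - x))
        - (1 - (1 - x) ^ (n + 1)) / ((real n + 1) * x * (1 - x)))"

lemma countable_lattice_star: "countable lattice_star"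
  unfolding lattice_star_def by (intro countable_Diff countable_image) auto

lemma closed_circular_scatterer: "closed (circular_scatterer \<epsilon>)"
  unfolding circular_scatterer_def case_prod_unfold
  by (intro closed_Collect_eq continuous_intros)

lemma closed_cross_scatterer: "closed (cross_scatterer \<epsilon>)"
  unfolding cross_scatterer_def by (intro closed_Un closed_Times) auto

lemma open_interval_as_Union:
  "{0<..<a::real} = (\<Union>n. {1 / real (Suc n) .. a - 1 / real (Suc n)})" (is "?L = ?R")
proof
  show "?R \<subseteq> ?L"
  proof
    fix x assume "x \<in> ?R"
    then obtain n where "1 / real (Suc n) \<le> x" "x \<le> a - 1 / real (Suc n)" by auto
    moreover have "0 < 1 / real (Suc n)" by simp
    ultimately have "0 < x" "x < a" by linarith+
    then show "x \<in> ?L" by simp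
  qed
  show "?L \<subseteq> ?R"
  proof
    fix x assume "x \<in> ?L"
    then have "0 < min x (a - x)" by simp
    then obtain n where "1 / real (Suc n) < min x (a - x)"
      using nat_approx_posE by blast
    then have "x \<in> {1 / real (Suc n) .. a - 1 / real (Suc n)}" by auto
    then show "x \<in> ?R" by blast
  qed
qed

lemma hit_before_borel:
  assumes K: "closed K"
  shows "{\<omega>. \<exists>\<tau>\<in>{0<..<a}. (\<tau> * cos \<omega>, \<tau> * sin \<omega>) \<in> {p + z |p z. p \<in> K \<and> z \<in> lattice_star}}
           \<in> sets borel"
proof -
  let ?C = "\<lambda>z n. {\<omega>. \<exists>\<tau>. \<tau> \<in> {1 / real (Suc n) .. a - 1 / real (Suc n)} \<and>
                          (\<tau>, \<omega>) \<in> {x. (fst x * cos (snd x), fst x * sin (snd x)) - z \<in> K}}"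
  have "closed (?C z n)" for z n
  proof (intro closed_compact_projection compact_Icc)
    have "continuous_on UNIV (\<lambda>x::real \<times> real. (fst x * cos (snd x), fst x * sin (snd x)) - z)"
      by (intro continuous_intros)
    then show "closed {x::real \<times> real. (fst x * cos (snd x), fst x * sin (snd x)) - z \<in> K}"
      using closed_vimage[OF K, of "\<lambda>x. (fst x * cos (snd x), fst x * sin (snd x)) - z"]
      by (simp add: vimage_def)
  qed
  then have "(\<Union>z\<in>lattice_star. \<Union>n. ?C z n) \<in> sets borel"
    using countable_lattice_star by (intro sets.countable_UN'' sets.countable_UN borel_closed) auto
  also have "(\<Union>z\<in>lattice_star. \<Union>n. ?C z n) =
     {\<omega>. \<exists>\<tau>\<in>{0<..<a}. (\<tau> * cos \<omega>, \<tau> * sin \<omega>) \<in> {p + z |p z. p \<in> K \<and> z \<in> lattice_star}}"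
    (is "?L = ?R")
  proof
    show "?L \<subseteq> ?R"
    proof
      fix \<omega> assume "\<omega> \<in> ?L"
      then obtain z n \<tau> where *: "z \<in> lattice_star" "\<tau> \<in> {1 / real (Suc n) .. a - 1 / real (Suc n)}"
        "(\<tau> * cos \<omega>, \<tau> * sin \<omega>) - z \<in> K" by auto
      have "\<tau> \<in> {0<..<a}" unfolding open_interval_as_Union using *(2) by blast
      moreover have "(\<tau> * cos \<omega>, \<tau> * sin \<omega>) = ((\<tau> * cos \<omega>, \<tau> * sin \<omega>) - z) + z" by simp
      ultimately show "\<omega> \<in> ?R" using * by blast
    qed
    show "?R \<subseteq> ?L"
    proof
      fix \<omega> assume "\<omega> \<in> ?R"
      then obtain \<tau> p z where *: "\<tau> \<in> {0<..<a}" "(\<tau> * cos \<omega>, \<tau> * sin \<omega>) = p + z" "p \<in> K"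
        "z \<in> lattice_star" by blast
      from *(1) obtain n where "\<tau> \<in> {1 / real (Suc n) .. a - 1 / real (Suc n)}"
        unfolding open_interval_as_Union by blast
      moreover have "(\<tau> * cos \<omega>, \<tau> * sin \<omega>) - z \<in> K" using *(2,3) by simp
      ultimately have "\<omega> \<in> ?C z n" by auto
      then show "\<omega> \<in> ?L" using *(4) by blast
    qed
  qed
  finally show ?thesis .
qed

lemma hitting_time_measurable:
  assumes K: "closed K"
  shows "hitting_time K \<in> borel_measurable borel"
proof (rule borel_measurable_iff_less[THEN iffD2], rule allI)
  fix a
  define H where "H \<omega> = {\<tau>. \<tau> > 0 \<and>
      (\<tau> * cos \<omega>, \<tau> * sin \<omega>) \<in> {p + z |p z. p \<in> K \<and> z \<in> lattice_star}}" for \<omega>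
  define B where "B b = {\<omega>. \<exists>\<tau>\<in>{0<..<b}.
      (\<tau> * cos \<omega>, \<tau> * sin \<omega>) \<in> {p + z |p z. p \<in> K \<and> z \<in> lattice_star}}" for b
  define N where "N = - (\<Union>n::nat. B (real n))"
  have B: "B b \<in> sets borel" for b
    unfolding B_def by (rule hit_before_borel[OF K])
  have N: "N \<in> sets borel" unfolding N_def using B by (auto intro: borel_comp)
  have N_iff: "\<omega> \<in> N \<longleftrightarrow> H \<omega> = {}" for \<omega>
  proof -
    have "(\<exists>n::nat. \<omega> \<in> B (real n)) \<longleftrightarrow> H \<omega> \<noteq> {}"
      unfolding B_def H_def using reals_Archimedean2 by fastforce
    then show ?thesis unfolding N_def by blast
  qed
  have bdd: "bdd_below (H \<omega>)" for \<omega>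
    unfolding H_def by (rule bdd_belowI[of _ 0]) auto
  have "{\<omega>. hitting_time K \<omega> < a} = B a \<union> (if Inf ({}::real set) < a then N else {})"
  proof (intro set_eqI)
    fix \<omega>
    have h: "hitting_time K \<omega> = Inf (H \<omega>)" unfolding hitting_time_def H_def ..
    have b: "\<omega> \<in> B a \<longleftrightarrow> (\<exists>\<tau>\<in>H \<omega>. \<tau> < a)" unfolding B_def H_def
      by (simp only: Bex_def greaterThanLessThan_iff mem_Collect_eq) blast
    show "\<omega> \<in> {\<omega>. hitting_time K \<omega> < a} \<longleftrightarrow>
        \<omega> \<in> B a \<union> (if Inf ({}::real set) < a then N else {})"
    proof (cases "H \<omega> = {}")
      case True
      then show ?thesis using b N_iff[of \<omega>] by (simp add: h)
    next
      case False
      then show ?thesis using b N_iff[of \<omega>] cInf_less_iff[OF False bdd] by (simp add: h)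
    qed
  qed
  also have "\<dots> \<in> sets borel" using B N by auto
  finally show "{\<omega> \<in> space borel. hitting_time K \<omega> < a} \<in> sets borel" by simp
qed

lemma crossings_measurable:
  fixes g T :: "real \<Rightarrow> real"
  assumes [measurable]: "g \<in> borel_measurable borel" "T \<in> borel_measurable borel"
  shows "(\<lambda>\<omega>. card {k::int. k \<noteq> 0 \<and> (\<exists>t. 0 < t \<and> t < T \<omega> \<and> t * g \<omega> = of_int k)})
           \<in> measurable borel (count_space UNIV)"
proof -
  let ?P = "\<lambda>\<omega> k. k \<noteq> 0 \<and> (\<exists>t. 0 < t \<and> t < T \<omega> \<and> t * g \<omega> = of_int (k::int))"
  have P: "?P \<omega> k \<longleftrightarrow> k \<noteq> 0 \<and> g \<omega> \<noteq> 0 \<and> 0 < of_int k / g \<omega> \<and> of_int k / g \<omega> < T \<omega>" for \<omega> k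
  proof
    assume "?P \<omega> k"
    then obtain t where t: "k \<noteq> 0" "0 < t" "t < T \<omega>" "t * g \<omega> = of_int k" by blast
    then have "g \<omega> \<noteq> 0" by auto
    moreover have "of_int k / g \<omega> = t" using t(4) \<open>g \<omega> \<noteq> 0\<close> by (simp add: field_simps)
    ultimately show "k \<noteq> 0 \<and> g \<omega> \<noteq> 0 \<and> 0 < of_int k / g \<omega> \<and> of_int k / g \<omega> < T \<omega>"
      using t by simp
  next
    assume "k \<noteq> 0 \<and> g \<omega> \<noteq> 0 \<and> 0 < of_int k / g \<omega> \<and> of_int k / g \<omega> < T \<omega>"
    then show "?P \<omega> k" by (intro conjI exI[of _ "of_int k / g \<omega>"]) auto
  qed
  have eq: "card {k. ?P \<omega> k} = card {i. ?P \<omega> (from_nat i) \<and> i \<in> range (to_nat :: int \<Rightarrow> nat)}" for \<omega>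
  proof -
    have "{i. ?P \<omega> (from_nat i) \<and> i \<in> range (to_nat :: int \<Rightarrow> nat)} = to_nat ` {k. ?P \<omega> k}"
    proof (intro set_eqI iffI)
      fix i assume "i \<in> {i. ?P \<omega> (from_nat i) \<and> i \<in> range (to_nat :: int \<Rightarrow> nat)}"
      then obtain k :: int where k: "i = to_nat k" "?P \<omega> (from_nat i)" by blast
      then have "k \<in> {k. ?P \<omega> k}" by simp
      then show "i \<in> to_nat ` {k. ?P \<omega> k}" using k(1) by blast
    next
      fix i assume "i \<in> to_nat ` {k. ?P \<omega> k}"
      then show "i \<in> {i. ?P \<omega> (from_nat i) \<and> i \<in> range (to_nat :: int \<Rightarrow> nat)}" by auto
    qed
    then show ?thesis by (simp add: card_image)
  qed
  show ?thesis unfolding eq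
  proof (rule measurable_card)
    fix i
    show "{x \<in> space borel. i \<in> {i. ?P x (from_nat i) \<and> i \<in> range (to_nat :: int \<Rightarrow> nat)}}
            \<in> sets borel"
      unfolding P mem_Collect_eq by measurable
  qed
qed

lemma reflections_measurable:
  assumes "closed K"
  shows "(\<lambda>\<omega>. reflections (hitting_time K \<omega>) \<omega>) \<in> measurable borel (count_space UNIV)"
proof -
  note [measurable] = hitting_time_measurable[OF assms]
  have [measurable]: "cos \<in> borel_measurable (borel :: real measure)"
    "sin \<in> borel_measurable (borel :: real measure)"
    by (auto intro!: borel_measurable_continuous_onI continuous_intros)
  note [measurable] = crossings_measurable[of cos "hitting_time K"]
    crossings_measurable[of sin "hitting_time K"]
  show ?thesis unfolding reflections_def by measurable
qed

lemma scaled_law_properties: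
  assumes I: "is_interval I" "I \<subseteq> {0..pi/4}" "0 < measure lborel I"
    and R[measurable]: "R \<in> measurable borel (count_space UNIV)" and "0 \<le> \<epsilon>"
  shows "real_distribution (scaled_law I \<epsilon> R)"
    and "measure (scaled_law I \<epsilon> R) {0..} = 1"
    and "\<And>f::real \<Rightarrow> real. f \<in> borel_measurable borel \<Longrightarrow>
           integral\<^sup>L (scaled_law I \<epsilon> R) f
             = 1 / measure lborel I * (LBINT \<omega>:I. f (\<epsilon> * real (R \<omega>)))"
proof -
  have Ib[measurable]: "I \<in> sets borel"
    using I(1) by (rule real_interval_borel_measurable)
  have fin: "emeasure lborel I \<noteq> \<infinity>"
  proof -
    have "emeasure lborel I \<le> emeasure lborel {0..pi/4}" using I(2) by (intro emeasure_mono) auto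
    also have "\<dots> < \<infinity>" by simp
    finally show ?thesis by simp
  qed
  have nz: "emeasure lborel I \<noteq> 0" using I(3) by (auto simp: measure_def)
  have em: "emeasure lborel I = ennreal (measure lborel I)"
    using fin by (simp add: emeasure_eq_ennreal_measure)
  interpret U: prob_space "uniform_measure lborel I"
    using nz fin by (intro prob_space_uniform_measure) auto
  have X[measurable]: "(\<lambda>\<omega>. \<epsilon> * real (R \<omega>)) \<in> borel_measurable borel" by measurable
  interpret D: prob_space "scaled_law I \<epsilon> R"
    unfolding scaled_law_def by (rule U.prob_space_distr) simp
  show "real_distribution (scaled_law I \<epsilon> R)"
    by standard (simp add: scaled_law_def)
  have "AE x in scaled_law I \<epsilon> R. x \<in> {0..}"
    unfolding scaled_law_def using \<open>0 \<le> \<epsilon>\<close> by (subst AE_distr_iff) auto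
  then show "measure (scaled_law I \<epsilon> R) {0..} = 1"
    by (subst D.prob_eq_1) (auto simp: scaled_law_def)
  fix f :: "real \<Rightarrow> real" assume f[measurable]: "f \<in> borel_measurable borel"
  have d: "indicator I x / emeasure lborel I = ennreal (indicator I x / measure lborel I)" for x
    unfolding em using I(3) by (auto simp: indicator_def divide_ennreal simp flip: ennreal_1)
  have "integral\<^sup>L (scaled_law I \<epsilon> R) f
      = (\<integral>\<omega>. f (\<epsilon> * real (R \<omega>)) \<partial>uniform_measure lborel I)"
    unfolding scaled_law_def by (rule integral_distr) auto
  also have "\<dots> = (\<integral>\<omega>. (indicator I \<omega> / measure lborel I) *\<^sub>R f (\<epsilon> * real (R \<omega>)) \<partial>lborel)"
    unfolding uniform_measure_def d by (rule integral_density) auto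
  also have "\<dots> = (\<integral>\<omega>. (1 / measure lborel I) * (indicator I \<omega> *\<^sub>R f (\<epsilon> * real (R \<omega>))) \<partial>lborel)"
    by (intro Bochner_Integration.integral_cong) auto
  also have "\<dots> = 1 / measure lborel I * (LBINT \<omega>:I. f (\<epsilon> * real (R \<omega>)))"
    unfolding set_lebesgue_integral_def by (rule integral_mult_right_zero)
  finally show "integral\<^sup>L (scaled_law I \<epsilon> R) f
      = 1 / measure lborel I * (LBINT \<omega>:I. f (\<epsilon> * real (R \<omega>)))" .
qed

lemma circular_law_properties:
  assumes I: "is_interval I" "I \<subseteq> {0..pi/4}" "0 < measure lborel I" and e: "0 \<le> \<epsilon>"
  shows "real_distribution (circular_law I \<epsilon>)"
    and "measure (circular_law I \<epsilon>) {0..} = 1"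
    and "\<And>f::real \<Rightarrow> real. f \<in> borel_measurable borel \<Longrightarrow>
           integral\<^sup>L (circular_law I \<epsilon>) f
             = 1 / measure lborel I * (LBINT \<omega>:I. f (\<epsilon> * real (circular_reflections \<epsilon> \<omega>)))"
proof -
  have R: "circular_reflections \<epsilon> \<in> measurable borel (count_space UNIV)"
    using reflections_measurable[OF closed_circular_scatterer[of \<epsilon>]]
    by (simp add: circular_reflections_def[abs_def] circular_time_def)
  note * = scaled_law_properties[OF I R e]
  show "real_distribution (circular_law I \<epsilon>)" "measure (circular_law I \<epsilon>) {0..} = 1"
    "\<And>f::real \<Rightarrow> real. f \<in> borel_measurable borel \<Longrightarrow>
           integral\<^sup>L (circular_law I \<epsilon>) f
             = 1 / measure lborel I * (LBINT \<omega>:I. f (\<epsilon> * real (circular_reflections \<epsilon> \<omega>)))"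
    unfolding circular_law_def by (fact *)+
qed

lemma cross_law_properties:
  assumes I: "is_interval I" "I \<subseteq> {0..pi/4}" "0 < measure lborel I" and e: "0 \<le> \<epsilon>"
  shows "real_distribution (cross_law I \<epsilon>)"
    and "measure (cross_law I \<epsilon>) {0..} = 1"
    and "\<And>f::real \<Rightarrow> real. f \<in> borel_measurable borel \<Longrightarrow>
           integral\<^sup>L (cross_law I \<epsilon>) f
             = 1 / measure lborel I * (LBINT \<omega>:I. f (\<epsilon> * real (cross_reflections \<epsilon> \<omega>)))"
proof -
  have R: "cross_reflections \<epsilon> \<in> measurable borel (count_space UNIV)"
    using reflections_measurable[OF closed_cross_scatterer[of \<epsilon>]]
    by (simp add: cross_reflections_def[abs_def] cross_time_def)
  note * = scaled_law_properties[OF I R e]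
  show "real_distribution (cross_law I \<epsilon>)" "measure (cross_law I \<epsilon>) {0..} = 1"
    "\<And>f::real \<Rightarrow> real. f \<in> borel_measurable borel \<Longrightarrow>
           integral\<^sup>L (cross_law I \<epsilon>) f
             = 1 / measure lborel I * (LBINT \<omega>:I. f (\<epsilon> * real (cross_reflections \<epsilon> \<omega>)))"
    unfolding cross_law_def by (fact *)+
qed

end

theory Submission
  imports Defs "HOL-Number_Theory.Totient" "HOL-Number_Theory.Cong" "HOL-Real_Asymp.Real_Asymp"
    "HOL-Analysis.Kronecker_Approximation_Theorem"
begin

text \<open>For a direction \<open>\<omega>\<close> with slope \<open>t = tan \<omega> \<in> {0..1}\<close> let \<open>q \<epsilon> t\<close> be the least \<open>q \<ge> 1\<close> for which \<open>q * t\<close> has an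
integer \<open>p\<close> within the distance \<open>\<epsilon>\<close>. The trajectory meets a vertical segment of half-length \<open>\<epsilon>\<close>
around \<open>(q, p)\<close> exactly if \<open>\<bar>q * t - p\<bar> \<le> \<epsilon>\<close>. So up to \<open>\<epsilon>\<close> the first coordinate of the particle when
it stops is \<open>q \<epsilon> t\<close> for crosses, whose horizontal arms do not act at slopes up to \<open>1\<close>, and
\<open>q (\<epsilon> / cos \<omega>) t\<close> for discs (\<open>cross_time_approx\<close>, \<open>circular_time_approx\<close>). The number of
reflections is the sum of the two coordinates up to a constant. Hence \<open>\<epsilon>\<close> times it is close to
\<open>(1 + tan \<omega>) * (\<epsilon> * q \<epsilon> t)\<close> and to \<open>(sin \<omega> + cos \<omega>) * (\<epsilon>' * q \<epsilon>' t)\<close> with \<open>\<epsilon>' = \<epsilon> / cos \<omega>\<close>, respectively.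

The heart of the matter is that for \<open>t\<close> uniformly distributed on an interval, \<open>\<epsilon> * q \<epsilon> t\<close> converges
in law to a distribution on the unit interval that does not depend on the interval
(\<open>near_rational_limit\<close>). Consequently \<open>\<omega>\<close> and the scaled denominator become independent, the limit
laws are those of \<open>(1 + tan \<omega>) * u\<close> and \<open>(sin \<omega> + cos \<omega>) * u\<close> with independent \<open>\<omega>\<close> and \<open>u\<close>
(\<open>mixture_law\<close>), and the moments are products in which \<open>c_moment n\<close> is the \<open>n\<close>-th moment of \<open>u\<close>
(\<open>limit_moment\<close>).

To find the law of \<open>u\<close>, one measures the set of all \<open>t\<close> with \<open>q \<epsilon> t \<le> U\<close>, where \<open>U = u / \<epsilon>\<close> and \<open>u < 1\<close>. At
most two reduced fractions with denominators up to \<open>U\<close> are close enough to \<open>t\<close>, and if there are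
two, they enclose \<open>t\<close> and have determinant \<open>1\<close> (\<open>near_rational_inclusion_exclusion\<close>). So the
measure is the total length of the intervals around single fractions, which amounts to counting
coprime pairs, minus the overlaps \<open>max 0 (\<epsilon> * (a + b) - 1) / (a * b)\<close> of the Farey pairs
\<open>p / a < p' / b\<close>. The second sum becomes an integral as soon as the Farey pairs in a fixed interval
make up the right proportion of all coprime \<open>(a, b)\<close> in a large box
(\<open>farey_pairs_equidistributed\<close>). That the limit has total mass \<open>1\<close> is a consequence of Dirichlet's
theorem (\<open>limit_cdf_1\<close>).

The equidistribution is a statement on inverses modulo \<open>b\<close>, since \<open>p' * a\<close> is congruent to \<open>1\<close>. It is
easy when \<open>a\<close> runs through many complete periods modulo \<open>b\<close>, because inversion permutes the units.
This covers the part of the box where \<open>a\<close> is much larger than \<open>b\<close>. A substitution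
\<open>(a, b) \<mapsto> a * w + b * v\<close> with nonnegative vectors \<open>w\<close> and \<open>v\<close> of determinant \<open>1\<close> respects Farey pairs
(\<open>farey_in_unimodular\<close>). In a cone spanned by such \<open>w\<close> and \<open>v\<close>, with \<open>w\<close> the shorter one, this controls
the narrow cone between \<open>w\<close> and \<open>k * w + v\<close> up to an error of the relative size \<open>1 / k\<close>, and the narrow
cone takes at least the proportion \<open>1 / (k + 1)\<close> of the whole (\<open>cone_rate_good\<close>, \<open>cone_rate_step\<close>). Repeating this in the remaining cones
exhausts the box geometrically (\<open>cone_rate_geometric\<close>).\<close>

section \<open>Units in an interval\<close>

lemma card_int_Ioc:
  fixes A B :: real assumes "A \<le> B"
  shows "finite {n::int. A < n \<and> n \<le> B}" "real (card {n::int. A < n \<and> n \<le> B}) = \<lfloor>B\<rfloor> - \<lfloor>A\<rfloor>"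
proof -
  have eq: "{n::int. A < n \<and> n \<le> B} = {\<lfloor>A\<rfloor><..\<lfloor>B\<rfloor>}"
    by (auto simp: floor_less_iff le_floor_iff)
  show "finite {n::int. A < n \<and> n \<le> B}" unfolding eq by simp
  have "\<lfloor>A\<rfloor> \<le> \<lfloor>B\<rfloor>" using assms by (rule floor_mono)
  then show "real (card {n::int. A < n \<and> n \<le> B}) = \<lfloor>B\<rfloor> - \<lfloor>A\<rfloor>" unfolding eq by simp
qed

text \<open>Among the integers that avoid the primes of \<open>S\<close>, the multiples of a new prime \<open>q\<close> are the
images under multiplication by \<open>q\<close> of such integers from the interval shrunk by \<open>q\<close>. So each
prime multiplies the main term by \<open>1 - 1 / q\<close> and doubles the error.\<close>

lemma sieve_interval:
  fixes S :: "nat set" and A B :: real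
  assumes "finite S" "\<And>p. p \<in> S \<Longrightarrow> prime p" "A \<le> B"
  shows "\<bar>real (card {n::int. A < n \<and> n \<le> B \<and> (\<forall>p\<in>S. \<not> int p dvd n)}) - (B - A) * (\<Prod>p\<in>S. 1 - 1 / real p)\<bar>
           \<le> 2 ^ card S"
  using assms
proof (induction S arbitrary: A B rule: finite_induct)
  case empty
  have "\<bar>(real_of_int \<lfloor>B\<rfloor> - real_of_int \<lfloor>A\<rfloor>) - (B - A)\<bar> \<le> 1" by linarith
  then show ?case using card_int_Ioc(2)[OF empty(2)] by simp
next
  case (insert q S)
  define N where "N A B = {n::int. A < n \<and> n \<le> B \<and> (\<forall>p\<in>S. \<not> int p dvd n)}" for A B :: real
  have q: "prime q" "q > 0" using insert.prems prime_gt_0_nat by auto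
  have fin: "finite (N A B)" if "A \<le> B" for A B
    unfolding N_def by (rule finite_subset[OF _ card_int_Ioc(1)[OF that]]) auto
  have AB: "A / q \<le> B / q" using insert.prems(2) q(2) by (simp add: divide_right_mono)
  have eq: "{n::int. A < n \<and> n \<le> B \<and> (\<forall>p\<in>insert q S. \<not> int p dvd n)} = N A B - (\<lambda>n. int q * n) ` N (A / q) (B / q)"
    (is "?L = _")
  proof (intro equalityI subsetI)
    fix n assume "n \<in> ?L"
    then show "n \<in> N A B - (\<lambda>n. int q * n) ` N (A / q) (B / q)" unfolding N_def by auto
  next
    fix n assume n: "n \<in> N A B - (\<lambda>n. int q * n) ` N (A / q) (B / q)"
    have "\<not> int q dvd n"
    proof
      assume "int q dvd n"
      then obtain m where m: "n = int q * m" by (auto elim: dvdE)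
      have "m \<in> N (A / q) (B / q)" using n q(2) unfolding N_def m by (auto simp: field_simps)
      then show False using n m by auto
    qed
    then show "n \<in> ?L" using n unfolding N_def by auto
  qed
  have sub: "(\<lambda>n. int q * n) ` N (A / q) (B / q) \<subseteq> N A B"
  proof clarify
    fix n assume n: "n \<in> N (A / q) (B / q)"
    have "\<not> int p dvd int q * n" if "p \<in> S" for p
    proof
      assume "int p dvd int q * n"
      moreover have p: "prime p" using insert.prems that by auto
      ultimately have "int p dvd int q \<or> int p dvd n" by (simp add: prime_dvd_mult_iff)
      moreover have "\<not> int p dvd n" using n that unfolding N_def by auto
      moreover have "\<not> int p dvd int q"
      proof
        assume "int p dvd int q"
        then have "p dvd q" by simp
        then have "p = q" using p q(1) primes_dvd_imp_eq by blast
        then show False using that insert.hyps by simp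
      qed
      ultimately show False by blast
    qed
    then show "int q * n \<in> N A B" using n q(2) unfolding N_def by (auto simp: field_simps)
  qed
  have "card ((\<lambda>n. int q * n) ` N (A / q) (B / q)) = card (N (A / q) (B / q))"
    using q(2) by (intro card_image) (auto simp: inj_on_def)
  then have c: "real (card ?L) = real (card (N A B)) - real (card (N (A / q) (B / q)))"
    unfolding eq using card_Diff_subset[OF finite_subset[OF sub fin[OF insert.prems(2)]] sub]
      card_mono[OF fin[OF insert.prems(2)] sub] by simp
  define D where "D = (\<Prod>p\<in>S. 1 - 1 / real p)"
  have 1: "\<bar>real (card (N A B)) - (B - A) * D\<bar> \<le> 2 ^ card S"
    unfolding N_def D_def using insert by auto
  have 2: "\<bar>real (card (N (A / q) (B / q))) - (B / q - A / q) * D\<bar> \<le> 2 ^ card S"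
    unfolding N_def D_def using insert AB by auto
  have p: "(\<Prod>p\<in>insert q S. 1 - 1 / real p) = (1 - 1 / q) * D"
    unfolding D_def using insert by simp
  have "(B - A) * ((1 - 1 / q) * D) = (B - A) * D - (B / q - A / q) * D"
    using q(2) by (simp add: field_simps)
  then show ?case unfolding c p using 1 2 insert.hyps by (simp add: algebra_simps)
qed

text \<open>A prime \<open>p\<close> with \<open>4 \<le> p\<close> satisfies \<open>2 \<le> sqrt p\<close>; the two smaller primes cost a factor \<open>2\<close> each.\<close>

lemma two_pow_omega_le:
  assumes "x > 0" shows "2 ^ card (prime_factors (x::nat)) \<le> 4 * sqrt x"
proof -
  let ?P = "prime_factors x"
  have pr: "prime p" if "p \<in> ?P" for p using that by auto
  have "(\<Prod>p\<in>?P. p) dvd x"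
  proof -
    have "(\<Prod>p\<in>?P. p) dvd (\<Prod>p\<in>?P. p ^ multiplicity p x)"
      by (intro prod_dvd_prod) (auto intro!: dvd_power simp: prime_factors_multiplicity)
    then show ?thesis using assms prime_factorization_nat by simp
  qed
  then have le: "(\<Prod>p\<in>?P. p) \<le> x" using assms by (rule dvd_imp_le)
  have "(2::real) ^ card ?P = (\<Prod>p\<in>?P. 2)" by simp
  also have "\<dots> \<le> (\<Prod>p\<in>?P. sqrt p * (if p \<in> {2,3} then 2 else 1))"
  proof (intro prod_mono conjI)
    fix p assume "p \<in> ?P"
    then have "p \<ge> 2" using pr prime_ge_2_nat by blast
    have "1 \<le> sqrt (real p)" using \<open>p \<ge> 2\<close> by simp
    moreover have "2 \<le> sqrt (real p)" if "p \<ge> 4"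
      using real_sqrt_le_mono[of 4 "real p"] that by simp
    ultimately show "2 \<le> sqrt (real p) * (if p \<in> {2,3} then 2 else 1)"
      using \<open>p \<ge> 2\<close> by (cases "p \<ge> 4") auto
  qed auto
  also have "\<dots> = sqrt (\<Prod>p\<in>?P. p) * (\<Prod>p\<in>?P. if p \<in> {2,3} then 2 else 1)"
  proof -
    have "(\<Prod>p\<in>Q. sqrt (real p)) = sqrt (\<Prod>p\<in>Q. real p)" if "finite Q" for Q
      using that by induction (auto simp: real_sqrt_mult)
    then show ?thesis by (simp add: prod.distrib)
  qed
  also have "(\<Prod>p\<in>?P. if p \<in> {2,3} then 2 else 1) = (\<Prod>p\<in>?P \<inter> {2,3}. (2::real))"
    by (rule prod.inter_restrict[symmetric]) simp
  also have "\<dots> = 2 ^ card (?P \<inter> {2,3})" by (rule prod_constant)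
  also have "\<dots> \<le> 2 ^ 2"
  proof -
    have "card (?P \<inter> {2,3}) \<le> card {2,3::nat}" by (intro card_mono) auto
    then show ?thesis by (intro power_increasing) auto
  qed
  finally have "2 ^ card ?P \<le> sqrt (\<Prod>p\<in>?P. p) * 2 ^ 2" by (simp add: mult_left_mono prod_nonneg)
  also have "sqrt (\<Prod>p\<in>?P. p) \<le> sqrt x" using le by (simp flip: of_nat_prod)
  finally show ?thesis by simp
qed

text \<open>The error has to be of smaller order than \<open>x\<close>: it will be summed over all moduli up to the
scale \<open>L\<close> and must stay below \<open>L\<^sup>2\<close>.\<close>

lemma coprime_count:
  fixes A B :: real
  assumes "x > 0" "A \<le> B"
  shows "\<bar>real (card {n::int. A < n \<and> n \<le> B \<and> coprime n (int x)}) - (B - A) * (totient x / x)\<bar> \<le> 4 * sqrt x"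
proof -
  have "coprime n (int x) \<longleftrightarrow> (\<forall>p\<in>prime_factors x. \<not> int p dvd n)" for n
  proof
    assume c: "coprime n (int x)"
    show "\<forall>p\<in>prime_factors x. \<not> int p dvd n"
    proof
      fix p assume p: "p \<in> prime_factors x"
      then have "int p dvd int x" by auto
      then have "int p dvd n \<Longrightarrow> is_unit (int p)" using c coprime_common_divisor by blast
      moreover have "prime p" using p by auto
      ultimately show "\<not> int p dvd n" using prime_gt_1_nat by fastforce
    qed
  next
    assume c: "\<forall>p\<in>prime_factors x. \<not> int p dvd n"
    show "coprime n (int x)"
    proof (rule ccontr)
      assume "\<not> coprime n (int x)"
      then have "gcd n (int x) \<noteq> 1" by (simp add: coprime_iff_gcd_eq_1)
      then have "nat (gcd n (int x)) \<noteq> 1" by linarith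
      then obtain p where p: "prime p" "p dvd nat (gcd n (int x))" using prime_factor_nat by blast
      have "int p dvd gcd n (int x)" using p(2) by (metis gcd_ge_0_int int_dvd_int_iff int_nat_eq)
      then have "int p dvd n" "int p dvd int x" by auto
      then show False using c p assms(1) by (auto simp: in_prime_factors_iff)
    qed
  qed
  then have "{n::int. A < n \<and> n \<le> B \<and> coprime n (int x)} = {n::int. A < n \<and> n \<le> B \<and> (\<forall>p\<in>prime_factors x. \<not> int p dvd n)}"
    by auto
  moreover have "totient x / x = (\<Prod>p\<in>prime_factors x. 1 - 1 / real p)"
    using totient_formula2[of x] assms(1) by simp
  moreover have "\<bar>real (card {n::int. A < n \<and> n \<le> B \<and> (\<forall>p\<in>prime_factors x. \<not> int p dvd n)})
      - (B - A) * (\<Prod>p\<in>prime_factors x. 1 - 1 / real p)\<bar> \<le> 2 ^ card (prime_factors x)"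
    using assms by (intro sieve_interval) auto
  ultimately show ?thesis using two_pow_omega_le[OF assms(1)] by simp
qed

section \<open>The density of coprime pairs\<close>

lemma sum_inverse_sqrt_le: "(\<Sum>d=1..n. 1 / sqrt (real d)) \<le> 2 * sqrt (real n)"
proof (induction n)
  case (Suc n)
  have "sqrt (real n) * sqrt (real (Suc n)) \<le> real n + 1 / 2"
  proof -
    have "(real n) * (real (Suc n)) \<le> (real n + 1 / 2)\<^sup>2" by (simp add: power2_eq_square algebra_simps)
    then have "sqrt (real n * real (Suc n)) \<le> real n + 1 / 2" by (intro real_le_lsqrt) auto
    then show ?thesis by (simp add: real_sqrt_mult)
  qed
  then have "2 * sqrt (real n) + 1 / sqrt (real (Suc n)) \<le> 2 * sqrt (real (Suc n))"
    by (simp add: field_simps)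
  then show ?case using Suc by simp
qed simp

lemma real_div_floor_bounds:
  assumes "d \<ge> 1"
  shows "real (n div d) \<le> real n / real d" "real n / real d \<le> real (n div d) + 1"
proof -
  have *: "real_of_int \<lfloor>real n / real d\<rfloor> = real (n div d)" by (simp add: floor_divide_of_nat_eq)
  show "real (n div d) \<le> real n / real d" "real n / real d \<le> real (n div d) + 1"
    using * by linarith+
qed

text \<open>That the bound lies strictly below \<open>1\<close> makes the recursion in the proof of
\<open>coprime_pairs_asymp\<close> a contraction.\<close>

lemma sum_inverse_squares_from2_le: "(\<Sum>d=2..n. 1 / (real d)\<^sup>2) \<le> 3 / 4"
proof -
  have "(\<Sum>d=2..n. 1 / (real d)\<^sup>2) \<le> 3 / 4 - 1 / real n" if "n \<ge> 2"
    using that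
  proof (induction n rule: dec_induct)
    case (step n)
    have "1 / (real (Suc n))\<^sup>2 \<le> 1 / real n - 1 / real (Suc n)"
    proof -
      have "1 / (real (Suc n))\<^sup>2 \<le> 1 / (real n * real (Suc n))"
        using step.hyps by (intro divide_left_mono) (auto simp: power2_eq_square)
      also have "\<dots> = 1 / real n - 1 / real (Suc n)" using step.hyps by (simp add: field_simps)
      finally show ?thesis .
    qed
    then show ?case using step by simp
  qed simp
  moreover have "0 \<le> 1 / real n" by simp
  ultimately show ?thesis by (cases "n \<ge> 2") (smt (verit), simp)
qed

definition coprime_pairs :: "nat \<Rightarrow> (nat \<times> nat) set" where
  "coprime_pairs n = {(a, b). a \<in> {1..n} \<and> b \<in> {1..n} \<and> coprime a b}"

lemma card_coprime_pairs_le: "card (coprime_pairs n) \<le> n\<^sup>2"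
proof -
  have "card (coprime_pairs n) \<le> card ({1..n} \<times> {1..n})"
    by (rule card_mono) (auto simp: coprime_pairs_def)
  then show ?thesis by (simp add: power2_eq_square)
qed

text \<open>The pairs in the square are sorted by their greatest common divisor \<open>d\<close>; division by \<open>d\<close> leaves
a coprime pair of numbers up to \<open>n div d\<close>.\<close>

lemma sum_card_coprime_pairs: "n\<^sup>2 = (\<Sum>d=1..n. card (coprime_pairs (n div d)))"
proof -
  define A where "A d = {(a, b). a \<in> {1..n} \<and> b \<in> {1..n} \<and> gcd a b = d}" for d
  have fin: "finite (A d)" for d
    by (rule finite_subset[of _ "{1..n} \<times> {1..n}"]) (auto simp: A_def)
  have "card (A d) = card (coprime_pairs (n div d))" if d: "d \<in> {1..n}" for d
  proof -
    have "A d = (\<lambda>(a, b). (d * a, d * b)) ` coprime_pairs (n div d)"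
    proof (intro equalityI subsetI)
      fix z assume "z \<in> A d"
      then obtain x y where xy: "z = (x, y)" "x \<in> {1..n}" "y \<in> {1..n}" "gcd x y = d" unfolding A_def by auto
      obtain a b where ab: "x = d * a" "y = d * b" by (metis dvdE gcd_dvd1 gcd_dvd2 xy(4))
      have "coprime a b" using xy ab d by (metis coprime_iff_gcd_eq_1 gcd_mult_distrib_nat mult_cancel1 mult.right_neutral atLeastAtMost_iff not_one_le_zero)
      moreover have "a \<in> {1..n div d}" "b \<in> {1..n div d}"
        using xy ab d by (auto simp: less_eq_div_iff_mult_less_eq mult.commute Suc_le_eq)
      ultimately show "z \<in> (\<lambda>(a, b). (d * a, d * b)) ` coprime_pairs (n div d)"
        unfolding xy ab coprime_pairs_def by force
    next
      fix z assume "z \<in> (\<lambda>(a, b). (d * a, d * b)) ` coprime_pairs (n div d)"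
      then obtain a b where ab: "z = (d * a, d * b)" "a \<in> {1..n div d}" "b \<in> {1..n div d}" "coprime a b"
        unfolding coprime_pairs_def by auto
      have "gcd (d * a) (d * b) = d" using ab by (simp flip: gcd_mult_distrib_nat)
      moreover have "d * a \<in> {1..n}" "d * b \<in> {1..n}"
        using ab d by (auto simp: less_eq_div_iff_mult_less_eq mult.commute Suc_le_eq)
      ultimately show "z \<in> A d" unfolding ab A_def by auto
    qed
    moreover have "inj_on (\<lambda>(a, b). (d * a, d * b)) (coprime_pairs (n div d))"
      using d by (auto simp: inj_on_def)
    ultimately show ?thesis by (simp add: card_image)
  qed
  then have "(\<Sum>d=1..n. card (coprime_pairs (n div d))) = (\<Sum>d=1..n. card (A d))" by simp
  also have "\<dots> = card (\<Union>d\<in>{1..n}. A d)"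
    using fin by (intro card_UN_disjoint[symmetric]) (auto simp: A_def)
  also have "(\<Union>d\<in>{1..n}. A d) = {1..n} \<times> {1..n}"
  proof -
    have "gcd a b \<in> {1..n}" if "a \<in> {1..n}" "b \<in> {1..n}" for a b
      using that gcd_le1_nat[of a b] by (auto simp: Suc_le_eq intro: order.trans[of _ a])
    then show ?thesis unfolding A_def by fastforce
  qed
  finally show ?thesis by (simp add: power2_eq_square)
qed

lemma basel_partial: "(\<lambda>n. \<Sum>d=1..n. 1 / (real d)\<^sup>2) \<longlonglongrightarrow> pi\<^sup>2 / 6"
proof -
  have "(\<lambda>n. \<Sum>d<n. 1 / (real d + 1)\<^sup>2) \<longlonglongrightarrow> pi\<^sup>2 / 6"
    using inverse_squares_sums unfolding sums_def by (simp add: add.commute)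
  moreover have "(\<Sum>d<n. 1 / (real d + 1)\<^sup>2) = (\<Sum>d=1..n. 1 / (real d)\<^sup>2)" for n
    by (rule sum.reindex_bij_witness[of _ "\<lambda>d. d - 1" Suc]) auto
  ultimately show ?thesis by simp
qed

text \<open>The identity \<open>sum_card_coprime_pairs\<close> is inverted by a contraction argument rather than by
Moebius inversion. With \<open>c = 6 / \<pi>\<^sup>2\<close>, the Basel sum shows that \<open>c n\<^sup>2\<close> solves the same identity up
to \<open>o(n\<^sup>2)\<close>, so that the error \<open>u\<close> of the claimed asymptotics satisfies
\<open>\<bar>u n\<bar> \<le> o(n\<^sup>2) + (\<Sum>d=2..n. \<bar>u (n div d)\<bar>)\<close>. As the inverse squares from \<open>2\<close> on add up to at most \<open>3 / 4\<close>,
a bound \<open>\<bar>u n\<bar> \<le> M n\<^sup>2\<close> for large \<open>n\<close> improves to \<open>\<bar>u n\<bar> \<le> (7 / 8) M n\<^sup>2\<close>, and this can be iterated.\<close>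

lemma coprime_pairs_asymp: "(\<lambda>n. card (coprime_pairs n) / (real n)\<^sup>2) \<longlonglongrightarrow> 6 / pi\<^sup>2"
proof -
  define c where "c = 6 / pi\<^sup>2"
  have c: "0 \<le> c" "c * (pi\<^sup>2 / 6) = 1" unfolding c_def by auto
  have c1: "c \<le> 1"
  proof -
    have "3\<^sup>2 \<le> pi\<^sup>2" using pi_gt3 by (intro power_mono) auto
    then show ?thesis unfolding c_def by (simp add: field_simps)
  qed
  define u where "u n = real (card (coprime_pairs n)) - c * (real n)\<^sup>2" for n
  have u_le: "\<bar>u n\<bar> \<le> (real n)\<^sup>2" for n
  proof -
    have "real (card (coprime_pairs n)) \<le> (real n)\<^sup>2"
      using card_coprime_pairs_le[of n] by (metis of_nat_le_iff of_nat_power)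
    moreover have "0 \<le> c * (real n)\<^sup>2" "c * (real n)\<^sup>2 \<le> 1 * (real n)\<^sup>2" using c(1) mult_right_mono[OF c1, of "(real n)\<^sup>2"] by auto
    ultimately show ?thesis unfolding u_def by linarith
  qed
  define r where "r n = (real n)\<^sup>2 - c * (\<Sum>d=1..n. (real (n div d))\<^sup>2)" for n
  have rec: "\<bar>u n\<bar> \<le> \<bar>r n\<bar> + (\<Sum>d=2..n. \<bar>u (n div d)\<bar>)" if "n \<ge> 1" for n
  proof -
    have "(real n)\<^sup>2 = (\<Sum>d=1..n. real (card (coprime_pairs (n div d))))"
      using sum_card_coprime_pairs[of n] by (metis of_nat_power of_nat_sum)
    also have "\<dots> = (\<Sum>d=1..n. u (n div d)) + c * (\<Sum>d=1..n. (real (n div d))\<^sup>2)"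
      unfolding u_def by (simp add: sum_subtractf sum_distrib_left)
    finally have "r n = (\<Sum>d=1..n. u (n div d))" unfolding r_def by simp
    also have "\<dots> = u n + (\<Sum>d=2..n. u (n div d))"
      using that by (subst sum.atLeast_Suc_atMost) (auto simp: numeral_2_eq_2)
    finally show ?thesis using sum_abs[of "\<lambda>d. u (n div d)" "{2..n}"] by linarith
  qed
  have r0: "(\<lambda>n. r n / (real n)\<^sup>2) \<longlonglongrightarrow> 0"
  proof -
    have bnd: "\<bar>r n / (real n)\<^sup>2\<bar> \<le> \<bar>1 - c * (\<Sum>d=1..n. 1 / (real d)\<^sup>2)\<bar> + 4 / sqrt n" if n: "n \<ge> 1" for n
    proof -
      have "\<bar>(real n)\<^sup>2 / (real d)\<^sup>2 - (real (n div d))\<^sup>2\<bar> \<le> 2 * n * (1 / sqrt d)" if d: "d \<in> {1..n}" for d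
      proof -
        define x where "x = real n / d"
        define y where "y = real (n div d)"
        have xy: "y \<le> x" "x \<le> y + 1" "0 \<le> y"
          unfolding x_def y_def using real_div_floor_bounds[of d n] d by auto
        have "(real n)\<^sup>2 / (real d)\<^sup>2 - (real (n div d))\<^sup>2 = (x - y) * (x + y)"
          unfolding x_def y_def by (simp add: power2_eq_square algebra_simps)
        moreover have "0 \<le> (x - y) * (x + y)" using xy by simp
        moreover have "(x - y) * (x + y) \<le> 1 * (2 * x)" using xy by (intro mult_mono) auto
        moreover have "2 * x \<le> 2 * n * (1 / sqrt d)"
        proof -
          have "sqrt (real d) \<le> real d" using d by (simp add: sqrt_le_D real_le_lsqrt power2_eq_square)
          then have "1 / real d \<le> 1 / sqrt (real d)" using d by (intro divide_left_mono) auto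
          then have "real n * (1 / real d) \<le> real n * (1 / sqrt d)" by (intro mult_left_mono) auto
          then show ?thesis unfolding x_def by simp
        qed
        ultimately show ?thesis by linarith
      qed
      then have "(\<Sum>d=1..n. \<bar>(real n)\<^sup>2 / (real d)\<^sup>2 - (real (n div d))\<^sup>2\<bar>) \<le> (\<Sum>d=1..n. 2 * n * (1 / sqrt d))"
        by (rule sum_mono)
      also have "\<dots> = 2 * n * (\<Sum>d=1..n. 1 / sqrt d)" by (rule sum_distrib_left[symmetric])
      also have "\<dots> \<le> 2 * n * (2 * sqrt n)" using sum_inverse_sqrt_le by (intro mult_left_mono) auto
      finally have 1: "\<bar>\<Sum>d=1..n. ((real n)\<^sup>2 / (real d)\<^sup>2 - (real (n div d))\<^sup>2)\<bar> \<le> 4 * n * sqrt n"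
        using sum_abs[of "\<lambda>d. (real n)\<^sup>2 / (real d)\<^sup>2 - (real (n div d))\<^sup>2" "{1..n}"] by linarith
      define A where "A = (\<Sum>d=1..n. 1 / (real d)\<^sup>2)"
      define B where "B = (\<Sum>d=1..n. ((real n)\<^sup>2 / (real d)\<^sup>2 - (real (n div d))\<^sup>2))"
      have "r n = (real n)\<^sup>2 * (1 - c * A) + c * B"
        unfolding r_def A_def B_def
        by (simp add: sum_subtractf algebra_simps sum_distrib_left)
      then have "\<bar>r n\<bar> \<le> (real n)\<^sup>2 * \<bar>1 - c * A\<bar> + c * \<bar>B\<bar>"
        using c(1) by (metis abs_mult abs_of_nonneg abs_triangle_ineq zero_le_power2)
      also have "c * \<bar>B\<bar> \<le> 1 * (4 * n * sqrt n)" using c c1 1 unfolding B_def by (intro mult_mono) auto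
      finally have "\<bar>r n\<bar> \<le> (real n)\<^sup>2 * \<bar>1 - c * A\<bar> + 4 * n * sqrt n" by simp
      then have "\<bar>r n\<bar> / (real n)\<^sup>2 \<le> ((real n)\<^sup>2 * \<bar>1 - c * A\<bar> + 4 * n * sqrt n) / (real n)\<^sup>2"
        by (intro divide_right_mono) auto
      also have "\<dots> = \<bar>1 - c * A\<bar> + 4 / sqrt n"
      proof -
        have "4 * n * sqrt n / (real n)\<^sup>2 = 4 / sqrt n"
          using n by (simp add: power2_eq_square field_simps)
        then show ?thesis using n by (simp add: add_divide_distrib)
      qed
      finally show ?thesis unfolding A_def by simp
    qed
    have "(\<lambda>n. \<bar>1 - c * (\<Sum>d=1..n. 1 / (real d)\<^sup>2)\<bar> + 4 / sqrt n) \<longlonglongrightarrow> \<bar>1 - c * (pi\<^sup>2 / 6)\<bar> + 0"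
      by (intro tendsto_intros basel_partial) real_asymp
    then have l: "(\<lambda>n. \<bar>1 - c * (\<Sum>d=1..n. 1 / (real d)\<^sup>2)\<bar> + 4 / sqrt n) \<longlonglongrightarrow> 0" unfolding c(2) by simp
    show ?thesis
      by (rule Lim_null_comparison[OF _ l], rule eventually_sequentiallyI[of 1]) (use bnd in simp)
  qed
  \<comment> \<open>The gap between \<open>3 / 4\<close> and \<open>7 / 8\<close> pays for \<open>r n\<close> and for the quotients \<open>n div d\<close> that are still below \<open>N\<close>.\<close>
  have step: "eventually (\<lambda>n. \<bar>u n\<bar> \<le> (7 / 8) * M * (real n)\<^sup>2) sequentially"
    if ev: "eventually (\<lambda>n. \<bar>u n\<bar> \<le> M * (real n)\<^sup>2) sequentially" and M: "M > 0" for M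
  proof -
    obtain N where N: "\<And>n. n \<ge> N \<Longrightarrow> \<bar>u n\<bar> \<le> M * (real n)\<^sup>2" using ev unfolding eventually_sequentially by auto
    have 1: "eventually (\<lambda>n. \<bar>r n / (real n)\<^sup>2\<bar> < M / 16) sequentially"
      using tendstoD[OF r0, of "M / 16"] M by (simp add: dist_real_def)
    have 2: "eventually (\<lambda>n. real n * (real N)\<^sup>2 \<le> M / 16 * (real n)\<^sup>2) sequentially"
    proof -
      have "(\<lambda>n. real N ^ 2 / real n) \<longlonglongrightarrow> 0" by real_asymp
      then have "eventually (\<lambda>n. real N ^ 2 / real n < M / 16) sequentially" using M by (intro order_tendstoD) auto
      then show ?thesis using eventually_gt_at_top[of 0]
        by eventually_elim (simp add: field_simps power2_eq_square)
    qed
    show ?thesis using 1 2 eventually_ge_at_top[of 1]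
    proof eventually_elim
      case (elim n)
      have "(\<Sum>d=2..n. \<bar>u (n div d)\<bar>) \<le> (\<Sum>d=2..n. M * (real n)\<^sup>2 * (1 / (real d)\<^sup>2) + (real N)\<^sup>2)"
      proof (rule sum_mono)
        fix d assume d: "d \<in> {2..n}"
        show "\<bar>u (n div d)\<bar> \<le> M * (real n)\<^sup>2 * (1 / (real d)\<^sup>2) + (real N)\<^sup>2"
        proof (cases "n div d \<ge> N")
          case True
          have "\<bar>u (n div d)\<bar> \<le> M * (real (n div d))\<^sup>2" using N True by simp
          also have "\<dots> \<le> M * (real n / real d)\<^sup>2"
            using M d real_div_floor_bounds[of d n] by (intro mult_left_mono power_mono) auto
          finally show ?thesis by (simp add: power_divide add_increasing2)
        next
          case False
          have "\<bar>u (n div d)\<bar> \<le> (real (n div d))\<^sup>2" by (rule u_le)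
          also have "\<dots> \<le> (real N)\<^sup>2" using False by (intro power_mono) auto
          finally show ?thesis using M by (simp add: add_increasing)
        qed
      qed
      also have "\<dots> = M * (real n)\<^sup>2 * (\<Sum>d=2..n. 1 / (real d)\<^sup>2) + real (n - 1) * (real N)\<^sup>2"
        by (simp add: sum.distrib sum_distrib_left)
      also have "\<dots> \<le> M * (real n)\<^sup>2 * (3 / 4) + n * (real N)\<^sup>2"
        using M sum_inverse_squares_from2_le[of n] by (intro add_mono mult_left_mono mult_right_mono) auto
      finally have 3: "(\<Sum>d=2..n. \<bar>u (n div d)\<bar>) \<le> M * (real n)\<^sup>2 * (3 / 4) + n * (real N)\<^sup>2" .
      have "\<bar>r n\<bar> \<le> M / 16 * (real n)\<^sup>2" using elim by (simp add: field_simps abs_divide)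
      then show ?case using 3 rec[OF elim(3)] elim(2) by (simp add: algebra_simps)
    qed
  qed
  have pow: "eventually (\<lambda>n. \<bar>u n\<bar> \<le> (7 / 8) ^ k * (real n)\<^sup>2) sequentially" for k
  proof (induction k)
    case 0
    then show ?case using u_le by simp
  next
    case (Suc k)
    show ?case using step[OF Suc] by (simp add: mult.assoc)
  qed
  have "(\<lambda>n. u n / (real n)\<^sup>2) \<longlonglongrightarrow> 0"
  proof (rule LIMSEQ_I, goal_cases)
    case (1 e)
    obtain k where k: "(7 / 8 :: real) ^ k < e" using real_arch_pow_inv[of e "7/8"] 1 by auto
    have "eventually (\<lambda>n. norm (u n / (real n)\<^sup>2 - 0) < e) sequentially"
      using pow[of k] eventually_gt_at_top[of 0]
    proof eventually_elim
      case (elim n)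
      have "\<bar>u n\<bar> / (real n)\<^sup>2 \<le> (7 / 8) ^ k" using elim by (simp add: field_simps)
      then show ?case using k by simp
    qed
    then show ?case unfolding eventually_sequentially by auto
  qed
  then have "(\<lambda>n. u n / (real n)\<^sup>2 + c) \<longlonglongrightarrow> 0 + c" by (intro tendsto_intros)
  moreover have "eventually (\<lambda>n. u n / (real n)\<^sup>2 + c = card (coprime_pairs n) / (real n)\<^sup>2) sequentially"
    using eventually_gt_at_top[of 0] by eventually_elim (simp add: u_def field_simps)
  ultimately show ?thesis unfolding c_def by (simp add: tendsto_cong)
qed

text \<open>By the sieve, the column of \<open>a\<close> contains \<open>n * totient a / a\<close> coprime pairs up to \<open>4 sqrt n\<close>.\<close>

lemma totient_sum_asymp: "(\<lambda>n. (\<Sum>a=1..n. totient a / a) / real n) \<longlonglongrightarrow> 6 / pi\<^sup>2"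
proof -
  define S where "S n = (\<Sum>a=1..n. totient a / real a)" for n
  have bnd: "\<bar>S n / n - card (coprime_pairs n) / (real n)\<^sup>2\<bar> \<le> 4 / sqrt n" if n: "n \<ge> 1" for n
  proof -
    have "coprime_pairs n = Sigma {1..n} (\<lambda>a. {b\<in>{1..n}. coprime a b})" unfolding coprime_pairs_def by auto
    then have c: "card (coprime_pairs n) = (\<Sum>a=1..n. card {b\<in>{1..n}. coprime a b})" by simp
    have 1: "\<bar>real (card {b\<in>{1..n}. coprime a b}) - n * (totient a / a)\<bar> \<le> 4 * sqrt n" if a: "a \<in> {1..n}" for a
    proof -
      have "card {b\<in>{1..n}. coprime a b} = card {b::int. (0::real) < b \<and> b \<le> real n \<and> coprime b (int a)}"
      proof -
        have "{b::int. (0::real) < b \<and> b \<le> real n \<and> coprime b (int a)} = int ` {b\<in>{1..n}. coprime a b}"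
        proof (intro equalityI subsetI)
          fix b :: int assume "b \<in> {b. (0::real) < b \<and> b \<le> real n \<and> coprime b (int a)}"
          then have b: "0 < b" "b \<le> int n" "coprime b (int a)" by auto
          then have "b = int (nat b)" "nat b \<in> {1..n}" by auto
          moreover have "coprime a (nat b)" using b by (metis calculation(1) coprime_commute coprime_int_iff)
          ultimately show "b \<in> int ` {b\<in>{1..n}. coprime a b}" by blast
        qed (auto simp: coprime_commute)
        then show ?thesis by (simp add: card_image)
      qed
      moreover have "sqrt a \<le> sqrt n" using a by simp
      moreover have "4 * sqrt a \<le> 4 * sqrt n" using a by simp
      ultimately show ?thesis using coprime_count[of a 0 n] a by (smt (verit) atLeastAtMost_iff less_le_trans of_nat_0_le_iff zero_less_one diff_zero)
    qed
    have "\<bar>(\<Sum>a=1..n. real (card {b\<in>{1..n}. coprime a b}) - n * (totient a / a))\<bar> \<le> (\<Sum>a=1..n. 4 * sqrt n)"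
      using 1 by (intro order.trans[OF sum_abs] sum_mono) auto
    then have "\<bar>real (card (coprime_pairs n)) - n * S n\<bar> \<le> n * (4 * sqrt n)"
      unfolding c S_def by (simp add: sum_subtractf sum_distrib_left)
    then have "\<bar>real (card (coprime_pairs n)) - n * S n\<bar> / (real n)\<^sup>2 \<le> n * (4 * sqrt n) / (real n)\<^sup>2"
      by (intro divide_right_mono) auto
    also have "\<dots> = 4 / sqrt n" using n by (simp add: power2_eq_square field_simps)
    also have "\<bar>real (card (coprime_pairs n)) - n * S n\<bar> / (real n)\<^sup>2 = \<bar>S n / n - card (coprime_pairs n) / (real n)\<^sup>2\<bar>"
    proof -
      have "S n / n - card (coprime_pairs n) / (real n)\<^sup>2 = (n * S n - card (coprime_pairs n)) / (real n)\<^sup>2"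
        using n by (simp add: power2_eq_square field_simps)
      then show ?thesis by (simp add: abs_divide abs_minus_commute)
    qed
    finally show ?thesis .
  qed
  have l: "(\<lambda>n. 4 / sqrt (real n)) \<longlonglongrightarrow> 0" by real_asymp
  have "(\<lambda>n. S n / n - card (coprime_pairs n) / (real n)\<^sup>2) \<longlonglongrightarrow> 0"
    by (rule Lim_null_comparison[OF _ l]) (use bnd in \<open>auto intro!: eventually_sequentiallyI[of 1]\<close>)
  from tendsto_add[OF this coprime_pairs_asymp] show ?thesis unfolding S_def by simp
qed

section \<open>Farey pairs with a fixed second denominator\<close>

text \<open>Two fractions \<open>p / a < p' / b\<close> with \<open>p' * a - p * b = 1\<close> are neighbours in a Farey sequence, a Farey
pair for short. The predicate says that a Farey pair with the denominators \<open>a\<close> and \<open>b\<close> lies in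
the interval from \<open>\<alpha>\<close> to \<open>\<beta>\<close>. One expects this for a proportion \<open>\<beta> - \<alpha>\<close> of the coprime pairs
\<open>(a, b)\<close>; \<open>farey_dev\<close> is the deviation from that proportion.\<close>

definition farey_in :: "real \<Rightarrow> real \<Rightarrow> int \<Rightarrow> int \<Rightarrow> bool" where
  "farey_in \<alpha> \<beta> a b \<longleftrightarrow> (\<exists>p p'. p' * a - p * b = 1 \<and> \<alpha> * a \<le> of_int p \<and> of_int p' \<le> \<beta> * b)"

definition farey_dev :: "real \<Rightarrow> real \<Rightarrow> int \<Rightarrow> int \<Rightarrow> real" where
  "farey_dev \<alpha> \<beta> a b = (if farey_in \<alpha> \<beta> a b then 1 else 0) - (\<beta> - \<alpha>)"

text \<open>A fraction strictly between the members of a Farey pair has a denominator of at least \<open>a + b\<close>.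
For \<open>d < a + b\<close> the endpoints of the interval therefore never separate the members, and the
position of one of them decides for both.\<close>

definition rat_interval :: "real \<Rightarrow> real \<Rightarrow> int \<Rightarrow> bool" where
  "rat_interval \<alpha> \<beta> d \<longleftrightarrow> d > 0 \<and> 0 \<le> \<alpha> \<and> \<alpha> < \<beta> \<and> \<beta> \<le> 1 \<and> \<alpha> * d \<in> \<int> \<and> \<beta> * d \<in> \<int>"

definition unimodular :: "int \<Rightarrow> int \<Rightarrow> int \<Rightarrow> int \<Rightarrow> bool" where
  "unimodular w1 w2 v1 v2 \<longleftrightarrow> 0 \<le> w1 \<and> 0 \<le> w2 \<and> 0 \<le> v1 \<and> 0 \<le> v2 \<and> w1 * v2 - w2 * v1 = 1"

lemma abs_farey_dev_le: "rat_interval \<alpha> \<beta> d \<Longrightarrow> \<bar>farey_dev \<alpha> \<beta> a b\<bar> \<le> 1"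
  unfolding farey_dev_def rat_interval_def by auto

lemma rat_intervalE:
  assumes "rat_interval \<alpha> \<beta> d"
  obtains i j where "d > 0" "0 \<le> i" "i < j" "j \<le> d" "\<alpha> = of_int i / of_int d" "\<beta> = of_int j / of_int d"
proof -
  obtain i j where ij: "\<alpha> * d = of_int i" "\<beta> * d = of_int j"
    using assms unfolding rat_interval_def by (auto elim!: Ints_cases)
  have d: "d > 0" using assms unfolding rat_interval_def by simp
  then have e: "\<alpha> = of_int i / of_int d" "\<beta> = of_int j / of_int d" using ij by (auto simp: field_simps)
  have "0 \<le> i" "i < j" "j \<le> d" using assms d unfolding rat_interval_def e
    by (auto simp: field_simps zero_le_divide_iff)
  then show ?thesis using that d e by blast
qed

lemma rat_interval_flip: "rat_interval \<alpha> \<beta> d \<Longrightarrow> rat_interval (1 - \<beta>) (1 - \<alpha>) d"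
  unfolding rat_interval_def by (auto simp: algebra_simps intro!: Ints_diff)

text \<open>The reflection of the unit interval exchanges the two members of a Farey pair.\<close>

lemma farey_in_flip: "farey_in (1 - \<beta>) (1 - \<alpha>) b a \<longleftrightarrow> farey_in \<alpha> \<beta> a b"
proof -
  have *: "farey_in (1 - \<beta>) (1 - \<alpha>) b a" if f: "farey_in \<alpha> \<beta> a b" for \<alpha> \<beta> a b
  proof -
    obtain p p' where p: "p' * a - p * b = 1" "\<alpha> * a \<le> of_int p" "of_int p' \<le> \<beta> * b"
      using f unfolding farey_in_def by blast
    have "(a - p) * b - (b - p') * a = 1" using p(1) by (simp add: algebra_simps)
    moreover have "(1 - \<beta>) * b \<le> of_int (b - p')" "of_int (a - p) \<le> (1 - \<alpha>) * a"
      using p(2,3) by (auto simp: algebra_simps)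
    ultimately show ?thesis unfolding farey_in_def by blast
  qed
  show ?thesis using *[of \<alpha> \<beta> a b] *[of "1 - \<beta>" "1 - \<alpha>" b a] by auto
qed

lemma farey_dev_flip: "farey_dev (1 - \<beta>) (1 - \<alpha>) b a = farey_dev \<alpha> \<beta> a b"
  unfolding farey_dev_def farey_in_flip by simp

text \<open>The numerator \<open>p'\<close> of the second member is an inverse of \<open>a\<close> modulo \<open>b\<close> and determines \<open>p\<close>. The
condition \<open>\<alpha> \<le> p / a\<close> follows from \<open>\<alpha> < p' / b\<close>, as \<open>\<alpha>\<close> does not separate the pair.\<close>

lemma farey_in_iff_inverse:
  assumes r: "rat_interval \<alpha> \<beta> d" and ab: "d \<le> a" "0 < b"
  shows "farey_in \<alpha> \<beta> a b \<longleftrightarrow> (\<exists>p'. [p' * a = 1] (mod b) \<and> \<alpha> * b < of_int p' \<and> of_int p' \<le> \<beta> * of_int b)"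
proof
  assume "farey_in \<alpha> \<beta> a b"
  then obtain p p' where p: "p' * a - p * b = 1" "\<alpha> * a \<le> of_int p" "of_int p' \<le> \<beta> * b"
    unfolding farey_in_def by blast
  have a: "0 < a" using r ab unfolding rat_interval_def by simp
  have "\<alpha> * a * b \<le> of_int p * of_int b" using p(2) ab by (intro mult_right_mono) auto
  moreover have "of_int p * of_int b + 1 = (of_int (p' * a) :: real)" using p(1) by (metis (no_types) add.commute diff_add_cancel of_int_1 of_int_add of_int_mult)
  ultimately have "(\<alpha> * b) * a < of_int p' * a" by (simp add: algebra_simps)
  then have "\<alpha> * b < p'" using a by (simp add: mult_less_cancel_right)
  moreover have "[p' * a = 1] (mod b)" using p(1) by (metis cong_iff_dvd_diff dvd_triv_right add_diff_cancel_left' diff_add_cancel diff_diff_eq2)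
  ultimately show "\<exists>p'. [p' * a = 1] (mod b) \<and> \<alpha> * b < of_int p' \<and> of_int p' \<le> \<beta> * of_int b" using p(3) by blast
next
  assume "\<exists>p'. [p' * a = 1] (mod b) \<and> \<alpha> * b < of_int p' \<and> of_int p' \<le> \<beta> * of_int b"
  then obtain p' where p': "[p' * a = 1] (mod b)" "\<alpha> * b < p'" "p' \<le> \<beta> * b" by blast
  obtain i j where ij: "d > 0" "\<alpha> = of_int i / of_int d" using rat_intervalE[OF r] by blast
  have "b dvd p' * a - 1" using p'(1) by (simp add: cong_iff_dvd_diff)
  then obtain p where p: "p' * a - 1 = b * p" by (auto elim: dvdE)
  have "of_int (i * b) < (of_int (d * p') :: real)" using p'(2) ij by (simp add: field_simps)
  then have "i * b + 1 \<le> d * p'" by linarith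
  then have "(i * b + 1) * a \<le> d * p' * a" using ab ij by (intro mult_right_mono) auto
  then have "i * a * b + d \<le> d * (p' * a)" using ab by (simp add: algebra_simps)
  also have "p' * a = b * p + 1" using p by simp
  finally have "(i * a) * b \<le> (d * p) * b" by (simp add: algebra_simps)
  then have "i * a \<le> d * p" using ab by simp
  then have "of_int (i * a) \<le> (of_int (d * p) :: real)" by linarith
  then have "\<alpha> * a \<le> p" unfolding ij(2) using ij(1) by (simp add: field_simps)
  moreover have "p' * a - p * b = 1" using p by (simp add: algebra_simps)
  ultimately show "farey_in \<alpha> \<beta> a b" unfolding farey_in_def using p'(3) by blast
qed

lemma card_eq_by_relation:
  assumes "\<And>x. x \<in> A \<Longrightarrow> \<exists>!y. y \<in> B \<and> R x y" "\<And>y. y \<in> B \<Longrightarrow> \<exists>!x. x \<in> A \<and> R x y"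
  shows "card A = card B"
proof -
  define f where "f x = (THE y. y \<in> B \<and> R x y)" for x
  have f: "f x \<in> B \<and> R x (f x)" if "x \<in> A" for x
    unfolding f_def by (rule theI') (rule assms(1)[OF that])
  have "bij_betw f A B"
    unfolding bij_betw_def
  proof
    show "inj_on f A"
    proof (rule inj_onI)
      fix x y assume "x \<in> A" "y \<in> A" "f x = f y"
      then show "x = y" using f[of x] f[of y] assms(2)[of "f x"] by auto
    qed
    show "f ` A = B"
    proof (intro equalityI subsetI)
      fix y assume y: "y \<in> B"
      then obtain x where x: "x \<in> A" "R x y" using assms(2) by blast
      then have "f x = y" using f[of x] assms(1)[of x] y by auto
      then show "y \<in> f ` A" using x by blast
    qed (use f in auto)
  qed
  then show ?thesis by (rule bij_betw_same_card)
qed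

lemma cong_eq_in_window:
  assumes "[x = y] (mod b)" "\<bar>x - y\<bar> < (b::int)"
  shows "x = y"
proof (rule ccontr)
  assume "x \<noteq> y"
  moreover have "b dvd x - y" using assms(1) by (simp add: cong_iff_dvd_diff)
  ultimately have "\<bar>b\<bar> \<le> \<bar>x - y\<bar>" by (intro dvd_imp_le_int) auto
  then show False using assms(2) by linarith
qed

text \<open>When \<open>a\<close> runs through a full period modulo \<open>b\<close>, its inverses run through all units once. However
irregularly inversion scatters the residues, the number of inverses in a window is thus the
number of units there.\<close>

lemma card_period:
  fixes l b :: int and \<alpha> \<beta> :: real
  assumes r: "0 \<le> \<alpha>" "\<alpha> \<le> \<beta>" "\<beta> \<le> 1" and b: "0 < b"
  shows "card {a. l < a \<and> a \<le> l + b \<and> coprime a b \<and> (\<exists>p'. [p' * a = 1] (mod b) \<and> \<alpha> * b < of_int p' \<and> of_int p' \<le> \<beta> * of_int b)}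
       = card {p'. \<alpha> * b < of_int p' \<and> of_int p' \<le> \<beta> * of_int b \<and> coprime p' b}" (is "card ?L = card ?R")
proof (rule card_eq_by_relation[of _ _ "\<lambda>a p'. [p' * a = 1] (mod b)"])
  fix a assume a: "a \<in> ?L"
  then obtain p' where p': "[p' * a = 1] (mod b)" "\<alpha> * b < of_int p'" "p' \<le> \<beta> * b" by blast
  have R: "p' \<in> ?R" using p' by (simp add: coprime_iff_invertible_int) blast
  have uniq: "q = p'" if q: "[q * a = 1] (mod b)" "\<alpha> * b < of_int q" "q \<le> \<beta> * b" for q
  proof (rule cong_eq_in_window[of _ _ b])
    have "[q * a = p' * a] (mod b)" using q(1) p'(1) cong_sym cong_trans by blast
    then show "[q = p'] (mod b)" using a by (simp add: cong_mult_rcancel)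
    have "\<beta> * of_int b - \<alpha> * of_int b \<le> 1 * real_of_int b" unfolding left_diff_distrib[symmetric] using r b by (intro mult_right_mono) auto
    then have "\<bar>real_of_int q - of_int p'\<bar> < of_int b" using q(2,3) p'(2,3) by linarith
    then show "\<bar>q - p'\<bar> < b" by (simp flip: of_int_diff of_int_abs)
  qed
  show "\<exists>!p'. p' \<in> ?R \<and> [p' * a = 1] (mod b)"
    by (rule ex1I[of _ p']) (use R p'(1) uniq in blast)+
next
  fix p' assume p': "p' \<in> ?R"
  then obtain x where x: "[p' * x = 1] (mod b)" using cong_solve_coprime_int by blast
  define a where "a = l + 1 + (x - l - 1) mod b"
  have "[a = l + 1 + (x - l - 1)] (mod b)" unfolding a_def by (intro cong_add) (auto simp: cong_def)
  then have "[p' * a = p' * x] (mod b)" by (intro cong_mult) auto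
  then have pa: "[p' * a = 1] (mod b)" using x cong_trans by blast
  then have ca: "coprime a b" by (metis coprime_iff_invertible_int mult.commute)
  have a: "l < a" "a \<le> l + b" unfolding a_def using b pos_mod_bound[of b "x - l - 1"] pos_mod_sign[of b "x - l - 1"] by linarith+
  have uniq: "y = a" if y: "l < y" "y \<le> l + b" "[p' * y = 1] (mod b)" for y
  proof (rule cong_eq_in_window[of _ _ b])
    have "[p' * y = p' * a] (mod b)" using y(3) pa cong_sym cong_trans by blast
    then show "[y = a] (mod b)" using p' by (simp add: cong_mult_lcancel)
    show "\<bar>y - a\<bar> < b" using y a by linarith
  qed
  have L: "a \<in> ?L" using a pa ca p' by blast
  show "\<exists>!a. a \<in> ?L \<and> [p' * a = 1] (mod b)"
    by (rule ex1I[of _ a]) (use L pa uniq in blast)+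
qed

definition column_term :: "real \<Rightarrow> real \<Rightarrow> int \<Rightarrow> int \<Rightarrow> real" where
  "column_term \<alpha> \<beta> b a = (if coprime a b then farey_dev \<alpha> \<beta> a b else 0)"

text \<open>The sum is the number of units in the window minus \<open>\<beta> - \<alpha>\<close> times the number of all units. Both
numbers are known up to \<open>4 sqrt b\<close> from \<open>coprime_count\<close> and have the same main term.\<close>

lemma period_sum_bound:
  assumes r: "rat_interval \<alpha> \<beta> d" and l: "d \<le> l + 1" and b: "0 < b"
  shows "\<bar>\<Sum>a\<in>{l<..l+b}. column_term \<alpha> \<beta> b a\<bar> \<le> 8 * sqrt b"
proof -
  have ab: "0 \<le> \<alpha>" "\<alpha> < \<beta>" "\<beta> \<le> 1" using r unfolding rat_interval_def by auto
  define L where "L \<alpha> \<beta> = {a. l < a \<and> a \<le> l + b \<and> coprime a b \<and> (\<exists>p'. [p' * a = 1] (mod b) \<and> \<alpha> * b < of_int p' \<and> of_int p' \<le> \<beta> * of_int b)}" for \<alpha> \<beta> :: real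
  \<comment> \<open>Every unit has an inverse in \<open>{0<..b}\<close>, so for the full unit interval the condition on inverses is void.\<close>
  have L01: "L 0 1 = {a. l < a \<and> a \<le> l + b \<and> coprime a b}"
  proof -
    have "\<exists>p'. [p' * a = 1] (mod b) \<and> 0 < p' \<and> p' \<le> b" if c: "coprime a b" for a
    proof -
      obtain x where x: "[a * x = 1] (mod b)" using c cong_solve_coprime_int by blast
      define y where "y = 1 + (x - 1) mod b"
      have "[y = 1 + (x - 1)] (mod b)" unfolding y_def by (intro cong_add) (auto simp: cong_def)
      then have "[a * y = a * x] (mod b)" by (intro cong_mult) auto
      then have "[y * a = 1] (mod b)" using x cong_trans by (metis mult.commute)
      moreover have "0 < y" "y \<le> b" unfolding y_def using b pos_mod_bound[of b "x - 1"] pos_mod_sign[of b "x - 1"] by linarith+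
      ultimately show ?thesis by blast
    qed
    then show ?thesis unfolding L_def by auto
  qed
  have count: "\<bar>real (card (L \<alpha> \<beta>)) - (\<beta> - \<alpha>) * totient (nat b)\<bar> \<le> 4 * sqrt b" if "0 \<le> \<alpha>" "\<alpha> < \<beta>" "\<beta> \<le> 1" for \<alpha> \<beta> :: real
  proof -
    have "\<bar>real (card {n::int. \<alpha> * b < n \<and> n \<le> \<beta> * b \<and> coprime n (int (nat b))}) - (\<beta> * b - \<alpha> * b) * (totient (nat b) / nat b)\<bar> \<le> 4 * sqrt (nat b)"
      using b that by (intro coprime_count) auto
    moreover have "(\<beta> * b - \<alpha> * b) * (totient (nat b) / nat b) = (\<beta> - \<alpha>) * totient (nat b)"
      using b by (simp add: field_simps)
    ultimately show ?thesis using card_period[of \<alpha> \<beta> b l] that b unfolding L_def by simp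
  qed
  have fin: "finite {l<..l+b}" by simp
  have sub: "L \<alpha> \<beta> \<subseteq> {l<..l+b}" "L 0 1 \<subseteq> {l<..l+b}" unfolding L_def by auto
  have "column_term \<alpha> \<beta> b a = indicator (L \<alpha> \<beta>) a - (\<beta> - \<alpha>) * indicator (L 0 1) a" if a: "a \<in> {l<..l+b}" for a
  proof -
    have "farey_in \<alpha> \<beta> a b \<longleftrightarrow> (\<exists>p'. [p' * a = 1] (mod b) \<and> \<alpha> * b < of_int p' \<and> of_int p' \<le> \<beta> * of_int b)"
      using farey_in_iff_inverse[OF r _ b] a l by auto
    then show ?thesis using a unfolding column_term_def farey_dev_def L01 by (auto simp: L_def indicator_def)
  qed
  then have "(\<Sum>a\<in>{l<..l+b}. column_term \<alpha> \<beta> b a) = (\<Sum>a\<in>{l<..l+b}. indicator (L \<alpha> \<beta>) a - (\<beta> - \<alpha>) * indicator (L 0 1) a)"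
    by simp
  also have "\<dots> = real (card (L \<alpha> \<beta>)) - (\<beta> - \<alpha>) * real (card (L 0 1))"
  proof -
    have "{l<..l+b} \<inter> L \<alpha> \<beta> = L \<alpha> \<beta>" "{l<..l+b} \<inter> L 0 1 = L 0 1" using sub by auto
    moreover have "(\<Sum>a\<in>{l<..l+b}. indicat_real B a) = real (card ({l<..l+b} \<inter> B))" for B
      unfolding indicator_def of_bool_def by (simp add: sum.If_cases[OF fin])
    ultimately show ?thesis unfolding sum_subtractf sum_distrib_left[symmetric] by simp
  qed
  finally have eq: "(\<Sum>a\<in>{l<..l+b}. column_term \<alpha> \<beta> b a) = real (card (L \<alpha> \<beta>)) - (\<beta> - \<alpha>) * real (card (L 0 1))" .
  have "\<bar>real (card (L 0 1)) - totient (nat b)\<bar> \<le> 4 * sqrt b" using count[of 0 1] by simp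
  then have "(\<beta> - \<alpha>) * \<bar>real (card (L 0 1)) - totient (nat b)\<bar> \<le> 1 * (4 * sqrt b)"
    using ab by (intro mult_mono) auto
  then have "\<bar>(\<beta> - \<alpha>) * (real (card (L 0 1)) - totient (nat b))\<bar> \<le> 4 * sqrt b" using ab by (simp add: abs_mult)
  moreover have "(\<beta> - \<alpha>) * (real (card (L 0 1)) - totient (nat b)) = (\<beta> - \<alpha>) * real (card (L 0 1)) - (\<beta> - \<alpha>) * totient (nat b)"
    by (simp add: algebra_simps)
  ultimately show ?thesis unfolding eq using count[OF ab] by linarith
qed

text \<open>Each complete period costs \<open>8 sqrt b\<close>; the last, incomplete one is bounded by its length.\<close>

lemma column_sum_bound:
  assumes r: "rat_interval \<alpha> \<beta> d" and b: "0 < b" and l: "d \<le> l + 1" "l \<le> r'"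
  shows "\<bar>\<Sum>a\<in>{l<..r'}. column_term \<alpha> \<beta> b a\<bar> \<le> of_int (r' - l) / b * (8 * sqrt b) + b"
  using l
proof (induction "nat (r' - l)" arbitrary: l rule: less_induct)
  case less
  show ?case
  proof (cases "r' \<le> l + b")
    case True
    have "\<bar>\<Sum>a\<in>{l<..r'}. column_term \<alpha> \<beta> b a\<bar> \<le> (\<Sum>a\<in>{l<..r'}. 1)"
      using abs_farey_dev_le[OF r] by (intro order.trans[OF sum_abs] sum_mono) (auto simp: column_term_def)
    also have "\<dots> = of_int (r' - l)" using less.prems by simp
    also have "\<dots> \<le> b" using True by linarith
    also have "\<dots> \<le> of_int (r' - l) / b * (8 * sqrt b) + b" using less.prems b by simp
    finally show ?thesis .
  next
    case False
    have "{l<..r'} = {l<..l+b} \<union> {l+b<..r'}" using False b by auto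
    then have "(\<Sum>a\<in>{l<..r'}. column_term \<alpha> \<beta> b a) = (\<Sum>a\<in>{l<..l+b}. column_term \<alpha> \<beta> b a) + (\<Sum>a\<in>{l+b<..r'}. column_term \<alpha> \<beta> b a)"
      by (simp add: sum.union_disjoint)
    moreover have "\<bar>\<Sum>a\<in>{l+b<..r'}. column_term \<alpha> \<beta> b a\<bar> \<le> of_int (r' - (l + b)) / b * (8 * sqrt b) + b"
      using less.prems b False by (intro less.hyps) auto
    moreover have "\<bar>\<Sum>a\<in>{l<..l+b}. column_term \<alpha> \<beta> b a\<bar> \<le> 8 * sqrt b"
      using period_sum_bound[OF r less.prems(1) b] .
    moreover have "of_int (r' - (l + b)) / b * (8 * sqrt b) + 8 * sqrt b = of_int (r' - l) / b * (8 * sqrt b)"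
      using b by (simp add: field_simps)
    ultimately show ?thesis by linarith
  qed
qed

section \<open>Unimodular cones\<close>

text \<open>The substitution replaces the members of a Farey pair by combinations of them with nonnegative
coefficients, which stay between the old members. The inverse substitution sends a pair in the
interval to a Farey pair \<open>P / a < P' / b\<close> again; if an endpoint \<open>m / d\<close> cut off one of these
fractions, it would lie strictly between \<open>P / a\<close> and \<open>P' / b\<close>, because it does not cut off the
combinations. This is impossible for \<open>d < a + b\<close>.\<close>

lemma farey_in_unimodular:
  assumes r: "rat_interval \<alpha> \<beta> d" and u: "unimodular w1 w2 v1 v2" and ab: "0 < a" "0 < b" "d < a + b"
  shows "farey_in \<alpha> \<beta> (a * w1 + b * v1) (a * w2 + b * v2) \<longleftrightarrow> farey_in \<alpha> \<beta> a b"
proof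
  have nn: "0 \<le> w1" "0 \<le> w2" "0 \<le> v1" "0 \<le> v2" and det: "w1 * v2 - w2 * v1 = 1"
    using u unfolding unimodular_def by auto
  {
    assume "farey_in \<alpha> \<beta> a b"
    then obtain p p' where p: "p' * a - p * b = 1" "\<alpha> * a \<le> of_int p" "of_int p' \<le> \<beta> * b"
      unfolding farey_in_def by blast
    have "p' * a = p * b + 1" using p(1) by simp
    then have pa: "real_of_int p' * of_int a = of_int p * of_int b + 1" by (metis of_int_1 of_int_add of_int_mult)
    have "\<alpha> * a * b \<le> of_int p * of_int b" using p(2) ab by (intro mult_right_mono) auto
    then have "(\<alpha> * b) * a \<le> of_int p' * of_int a" using pa by (simp add: algebra_simps)
    then have 1: "\<alpha> * b \<le> p'" using ab by simp
    have "of_int p' * of_int a \<le> \<beta> * b * a" using p(3) ab by (intro mult_right_mono) auto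
    then have "of_int p * of_int b \<le> (\<beta> * a) * b" using pa by (simp add: algebra_simps)
    then have 2: "p \<le> \<beta> * a" using ab by simp
    have "(p * w2 + p' * v2) * (a * w1 + b * v1) - (p * w1 + p' * v1) * (a * w2 + b * v2)
        = (p' * a - p * b) * (w1 * v2 - w2 * v1)" by (simp add: algebra_simps)
    then have "(p * w2 + p' * v2) * (a * w1 + b * v1) - (p * w1 + p' * v1) * (a * w2 + b * v2) = 1"
      using p(1) det by simp
    moreover have "\<alpha> * of_int (a * w1 + b * v1) \<le> of_int (p * w1 + p' * v1)"
    proof -
      have "\<alpha> * a * w1 \<le> of_int p * of_int w1" "\<alpha> * b * v1 \<le> of_int p' * of_int v1" using p(2) 1 nn by (auto intro!: mult_right_mono)
      then show ?thesis by (simp add: algebra_simps)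
    qed
    moreover have "of_int (p * w2 + p' * v2) \<le> \<beta> * of_int (a * w2 + b * v2)"
    proof -
      have "of_int p * of_int w2 \<le> \<beta> * a * w2" "of_int p' * of_int v2 \<le> \<beta> * b * v2" using p(3) 2 nn by (auto intro!: mult_right_mono)
      then show ?thesis by (simp add: algebra_simps)
    qed
    ultimately show "farey_in \<alpha> \<beta> (a * w1 + b * v1) (a * w2 + b * v2)" unfolding farey_in_def by blast
  }
  assume "farey_in \<alpha> \<beta> (a * w1 + b * v1) (a * w2 + b * v2)"
  then obtain p p' where p: "p' * (a * w1 + b * v1) - p * (a * w2 + b * v2) = 1"
      "\<alpha> * of_int (a * w1 + b * v1) \<le> of_int p" "of_int p' \<le> \<beta> * of_int (a * w2 + b * v2)"
      unfolding farey_in_def by blast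
  define P P' where "P = v2 * p - v1 * p'" and "P' = w1 * p' - w2 * p"
  have PP: "P' * a - P * b = 1" using p(1) unfolding P_def P'_def by (simp add: algebra_simps)
  have inv1: "P * w1 + P' * v1 = p"
  proof -
    have "P * w1 + P' * v1 = p * (w1 * v2 - w2 * v1)" unfolding P_def P'_def by (simp add: algebra_simps)
    then show ?thesis using det by simp
  qed
  have inv2: "P * w2 + P' * v2 = p'"
  proof -
    have "P * w2 + P' * v2 = p' * (w1 * v2 - w2 * v1)" unfolding P_def P'_def by (simp add: algebra_simps)
    then show ?thesis using det by simp
  qed
  have w1: "0 < w1" and v2: "0 < v2" using det nn by (smt (verit) mult_nonneg_nonneg mult_eq_0_iff)+
  obtain i j where ij: "d > 0" "\<alpha> = of_int i / of_int d" "\<beta> = of_int j / of_int d" using rat_intervalE[OF r] by blast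
  have p2: "i * (a * w1 + b * v1) \<le> d * p"
  proof -
    have "real_of_int (i * (a * w1 + b * v1)) \<le> of_int (d * p)" using p(2) ij(1) unfolding ij(2) by (simp add: field_simps)
    then show ?thesis by linarith
  qed
  have p3: "d * p' \<le> j * (a * w2 + b * v2)"
  proof -
    have "real_of_int (d * p') \<le> of_int (j * (a * w2 + b * v2))" using p(3) ij(1) unfolding ij(3) by (simp add: field_simps)
    then show ?thesis by linarith
  qed
  have det2: "d = a * (d * P' - m * b) + b * (m * a - d * P)" for m
  proof -
    have "a * (d * P' - m * b) + b * (m * a - d * P) = d * (P' * a - P * b)" by (simp add: algebra_simps)
    then show ?thesis using PP by simp
  qed
  have no: False if "m * b < d * P'" "d * P < m * a" for m
  proof -
    have "a * 1 + b * 1 \<le> a * (d * P' - m * b) + b * (m * a - d * P)"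
      using that ab by (intro add_mono mult_left_mono) auto
    then show False using det2[of m] ab by simp
  qed
  have "i * a \<le> d * P"
  proof (rule ccontr)
    assume "\<not> i * a \<le> d * P"
    then have lt: "d * P < i * a" by simp
    have "d * P * w1 < i * a * w1" using lt w1 by (rule mult_strict_right_mono)
    moreover have "i * a * w1 + i * b * v1 \<le> d * P * w1 + d * P' * v1" using p2 unfolding inv1[symmetric] by (simp add: algebra_simps)
    ultimately have "i * b * v1 < d * P' * v1" by linarith
    then have "i * b < d * P'" using nn by (metis mult_less_cancel_right_disj not_le mult_right_mono)
    then show False using no lt by blast
  qed
  moreover have "d * P' \<le> j * b"
  proof (rule ccontr)
    assume "\<not> d * P' \<le> j * b"
    then have lt: "j * b < d * P'" by simp
    have "j * b * v2 < d * P' * v2" using lt v2 by (rule mult_strict_right_mono)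
    moreover have "d * P * w2 + d * P' * v2 \<le> j * a * w2 + j * b * v2" using p3 unfolding inv2[symmetric] by (simp add: algebra_simps)
    ultimately have "d * P * w2 < j * a * w2" by linarith
    then have "d * P < j * a" using nn by (metis mult_less_cancel_right_disj not_le mult_right_mono)
    then show False using no lt by blast
  qed
  ultimately have "real_of_int (i * a) \<le> of_int (d * P)" "real_of_int (d * P') \<le> of_int (j * b)" by linarith+
  then have "\<alpha> * a \<le> P" "P' \<le> \<beta> * b" unfolding ij(2,3) using ij(1) by (auto simp: field_simps)
  then show "farey_in \<alpha> \<beta> a b" unfolding farey_in_def using PP by blast
qed

text \<open>The primitive lattice points of the open cone spanned by \<open>w\<close> and \<open>v\<close> that lie below \<open>(X, Y)\<close>,
given by their coordinates with respect to \<open>w\<close> and \<open>v\<close>.\<close>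

definition cone_points :: "int \<Rightarrow> int \<Rightarrow> int \<Rightarrow> int \<Rightarrow> real \<Rightarrow> real \<Rightarrow> (int \<times> int) set" where
  "cone_points w1 w2 v1 v2 X Y = {(a, b). 0 < a \<and> 0 < b \<and> coprime a b \<and>
     of_int (a * w1 + b * v1) \<le> X \<and> of_int (a * w2 + b * v2) \<le> Y}"

definition cone_sum :: "real \<Rightarrow> real \<Rightarrow> int \<Rightarrow> int \<Rightarrow> int \<Rightarrow> int \<Rightarrow> real \<Rightarrow> real \<Rightarrow> real" where
  "cone_sum \<alpha> \<beta> w1 w2 v1 v2 X Y =
     (\<Sum>(a, b)\<in>cone_points w1 w2 v1 v2 X Y. farey_dev \<alpha> \<beta> (a * w1 + b * v1) (a * w2 + b * v2))"

lemma unimodular_pos: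
  assumes "unimodular w1 w2 v1 v2" shows "1 \<le> w1 + w2" "1 \<le> v1 + v2"
  using assms unfolding unimodular_def by (smt (verit) mult_nonneg_nonneg mult_eq_0_iff)+

lemma cone_points_bound:
  assumes u: "unimodular w1 w2 v1 v2" and z: "(a, b) \<in> cone_points w1 w2 v1 v2 X Y"
  shows "of_int a * of_int (w1 + w2) + of_int b * of_int (v1 + v2) \<le> X + Y" "of_int a * of_int (w1 + w2) \<le> X + Y" "of_int b * of_int (v1 + v2) \<le> X + Y"
    "a \<le> X + Y" "b \<le> X + Y"
proof -
  have p: "0 < a" "0 < b" and le: "of_int (a * w1 + b * v1) \<le> X" "of_int (a * w2 + b * v2) \<le> Y"
    using z unfolding cone_points_def by auto
  note s = unimodular_pos[OF u]
  show 1: "of_int a * of_int (w1 + w2) + of_int b * of_int (v1 + v2) \<le> X + Y" using le by (simp add: algebra_simps)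
  have g: "1 \<le> real_of_int (w1 + w2)" "1 \<le> real_of_int (v1 + v2)" using s by linarith+
  have 2: "real_of_int a * 1 \<le> real_of_int a * of_int (w1 + w2)" "real_of_int b * 1 \<le> real_of_int b * of_int (v1 + v2)"
    using g p by (intro mult_left_mono; simp)+
  then show "of_int a * of_int (w1 + w2) \<le> X + Y" "of_int b * of_int (v1 + v2) \<le> X + Y" "a \<le> X + Y" "b \<le> X + Y" using 1 p mult_nonneg_nonneg[of "real_of_int a" "of_int (w1 + w2)"] mult_nonneg_nonneg[of "real_of_int b" "of_int (v1 + v2)"] g by linarith+
qed

lemma finite_cone_points:
  assumes "unimodular w1 w2 v1 v2" shows "finite (cone_points w1 w2 v1 v2 X Y)"
proof -
  have "cone_points w1 w2 v1 v2 X Y \<subseteq> {0<..\<lfloor>X + Y\<rfloor>} \<times> {0<..\<lfloor>X + Y\<rfloor>}"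
    using cone_points_bound(4,5)[OF assms, of _ _ X Y] by (auto simp: cone_points_def le_floor_iff)
  then show ?thesis using finite_subset by blast
qed

lemma card_cone_points_le:
  assumes u: "unimodular w1 w2 v1 v2" and XY: "0 \<le> X + Y"
  shows "card (cone_points w1 w2 v1 v2 X Y) \<le> (X + Y)\<^sup>2 / (of_int (w1 + w2) * of_int (v1 + v2))"
proof -
  let ?w = "real_of_int (w1 + w2)" and ?v = "real_of_int (v1 + v2)"
  have g: "1 \<le> ?w" "1 \<le> ?v" using unimodular_pos[OF u] by linarith+
  have "a \<le> (X + Y) / ?w \<and> b \<le> (X + Y) / ?v" if "(a, b) \<in> cone_points w1 w2 v1 v2 X Y" for a b
  proof
    show "real_of_int a \<le> (X + Y) / ?w" using cone_points_bound(2)[OF u that] g(1) by (subst pos_le_divide_eq) linarith+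
    show "real_of_int b \<le> (X + Y) / ?v" using cone_points_bound(3)[OF u that] g(2) by (subst pos_le_divide_eq) linarith+
  qed
  then have "cone_points w1 w2 v1 v2 X Y \<subseteq> {0<..\<lfloor>(X + Y) / ?w\<rfloor>} \<times> {0<..\<lfloor>(X + Y) / ?v\<rfloor>}"
    by (auto simp: cone_points_def le_floor_iff)
  then have "card (cone_points w1 w2 v1 v2 X Y) \<le> card ({0<..\<lfloor>(X + Y) / ?w\<rfloor>} \<times> {0<..\<lfloor>(X + Y) / ?v\<rfloor>})"
    by (intro card_mono) auto
  also have "\<dots> = nat \<lfloor>(X + Y) / ?w\<rfloor> * nat \<lfloor>(X + Y) / ?v\<rfloor>" by simp
  finally have "real (card (cone_points w1 w2 v1 v2 X Y)) \<le> real (nat \<lfloor>(X + Y) / ?w\<rfloor>) * real (nat \<lfloor>(X + Y) / ?v\<rfloor>)"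
    by (metis of_nat_le_iff of_nat_mult)
  also have "\<dots> \<le> ((X + Y) / ?w) * ((X + Y) / ?v)"
    using XY g by (intro mult_mono of_nat_floor) auto
  finally show ?thesis by (simp add: power2_eq_square)
qed

text \<open>The trivial bound is of the order of the area of the cone below the line \<open>x + y = X + Y\<close>.\<close>

lemma abs_cone_sum_le:
  assumes u: "unimodular w1 w2 v1 v2" and XY: "0 \<le> X + Y" and r: "rat_interval \<alpha> \<beta> d"
  shows "\<bar>cone_sum \<alpha> \<beta> w1 w2 v1 v2 X Y\<bar> \<le> (X + Y)\<^sup>2 / (of_int (w1 + w2) * of_int (v1 + v2))"
proof -
  have "\<bar>cone_sum \<alpha> \<beta> w1 w2 v1 v2 X Y\<bar> \<le> (\<Sum>z\<in>cone_points w1 w2 v1 v2 X Y. 1)"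
    unfolding cone_sum_def using abs_farey_dev_le[OF r]
    by (intro order.trans[OF sum_abs] sum_mono) (auto split: prod.splits)
  then show ?thesis using card_cone_points_le[OF u XY] by simp
qed

lemma unimodular_right: "unimodular w1 w2 v1 v2 \<Longrightarrow> unimodular (w1 + v1) (w2 + v2) v1 v2"
  unfolding unimodular_def by (auto simp: algebra_simps)

lemma coprime_add_left: "coprime (a + b) b \<longleftrightarrow> coprime a (b::int)"
  by (metis coprime_iff_gcd_eq_1 gcd_add1)

lemma coprime_add_right: "coprime a (a + b) \<longleftrightarrow> coprime a (b::int)"
  by (metis coprime_add_left add.commute coprime_commute)

lemma coprime_diff_left: "coprime (a - b) b \<longleftrightarrow> coprime a (b::int)"
  using coprime_add_left[of "a - b" b] by simp

lemma coprime_diff_right: "coprime a (b - a) \<longleftrightarrow> coprime a (b::int)"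
  using coprime_add_right[of a "b - a"] by simp

text \<open>The ray through \<open>w + v\<close> cuts the cone in two and contains a single primitive point.\<close>

lemma cone_sum_split:
  assumes u: "unimodular w1 w2 v1 v2" and r: "rat_interval \<alpha> \<beta> d"
  shows "\<bar>cone_sum \<alpha> \<beta> w1 w2 v1 v2 X Y\<bar> \<le>
    \<bar>cone_sum \<alpha> \<beta> w1 w2 (w1 + v1) (w2 + v2) X Y\<bar> + \<bar>cone_sum \<alpha> \<beta> (w1 + v1) (w2 + v2) v1 v2 X Y\<bar> + 1"
proof -
  let ?P = "cone_points w1 w2 v1 v2 X Y"
  define F where "F z = farey_dev \<alpha> \<beta> (fst z * w1 + snd z * v1) (fst z * w2 + snd z * v2)" for z
  have fin: "finite ?P" using finite_cone_points[OF u] .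
  define P1 P2 P3 where "P1 = {z\<in>?P. snd z < fst z}" and "P2 = {z\<in>?P. fst z < snd z}" and "P3 = {z\<in>?P. fst z = snd z}"
  have "?P = P1 \<union> (P2 \<union> P3)" unfolding P1_def P2_def P3_def using less_linear by blast
  moreover have "finite P1" "finite P2" "finite P3" using fin unfolding P1_def P2_def P3_def by simp_all
  moreover have "P1 \<inter> (P2 \<union> P3) = {}" "P2 \<inter> P3 = {}" unfolding P1_def P2_def P3_def by auto
  ultimately have "sum F ?P = sum F P1 + (sum F P2 + sum F P3)"
    by (simp add: sum.union_disjoint)
  moreover have "sum F P1 = cone_sum \<alpha> \<beta> w1 w2 (w1 + v1) (w2 + v2) X Y"
  proof -
    have "P1 = (\<lambda>(a, b). (a + b, b)) ` cone_points w1 w2 (w1 + v1) (w2 + v2) X Y"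
    proof (intro equalityI subsetI)
      fix z assume z: "z \<in> P1"
      obtain a b where ab: "z = (a, b)" by (cases z)
      have "(a - b, b) \<in> cone_points w1 w2 (w1 + v1) (w2 + v2) X Y"
        using z unfolding ab P1_def cone_points_def by (simp add: coprime_diff_left algebra_simps)
      then show "z \<in> (\<lambda>(a, b). (a + b, b)) ` cone_points w1 w2 (w1 + v1) (w2 + v2) X Y"
        unfolding ab by (rule rev_image_eqI) simp
    next
      fix z assume "z \<in> (\<lambda>(a, b). (a + b, b)) ` cone_points w1 w2 (w1 + v1) (w2 + v2) X Y"
      then obtain a b where ab: "z = (a + b, b)" "(a, b) \<in> cone_points w1 w2 (w1 + v1) (w2 + v2) X Y" by auto
      then show "z \<in> P1"
        unfolding ab P1_def cone_points_def by (simp add: coprime_add_left algebra_simps)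
    qed
    moreover have inj: "inj_on (\<lambda>(a::int, b). (a + b, b)) Q" for Q
      by (auto simp: inj_on_def)
    ultimately have "sum F P1 = sum (F \<circ> (\<lambda>(a, b). (a + b, b))) (cone_points w1 w2 (w1 + v1) (w2 + v2) X Y)"
      by (simp only: sum.reindex[OF inj])
    also have "\<dots> = cone_sum \<alpha> \<beta> w1 w2 (w1 + v1) (w2 + v2) X Y"
      unfolding cone_sum_def by (rule sum.cong) (simp_all add: F_def case_prod_unfold algebra_simps)
    finally show ?thesis .
  qed
  moreover have "sum F P2 = cone_sum \<alpha> \<beta> (w1 + v1) (w2 + v2) v1 v2 X Y"
  proof -
    have "P2 = (\<lambda>(a, b). (a, a + b)) ` cone_points (w1 + v1) (w2 + v2) v1 v2 X Y"
    proof (intro equalityI subsetI)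
      fix z assume z: "z \<in> P2"
      obtain a b where ab: "z = (a, b)" by (cases z)
      have "(a, b - a) \<in> cone_points (w1 + v1) (w2 + v2) v1 v2 X Y"
        using z unfolding ab P2_def cone_points_def by (simp add: coprime_diff_right algebra_simps)
      then show "z \<in> (\<lambda>(a, b). (a, a + b)) ` cone_points (w1 + v1) (w2 + v2) v1 v2 X Y"
        unfolding ab by (rule rev_image_eqI) simp
    next
      fix z assume "z \<in> (\<lambda>(a, b). (a, a + b)) ` cone_points (w1 + v1) (w2 + v2) v1 v2 X Y"
      then obtain a b where ab: "z = (a, a + b)" "(a, b) \<in> cone_points (w1 + v1) (w2 + v2) v1 v2 X Y" by auto
      then show "z \<in> P2"
        unfolding ab P2_def cone_points_def by (simp add: coprime_add_right algebra_simps)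
    qed
    moreover have inj: "inj_on (\<lambda>(a::int, b). (a, a + b)) Q" for Q
      by (auto simp: inj_on_def)
    ultimately have "sum F P2 = sum (F \<circ> (\<lambda>(a, b). (a, a + b))) (cone_points (w1 + v1) (w2 + v2) v1 v2 X Y)"
      by (simp only: sum.reindex[OF inj])
    also have "\<dots> = cone_sum \<alpha> \<beta> (w1 + v1) (w2 + v2) v1 v2 X Y"
      unfolding cone_sum_def by (rule sum.cong) (simp_all add: F_def case_prod_unfold algebra_simps)
    finally show ?thesis .
  qed
  moreover have "\<bar>sum F P3\<bar> \<le> 1"
  proof -
    have "P3 \<subseteq> {(1, 1)}" by (auto simp: P3_def cone_points_def)
    then consider "P3 = {}" | "P3 = {(1, 1)}" by blast
    then show ?thesis
    proof cases
      case 2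
      show ?thesis unfolding 2 using abs_farey_dev_le[OF r] by (simp add: F_def)
    qed (auto simp only: sum.empty)
  qed
  moreover have "cone_sum \<alpha> \<beta> w1 w2 v1 v2 X Y = sum F ?P"
    unfolding cone_sum_def F_def by (simp add: case_prod_unfold)
  ultimately show ?thesis by linarith
qed

lemma cone_sum_flip:
  "cone_sum (1 - \<beta>) (1 - \<alpha>) v2 v1 w2 w1 Y X = cone_sum \<alpha> \<beta> w1 w2 v1 v2 X Y"
  unfolding cone_sum_def
  by (rule sum.reindex_bij_witness[of _ "\<lambda>(a, b). (b, a)" "\<lambda>(a, b). (b, a)"])
     (auto simp: cone_points_def coprime_commute farey_dev_flip add.commute)

lemma unimodular_flip: "unimodular w1 w2 v1 v2 \<Longrightarrow> unimodular v2 v1 w2 w1"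
  unfolding unimodular_def by (auto simp: algebra_simps)

lemma unimodular_add_multiple: "unimodular w1 w2 v1 v2 \<Longrightarrow> unimodular w1 w2 (int k * w1 + v1) (int k * w2 + v2)"
  unfolding unimodular_def by (auto simp: algebra_simps)

lemma downward_closed_interval:
  assumes "finite T" "\<And>a. a \<in> T \<Longrightarrow> (0::int) < a" "\<And>a b. a \<in> T \<Longrightarrow> 0 < b \<Longrightarrow> b \<le> a \<Longrightarrow> b \<in> T"
  obtains r where "T = {0<..r}" "0 \<le> r"
proof (cases "T = {}")
  case True
  then show ?thesis using that[of 0] by simp
next
  case False
  have M: "Max T \<in> T" using Max_in[OF assms(1) False] .
  have "T = {0<..Max T}"
  proof (intro equalityI subsetI)
    fix a assume "a \<in> T"
    then show "a \<in> {0<..Max T}" using assms(2) Max_ge[OF assms(1)] by simp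
  next
    fix a assume "a \<in> {0<..Max T}"
    then show "a \<in> T" using assms(3)[OF M] by simp
  qed
  moreover have "0 \<le> Max T" using assms(2)[OF M] by simp
  ultimately show ?thesis using that by blast
qed

text \<open>Let \<open>u = k * w + v\<close>. The point \<open>a * w + b * u\<close> has the coordinates \<open>(a + k * b, b)\<close> with respect to
\<open>w\<close> and \<open>v\<close>, so that \<open>farey_in_unimodular\<close> turns the sum over a fixed \<open>b\<close> into a sum over a stretch
of the column of \<open>b\<close> to which \<open>column_sum_bound\<close> applies. The three terms of the bound come from
the incomplete periods of all columns, from the complete periods, and from the columns \<open>b < d\<close>,
which are bounded by their lengths. The first term is small compared with the number of points
when \<open>u\<close> is much longer than \<open>w\<close>.\<close>

lemma good_cone_bound:
  assumes u: "unimodular w1 w2 v1 v2" and r: "rat_interval \<alpha> \<beta> d" and k: "1 \<le> k" and XY: "0 \<le> X" "0 \<le> Y"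
  defines "u1 \<equiv> int k * w1 + v1" and "u2 \<equiv> int k * w2 + v2"
  shows "\<bar>cone_sum \<alpha> \<beta> w1 w2 u1 u2 X Y\<bar> \<le> (X + Y)\<^sup>2 / (of_int (u1 + u2))\<^sup>2 + 16 * (X + Y) * sqrt (X + Y) + d * (X + Y)"
proof -
  let ?P = "cone_points w1 w2 u1 u2 X Y"
  let ?u = "real_of_int (u1 + u2)"
  define A where "A = X + Y"
  have A: "0 \<le> A" using XY unfolding A_def by simp
  have d: "0 < d" using r unfolding rat_interval_def by simp
  have uu: "unimodular w1 w2 u1 u2" unfolding u1_def u2_def using unimodular_add_multiple[OF u] .
  have g: "1 \<le> ?u" using unimodular_pos[OF uu] by linarith
  define B where "B = nat \<lfloor>A / ?u\<rfloor>"
  have B: "real B \<le> A / ?u" unfolding B_def using A g by (intro of_nat_floor) auto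
  define T where "T b = {a. 0 < a \<and> of_int (a * w1 + b * u1) \<le> X \<and> of_int (a * w2 + b * u2) \<le> Y}" for b :: int
  define F where "F a b = farey_dev \<alpha> \<beta> (a * w1 + b * u1) (a * w2 + b * u2)" for a b
  have a_le: "of_int a \<le> A" if "a \<in> T b" "0 < b" for a b
  proof -
    have "of_int (a * (w1 + w2)) + of_int (b * (u1 + u2)) \<le> A" using that unfolding T_def A_def by (simp add: algebra_simps)
    moreover have "a * 1 \<le> a * (w1 + w2)"
      using that unimodular_pos[OF uu] unfolding T_def by (intro mult_left_mono; simp)
    moreover have "0 \<le> b * (u1 + u2)"
      using that unimodular_pos[OF uu] by (intro mult_nonneg_nonneg) linarith+
    ultimately show ?thesis by linarith
  qed
  have finT: "finite (T b)" if "0 < b" for b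
    by (rule finite_subset[of _ "{0<..\<lfloor>A\<rfloor>}"]) (use a_le[OF _ that] in \<open>auto simp: T_def le_floor_iff\<close>)
  have PB: "?P = (\<lambda>(b, a). (a, b)) ` (SIGMA b:int ` {1..B}. {a\<in>T b. coprime a b})"
  proof (intro equalityI subsetI)
    fix z assume z: "z \<in> ?P"
    then obtain a b where ab: "z = (a, b)" by (cases z)
    have "of_int b * ?u \<le> A" using cone_points_bound(3)[OF uu] z ab unfolding A_def by blast
    then have "of_int b \<le> A / ?u" using g by (subst pos_le_divide_eq) linarith+
    then have "nat b \<le> B" unfolding B_def by (simp add: le_floor_iff nat_mono)
    moreover have "0 < b" using z ab unfolding cone_points_def by auto
    ultimately have "b \<in> int ` {1..B}" by (intro image_eqI[of _ _ "nat b"]) auto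
    then show "z \<in> (\<lambda>(b, a). (a, b)) ` (SIGMA b:int ` {1..B}. {a\<in>T b. coprime a b})"
      using z unfolding ab cone_points_def T_def by (intro image_eqI[of _ _ "(b, a)"]) auto
  qed (auto simp: cone_points_def T_def)
  have "cone_sum \<alpha> \<beta> w1 w2 u1 u2 X Y = (\<Sum>(b, a)\<in>(SIGMA b:int ` {1..B}. {a\<in>T b. coprime a b}). F a b)"
    unfolding cone_sum_def PB F_def
    by (subst sum.reindex) (auto simp: inj_on_def case_prod_unfold)
  also have "\<dots> = (\<Sum>b\<in>int ` {1..B}. \<Sum>a\<in>{a\<in>T b. coprime a b}. F a b)"
    using finT by (intro sum.Sigma[symmetric]) auto
  also have "\<dots> = (\<Sum>b=1..B. \<Sum>a\<in>{a\<in>T (int b). coprime a (int b)}. F a (int b))"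
    by (subst sum.reindex) auto
  finally have S: "cone_sum \<alpha> \<beta> w1 w2 u1 u2 X Y = (\<Sum>b=1..B. \<Sum>a\<in>{a\<in>T (int b). coprime a (int b)}. F a (int b))" .
  have col: "\<bar>\<Sum>a\<in>{a\<in>T (int b). coprime a (int b)}. F a (int b)\<bar> \<le> 8 * A * (1 / sqrt b) + b + (if b < nat d then A else 0)"
    if b: "b \<in> {1..B}" for b
  proof -
    have b0: "0 < int b" using b by auto
    obtain r' where r': "T (int b) = {0<..r'}" "0 \<le> r'"
    proof (rule downward_closed_interval[of "T (int b)"])
      show "finite (T (int b))" using finT b0 .
      fix a a' assume a: "a \<in> T (int b)" "0 < a'" "a' \<le> a"
      have "a' * w1 \<le> a * w1" "a' * w2 \<le> a * w2" using a(3) u unfolding unimodular_def by (auto intro: mult_right_mono)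
      then have "real_of_int (a' * w1) \<le> of_int (a * w1)" "real_of_int (a' * w2) \<le> of_int (a * w2)" by linarith+
      then show "a' \<in> T (int b)" using a unfolding T_def by simp
    qed (auto simp: T_def)
    have rA: "of_int r' \<le> A" using a_le[of r' "int b"] b0 r' A by (cases "r' = 0") auto
    show ?thesis
    proof (cases "b < nat d")
      case True
      have "\<bar>\<Sum>a\<in>{a\<in>T (int b). coprime a (int b)}. F a (int b)\<bar> \<le> (\<Sum>a\<in>{a\<in>T (int b). coprime a (int b)}. 1)"
        unfolding F_def using abs_farey_dev_le[OF r] by (intro order.trans[OF sum_abs] sum_mono) auto
      also have "\<dots> \<le> (\<Sum>a\<in>T (int b). 1)" using finT[OF b0] by (intro sum_mono2) auto
      also have "\<dots> = of_int r'" unfolding r' using r'(2) by simp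
      finally show ?thesis using rA True A by (simp add: add_increasing)
    next
      case False
      then have db: "d \<le> int b" by linarith
      have "F a (int b) = farey_dev \<alpha> \<beta> (a + int k * int b) (int b)" if a: "0 < a" for a
      proof -
        have "int b * 1 \<le> int b * int k" using k by (intro mult_left_mono) auto
        then have ge: "d < (a + int k * int b) + int b" using a db b0 by (smt (verit) mult.commute)
        have "a * w1 + int b * u1 = (a + int k * int b) * w1 + int b * v1"
             "a * w2 + int b * u2 = (a + int k * int b) * w2 + int b * v2"
          unfolding u1_def u2_def by (auto simp: algebra_simps)
        then show ?thesis unfolding F_def farey_dev_def
          using farey_in_unimodular[OF r u _ b0 ge] a b0 by (simp add: add_pos_nonneg)
      qed
      then have "(\<Sum>a\<in>{a\<in>T (int b). coprime a (int b)}. F a (int b))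
          = (\<Sum>a\<in>{a\<in>{0<..r'}. coprime a (int b)}. farey_dev \<alpha> \<beta> (a + int k * int b) (int b))"
        unfolding r' by (intro sum.cong) auto
      also have "\<dots> = (\<Sum>a\<in>{0<..r'}. column_term \<alpha> \<beta> (int b) (a + int k * int b))"
      proof -
        have "coprime (a + int k * int b) (int b) \<longleftrightarrow> coprime a (int b)" for a
          by (metis coprime_iff_gcd_eq_1 gcd_add_mult mult.commute gcd.commute add.commute)
        then show ?thesis by (subst sum.inter_filter) (auto simp: column_term_def intro!: sum.cong)
      qed
      also have "\<dots> = (\<Sum>a\<in>{int k * int b<..int k * int b + r'}. column_term \<alpha> \<beta> (int b) a)"
        by (rule sum.reindex_bij_witness[of _ "\<lambda>a. a - int k * int b" "\<lambda>a. a + int k * int b"]) auto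
      finally have eq: "(\<Sum>a\<in>{a\<in>T (int b). coprime a (int b)}. F a (int b)) = \<dots>" .
      have "int b * 1 \<le> int b * int k" using k by (intro mult_left_mono) auto
      then have "d \<le> int k * int b + 1" using db by (simp add: mult.commute)
      then have "\<bar>\<Sum>a\<in>{int k * int b<..int k * int b + r'}. column_term \<alpha> \<beta> (int b) a\<bar>
          \<le> of_int (int k * int b + r' - int k * int b) / of_int (int b) * (8 * sqrt (of_int (int b))) + of_int (int b)"
        using b0 r'(2) by (intro column_sum_bound[OF r]) auto
      also have "\<dots> = of_int r' / b * (8 * sqrt b) + b" by simp
      also have "\<dots> \<le> A / b * (8 * sqrt b) + b" using rA b by (intro add_mono mult_right_mono divide_right_mono) auto
      also have "A / b * (8 * sqrt b) = 8 * A * (1 / sqrt b)"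
      proof -
        have "A / b * (8 * sqrt b) = 8 * A * (sqrt b / b)" by simp
        also have "sqrt b / b = 1 / sqrt b" using real_div_sqrt[of "real b"] b by (simp add: field_simps)
        finally show ?thesis .
      qed
      finally show ?thesis unfolding eq using A by simp
    qed
  qed
  have "\<bar>cone_sum \<alpha> \<beta> w1 w2 u1 u2 X Y\<bar> \<le> (\<Sum>b=1..B. 8 * A * (1 / sqrt b) + b + (if b < nat d then A else 0))"
    unfolding S by (rule order.trans[OF sum_abs], rule sum_mono) (rule col)
  also have "\<dots> = 8 * A * (\<Sum>b=1..B. 1 / sqrt b) + (\<Sum>b=1..B. real b) + (\<Sum>b=1..B. if b < nat d then A else 0)"
    by (simp add: sum.distrib sum_distrib_left)
  also have "\<dots> \<le> 16 * A * sqrt A + (A / ?u)\<^sup>2 + d * A"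
  proof (intro add_mono)
    have BA: "real B \<le> A"
    proof -
      have "A / ?u \<le> A / 1" using g A by (intro divide_left_mono) auto
      then show ?thesis using B by simp
    qed
    have "8 * A * (\<Sum>b=1..B. 1 / sqrt b) \<le> 8 * A * (2 * sqrt B)"
      using A sum_inverse_sqrt_le[of B] by (intro mult_left_mono) auto
    also have "\<dots> \<le> 8 * A * (2 * sqrt A)" using A BA by (intro mult_left_mono) auto
    finally show "8 * A * (\<Sum>b=1..B. 1 / sqrt b) \<le> 16 * A * sqrt A" by simp
    have "(\<Sum>b=1..B. real b) \<le> (\<Sum>b=1..B. real B)" by (intro sum_mono) auto
    also have "\<dots> = (real B)\<^sup>2" by (simp add: power2_eq_square)
    also have "\<dots> \<le> (A / ?u)\<^sup>2" using B by (intro power_mono) auto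
    finally show "(\<Sum>b=1..B. real b) \<le> (A / ?u)\<^sup>2" .
    have "(\<Sum>b=1..B. if b < nat d then A else 0) = (\<Sum>b\<in>{b\<in>{1..B}. b < nat d}. A)"
      by (rule sum.inter_filter[symmetric]) simp
    also have "\<dots> = real (card {b\<in>{1..B}. b < nat d}) * A" by simp
    also have "\<dots> \<le> real (card {..<nat d}) * A" using A by (intro mult_right_mono of_nat_mono card_mono) auto
    also have "\<dots> = d * A" using d by simp
    finally show "(\<Sum>b=1..B. if b < nat d then A else 0) \<le> d * A" .
  qed
  finally show ?thesis unfolding A_def[symmetric] by (simp add: power_divide)
qed

section \<open>Equidistribution of Farey pairs\<close>

text \<open>Twice the area of the triangle that the line \<open>x + y = 1\<close> cuts off from the cone.\<close>

definition cone_mass :: "int \<Rightarrow> int \<Rightarrow> int \<Rightarrow> int \<Rightarrow> real" where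
  "cone_mass w1 w2 v1 v2 = 1 / (of_int (w1 + w2) * of_int (v1 + v2))"

lemma cone_mass_split:
  assumes "unimodular w1 w2 v1 v2"
  shows "cone_mass w1 w2 v1 v2 = cone_mass w1 w2 (w1 + v1) (w2 + v2) + cone_mass (w1 + v1) (w2 + v2) v1 v2"
proof -
  define W V where "W = real_of_int (w1 + w2)" and "V = real_of_int (v1 + v2)"
  have pos: "0 < W" "0 < V" using unimodular_pos[OF assms] unfolding W_def V_def by linarith+
  then have "1 / (W * (W + V)) + 1 / ((W + V) * V) = (V + W) / (W * V * (W + V))"
    by (simp add: add_divide_distrib)
  also have "\<dots> = (1 * (W + V)) / ((W * V) * (W + V))" by (simp add: add.commute)
  also have "\<dots> = 1 / (W * V)"
    by (rule nonzero_mult_divide_mult_cancel_right) (use pos in simp)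
  finally have "1 / (W * V) = 1 / (W * (W + V)) + 1 / ((W + V) * V)" by simp
  moreover have "real_of_int (w1 + v1 + (w2 + v2)) = W + V" unfolding W_def V_def by simp
  ultimately show ?thesis unfolding cone_mass_def W_def[symmetric] V_def[symmetric] by simp
qed

lemma cone_mass_pos: "unimodular w1 w2 v1 v2 \<Longrightarrow> 0 < cone_mass w1 w2 v1 v2"
  unfolding cone_mass_def using unimodular_pos[of w1 w2 v1 v2] by (intro divide_pos_pos mult_pos_pos) linarith+

lemma cone_mass_flip: "cone_mass v2 v1 w2 w1 = cone_mass w1 w2 v1 v2"
  unfolding cone_mass_def by (simp add: algebra_simps)

text \<open>\<open>K\<close> bounds the limit superior of \<open>\<bar>cone_sum\<bar> / L\<^sup>2\<close>; the surplus \<open>\<delta>\<close> makes such bounds additive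
without a separate treatment of lower order terms.\<close>

definition cone_rate :: "real \<Rightarrow> real \<Rightarrow> int \<Rightarrow> int \<Rightarrow> int \<Rightarrow> int \<Rightarrow> real \<Rightarrow> real \<Rightarrow> real \<Rightarrow> bool" where
  "cone_rate \<alpha> \<beta> w1 w2 v1 v2 x y K \<longleftrightarrow>
     (\<forall>\<delta>>0. eventually (\<lambda>L. \<bar>cone_sum \<alpha> \<beta> w1 w2 v1 v2 (x * L) (y * L)\<bar> \<le> (K + \<delta>) * L\<^sup>2) at_top)"

lemma cone_rate_mono:
  assumes "cone_rate \<alpha> \<beta> w1 w2 v1 v2 x y K" "K \<le> K'"
  shows "cone_rate \<alpha> \<beta> w1 w2 v1 v2 x y K'"
  unfolding cone_rate_def
proof (intro allI impI)
  fix \<delta> :: real assume "\<delta> > 0"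
  then have "eventually (\<lambda>L. \<bar>cone_sum \<alpha> \<beta> w1 w2 v1 v2 (x * L) (y * L)\<bar> \<le> (K + \<delta>) * L\<^sup>2) at_top"
    using assms(1) unfolding cone_rate_def by blast
  then show "eventually (\<lambda>L. \<bar>cone_sum \<alpha> \<beta> w1 w2 v1 v2 (x * L) (y * L)\<bar> \<le> (K' + \<delta>) * L\<^sup>2) at_top"
  proof eventually_elim
    case (elim L)
    have "(K + \<delta>) * L\<^sup>2 \<le> (K' + \<delta>) * L\<^sup>2" using assms(2) by (intro mult_right_mono) auto
    then show ?case using elim by linarith
  qed
qed

lemma cone_rate_trivial:
  assumes u: "unimodular w1 w2 v1 v2" and r: "rat_interval \<alpha> \<beta> d" and xy: "0 \<le> x" "0 \<le> y"
  shows "cone_rate \<alpha> \<beta> w1 w2 v1 v2 x y ((x + y)\<^sup>2 * cone_mass w1 w2 v1 v2)"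
  unfolding cone_rate_def
proof (intro allI impI)
  fix \<delta> :: real assume d: "\<delta> > 0"
  show "eventually (\<lambda>L. \<bar>cone_sum \<alpha> \<beta> w1 w2 v1 v2 (x * L) (y * L)\<bar> \<le> ((x + y)\<^sup>2 * cone_mass w1 w2 v1 v2 + \<delta>) * L\<^sup>2) at_top"
    using eventually_ge_at_top[of 0]
  proof eventually_elim
    case (elim L)
    have "\<bar>cone_sum \<alpha> \<beta> w1 w2 v1 v2 (x * L) (y * L)\<bar> \<le> (x * L + y * L)\<^sup>2 / (of_int (w1 + w2) * of_int (v1 + v2))"
      using xy elim by (intro abs_cone_sum_le[OF u _ r]) simp
    also have "\<dots> = (x + y)\<^sup>2 * cone_mass w1 w2 v1 v2 * L\<^sup>2"
      unfolding cone_mass_def by (simp add: power_mult_distrib flip: distrib_right)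
    also have "\<dots> \<le> ((x + y)\<^sup>2 * cone_mass w1 w2 v1 v2 + \<delta>) * L\<^sup>2" using d by (intro mult_right_mono) auto
    finally show ?case .
  qed
qed

lemma cone_rate_split:
  assumes u: "unimodular w1 w2 v1 v2" and r: "rat_interval \<alpha> \<beta> d"
    and 1: "cone_rate \<alpha> \<beta> w1 w2 (w1 + v1) (w2 + v2) x y K1"
    and 2: "cone_rate \<alpha> \<beta> (w1 + v1) (w2 + v2) v1 v2 x y K2"
  shows "cone_rate \<alpha> \<beta> w1 w2 v1 v2 x y (K1 + K2)"
  unfolding cone_rate_def
proof (intro allI impI)
  fix \<delta> :: real assume d: "\<delta> > 0"
  then have d3: "\<delta> / 3 > 0" by simp
  have e: "eventually (\<lambda>L::real. 1 \<le> \<delta> / 3 * L\<^sup>2) at_top" using d by real_asymp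
  note ev1 = 1[unfolded cone_rate_def, rule_format, OF d3] and ev2 = 2[unfolded cone_rate_def, rule_format, OF d3]
  show "eventually (\<lambda>L. \<bar>cone_sum \<alpha> \<beta> w1 w2 v1 v2 (x * L) (y * L)\<bar> \<le> (K1 + K2 + \<delta>) * L\<^sup>2) at_top"
    using ev1 ev2 e
  proof eventually_elim
    case (elim L)
    have "(K1 + K2 + \<delta>) * L\<^sup>2 = (K1 + \<delta> / 3) * L\<^sup>2 + (K2 + \<delta> / 3) * L\<^sup>2 + \<delta> / 3 * L\<^sup>2" by (simp add: algebra_simps)
    then show ?case using elim cone_sum_split[OF u r, of "x * L" "y * L"] by linarith
  qed
qed

text \<open>The main term \<open>1 / \<bar>u\<bar>\<^sup>2\<close> of \<open>good_cone_bound\<close> falls short of the mass \<open>1 / (\<bar>w\<bar> \<bar>u\<bar>)\<close> by the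
factor \<open>\<bar>w\<bar> / \<bar>u\<bar> \<le> 1 / k\<close>, where \<open>\<bar>\<cdot>\<bar>\<close> adds the two entries.\<close>

lemma cone_rate_good:
  assumes u: "unimodular w1 w2 v1 v2" and r: "rat_interval \<alpha> \<beta> d" and k: "1 \<le> k" and xy: "0 \<le> x" "0 \<le> y"
  shows "cone_rate \<alpha> \<beta> w1 w2 (int k * w1 + v1) (int k * w2 + v2) x y
     ((x + y)\<^sup>2 * (cone_mass w1 w2 (int k * w1 + v1) (int k * w2 + v2) / k))"
proof -
  define u1 u2 where "u1 = int k * w1 + v1" and "u2 = int k * w2 + v2"
  have uu: "unimodular w1 w2 u1 u2" unfolding u1_def u2_def using unimodular_add_multiple[OF u] .
  define W V U where "W = real_of_int (w1 + w2)" and "V = real_of_int (v1 + v2)" and "U = real_of_int (u1 + u2)"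
  have pos: "0 < W" "0 < V" using unimodular_pos[OF u] unfolding W_def V_def by linarith+
  have U: "U = k * W + V" unfolding U_def W_def V_def u1_def u2_def by (simp add: algebra_simps)
  have U0: "k * W \<le> U" "0 < k * W" "0 < U" using U pos k by (auto intro: add_nonneg_pos)
  have "cone_rate \<alpha> \<beta> w1 w2 u1 u2 x y ((x + y)\<^sup>2 * (1 / U\<^sup>2))"
    unfolding cone_rate_def
  proof (intro allI impI)
    fix \<delta> :: real assume d: "\<delta> > 0"
    define A where "A = x + y"
    have A: "0 \<le> A" using xy unfolding A_def by simp
    have e: "eventually (\<lambda>L::real. 16 * (A * L) * sqrt (A * L) + d * (A * L) \<le> \<delta> * L\<^sup>2) at_top"
    proof (cases "A = 0")
      case False
      then have "0 < A" using A by simp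
      then show ?thesis using d by real_asymp
    qed (use d in auto)
    show "eventually (\<lambda>L. \<bar>cone_sum \<alpha> \<beta> w1 w2 u1 u2 (x * L) (y * L)\<bar> \<le> ((x + y)\<^sup>2 * (1 / U\<^sup>2) + \<delta>) * L\<^sup>2) at_top"
      using e eventually_ge_at_top[of 0]
    proof eventually_elim
      case (elim L)
      have "\<bar>cone_sum \<alpha> \<beta> w1 w2 u1 u2 (x * L) (y * L)\<bar> \<le> (x * L + y * L)\<^sup>2 / U\<^sup>2 + 16 * (x * L + y * L) * sqrt (x * L + y * L) + d * (x * L + y * L)"
        unfolding u1_def u2_def U_def using xy elim(2) by (intro good_cone_bound[OF u r k]) auto
      also have "x * L + y * L = A * L" unfolding A_def by (simp add: algebra_simps)
      finally have "\<bar>cone_sum \<alpha> \<beta> w1 w2 u1 u2 (x * L) (y * L)\<bar> \<le> (A * L)\<^sup>2 / U\<^sup>2 + \<delta> * L\<^sup>2" using elim by linarith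
      also have "\<dots> = ((x + y)\<^sup>2 * (1 / U\<^sup>2) + \<delta>) * L\<^sup>2"
        unfolding A_def[symmetric] by (simp add: algebra_simps power_mult_distrib)
      finally show ?case .
    qed
  qed
  moreover have "(x + y)\<^sup>2 * (1 / U\<^sup>2) \<le> (x + y)\<^sup>2 * (cone_mass w1 w2 u1 u2 / k)"
  proof (rule mult_left_mono)
    have "1 / U\<^sup>2 = 1 / (U * U)" by (simp add: power2_eq_square)
    also have "\<dots> \<le> 1 / ((k * W) * U)" using U0 pos k by (intro divide_left_mono mult_right_mono mult_pos_pos) auto
    also have "\<dots> = cone_mass w1 w2 u1 u2 / k" unfolding cone_mass_def W_def[symmetric] U_def[symmetric] by (simp add: field_simps)
    finally show "1 / U\<^sup>2 \<le> cone_mass w1 w2 u1 u2 / k" .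
  qed simp
  ultimately show ?thesis unfolding u1_def[symmetric] u2_def[symmetric] by (rule cone_rate_mono)
qed

text \<open>The rays through \<open>w + v\<close>, \<open>2 * w + v\<close>, ..., \<open>k * w + v\<close> cut the cone into the good cone next to
\<open>w\<close> and \<open>k\<close> others. The good one has rate \<open>1 / k\<close> per unit of mass, the others \<open>1 / k + s\<close> by
hypothesis. If \<open>w\<close> is not longer than \<open>v\<close>, the good cone takes at least the proportion
\<open>1 / (k + 1)\<close> of the mass, whence the excess \<open>s\<close> is multiplied by at most \<open>k / (k + 1)\<close>.\<close>

lemma cone_rate_step:
  assumes u: "unimodular w1 w2 v1 v2" and r: "rat_interval \<alpha> \<beta> d" and k: "1 \<le> k" and xy: "0 \<le> x" "0 \<le> y"
    and le: "w1 + w2 \<le> v1 + v2" and s: "0 \<le> s"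
    and H: "\<And>w1 w2 v1 v2. unimodular w1 w2 v1 v2 \<Longrightarrow> cone_rate \<alpha> \<beta> w1 w2 v1 v2 x y ((x + y)\<^sup>2 * cone_mass w1 w2 v1 v2 * (1 / real k + s))"
  shows "cone_rate \<alpha> \<beta> w1 w2 v1 v2 x y ((x + y)\<^sup>2 * cone_mass w1 w2 v1 v2 * (1 / real k + real k / (real k + 1) * s))"
proof -
  define m where "m j = cone_mass w1 w2 (int j * w1 + v1) (int j * w2 + v2)" for j
  have chain: "cone_rate \<alpha> \<beta> w1 w2 (int (k - i) * w1 + v1) (int (k - i) * w2 + v2) x y
      ((x + y)\<^sup>2 * (m k / k + (m (k - i) - m k) * (1 / real k + s)))" if "i \<le> k" for i
    using that
  proof (induction i)
    case 0
    show ?case using cone_rate_good[OF u r k xy] unfolding m_def by simp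
  next
    case (Suc i)
    define j where "j = k - Suc i"
    define z1 z2 where "z1 = int j * w1 + v1" and "z2 = int j * w2 + v2"
    have ki: "k - i = Suc j" using Suc.prems unfolding j_def by simp
    have uj: "unimodular w1 w2 z1 z2" unfolding z1_def z2_def using unimodular_add_multiple[OF u] .
    have zz: "int (Suc j) * w1 + v1 = w1 + z1" "int (Suc j) * w2 + v2 = w2 + z2" unfolding z1_def z2_def by (auto simp: algebra_simps)
    have 1: "cone_rate \<alpha> \<beta> w1 w2 (w1 + z1) (w2 + z2) x y ((x + y)\<^sup>2 * (m k / k + (m (Suc j) - m k) * (1 / real k + s)))"
      using Suc.IH Suc.prems unfolding ki zz by simp
    have 2: "cone_rate \<alpha> \<beta> (w1 + z1) (w2 + z2) z1 z2 x y ((x + y)\<^sup>2 * cone_mass (w1 + z1) (w2 + z2) z1 z2 * (1 / real k + s))"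
      by (rule H[OF unimodular_right[OF uj]])
    have "m j = m (Suc j) + cone_mass (w1 + z1) (w2 + z2) z1 z2"
      using cone_mass_split[OF uj] unfolding m_def zz by (simp add: z1_def z2_def)
    then have cm: "cone_mass (w1 + z1) (w2 + z2) z1 z2 = m j - m (Suc j)" by simp
    have "C * (mk / k + (mS - mk) * c) + C * (mj - mS) * c = C * (mk / k + (mj - mk) * c)" for C mk mS mj c :: real
      by (simp add: algebra_simps)
    then show ?case using cone_rate_split[OF uj r 1 2] unfolding cm j_def[symmetric] z1_def[symmetric] z2_def[symmetric]
      by simp
  qed
  have c: "cone_rate \<alpha> \<beta> w1 w2 v1 v2 x y ((x + y)\<^sup>2 * (m k / k + (m 0 - m k) * (1 / real k + s)))"
    using chain[of k] by simp
  define W V where "W = real_of_int (w1 + w2)" and "V = real_of_int (v1 + v2)"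
  have pos: "0 < W" "0 < V" "W \<le> V" using unimodular_pos[OF u] le unfolding W_def V_def by linarith+
  have "real_of_int (int k * w1 + v1 + (int k * w2 + v2)) = k * W + V" unfolding W_def V_def by (simp add: algebra_simps)
  then have mk: "m k = 1 / (W * (k * W + V))" unfolding m_def cone_mass_def W_def[symmetric] by simp
  have m0: "m 0 = 1 / (W * V)" unfolding m_def cone_mass_def W_def V_def by simp
  have "1 / (real k + 1) * m 0 \<le> m k"
  proof -
    have "k * W + V \<le> k * V + V" using pos by (simp add: mult_left_mono)
    then have "W * (k * W + V) \<le> W * (k * V + V)" using pos by (intro mult_left_mono) auto
    then have "1 / (W * (k * V + V)) \<le> 1 / (W * (k * W + V))" using pos by (intro divide_left_mono mult_pos_pos add_nonneg_pos) auto
    moreover have "1 / (real k + 1) * m 0 = 1 / (W * (k * V + V))" unfolding m0 by (simp add: algebra_simps)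
    ultimately show ?thesis unfolding mk by simp
  qed
  then have "m 0 - m k \<le> m 0 - 1 / (real k + 1) * m 0" by simp
  also have "\<dots> = m 0 * (real k / (real k + 1))" by (simp add: field_simps)
  finally have le': "(m 0 - m k) * s \<le> m 0 * (real k / (real k + 1)) * s" using s by (rule mult_right_mono)
  have e1: "m k / k + (m 0 - m k) * (1 / real k + s) = m 0 * (1 / real k) + (m 0 - m k) * s" by (simp add: algebra_simps diff_divide_distrib)
  have e2: "m 0 * (1 / real k + real k / (real k + 1) * s) = m 0 * (1 / real k) + m 0 * (real k / (real k + 1)) * s"
    by (simp add: distrib_left mult.assoc)
  have "m k / k + (m 0 - m k) * (1 / real k + s) \<le> m 0 * (1 / real k + real k / (real k + 1) * s)"
    unfolding e1 e2 by (rule add_left_mono[OF le'])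
  then have "(x + y)\<^sup>2 * (m k / k + (m 0 - m k) * (1 / real k + s)) \<le> (x + y)\<^sup>2 * (m 0 * (1 / real k + real k / (real k + 1) * s))"
    by (intro mult_left_mono) auto
  from cone_rate_mono[OF c this] show ?thesis unfolding m_def by (simp add: mult.assoc)
qed

text \<open>Iteration of \<open>cone_rate_step\<close>. If \<open>w\<close> is longer than \<open>v\<close>, the reflection of the unit interval
exchanges the two generators.\<close>

lemma cone_rate_geometric:
  assumes k: "1 \<le> k"
  shows "unimodular w1 w2 v1 v2 \<Longrightarrow> rat_interval \<alpha> \<beta> d \<Longrightarrow> 0 \<le> x \<Longrightarrow> 0 \<le> y \<Longrightarrow>
    cone_rate \<alpha> \<beta> w1 w2 v1 v2 x y ((x + y)\<^sup>2 * cone_mass w1 w2 v1 v2 * (1 / real k + (real k / (real k + 1)) ^ n))"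
proof (induction n arbitrary: w1 w2 v1 v2 \<alpha> \<beta> x y)
  case 0
  have "(x + y)\<^sup>2 * cone_mass w1 w2 v1 v2 * 1 \<le> (x + y)\<^sup>2 * cone_mass w1 w2 v1 v2 * (1 / real k + (real k / (real k + 1)) ^ 0)"
    using cone_mass_pos[OF 0(1)] by (intro mult_left_mono) auto
  then show ?case using cone_rate_mono cone_rate_trivial[OF 0] by simp
next
  case (Suc n)
  show ?case
  proof (cases "w1 + w2 \<le> v1 + v2")
    case True
    show ?thesis using cone_rate_step[OF Suc.prems(1,2) k Suc.prems(3,4) True _ Suc.IH[OF _ Suc.prems(2-4)]] by simp
  next
    case False
    have "cone_rate (1 - \<beta>) (1 - \<alpha>) v2 v1 w2 w1 y x ((y + x)\<^sup>2 * cone_mass v2 v1 w2 w1 * (1 / real k + real k / (real k + 1) * (real k / (real k + 1)) ^ n))"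
      using False by (intro cone_rate_step[OF unimodular_flip[OF Suc.prems(1)] rat_interval_flip[OF Suc.prems(2)] k Suc.prems(4,3) _ _
         Suc.IH[OF _ rat_interval_flip[OF Suc.prems(2)] Suc.prems(4,3)]]) auto
    then show ?thesis unfolding cone_rate_def cone_sum_flip[of \<beta> \<alpha> v2 v1 w2 w1] cone_mass_flip[of v2 v1 w2 w1]
      by (simp add: add.commute)
  qed
qed

text \<open>The quadrant is the cone of the two unit vectors. In \<open>1 / k + (k / (k + 1)) ^ n\<close> one chooses \<open>k\<close> large
and then \<open>n\<close> large depending on \<open>k\<close>.\<close>

lemma quadrant_sum_tendsto_0:
  assumes r: "rat_interval \<alpha> \<beta> d" and xy: "0 \<le> x" "0 \<le> y"
  shows "((\<lambda>L. cone_sum \<alpha> \<beta> 1 0 0 1 (x * L) (y * L) / L\<^sup>2) \<longlongrightarrow> 0) at_top"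
proof (rule tendstoI)
  fix e :: real assume e: "0 < e"
  define C where "C = (x + y)\<^sup>2 + 1"
  have C: "C > 0" unfolding C_def by (simp add: add_nonneg_pos)
  obtain k where k: "1 / real (Suc k) < e / (3 * C)" using nat_approx_posE[of "e / (3 * C)"] e C by auto
  define K where "K = Suc k"
  have "real K / (real K + 1) < 1" "0 < e / (3 * C)" using e C by (auto simp: K_def)
  then obtain n where n: "(real K / (real K + 1)) ^ n < e / (3 * C)" using real_arch_pow_inv by blast
  have u: "unimodular 1 0 0 1" unfolding unimodular_def by simp
  have m: "cone_mass 1 0 0 1 = 1" unfolding cone_mass_def by simp
  have "cone_rate \<alpha> \<beta> 1 0 0 1 x y ((x + y)\<^sup>2 * (1 / real K + (real K / (real K + 1)) ^ n))"
    using cone_rate_geometric[OF _ u r xy, of K n] unfolding m K_def by simp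
  moreover have "(x + y)\<^sup>2 * (1 / real K + (real K / (real K + 1)) ^ n) \<le> C * (e / (3 * C) + e / (3 * C))"
    using k n unfolding K_def[symmetric] by (intro mult_mono add_mono) (auto simp: C_def K_def)
  moreover have "C * (e / (3 * C) + e / (3 * C)) = 2 * e / 3" using C by (simp add: field_simps)
  moreover have e6: "0 < e / 6" using e by simp
  ultimately have "cone_rate \<alpha> \<beta> 1 0 0 1 x y (2 * e / 3)" by (metis cone_rate_mono)
  then have "eventually (\<lambda>L. \<bar>cone_sum \<alpha> \<beta> 1 0 0 1 (x * L) (y * L)\<bar> \<le> (2 * e / 3 + e / 6) * L\<^sup>2) at_top"
    using e6 unfolding cone_rate_def by blast
  then show "eventually (\<lambda>L. dist (cone_sum \<alpha> \<beta> 1 0 0 1 (x * L) (y * L) / L\<^sup>2) 0 < e) at_top"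
    using eventually_gt_at_top[of 0]
  proof eventually_elim
    case (elim L)
    have "(2 * e / 3 + e / 6) * L\<^sup>2 < e * L\<^sup>2" using e elim(2) by (intro mult_strict_right_mono) auto
    then have "\<bar>cone_sum \<alpha> \<beta> 1 0 0 1 (x * L) (y * L)\<bar> < e * L\<^sup>2" using elim(1) by linarith
    then show ?case using elim(2) by (simp add: dist_real_def abs_divide field_simps)
  qed
qed

definition coprime_box :: "real \<Rightarrow> real \<Rightarrow> (int \<times> int) set" where
  "coprime_box X Y = {(a, b). 0 < a \<and> 0 < b \<and> coprime a b \<and> of_int a \<le> X \<and> of_int b \<le> Y}"

lemma coprime_box_eq: "coprime_box X Y = cone_points 1 0 0 1 X Y"
  unfolding coprime_box_def cone_points_def by simp

lemma finite_coprime_box [simp]: "finite (coprime_box X Y)"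
  unfolding coprime_box_eq by (rule finite_cone_points) (simp add: unimodular_def)

lemma floor_ratio_tendsto:
  assumes "0 \<le> x" shows "((\<lambda>L. real (nat \<lfloor>x * L\<rfloor>) / L) \<longlongrightarrow> x) at_top"
proof (rule tendsto_sandwich[of "\<lambda>L. (x * L - 1) / L" _ _ "\<lambda>L. x"])
  show "eventually (\<lambda>L. (x * L - 1) / L \<le> real (nat \<lfloor>x * L\<rfloor>) / L) at_top"
    using eventually_gt_at_top[of 0]
  proof eventually_elim
    case (elim L)
    have "0 \<le> \<lfloor>x * L\<rfloor>" using assms elim by simp
    then have "x * L - 1 \<le> real (nat \<lfloor>x * L\<rfloor>)" by linarith
    then show ?case using elim by (intro divide_right_mono) auto
  qed
  show "eventually (\<lambda>L. real (nat \<lfloor>x * L\<rfloor>) / L \<le> x) at_top"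
    using eventually_gt_at_top[of 0]
  proof eventually_elim
    case (elim L)
    have "real (nat \<lfloor>x * L\<rfloor>) \<le> x * L" using assms elim by (intro of_nat_floor) auto
    then show ?case using elim by (simp add: field_simps)
  qed
  show "((\<lambda>L. (x * L - 1) / L) \<longlongrightarrow> x) at_top" by real_asymp
qed auto

lemma totient_sum_scaled:
  assumes "0 \<le> x"
  shows "((\<lambda>L. (\<Sum>a=1..nat \<lfloor>x * L\<rfloor>. totient a / a) / L) \<longlongrightarrow> 6 / pi\<^sup>2 * x) at_top"
proof (cases "x = 0")
  case False
  then have x: "0 < x" using assms by simp
  have "filterlim (\<lambda>L::real. x * L) at_top at_top" using x by real_asymp
  then have f: "filterlim (\<lambda>L. nat \<lfloor>x * L\<rfloor>) at_top at_top"
    by (intro filterlim_compose[OF filterlim_nat_sequentially] filterlim_compose[OF filterlim_floor_sequentially])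
  have "((\<lambda>L. (\<Sum>a=1..nat \<lfloor>x * L\<rfloor>. totient a / a) / real (nat \<lfloor>x * L\<rfloor>) * (real (nat \<lfloor>x * L\<rfloor>) / L)) \<longlongrightarrow> 6 / pi\<^sup>2 * x) at_top"
    by (intro tendsto_mult filterlim_compose[OF totient_sum_asymp f] floor_ratio_tendsto assms)
  moreover have "eventually (\<lambda>L. (\<Sum>a=1..nat \<lfloor>x * L\<rfloor>. totient a / a) / real (nat \<lfloor>x * L\<rfloor>) * (real (nat \<lfloor>x * L\<rfloor>) / L)
      = (\<Sum>a=1..nat \<lfloor>x * L\<rfloor>. totient a / a) / L) at_top"
  proof -
    have "eventually (\<lambda>L. nat \<lfloor>x * L\<rfloor> > 0) at_top" using f eventually_gt_at_top[of 0] unfolding filterlim_iff by blast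
    then show ?thesis by eventually_elim simp
  qed
  ultimately show ?thesis by (rule Lim_transform_eventually)
qed simp

lemma card_coprime_box_asymp:
  assumes xy: "0 \<le> x" "0 \<le> y"
  shows "((\<lambda>L. card (coprime_box (x * L) (y * L)) / L\<^sup>2) \<longlongrightarrow> 6 / pi\<^sup>2 * x * y) at_top"
proof -
  define S where "S L = (\<Sum>a=1..nat \<lfloor>x * L\<rfloor>. totient a / real a)" for L
  have bnd: "\<bar>card (coprime_box (x * L) (y * L)) / L\<^sup>2 - y * (S L / L)\<bar> \<le> 4 * x * sqrt (x * L) / L" if L: "L > 0" for L
  proof -
    let ?n = "nat \<lfloor>x * L\<rfloor>"
    define T where "T a = {b::int. (0::real) < b \<and> b \<le> y * L \<and> coprime b (int a)}" for a
    have fin: "finite (T a)" for a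
      by (rule finite_subset[OF _ card_int_Ioc(1)[of 0 "y * L"]]) (use xy L in \<open>auto simp: T_def\<close>)
    have "coprime_box (x * L) (y * L) = (\<lambda>(a, b). (int a, b)) ` (SIGMA a:{1..?n}. T a)"
    proof (intro equalityI subsetI)
      fix z assume z: "z \<in> coprime_box (x * L) (y * L)"
      obtain a b where ab: "z = (a, b)" by (cases z)
      have "0 < a" "of_int a \<le> x * L" using z unfolding ab coprime_box_def by auto
      then have "nat a \<in> {1..?n}" "int (nat a) = a" by (auto simp: le_floor_iff nat_mono Suc_le_eq)
      moreover have "b \<in> T (nat a)" using z \<open>0 < a\<close> unfolding ab coprime_box_def T_def by (auto simp: coprime_commute)
      ultimately show "z \<in> (\<lambda>(a, b). (int a, b)) ` (SIGMA a:{1..?n}. T a)"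
        unfolding ab by (intro image_eqI[of _ _ "(nat a, b)"]) auto
    next
      fix z assume "z \<in> (\<lambda>(a, b). (int a, b)) ` (SIGMA a:{1..?n}. T a)"
      then obtain a b where ab: "z = (int a, b)" "a \<in> {1..?n}" "b \<in> T a" by auto
      have "real a \<le> real ?n" using ab(2) by simp
      also have "\<dots> \<le> x * L" using xy L by (intro of_nat_floor) auto
      finally show "z \<in> coprime_box (x * L) (y * L)" using ab unfolding coprime_box_def T_def by (auto simp: coprime_commute)
    qed
    then have "card (coprime_box (x * L) (y * L)) = card (SIGMA a:{1..?n}. T a)"
      by (simp add: card_image inj_on_def)
    then have c: "card (coprime_box (x * L) (y * L)) = (\<Sum>a=1..?n. card (T a))" using fin by simp
    have n: "real ?n \<le> x * L" using xy L by (intro of_nat_floor) auto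
    have "\<bar>real (card (T a)) - y * L * (totient a / a)\<bar> \<le> 4 * sqrt (x * L)" if a: "a \<in> {1..?n}" for a
    proof -
      have "\<bar>real (card (T a)) - (y * L - 0) * (totient a / a)\<bar> \<le> 4 * sqrt a"
        unfolding T_def using a xy L by (intro coprime_count) auto
      moreover have "sqrt a \<le> sqrt (x * L)" using a n by simp
      ultimately show ?thesis by (simp del: real_sqrt_le_iff)
    qed
    then have "\<bar>\<Sum>a=1..?n. (real (card (T a)) - y * L * (totient a / a))\<bar> \<le> (\<Sum>a=1..?n. 4 * sqrt (x * L))"
      by (intro order.trans[OF sum_abs] sum_mono) auto
    also have "\<dots> \<le> x * L * (4 * sqrt (x * L))" using n xy L by (simp add: mult_right_mono)
    finally have "\<bar>real (card (coprime_box (x * L) (y * L))) - y * L * S L\<bar> \<le> x * L * (4 * sqrt (x * L))"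
      unfolding c S_def by (simp add: sum_subtractf sum_distrib_left)
    then have "\<bar>real (card (coprime_box (x * L) (y * L))) - y * L * S L\<bar> / L\<^sup>2 \<le> x * L * (4 * sqrt (x * L)) / L\<^sup>2"
      by (intro divide_right_mono) auto
    also have "x * L * (4 * sqrt (x * L)) / L\<^sup>2 = 4 * x * sqrt (x * L) / L" using L by (simp add: power2_eq_square)
    also have "\<bar>real (card (coprime_box (x * L) (y * L))) - y * L * S L\<bar> / L\<^sup>2 = \<bar>card (coprime_box (x * L) (y * L)) / L\<^sup>2 - y * (S L / L)\<bar>"
    proof -
      have "card (coprime_box (x * L) (y * L)) / L\<^sup>2 - y * (S L / L) = (card (coprime_box (x * L) (y * L)) - y * L * S L) / L\<^sup>2"
        using L by (simp add: power2_eq_square field_simps)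
      then show ?thesis by (simp add: abs_divide)
    qed
    finally show ?thesis .
  qed
  have l: "((\<lambda>L. 4 * x * sqrt (x * L) / L) \<longlongrightarrow> 0) at_top"
  proof (cases "x = 0")
    case False
    then have "x > 0" using xy by simp
    then show ?thesis by real_asymp
  qed simp
  have "((\<lambda>L. card (coprime_box (x * L) (y * L)) / L\<^sup>2 - y * (S L / L)) \<longlongrightarrow> 0) at_top"
    by (rule Lim_null_comparison[OF _ l]) (use bnd in \<open>auto intro!: eventually_mono[OF eventually_gt_at_top[of 0]]\<close>)
  moreover have "((\<lambda>L. y * (S L / L)) \<longlongrightarrow> y * (6 / pi\<^sup>2 * x)) at_top"
    unfolding S_def by (intro tendsto_intros totient_sum_scaled xy)
  ultimately have "((\<lambda>L. card (coprime_box (x * L) (y * L)) / L\<^sup>2 - y * (S L / L) + y * (S L / L)) \<longlongrightarrow> 0 + y * (6 / pi\<^sup>2 * x)) at_top"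
    by (rule tendsto_add)
  then show ?thesis by (simp add: mult_ac)
qed

text \<open>For coprime \<open>a\<close> and \<open>b\<close> the position of the Farey pair is the inverse of \<open>a\<close> modulo \<open>b\<close>, divided by
\<open>b\<close>. The usual proof of its equidistribution uses Weil's bound for Kloosterman sums and yields a
rate of convergence; the bare limit follows from the decomposition into cones.\<close>

theorem farey_pairs_equidistributed:
  assumes r: "rat_interval \<alpha> \<beta> d" and xy: "0 \<le> x" "0 \<le> y"
  shows "((\<lambda>L. card {(a, b) \<in> coprime_box (x * L) (y * L). farey_in \<alpha> \<beta> a b} / L\<^sup>2) \<longlongrightarrow> (\<beta> - \<alpha>) * (6 / pi\<^sup>2 * x * y)) at_top"
proof -
  have "real (card {(a, b) \<in> coprime_box X Y. farey_in \<alpha> \<beta> a b}) = cone_sum \<alpha> \<beta> 1 0 0 1 X Y + (\<beta> - \<alpha>) * card (coprime_box X Y)" for X Y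
  proof -
    have "cone_sum \<alpha> \<beta> 1 0 0 1 X Y = (\<Sum>z\<in>coprime_box X Y. (if farey_in \<alpha> \<beta> (fst z) (snd z) then 1 else 0) - (\<beta> - \<alpha>))"
      unfolding cone_sum_def coprime_box_eq farey_dev_def by (simp add: case_prod_unfold)
    also have "\<dots> = (\<Sum>z\<in>coprime_box X Y. if farey_in \<alpha> \<beta> (fst z) (snd z) then 1 else 0) - (\<beta> - \<alpha>) * card (coprime_box X Y)"
      by (simp add: sum_subtractf)
    also have "(\<Sum>z\<in>coprime_box X Y. if farey_in \<alpha> \<beta> (fst z) (snd z) then 1 else (0::real)) = card {z \<in> coprime_box X Y. farey_in \<alpha> \<beta> (fst z) (snd z)}"
      by (subst sum.inter_filter[symmetric]) simp_all
    finally show ?thesis by (simp add: case_prod_unfold)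
  qed
  moreover have "((\<lambda>L. cone_sum \<alpha> \<beta> 1 0 0 1 (x * L) (y * L) / L\<^sup>2 + (\<beta> - \<alpha>) * (card (coprime_box (x * L) (y * L)) / L\<^sup>2))
      \<longlongrightarrow> 0 + (\<beta> - \<alpha>) * (6 / pi\<^sup>2 * x * y)) at_top"
    by (intro tendsto_add quadrant_sum_tendsto_0[OF r xy] tendsto_mult tendsto_const card_coprime_box_asymp xy)
  ultimately show ?thesis by (simp add: add_divide_distrib)
qed

section \<open>Inclusion and exclusion for rational approximations\<close>

definition near_rational :: "real \<Rightarrow> real \<Rightarrow> real set" where
  "near_rational \<epsilon> U = {t. \<exists>q p::int. 1 \<le> q \<and> of_int q \<le> U \<and> \<bar>of_int q * t - of_int p\<bar> \<le> \<epsilon>}"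

definition approximants :: "real \<Rightarrow> real \<Rightarrow> real \<Rightarrow> (int \<times> int) set" where
  "approximants \<epsilon> U t = {(q, p). 1 \<le> q \<and> of_int q \<le> U \<and> coprime q p \<and> \<bar>of_int q * t - of_int p\<bar> \<le> \<epsilon>}"

definition farey_quads :: "real \<Rightarrow> real \<Rightarrow> real \<Rightarrow> (int \<times> int \<times> int \<times> int) set" where
  "farey_quads \<alpha> \<beta> U = {(a, b, p, p'). (a, b) \<in> coprime_box U U \<and> p' * a - p * b = 1 \<and>
     \<alpha> * of_int a \<le> of_int p \<and> of_int p' \<le> \<beta> * of_int b}"

text \<open>The points within reach of both members of a Farey pair: between \<open>p / a\<close> and \<open>p' / b\<close> the second
fraction bounds them from below and the first one from above.\<close>

definition overlap :: "real \<Rightarrow> int \<times> int \<times> int \<times> int \<Rightarrow> real set" where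
  "overlap \<epsilon> = (\<lambda>(a, b, p, p'). {(of_int p' - \<epsilon>) / of_int b .. (of_int p + \<epsilon>) / of_int a})"

text \<open>Reducing a fraction to lowest terms decreases both its denominator and \<open>\<bar>q * t - p\<bar>\<close>.\<close>

lemma near_rational_iff: "t \<in> near_rational \<epsilon> U \<longleftrightarrow> approximants \<epsilon> U t \<noteq> {}"
proof
  assume "t \<in> near_rational \<epsilon> U"
  then obtain q p :: int where qp: "1 \<le> q" "of_int q \<le> U" "\<bar>of_int q * t - of_int p\<bar> \<le> \<epsilon>"
    unfolding near_rational_def by blast
  define g where "g = gcd q p"
  have g: "1 \<le> g" unfolding g_def using qp(1) by (smt (verit) gcd_pos_int)
  define q' p' where "q' = q div g" and "p' = p div g"
  have q': "q = g * q'" and p': "p = g * p'" unfolding q'_def p'_def g_def by simp_all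
  have "coprime q' p'" unfolding q'_def p'_def g_def using qp(1) by (intro div_gcd_coprime) auto
  moreover have q'1: "1 \<le> q'" using qp(1) g unfolding q' by (smt (verit) mult_nonneg_nonpos)
  moreover have "of_int q' \<le> U"
  proof -
    have "q' * 1 \<le> q' * g" using q'1 g by (intro mult_left_mono) auto
    then have "real_of_int q' \<le> of_int q" unfolding q' by (metis mult.commute mult.right_neutral of_int_le_iff)
    then show ?thesis using qp(2) by linarith
  qed
  moreover have "\<bar>of_int q' * t - of_int p'\<bar> \<le> \<epsilon>"
  proof -
    have "of_int q * t - of_int p = of_int g * (of_int q' * t - of_int p')" unfolding q' p' by (simp add: algebra_simps)
    then have "of_int g * \<bar>of_int q' * t - of_int p'\<bar> \<le> \<epsilon>" using qp(3) g by (simp add: abs_mult)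
    moreover have "1 * \<bar>of_int q' * t - of_int p'\<bar> \<le> of_int g * \<bar>of_int q' * t - of_int p'\<bar>" using g by (intro mult_right_mono) auto
    ultimately show ?thesis by (metis mult_1 order_trans)
  qed
  ultimately show "approximants \<epsilon> U t \<noteq> {}" unfolding approximants_def by blast
qed (auto simp: near_rational_def approximants_def)

lemma coprime_fraction_unique:
  fixes q1 q2 p1 p2 :: int
  assumes "0 < q1" "0 < q2" "coprime q1 p1" "coprime q2 p2" "q1 * p2 = q2 * p1"
  shows "q1 = q2 \<and> p1 = p2"
proof -
  have "q1 dvd q2 * p1" using assms(5) by (metis dvd_triv_left)
  then have 1: "q1 dvd q2" using assms(3) by (simp add: coprime_dvd_mult_left_iff)
  have "q2 dvd q1 * p2" using assms(5) by (metis dvd_triv_left)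
  then have 2: "q2 dvd q1" using assms(4) by (simp add: coprime_dvd_mult_left_iff)
  have "q1 = q2" using 1 2 assms by (intro zdvd_antisym_nonneg) auto
  then show ?thesis using assms by auto
qed

text \<open>With \<open>e\<^sub>i = q\<^sub>i * t - p\<^sub>i\<close> the determinant of the two fractions is \<open>e\<^sub>1 * q\<^sub>2 - e\<^sub>2 * q\<^sub>1\<close>. If \<open>e\<^sub>1\<close> and \<open>e\<^sub>2\<close>
have the same sign, this integer is smaller than \<open>1\<close> in absolute value and hence zero.\<close>

lemma approximants_opposite:
  fixes \<epsilon> U t :: real
  assumes eU: "\<epsilon> * U < 1" and e: "0 \<le> \<epsilon>"
    and 1: "(q1, p1) \<in> approximants \<epsilon> U t" and 2: "(q2, p2) \<in> approximants \<epsilon> U t" and ne: "(q1, p1) \<noteq> (q2, p2)"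
  shows "(of_int q1 * t - of_int p1) * (of_int q2 * t - of_int p2) < 0"
proof (rule ccontr)
  define e1 e2 where "e1 = of_int q1 * t - of_int p1" and "e2 = of_int q2 * t - of_int p2"
  assume "\<not> ?thesis"
  then have s: "0 \<le> e1 * e2" unfolding e1_def e2_def by simp
  have q: "1 \<le> q1" "of_int q1 \<le> U" "1 \<le> q2" "of_int q2 \<le> U" "\<bar>e1\<bar> \<le> \<epsilon>" "\<bar>e2\<bar> \<le> \<epsilon>" "coprime q1 p1" "coprime q2 p2"
    using 1 2 unfolding approximants_def e1_def e2_def by auto
  have det: "real_of_int (q1 * p2 - q2 * p1) = e1 * of_int q2 - e2 * of_int q1"
    unfolding e1_def e2_def by (simp add: algebra_simps)
  have x: "\<bar>e1 * of_int q2\<bar> \<le> \<epsilon> * U" using q e by (auto simp: abs_mult intro!: mult_mono)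
  have y: "\<bar>e2 * of_int q1\<bar> \<le> \<epsilon> * U" using q e by (auto simp: abs_mult intro!: mult_mono)
  have "(0 \<le> e1 \<and> 0 \<le> e2) \<or> (e1 \<le> 0 \<and> e2 \<le> 0)" using s by (simp add: zero_le_mult_iff)
  then have "(0 \<le> e1 * of_int q2 \<and> 0 \<le> e2 * of_int q1) \<or> (e1 * of_int q2 \<le> 0 \<and> e2 * of_int q1 \<le> 0)"
    using q by (auto intro: mult_nonneg_nonneg mult_nonpos_nonneg)
  then have "\<bar>e1 * of_int q2 - e2 * of_int q1\<bar> < 1" using x y eU by linarith
  then have "\<bar>q1 * p2 - q2 * p1\<bar> < 1" using det by linarith
  then have "q1 * p2 = q2 * p1" by linarith
  then show False using coprime_fraction_unique[of q1 q2 p1 p2] q ne by auto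
qed

text \<open>A point of the overlap lies strictly between the two fractions, as \<open>(1 - \<epsilon> * U) / b\<close> and
\<open>(1 - \<epsilon> * U) / a\<close> bound its distances \<open>a * t - p\<close> and \<open>p' - b * t\<close> from below.\<close>

lemma overlap_approximants:
  fixes \<epsilon> U t :: real
  assumes eU: "\<epsilon> * U < 1" and e: "0 \<le> \<epsilon>"
    and z: "(a, b, p, p') \<in> farey_quads \<alpha> \<beta> U" and t: "t \<in> overlap \<epsilon> (a, b, p, p')"
  shows "(a, p) \<in> approximants \<epsilon> U t" "(b, p') \<in> approximants \<epsilon> U t"
    "0 < of_int a * t - of_int p" "of_int b * t - of_int p' < 0"
proof -
  have q: "1 \<le> a" "of_int a \<le> U" "1 \<le> b" "of_int b \<le> U" and det: "p' * a - p * b = 1"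
    using z unfolding farey_quads_def coprime_box_def by auto
  have ab: "0 < real_of_int a" "0 < real_of_int b" using q by auto
  have t': "of_int p' - \<epsilon> \<le> of_int b * t" "of_int a * t \<le> of_int p + \<epsilon>"
    using t ab unfolding overlap_def by (auto simp: field_simps)
  have "real_of_int (p' * a - p * b) = 1" using det by simp
  then have d: "of_int p' * of_int a - of_int p * of_int b = (1::real)" by simp
  have ea: "\<epsilon> * of_int a \<le> \<epsilon> * U" "\<epsilon> * of_int b \<le> \<epsilon> * U" using q e by (auto intro: mult_left_mono)
  have "(of_int p' - \<epsilon>) * of_int a \<le> of_int b * t * of_int a" using t'(1) ab by (intro mult_right_mono) auto
  then have "of_int p * of_int b < (of_int a * t) * of_int b" using d ea eU by (simp add: algebra_simps)
  then show 1: "0 < of_int a * t - of_int p" using ab by simp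
  have "of_int a * t * of_int b \<le> (of_int p + \<epsilon>) * of_int b" using t'(2) ab by (intro mult_right_mono) auto
  then have "(of_int b * t) * of_int a < of_int p' * of_int a" using d ea eU by (simp add: algebra_simps)
  then show 2: "of_int b * t - of_int p' < 0" using ab by simp
  have "coprime a p"
    by (rule coprimeI) (metis det dvd_diff dvd_mult dvd_mult2)
  moreover have "coprime b p'"
    by (rule coprimeI) (metis det dvd_diff dvd_mult dvd_mult2)
  ultimately show "(a, p) \<in> approximants \<epsilon> U t" "(b, p') \<in> approximants \<epsilon> U t"
    using q t' 1 2 unfolding approximants_def by auto
qed

text \<open>Approximations from opposite sides have a determinant strictly between \<open>0\<close> and \<open>2\<close>, hence form a
Farey pair around \<open>t\<close>. Moreover \<open>1 \<le> \<epsilon> * (q1 + q2)\<close>, so \<open>\<epsilon> * d < 1\<close> gives \<open>d < q1 + q2\<close>: no endpoint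
separates the pair, and with \<open>t\<close> the whole pair lies in the interval.\<close>

lemma approximants_overlap:
  fixes \<epsilon> U t :: real
  assumes r: "rat_interval \<alpha> \<beta> d" and eU: "\<epsilon> * U < 1" and e: "0 < \<epsilon>" "\<epsilon> * d < 1" and t: "\<alpha> < t" "t < \<beta>"
    and 1: "(q1, p1) \<in> approximants \<epsilon> U t" and 2: "(q2, p2) \<in> approximants \<epsilon> U t"
    and s: "0 < of_int q1 * t - of_int p1" "of_int q2 * t - of_int p2 < 0"
  shows "(q1, q2, p1, p2) \<in> farey_quads \<alpha> \<beta> U \<and> t \<in> overlap \<epsilon> (q1, q2, p1, p2)"
proof
  define e1 e2 where "e1 = of_int q1 * t - of_int p1" and "e2 = of_int q2 * t - of_int p2"
  have q: "1 \<le> q1" "of_int q1 \<le> U" "1 \<le> q2" "of_int q2 \<le> U" "\<bar>e1\<bar> \<le> \<epsilon>" "\<bar>e2\<bar> \<le> \<epsilon>"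
    using 1 2 unfolding approximants_def e1_def e2_def by auto
  have q0: "0 < real_of_int q1" "0 < real_of_int q2" using q by auto
  have s': "0 < e1" "e2 < 0" using s unfolding e1_def e2_def by auto
  have det: "real_of_int (p2 * q1 - p1 * q2) = e1 * of_int q2 - e2 * of_int q1"
    unfolding e1_def e2_def by (simp add: algebra_simps)
  have "e1 \<le> \<epsilon>" "- e2 \<le> \<epsilon>" using q by linarith+
  then have x: "e1 * of_int q2 \<le> \<epsilon> * of_int q2" "- e2 * of_int q1 \<le> \<epsilon> * of_int q1"
    using mult_right_mono[OF _ less_imp_le[OF q0(2)]] mult_right_mono[OF _ less_imp_le[OF q0(1)]] by blast+
  have y: "\<epsilon> * of_int q2 \<le> \<epsilon> * U" "\<epsilon> * of_int q1 \<le> \<epsilon> * U" using q e by (auto intro!: mult_left_mono)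
  have "0 < e1 * of_int q2" "0 < - e2 * of_int q1" using s' q0 by (auto intro: mult_pos_pos simp: mult_neg_pos)
  then have "0 < real_of_int (p2 * q1 - p1 * q2)" "real_of_int (p2 * q1 - p1 * q2) < 2" using det x y eU by linarith+
  then have D: "p2 * q1 - p1 * q2 = 1" by linarith
  then have "1 \<le> \<epsilon> * of_int (q1 + q2)" using det x by (simp add: algebra_simps)
  then have "\<epsilon> * d < \<epsilon> * of_int (q1 + q2)" using e(2) by linarith
  then have dq: "d < q1 + q2" using e(1) by simp
  obtain i j where ij: "d > 0" "\<alpha> = of_int i / of_int d" "\<beta> = of_int j / of_int d" using rat_intervalE[OF r] by blast
  have no: False if "d * p1 < m * q1" "m * q2 < d * p2" for m
  proof -
    have "q1 * 1 + q2 * 1 \<le> q1 * (d * p2 - m * q2) + q2 * (m * q1 - d * p1)"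
      using that q by (intro add_mono mult_left_mono) auto
    also have "\<dots> = d * (p2 * q1 - p1 * q2)" by (simp add: algebra_simps)
    finally show False using D dq by simp
  qed
  have "i * q2 < d * p2"
  proof -
    have "\<alpha> * of_int q2 < t * of_int q2" using t q0 by (intro mult_strict_right_mono) auto
    also have "\<dots> < of_int p2" using s by (simp add: mult.commute)
    finally have "real_of_int (i * q2) < of_int (d * p2)" unfolding ij(2) using ij(1) by (simp add: field_simps)
    then show ?thesis by linarith
  qed
  then have "i * q1 \<le> d * p1" using no[of i] by (meson not_le)
  then have "real_of_int (i * q1) \<le> of_int (d * p1)" by linarith
  then have A: "\<alpha> * of_int q1 \<le> of_int p1" unfolding ij(2) using ij(1) by (simp add: field_simps)
  have "d * p1 < j * q1"
  proof -
    have "of_int p1 < t * of_int q1" using s by (simp add: mult.commute)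
    also have "\<dots> < \<beta> * of_int q1" using t q0 by (intro mult_strict_right_mono) auto
    finally have "real_of_int (d * p1) < of_int (j * q1)" unfolding ij(3) using ij(1) by (simp add: field_simps)
    then show ?thesis by linarith
  qed
  then have "d * p2 \<le> j * q2" using no[of j] by (meson not_le)
  then have "real_of_int (d * p2) \<le> of_int (j * q2)" by linarith
  then have B: "of_int p2 \<le> \<beta> * of_int q2" unfolding ij(3) using ij(1) by (simp add: field_simps)
  have "coprime q1 q2" by (rule coprimeI) (metis D dvd_diff dvd_mult dvd_mult2 mult.commute)
  then show "(q1, q2, p1, p2) \<in> farey_quads \<alpha> \<beta> U" unfolding farey_quads_def coprime_box_def using q D A B by auto
  have "of_int q1 * t - of_int p1 \<le> \<epsilon>" "of_int p2 - of_int q2 * t \<le> \<epsilon>" using q(5,6) unfolding e1_def e2_def by linarith+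
  then show "t \<in> overlap \<epsilon> (q1, q2, p1, p2)" unfolding overlap_def using q0 by (auto simp: field_simps)
qed

text \<open>The numerator of the second member is determined modulo \<open>b\<close> and lies in \<open>{1..b}\<close>.\<close>

lemma farey_quads_inj:
  assumes r: "rat_interval \<alpha> \<beta> d" and 1: "(a, b, p, p') \<in> farey_quads \<alpha> \<beta> U" and 2: "(a, b, q, q') \<in> farey_quads \<alpha> \<beta> U"
  shows "p = q \<and> p' = q'"
proof -
  have ab: "0 < a" "0 < b" "coprime a b" and p: "p' * a - p * b = 1" "q' * a - q * b = 1"
    and le: "\<alpha> * of_int a \<le> of_int p" "of_int p' \<le> \<beta> * of_int b" "\<alpha> * of_int a \<le> of_int q" "of_int q' \<le> \<beta> * of_int b"
    using 1 2 unfolding farey_quads_def coprime_box_def by auto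
  have rr: "0 \<le> \<alpha>" "\<beta> \<le> 1" using r unfolding rat_interval_def by auto
  have "0 \<le> \<alpha> * of_int a" "\<beta> * of_int b \<le> 1 * of_int b" using rr ab by (auto intro: mult_right_mono)
  then have b: "0 \<le> p" "0 \<le> q" "p' \<le> b" "q' \<le> b" using le by linarith+
  have eq: "(p' - q') * a = (p - q) * b" using p by (simp add: algebra_simps)
  have "b dvd (p' - q') * a" unfolding eq by simp
  then have dvd: "b dvd p' - q'" using ab(3) by (simp add: coprime_dvd_mult_left_iff coprime_commute)
  have "0 < p' * a" "0 < q' * a" using p b ab by (smt (verit) mult_nonneg_nonneg)+
  then have "0 < p'" "0 < q'" using ab by (auto simp: zero_less_mult_iff)
  then have "\<bar>p' - q'\<bar> < b" using b by linarith
  then have "p' = q'" using dvd by (metis abs_ge_zero dvd_imp_le_int eq_iff_diff_eq_0 abs_of_pos ab(2) not_le)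
  then show ?thesis using eq ab by simp
qed

lemma finite_farey_quads:
  assumes r: "rat_interval \<alpha> \<beta> d" shows "finite (farey_quads \<alpha> \<beta> U)"
    and "(\<lambda>(a, b, p, p'). (a, b)) ` farey_quads \<alpha> \<beta> U = {(a, b) \<in> coprime_box U U. farey_in \<alpha> \<beta> a b}"
    and "inj_on (\<lambda>(a, b, p, p'). (a, b)) (farey_quads \<alpha> \<beta> U)"
proof -
  show eq: "(\<lambda>(a, b, p, p'). (a, b)) ` farey_quads \<alpha> \<beta> U = {(a, b) \<in> coprime_box U U. farey_in \<alpha> \<beta> a b}"
  proof (intro equalityI subsetI)
    fix z assume "z \<in> {(a, b) \<in> coprime_box U U. farey_in \<alpha> \<beta> a b}"
    then obtain a b p p' where z: "z = (a, b)" "(a, b, p, p') \<in> farey_quads \<alpha> \<beta> U"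
      unfolding farey_quads_def farey_in_def by blast
    then show "z \<in> (\<lambda>(a, b, p, p'). (a, b)) ` farey_quads \<alpha> \<beta> U" by (intro image_eqI[OF _ z(2)]) simp
  next
    fix z assume "z \<in> (\<lambda>(a, b, p, p'). (a, b)) ` farey_quads \<alpha> \<beta> U"
    then obtain a b p p' where z: "z = (a, b)" "(a, b, p, p') \<in> farey_quads \<alpha> \<beta> U" by auto
    then show "z \<in> {(a, b) \<in> coprime_box U U. farey_in \<alpha> \<beta> a b}"
      unfolding farey_quads_def farey_in_def by blast
  qed
  show inj: "inj_on (\<lambda>(a, b, p, p'). (a, b)) (farey_quads \<alpha> \<beta> U)"
  proof (rule inj_onI)
    fix x y assume xy: "x \<in> farey_quads \<alpha> \<beta> U" "y \<in> farey_quads \<alpha> \<beta> U"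
      "(case x of (a, b, p, p') \<Rightarrow> (a, b)) = (case y of (a, b, p, p') \<Rightarrow> (a, b))"
    obtain a b p p' where x: "x = (a, b, p, p')" by (cases x) auto
    moreover obtain q q' where y: "y = (a, b, q, q')" using xy(3) x by (cases y) auto
    ultimately show "x = y" using farey_quads_inj[OF r, of a b p p' U q q'] xy by simp
  qed
  have "finite ((\<lambda>(a, b, p, p'). (a, b)) ` farey_quads \<alpha> \<beta> U)"
    unfolding eq by (rule finite_subset[OF _ finite_coprime_box[of U U]]) auto
  then show "finite (farey_quads \<alpha> \<beta> U)" using inj by (rule finite_imageD)
qed

text \<open>Among three approximations two would lie on the same side of \<open>t\<close>; so there are at most two, and
if there are two, they form exactly one Farey pair.\<close>

lemma near_rational_inclusion_exclusion:
  fixes \<epsilon> U t :: real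
  assumes r: "rat_interval \<alpha> \<beta> d" and eU: "\<epsilon> * U < 1" and e: "0 < \<epsilon>" "\<epsilon> * d < 1" and t: "\<alpha> < t" "t < \<beta>"
  shows "indicator (near_rational \<epsilon> U) t = real (card (approximants \<epsilon> U t)) - real (card {z \<in> farey_quads \<alpha> \<beta> U. t \<in> overlap \<epsilon> z})"
proof -
  define E where "E z = of_int (fst z) * t - of_int (snd z)" for z :: "int \<times> int"
  let ?H = "approximants \<epsilon> U t" and ?Q = "{z \<in> farey_quads \<alpha> \<beta> U. t \<in> overlap \<epsilon> z}"
  have opp: "E z1 * E z2 < 0" if "z1 \<in> ?H" "z2 \<in> ?H" "z1 \<noteq> z2" for z1 z2
    using approximants_opposite[OF eU, of "fst z1" "snd z1" t "fst z2" "snd z2"] that e unfolding E_def by (auto simp: prod_eq_iff)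
  have Q: "(a, p) \<in> ?H \<and> (b, p') \<in> ?H \<and> 0 < E (a, p) \<and> E (b, p') < 0" if "(a, b, p, p') \<in> ?Q" for a b p p'
    using overlap_approximants[OF eU, of a b p p' \<alpha> \<beta> t] that e unfolding E_def by auto
  have Q': "(q1, q2, p1, p2) \<in> ?Q" if "(q1, p1) \<in> ?H" "(q2, p2) \<in> ?H" "0 < E (q1, p1)" "E (q2, p2) < 0" for q1 q2 p1 p2
    using approximants_overlap[OF r eU e t] that unfolding E_def by auto
  consider "?H = {}" | z where "?H = {z}" | z1 z2 where "z1 \<in> ?H" "z2 \<in> ?H" "z1 \<noteq> z2" by blast
  then show ?thesis
  proof cases
    case 1
    then have "?Q = {}" using Q by fast
    then show ?thesis using 1 near_rational_iff[of t \<epsilon> U] by (simp only: card.empty) simp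
  next
    case (2 z)
    have "?Q = {}"
    proof (rule ccontr)
      assume "?Q \<noteq> {}"
      then obtain a b p p' where "(a, b, p, p') \<in> ?Q" by auto
      from Q[OF this] show False unfolding 2 by auto
    qed
    then show ?thesis using 2 near_rational_iff[of t \<epsilon> U] by (simp only: card.empty) simp
  next
    case (3 x1 x2)
    have "(0 < E x1 \<and> E x2 < 0) \<or> (E x1 < 0 \<and> 0 < E x2)"
      using opp[OF 3] by (auto simp: mult_less_0_iff)
    then obtain z1 z2 where z: "z1 \<in> ?H" "z2 \<in> ?H" "0 < E z1" "E z2 < 0"
      using 3 by blast
    have H: "?H = {z1, z2}"
    proof (rule ccontr)
      assume "?H \<noteq> {z1, z2}"
      then obtain z3 where "z3 \<in> ?H" "z3 \<noteq> z1" "z3 \<noteq> z2" using z by blast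
      then show False using opp[of z3 z1] opp[of z3 z2] z by (auto simp: mult_less_0_iff)
    qed
    have ne: "z1 \<noteq> z2" using z by auto
    have "?Q = {(fst z1, fst z2, snd z1, snd z2)}"
    proof (intro equalityI subsetI)
      fix w assume w: "w \<in> ?Q"
      obtain a b p p' where w': "w = (a, b, p, p')" by (cases w) auto
      from Q[OF w[unfolded w']] have "(a, p) = z1" "(b, p') = z2" using z unfolding H by auto
      then show "w \<in> {(fst z1, fst z2, snd z1, snd z2)}" unfolding w' by auto
    qed (use Q'[of "fst z1" "snd z1" "fst z2" "snd z2"] z in auto)
    then have "card ?Q = 1" by (simp only: card.empty card_insert_disjoint finite.emptyI) simp
    moreover have "card ?H = 2" unfolding H using ne by simp
    moreover have "t \<in> near_rational \<epsilon> U" using near_rational_iff H by auto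
    ultimately show ?thesis by simp
  qed
qed

section \<open>Weak convergence from rectangles\<close>

lemma measure_cell_eq:
  fixes \<mu> :: "(real \<times> real) measure"
  assumes \<mu>: "finite_measure \<mu>" "sets \<mu> = sets borel" and le: "a \<le> y'" "y' \<le> y" "c \<le> z'" "z' \<le> z"
  shows "measure \<mu> ({y'<..y} \<times> {z'<..z}) =
    measure \<mu> ({a<..y} \<times> {c<..z}) - measure \<mu> ({a<..y'} \<times> {c<..z}) - measure \<mu> ({a<..y} \<times> {c<..z'}) + measure \<mu> ({a<..y'} \<times> {c<..z'})"
proof -
  interpret finite_measure \<mu> by fact
  have S: "{y1<..y2} \<times> {z1<..z2} \<in> sets \<mu>" for y1 y2 z1 z2 :: real
    unfolding \<mu>(2) by (intro borel_Times) auto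
  have 1: "measure \<mu> ({a<..y2} \<times> {z1<..z2}) = measure \<mu> ({a<..y1} \<times> {z1<..z2}) + measure \<mu> ({y1<..y2} \<times> {z1<..z2})"
    if "a \<le> y1" "y1 \<le> y2" for y1 y2 z1 z2
  proof -
    have "{a<..y2} \<times> {z1<..z2} = {a<..y1} \<times> {z1<..z2} \<union> {y1<..y2} \<times> {z1<..z2}" using that by auto
    moreover have "measure \<mu> ({a<..y1} \<times> {z1<..z2} \<union> {y1<..y2} \<times> {z1<..z2}) = measure \<mu> ({a<..y1} \<times> {z1<..z2}) + measure \<mu> ({y1<..y2} \<times> {z1<..z2})"
      by (intro finite_measure_Union S) auto
    ultimately show ?thesis by simp
  qed
  have 2: "measure \<mu> ({y1<..y2} \<times> {c<..z2}) = measure \<mu> ({y1<..y2} \<times> {c<..z1}) + measure \<mu> ({y1<..y2} \<times> {z1<..z2})"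
    if "c \<le> z1" "z1 \<le> z2" for y1 y2 z1 z2
  proof -
    have "{y1<..y2} \<times> {c<..z2} = {y1<..y2} \<times> {c<..z1} \<union> {y1<..y2} \<times> {z1<..z2}" using that by auto
    moreover have "measure \<mu> ({y1<..y2} \<times> {c<..z1} \<union> {y1<..y2} \<times> {z1<..z2}) = measure \<mu> ({y1<..y2} \<times> {c<..z1}) + measure \<mu> ({y1<..y2} \<times> {z1<..z2})"
      by (intro finite_measure_Union S) auto
    ultimately show ?thesis by simp
  qed
  show ?thesis
    using 1[OF le(1,2), of c z] 1[OF le(1,2), of c z'] 2[OF le(3,4), of y' y] by linarith
qed

text \<open>Half-open cells tile the half-open rectangle, so that masses on the grid lines are counted once.\<close>

lemma rectangle_integral_approx:
  fixes \<mu> :: "(real \<times> real) measure" and \<Psi> :: "real \<times> real \<Rightarrow> real"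
  assumes \<mu>: "finite_measure \<mu>" "sets \<mu> = sets borel"
    and cont: "continuous_on ({a..b} \<times> {c..d}) \<Psi>"
    and Y: "\<And>j. j \<le> n \<Longrightarrow> Y j \<in> {a..b}" "Y 0 = a" "Y n = b" "mono Y"
    and Z: "\<And>j. j \<le> n \<Longrightarrow> Z j \<in> {c..d}" "Z 0 = c" "Z n = d" "mono Z"
    and osc: "\<And>j k y z. j < n \<Longrightarrow> k < n \<Longrightarrow> y \<in> {Y j<..Y (Suc j)} \<Longrightarrow> z \<in> {Z k<..Z (Suc k)} \<Longrightarrow> \<bar>\<Psi> (y, z) - \<Psi> (Y (Suc j), Z (Suc k))\<bar> \<le> e"
  shows "\<bar>(LINT x:({a<..b} \<times> {c<..d})|\<mu>. \<Psi> x) - (\<Sum>(j,k)\<in>{..<n}\<times>{..<n}. \<Psi> (Y (Suc j), Z (Suc k)) * measure \<mu> ({Y j<..Y (Suc j)} \<times> {Z k<..Z (Suc k)}))\<bar>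
     \<le> e * measure \<mu> ({a<..b} \<times> {c<..d})"
proof -
  interpret finite_measure \<mu> by fact
  let ?R = "{a<..b} \<times> {c<..d}"
  define C where "C = (\<lambda>(j,k). {Y j<..Y (Suc j)} \<times> {Z k<..Z (Suc k)})"
  define I where "I = {..<n} \<times> {..<n}"
  have I: "finite I" unfolding I_def by simp
  have S: "{y1<..y2} \<times> {z1<..z2} \<in> sets \<mu>" for y1 y2 z1 z2 :: real
    unfolding \<mu>(2) by (intro borel_Times) auto
  have CS: "C i \<in> sets \<mu>" for i unfolding C_def using S by (cases i) auto
  have find: "\<exists>j<n. y \<in> {Y j<..Y (Suc j)}" if "Y 0 < y" "y \<le> Y n" for Y :: "nat \<Rightarrow> real" and y
  proof -
    define j where "j = (LEAST j. y \<le> Y j)"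
    have 1: "y \<le> Y j" unfolding j_def using that(2) by (rule LeastI)
    have jn: "j \<le> n" unfolding j_def using that(2) by (rule Least_le)
    have "j \<noteq> 0" using 1 that(1) by (cases j) auto
    then obtain i where i: "j = Suc i" by (cases j) auto
    have "\<not> y \<le> Y i" using not_less_Least[of i "\<lambda>j. y \<le> Y j"] i unfolding j_def by simp
    then show ?thesis using 1 i jn by (intro exI[of _ i]) auto
  qed
  have R: "?R = (\<Union>i\<in>I. C i)"
  proof (intro equalityI subsetI)
    fix x assume x: "x \<in> ?R"
    obtain y z where yz: "x = (y, z)" by (cases x)
    obtain j where "j < n" "y \<in> {Y j<..Y (Suc j)}" using find[of Y y] x yz Y by auto
    moreover obtain k where "k < n" "z \<in> {Z k<..Z (Suc k)}" using find[of Z z] x yz Z by auto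
    ultimately show "x \<in> (\<Union>i\<in>I. C i)" unfolding yz I_def C_def by auto
  next
    fix x assume "x \<in> (\<Union>i\<in>I. C i)"
    then obtain j k where jk: "j < n" "k < n" "x \<in> {Y j<..Y (Suc j)} \<times> {Z k<..Z (Suc k)}" unfolding I_def C_def by auto
    have "Y j \<in> {a..b}" "Y (Suc j) \<in> {a..b}" "Z k \<in> {c..d}" "Z (Suc k) \<in> {c..d}" using Y(1) Z(1) jk by auto
    then show "x \<in> ?R" using jk by auto
  qed
  have dj: "disjoint_family_on C I"
  proof -
    have mono_disj: "{Y j<..Y (Suc j)} \<inter> {Y k<..Y (Suc k)} = {}" if "mono Y" "j \<noteq> k" for Y :: "nat \<Rightarrow> real" and j k
    proof (cases "j < k")
      case True
      then have "Y (Suc j) \<le> Y k" using that(1) by (auto intro: monoD)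
      then show ?thesis by auto
    next
      case False
      then have "Y (Suc k) \<le> Y j" using that by (auto intro: monoD)
      then show ?thesis by auto
    qed
    show ?thesis unfolding disjoint_family_on_def
    proof (intro ballI impI)
      fix i i' assume "i \<in> I" "i' \<in> I" "i \<noteq> i'"
      obtain j k j' k' where ii: "i = (j, k)" "i' = (j', k')" by (cases i, cases i')
      have "j \<noteq> j' \<or> k \<noteq> k'" using \<open>i \<noteq> i'\<close> ii by auto
      then show "C i \<inter> C i' = {}" using mono_disj[OF Y(4), of j j'] mono_disj[OF Z(4), of k k'] unfolding ii C_def by auto
    qed
  qed
  have int: "set_integrable \<mu> A \<Psi>" if A: "A \<in> sets \<mu>" "A \<subseteq> ?R" for A
  proof -
    have "compact ({a..b} \<times> {c..d})" by (intro compact_Times) auto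
    then have "bounded (\<Psi> ` ({a..b} \<times> {c..d}))" using compact_continuous_image[OF cont] compact_imp_bounded by blast
    then obtain B where B: "\<And>x. x \<in> {a..b} \<times> {c..d} \<Longrightarrow> \<bar>\<Psi> x\<bar> \<le> B" unfolding bounded_iff by (auto simp: image_iff)
    have "(\<lambda>x. indicator ({a..b} \<times> {c..d}) x *\<^sub>R \<Psi> x) \<in> borel_measurable borel"
      by (intro borel_measurable_continuous_on_indicator cont borel_closed closed_Times) auto
    then have m: "(\<lambda>x. indicator ({a..b} \<times> {c..d}) x *\<^sub>R \<Psi> x) \<in> borel_measurable \<mu>"
      using \<mu>(2) by (simp cong: measurable_cong_sets)
    have "(\<lambda>x. indicator A x *\<^sub>R (indicator ({a..b} \<times> {c..d}) x *\<^sub>R \<Psi> x)) \<in> borel_measurable \<mu>"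
      using m A by measurable
    also have "(\<lambda>x. indicator A x *\<^sub>R (indicator ({a..b} \<times> {c..d}) x *\<^sub>R \<Psi> x)) = (\<lambda>x. indicator A x *\<^sub>R \<Psi> x)"
      using A(2) by (auto simp: indicator_def fun_eq_iff)
    finally have "(\<lambda>x. indicator A x *\<^sub>R \<Psi> x) \<in> borel_measurable \<mu>" .
    then show ?thesis unfolding set_integrable_def
    proof (rule integrable_const_bound[of _ "\<bar>B\<bar>", rotated])
      show "AE x in \<mu>. norm (indicator A x *\<^sub>R \<Psi> x) \<le> \<bar>B\<bar>"
        using A(2) by (intro AE_I2) (auto simp: indicator_def intro!: order.trans[OF B])
    qed
  qed
  have CR: "C i \<subseteq> ?R" if "i \<in> I" for i using that R by blast
  have "(LINT x:?R|\<mu>. \<Psi> x) = (\<Sum>i\<in>I. LINT x:C i|\<mu>. \<Psi> x)"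
    unfolding R using I CR by (intro set_integral_finite_Union dj int CS) auto
  moreover have "\<bar>(LINT x:C i|\<mu>. \<Psi> x) - \<Psi> (Y (Suc (fst i)), Z (Suc (snd i))) * measure \<mu> (C i)\<bar> \<le> e * measure \<mu> (C i)" if i: "i \<in> I" for i
  proof -
    let ?c = "\<Psi> (Y (Suc (fst i)), Z (Suc (snd i)))"
    have ii: "set_integrable \<mu> (C i) \<Psi>" using int CS CR i by blast
    have ic: "set_integrable \<mu> (C i) (\<lambda>x. k)" for k :: real using CS by (simp add: set_integrable_def less_top[symmetric])
    have cc: "(LINT x:C i|\<mu>. k) = k * measure \<mu> (C i)" for k using CS by (simp add: set_integral_const less_top[symmetric] set_lebesgue_integral_def)
    have "(LINT x:C i|\<mu>. \<Psi> x) - ?c * measure \<mu> (C i) = (LINT x:C i|\<mu>. \<Psi> x - ?c)"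
      using ii ic by (simp add: set_integral_diff cc)
    also have "\<bar>\<dots>\<bar> \<le> (LINT x:C i|\<mu>. \<bar>\<Psi> x - ?c\<bar>)"
      unfolding set_lebesgue_integral_def by (rule order.trans[OF integral_abs_bound]) (simp add: abs_mult)
    also have "\<dots> \<le> (LINT x:C i|\<mu>. e)"
    proof (rule set_integral_mono)
      show "set_integrable \<mu> (C i) (\<lambda>x. \<bar>\<Psi> x - ?c\<bar>)" using ii ic by (intro set_integrable_abs set_integral_diff)
      fix x assume "x \<in> C i"
      then show "\<bar>\<Psi> x - ?c\<bar> \<le> e" using osc i unfolding C_def I_def by (cases i; cases x) auto
    qed (rule ic)
    finally show ?thesis unfolding cc .
  qed
  ultimately have "\<bar>(LINT x:?R|\<mu>. \<Psi> x) - (\<Sum>i\<in>I. \<Psi> (Y (Suc (fst i)), Z (Suc (snd i))) * measure \<mu> (C i))\<bar> \<le> (\<Sum>i\<in>I. e * measure \<mu> (C i))"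
    by (simp only: sum_subtractf[symmetric]) (rule order.trans[OF sum_abs], rule sum_mono, simp)
  also have "\<dots> = e * measure \<mu> ?R"
    unfolding R sum_distrib_left[symmetric] using CS I dj by (subst finite_measure_finite_Union) auto
  finally show ?thesis unfolding I_def C_def by (simp add: case_prod_unfold)
qed

text \<open>It suffices to test rectangles with one corner at \<open>(a, c)\<close>; a cell is an alternating sum of four
of them by \<open>measure_cell_eq\<close>.\<close>

lemma rectangle_weak_convergence:
  fixes \<mu> :: "'i \<Rightarrow> (real \<times> real) measure" and \<nu> :: "(real \<times> real) measure" and \<Psi> :: "real \<times> real \<Rightarrow> real"
  assumes \<mu>: "\<And>i. finite_measure (\<mu> i)" "\<And>i. sets (\<mu> i) = sets borel" and \<nu>: "finite_measure \<nu>" "sets \<nu> = sets borel"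
    and ab: "a < b" "c < d"
    and lim: "\<And>y z. y \<in> {a..b} \<Longrightarrow> z \<in> {c..d} \<Longrightarrow>
       ((\<lambda>i. measure (\<mu> i) ({a<..y} \<times> {c<..z})) \<longlongrightarrow> measure \<nu> ({a<..y} \<times> {c<..z})) F"
    and cont: "continuous_on ({a..b} \<times> {c..d}) \<Psi>"
  shows "((\<lambda>i. LINT x:({a<..b} \<times> {c<..d})|\<mu> i. \<Psi> x) \<longlongrightarrow> (LINT x:({a<..b} \<times> {c<..d})|\<nu>. \<Psi> x)) F"
proof (rule tendstoI)
  fix e :: real assume e: "e > 0"
  let ?R = "{a<..b} \<times> {c<..d}"
  define K where "K = measure \<nu> ?R + 1"
  have K: "K > 0" unfolding K_def by (simp add: add_nonneg_pos)
  define \<delta> where "\<delta> = e / (4 * K)"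
  have \<delta>: "\<delta> > 0" using e K unfolding \<delta>_def by simp
  have "compact ({a..b} \<times> {c..d})" by (intro compact_Times) auto
  then have "uniformly_continuous_on ({a..b} \<times> {c..d}) \<Psi>" using cont compact_uniformly_continuous by blast
  then obtain r where r: "r > 0" "\<And>x x'. x \<in> {a..b} \<times> {c..d} \<Longrightarrow> x' \<in> {a..b} \<times> {c..d} \<Longrightarrow> dist x' x < r \<Longrightarrow> dist (\<Psi> x') (\<Psi> x) < \<delta>"
    unfolding uniformly_continuous_on_def using \<delta> by metis
  obtain n0 :: nat where n0: "((b - a) + (d - c)) / r < n0" using reals_Archimedean2 by blast
  define n where "n = Suc n0"
  have n: "((b - a) + (d - c)) / n < r"
  proof -
    have "((b - a) + (d - c)) / r < real n" using n0 unfolding n_def by simp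
    then show ?thesis using r(1) unfolding n_def by (simp add: field_simps)
  qed
  define Y where "Y j = a + real j / n * (b - a)" for j
  define Z where "Z j = c + real j / n * (d - c)" for j
  have n1: "real n > 0" unfolding n_def by simp
  have fr: "0 \<le> real j / n" "real j / n \<le> 1" if "j \<le> n" for j using that n1 by auto
  have Yj: "Y j \<in> {a..b}" if "j \<le> n" for j
    using mult_right_mono[OF fr(2)[OF that], of "b - a"] fr(1)[OF that] ab unfolding Y_def by simp
  have Zj: "Z j \<in> {c..d}" if "j \<le> n" for j
    using mult_right_mono[OF fr(2)[OF that], of "d - c"] fr(1)[OF that] ab unfolding Z_def by simp
  have mono: "mono Y" "mono Z" unfolding Y_def Z_def using ab n1 by (auto intro!: monoI mult_right_mono divide_right_mono)
  have ends: "Y 0 = a" "Y n = b" "Z 0 = c" "Z n = d" unfolding Y_def Z_def using n1 by auto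
  have step: "Y (Suc j) - Y j = (b - a) / n" "Z (Suc j) - Z j = (d - c) / n" for j
    unfolding Y_def Z_def by (auto simp: add_divide_distrib algebra_simps)
  have osc: "\<bar>\<Psi> (y, z) - \<Psi> (Y (Suc j), Z (Suc k))\<bar> \<le> \<delta>"
    if "j < n" "k < n" "y \<in> {Y j<..Y (Suc j)}" "z \<in> {Z k<..Z (Suc k)}" for j k y z
  proof -
    have "Y j \<in> {a..b}" "Y (Suc j) \<in> {a..b}" "Z k \<in> {c..d}" "Z (Suc k) \<in> {c..d}" using Yj Zj that by auto
    moreover then have "(y, z) \<in> {a..b} \<times> {c..d}" using that by auto
    moreover have "dist (y, z) (Y (Suc j), Z (Suc k)) < r"
    proof -
      have "dist (y, z) (Y (Suc j), Z (Suc k)) \<le> dist y (Y (Suc j)) + dist z (Z (Suc k))"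
        unfolding dist_Pair_Pair by (intro sqrt_sum_squares_le_sum) auto
      also have "\<dots> \<le> (b - a) / n + (d - c) / n" using that step[of j] step[of k] by (simp add: dist_real_def)
      also have "\<dots> < r" using n by (simp add: add_divide_distrib)
      finally show ?thesis .
    qed
    ultimately have "dist (\<Psi> (y, z)) (\<Psi> (Y (Suc j), Z (Suc k))) < \<delta>" by (intro r(2)) auto
    then show ?thesis by (simp add: dist_real_def)
  qed
  define S where "S \<mu> = (\<Sum>(j,k)\<in>{..<n}\<times>{..<n}. \<Psi> (Y (Suc j), Z (Suc k)) * measure \<mu> ({Y j<..Y (Suc j)} \<times> {Z k<..Z (Suc k)}))" for \<mu>
  have approx: "\<bar>(LINT x:?R|\<mu>. \<Psi> x) - S \<mu>\<bar> \<le> \<delta> * measure \<mu> ?R" if "finite_measure \<mu>" "sets \<mu> = sets borel" for \<mu>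
    unfolding S_def by (rule rectangle_integral_approx[OF that cont Yj ends(1,2) mono(1) Zj ends(3,4) mono(2) osc])
  have "((\<lambda>i. S (\<mu> i)) \<longlongrightarrow> S \<nu>) F"
    unfolding S_def
  proof (intro tendsto_sum, clarsimp)
    fix j k assume jk: "j < n" "k < n"
    have mem: "Y j \<in> {a..b}" "Y (Suc j) \<in> {a..b}" "Z k \<in> {c..d}" "Z (Suc k) \<in> {c..d}" using Yj Zj jk by auto
    have le: "a \<le> Y j" "Y j \<le> Y (Suc j)" "c \<le> Z k" "Z k \<le> Z (Suc k)" using mem mono by (auto intro: monoD)
    have "((\<lambda>i. measure (\<mu> i) ({Y j<..Y (Suc j)} \<times> {Z k<..Z (Suc k)})) \<longlongrightarrow> measure \<nu> ({Y j<..Y (Suc j)} \<times> {Z k<..Z (Suc k)})) F"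
      unfolding measure_cell_eq[OF \<mu>(1) \<mu>(2) le] measure_cell_eq[OF \<nu>(1) \<nu>(2) le]
      using mem by (intro tendsto_add tendsto_diff lim)
    then show "((\<lambda>i. \<Psi> (Y (Suc j), Z (Suc k)) * measure (\<mu> i) ({Y j<..Y (Suc j)} \<times> {Z k<..Z (Suc k)})) \<longlongrightarrow>
        \<Psi> (Y (Suc j), Z (Suc k)) * measure \<nu> ({Y j<..Y (Suc j)} \<times> {Z k<..Z (Suc k)})) F"
      by (intro tendsto_mult tendsto_const)
  qed
  then have 1: "eventually (\<lambda>i. dist (S (\<mu> i)) (S \<nu>) < e / 4) F" using e by (intro tendstoD) auto
  have "((\<lambda>i. measure (\<mu> i) ?R) \<longlongrightarrow> measure \<nu> ?R) F" using lim[of b d] ab by simp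
  then have 2: "eventually (\<lambda>i. measure (\<mu> i) ?R < K) F" by (rule order_tendstoD) (simp add: K_def)
  show "eventually (\<lambda>i. dist (LINT x:?R|\<mu> i. \<Psi> x) (LINT x:?R|\<nu>. \<Psi> x) < e) F"
    using 1 2
  proof eventually_elim
    case (elim i)
    have dK: "\<delta> * K = e / 4" unfolding \<delta>_def using K by simp
    have "\<delta> * measure (\<mu> i) ?R \<le> \<delta> * K" "\<delta> * measure \<nu> ?R \<le> \<delta> * K" using elim(2) \<delta> unfolding K_def by (auto intro!: mult_left_mono)
    then show ?case using elim(1) approx[OF \<mu>(1) \<mu>(2), of i] approx[OF \<nu>] dK e unfolding dist_real_def by linarith
  qed
qed

section \<open>The measure of the points close to rationals\<close>

lemma near_rational_borel: "near_rational \<epsilon> U \<in> sets borel"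
proof -
  have "near_rational \<epsilon> U = (\<Union>q\<in>{q::int. 1 \<le> q \<and> of_int q \<le> U}. \<Union>p::int. {t. \<bar>of_int q * t - of_int p\<bar> \<le> \<epsilon>})"
    unfolding near_rational_def by auto
  moreover have "{t::real. \<bar>of_int q * t - of_int p\<bar> \<le> \<epsilon>} \<in> sets borel" for q p :: int
    by (intro borel_closed closed_Collect_le continuous_intros)
  ultimately show ?thesis by (auto intro!: sets.countable_UN'' sets.countable_UN)
qed

lemma measure_overlap:
  assumes z: "(a, b, p, p') \<in> farey_quads \<alpha> \<beta> U"
  shows "measure lborel (overlap \<epsilon> (a, b, p, p')) = max 0 (\<epsilon> * (of_int a + of_int b) - 1) / (of_int a * of_int b)"
proof -
  have ab: "0 < real_of_int a" "0 < real_of_int b" and det: "p' * a - p * b = 1"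
    using z unfolding farey_quads_def coprime_box_def by auto
  have "real_of_int (p' * a - p * b) = 1" using det by simp
  then have d: "of_int p' * of_int a = of_int p * of_int b + (1::real)" by simp
  define l where "l = (of_int p + \<epsilon>) / of_int a - (of_int p' - \<epsilon>) / real_of_int b"
  have "l * (of_int a * of_int b) = (of_int p + \<epsilon>) * of_int b - (of_int p' - \<epsilon>) * real_of_int a"
    unfolding l_def using ab by (simp add: field_simps)
  also have "\<dots> = \<epsilon> * (of_int a + of_int b) - 1" using d by (simp add: algebra_simps)
  finally have l: "l = (\<epsilon> * (of_int a + of_int b) - 1) / (of_int a * of_int b)" using ab by (simp add: field_simps)
  have "measure lborel (overlap \<epsilon> (a, b, p, p')) = max 0 l" unfolding overlap_def l_def by (auto simp: max_def)
  also have "\<dots> = max 0 (\<epsilon> * (of_int a + of_int b) - 1) / (of_int a * of_int b)"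
  proof -
    have "max 0 (n / P) = max 0 n / P" if "0 < P" for n P :: real
      using that by (auto simp: max_def divide_le_0_iff zero_le_divide_iff)
    then show ?thesis unfolding l using ab by simp
  qed
  finally show ?thesis .
qed

text \<open>The distance between \<open>p / q\<close> and an endpoint with denominator \<open>d\<close> is zero or at least
\<open>1 / (q * d) > \<epsilon> / q\<close>. Hence the interval of reach around \<open>p / q\<close> lies inside or outside, except
when \<open>p / q\<close> is an endpoint itself.\<close>

lemma measure_near_one_rational:
  fixes p q :: int
  assumes r: "rat_interval \<alpha> \<beta> d" and e: "0 < \<epsilon>" "\<epsilon> * d < 1" and q: "1 \<le> q"
  defines "I \<equiv> {(of_int p - \<epsilon>) / of_int q .. (of_int p + \<epsilon>) / real_of_int q}"
  shows "\<bar>measure lborel ({\<alpha><..<\<beta>} \<inter> I) - (if \<alpha> * of_int q < of_int p \<and> of_int p \<le> \<beta> * of_int q then 2 * \<epsilon> / of_int q else 0)\<bar>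
    \<le> (if of_int p = \<alpha> * of_int q \<or> of_int p = \<beta> * of_int q then 2 * \<epsilon> else 0)"
proof -
  have q0: "1 \<le> real_of_int q" "0 < real_of_int q" using q by auto
  have I: "measure lborel I = 2 * \<epsilon> / of_int q"
    unfolding I_def using e q0 by (simp add: diff_divide_distrib[symmetric] divide_right_mono)
  have le: "measure lborel ({\<alpha><..<\<beta>} \<inter> I) \<le> 2 * \<epsilon> / of_int q"
    unfolding I[symmetric] by (rule measure_mono_fmeasurable) (auto simp: I_def fmeasurable_def emeasure_lborel_Icc_eq)
  have le2: "2 * \<epsilon> / of_int q \<le> 2 * \<epsilon>" using e q0 by (simp add: field_simps)
  have nn: "0 \<le> 2 * \<epsilon> / of_int q" using e q0 by simp
  obtain i j where ij: "d > 0" "\<alpha> = of_int i / of_int d" "\<beta> = of_int j / of_int d" using rat_intervalE[OF r] by blast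
  have d0: "0 < real_of_int d" using ij by simp
  consider (b) "of_int p = \<alpha> * of_int q \<or> of_int p = \<beta> * of_int q" | (i) "\<alpha> * of_int q < of_int p" "of_int p < \<beta> * of_int q"
    | (l) "of_int p < \<alpha> * of_int q" | (g) "\<beta> * of_int q < of_int p" by linarith
  then show ?thesis
  proof cases
    case b
    have m0: "0 \<le> measure lborel ({\<alpha><..<\<beta>} \<inter> I)" by simp
    have "\<bar>measure lborel ({\<alpha><..<\<beta>} \<inter> I) - x\<bar> \<le> 2 * \<epsilon>" if "x = 0 \<or> x = 2 * \<epsilon> / of_int q" for x
      using that le le2 nn m0 by (elim disjE) linarith+
    then show ?thesis using b by presburger
  next
    case i
    have "real_of_int (i * q) < of_int (d * p)" "real_of_int (d * p) < of_int (j * q)"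
      using i unfolding ij(2,3) using d0 by (auto simp: field_simps)
    then have "i * q + 1 \<le> d * p" "d * p + 1 \<le> j * q" by linarith+
    then have "real_of_int (i * q + 1) \<le> of_int (d * p)" "real_of_int (d * p + 1) \<le> of_int (j * q)" by linarith+
    then have "of_int i * of_int q + \<epsilon> * d < d * of_int p" "d * of_int p + \<epsilon> * d < of_int j * of_int q" using e by auto
    then have "\<alpha> * of_int q < of_int p - \<epsilon>" "of_int p + \<epsilon> < \<beta> * of_int q" unfolding ij(2,3) using d0 by (auto simp: field_simps)
    then have "\<alpha> < (of_int p - \<epsilon>) / of_int q" "(of_int p + \<epsilon>) / of_int q < \<beta>"
      using q0 by (simp_all add: pos_divide_less_eq pos_less_divide_eq)
    then have "I \<subseteq> {\<alpha><..<\<beta>}" unfolding I_def by auto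
    then have "{\<alpha><..<\<beta>} \<inter> I = I" by blast
    then show ?thesis using i I by auto
  next
    case l
    have "real_of_int (d * p) < of_int (i * q)" using l unfolding ij(2) using d0 by (auto simp: field_simps)
    then have "d * p + 1 \<le> i * q" by linarith
    then have "real_of_int (d * p + 1) \<le> of_int (i * q)" by linarith
    then have "d * of_int p + \<epsilon> * d < of_int i * of_int q" using e by auto
    then have "of_int p + \<epsilon> < \<alpha> * of_int q" unfolding ij(2) using d0 by (auto simp: field_simps)
    then have "(of_int p + \<epsilon>) / of_int q < \<alpha>" using q0 by (simp add: pos_divide_less_eq)
    then have "{\<alpha><..<\<beta>} \<inter> I = {}" unfolding I_def by auto
    then show ?thesis using l e by auto
  next
    case g
    have "real_of_int (j * q) < of_int (d * p)" using g unfolding ij(3) using d0 by (auto simp: field_simps)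
    then have "j * q + 1 \<le> d * p" by linarith
    then have "real_of_int (j * q + 1) \<le> of_int (d * p)" by linarith
    then have "of_int j * of_int q + \<epsilon> * d < d * of_int p" using e by auto
    then have "\<beta> * of_int q < of_int p - \<epsilon>" unfolding ij(3) using d0 by (auto simp: field_simps)
    then have "\<beta> < (of_int p - \<epsilon>) / of_int q" using q0 by (simp add: pos_less_divide_eq)
    then have "{\<alpha><..<\<beta>} \<inter> I = {}" unfolding I_def by auto
    then show ?thesis using g e by auto
  qed
qed

lemma card_le_1I: "(\<And>x y. x \<in> A \<Longrightarrow> y \<in> A \<Longrightarrow> x = y) \<Longrightarrow> card A \<le> 1"
  by (metis card.infinite card_le_Suc0_iff_eq One_nat_def zero_le)

text \<open>Integration of \<open>near_rational_inclusion_exclusion\<close> over the interval. The error \<open>4 * \<epsilon>\<close> comes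
from the two endpoints and \<open>16 * \<epsilon> * sqrt U\<close> from the sieve that counts the fractions.\<close>

lemma near_rational_measure_formula:
  assumes r: "rat_interval \<alpha> \<beta> d" and e: "0 < \<epsilon>" "\<epsilon> \<le> 1" "\<epsilon> * d < 1" and eU: "\<epsilon> * U < 1" and U: "0 \<le> U"
  shows "\<bar>measure lborel ({\<alpha><..<\<beta>} \<inter> near_rational \<epsilon> U) -
     (2 * \<epsilon> * (\<beta> - \<alpha>) * (\<Sum>q=1..nat \<lfloor>U\<rfloor>. totient q / real q)
      - (\<Sum>(a, b) \<in> {(a, b) \<in> coprime_box U U. farey_in \<alpha> \<beta> a b}. max 0 (\<epsilon> * (of_int a + of_int b) - 1) / (of_int a * of_int b)))\<bar>
    \<le> 4 * \<epsilon> + 16 * \<epsilon> * sqrt U"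
proof -
  let ?J = "{\<alpha><..<\<beta>}" and ?N = "near_rational \<epsilon> U" and ?Q = "farey_quads \<alpha> \<beta> U"
  \<comment> \<open>The bound on \<open>p\<close> makes \<open>V\<close> finite without losing an approximant of a point of the unit interval.\<close>
  define V where "V = {(q::int, p::int). 1 \<le> q \<and> of_int q \<le> U \<and> coprime q p \<and> \<bar>p\<bar> \<le> q + 1}"
  define I where "I v = {(of_int (snd v) - \<epsilon>) / of_int (fst v) .. (of_int (snd v) + \<epsilon>) / real_of_int (fst v)}" for v :: "int \<times> int"
  have rr: "0 \<le> \<alpha>" "\<alpha> < \<beta>" "\<beta> \<le> 1" using r unfolding rat_interval_def by auto
  have finV: "finite V"
  proof (rule finite_subset)
    show "V \<subseteq> {1..\<lfloor>U\<rfloor>} \<times> {-\<lfloor>U\<rfloor>-1..\<lfloor>U\<rfloor>+1}" unfolding V_def by (auto simp: le_floor_iff) linarith+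
  qed auto
  have finQ: "finite ?Q" using finite_farey_quads(1)[OF r] .
  have I_iff: "t \<in> I (q, p) \<longleftrightarrow> \<bar>of_int q * t - of_int p\<bar> \<le> \<epsilon>" if "1 \<le> q" for q p t
    using that unfolding I_def by (auto simp: field_simps abs_le_iff)
  have point: "indicator (?J \<inter> ?N) t = (\<Sum>v\<in>V. indicator (?J \<inter> I v) t) - (\<Sum>z\<in>?Q. indicator (overlap \<epsilon> z) t :: real)" for t
  proof (cases "t \<in> ?J")
    case True
    have "approximants \<epsilon> U t = {v \<in> V. t \<in> I v}"
    proof (intro equalityI subsetI)
      fix v assume v: "v \<in> approximants \<epsilon> U t"
      obtain q p where qp: "v = (q, p)" by (cases v)
      have q: "1 \<le> q" "of_int q \<le> U" "coprime q p" "\<bar>of_int q * t - of_int p\<bar> \<le> \<epsilon>" using v unfolding qp approximants_def by auto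
      have "0 \<le> of_int q * t" "of_int q * t \<le> of_int q * 1" using True rr q(1) by (auto intro!: mult_left_mono mult_nonneg_nonneg)
      then have "\<bar>p\<bar> \<le> q + 1" using q(4) e(2) by linarith
      then show "v \<in> {v \<in> V. t \<in> I v}" using q I_iff[OF q(1)] unfolding qp V_def by auto
    qed (auto simp: V_def approximants_def I_iff)
    then have "real (card (approximants \<epsilon> U t)) = (\<Sum>v\<in>V. indicator (I v) t)"
      unfolding indicator_def of_bool_def using finV by (simp add: sum.If_cases Int_def)
    moreover have "real (card {z \<in> ?Q. t \<in> overlap \<epsilon> z}) = (\<Sum>z\<in>?Q. indicator (overlap \<epsilon> z) t)"
      unfolding indicator_def of_bool_def using finQ by (simp add: sum.If_cases Int_def)
    moreover have "indicator (?J \<inter> ?N) t = (indicator ?N t :: real)" "indicator (?J \<inter> I v) t = (indicator (I v) t :: real)" for v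
      using True by (auto simp: indicator_def)
    ultimately show ?thesis using near_rational_inclusion_exclusion[OF r eU e(1,3), of t] True by simp
  next
    case False
    have "indicator (overlap \<epsilon> z) t = (0::real)" if z: "z \<in> ?Q" for z
    proof (rule ccontr)
      assume "\<not> ?thesis"
      then have t: "t \<in> overlap \<epsilon> z" by (auto simp: indicator_def split: if_splits)
      obtain a b p p' where z': "z = (a, b, p, p')" by (cases z) auto
      have o: "0 < of_int a * t - of_int p" "of_int b * t - of_int p' < 0"
        using overlap_approximants(3,4)[OF eU less_imp_le[OF e(1)]] z t unfolding z' by blast+
      have ab: "0 < real_of_int a" "0 < real_of_int b" "\<alpha> * of_int a \<le> of_int p" "of_int p' \<le> \<beta> * of_int b"
        using z unfolding z' farey_quads_def coprime_box_def by auto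
      have "\<alpha> * of_int a < t * of_int a" "t * of_int b < \<beta> * of_int b"
        using o ab mult.commute[of t "of_int a"] mult.commute[of t "of_int b"] by linarith+
      then have "\<alpha> < t" "t < \<beta>" using ab(1,2) by (simp_all only: mult_less_cancel_right_pos)
      then show False using False by auto
    qed
    moreover have "indicator (?J \<inter> A) t = (0::real)" for A using False by auto
    ultimately show ?thesis by simp
  qed
  have mJ: "measure lborel (?J \<inter> ?N) = (\<Sum>v\<in>V. measure lborel (?J \<inter> I v)) - (\<Sum>z\<in>?Q. measure lborel (overlap \<epsilon> z))"
  proof -
    have i1: "integrable lborel (indicator (?J \<inter> I v) :: real \<Rightarrow> real)" for v
    proof (rule integrable_real_indicator)
      have "emeasure lborel (?J \<inter> I v) \<le> emeasure lborel ?J" by (rule emeasure_mono) auto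
      also have "\<dots> < \<infinity>" using rr by simp
      finally show "emeasure lborel (?J \<inter> I v) < \<infinity>" .
    qed (auto simp: I_def)
    have i2: "integrable lborel (indicator (overlap \<epsilon> z) :: real \<Rightarrow> real)" for z
      unfolding overlap_def by (cases z) (auto intro!: integrable_real_indicator simp: emeasure_lborel_Icc_eq)
    have "measure lborel (?J \<inter> ?N) = (\<integral>t. indicator (?J \<inter> ?N) t \<partial>lborel)" by simp
    also have "\<dots> = (\<integral>t. (\<Sum>v\<in>V. indicator (?J \<inter> I v) t) - (\<Sum>z\<in>?Q. indicator (overlap \<epsilon> z) t) \<partial>lborel)"
      by (simp only: point)
    also have "\<dots> = (\<Sum>v\<in>V. \<integral>t. indicator (?J \<inter> I v) t \<partial>lborel) - (\<Sum>z\<in>?Q. \<integral>t. indicator (overlap \<epsilon> z) t \<partial>lborel)"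
      using i1 i2 by (simp add: Bochner_Integration.integral_sum Bochner_Integration.integral_diff)
    finally show ?thesis by simp
  qed
  have Qsum: "(\<Sum>z\<in>?Q. measure lborel (overlap \<epsilon> z)) = (\<Sum>(a, b) \<in> {(a, b) \<in> coprime_box U U. farey_in \<alpha> \<beta> a b}. max 0 (\<epsilon> * (of_int a + of_int b) - 1) / (of_int a * of_int b))"
    unfolding finite_farey_quads(2)[OF r, symmetric]
    by (subst sum.reindex[OF finite_farey_quads(3)[OF r]]) (auto intro!: sum.cong simp: measure_overlap)
  define w where "w v = (if \<alpha> * of_int (fst v) < of_int (snd v) \<and> of_int (snd v) \<le> \<beta> * of_int (fst v) then 2 * \<epsilon> / real_of_int (fst v) else 0)" for v :: "int \<times> int"
  have Vsum: "\<bar>(\<Sum>v\<in>V. measure lborel (?J \<inter> I v)) - (\<Sum>v\<in>V. w v)\<bar> \<le> 4 * \<epsilon>"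
  proof -
    define B where "B \<gamma> = {v\<in>V. of_int (snd v) = \<gamma> * of_int (fst v)}" for \<gamma> :: real
    have cB: "card (B \<gamma>) \<le> 1" for \<gamma>
    proof (rule card_le_1I)
      fix x y assume xy: "x \<in> B \<gamma>" "y \<in> B \<gamma>"
      obtain q1 p1 q2 p2 where z: "x = (q1, p1)" "y = (q2, p2)" by (cases x, cases y)
      have "real_of_int (q1 * p2) = of_int (q2 * p1)" using xy unfolding z B_def by simp
      then have "q1 * p2 = q2 * p1" by linarith
      then show "x = y" using coprime_fraction_unique[of q1 q2 p1 p2] xy unfolding z B_def V_def by auto
    qed
    have "\<bar>(\<Sum>v\<in>V. measure lborel (?J \<inter> I v) - w v)\<bar> \<le> (\<Sum>v\<in>V. if v \<in> B \<alpha> \<union> B \<beta> then 2 * \<epsilon> else 0)"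
    proof (rule order.trans[OF sum_abs], rule sum_mono)
      fix v assume v: "v \<in> V"
      obtain q p where qp: "v = (q, p)" by (cases v)
      have memB: "(q, p) \<in> B \<alpha> \<union> B \<beta> \<longleftrightarrow> of_int p = \<alpha> * of_int q \<or> of_int p = \<beta> * of_int q"
        using v unfolding qp B_def by simp
      have "1 \<le> q" using v unfolding qp V_def by auto
      from measure_near_one_rational[OF r e(1,3) this, where p = p] show "\<bar>measure lborel (?J \<inter> I v) - w v\<bar> \<le> (if v \<in> B \<alpha> \<union> B \<beta> then 2 * \<epsilon> else 0)"
        using v unfolding qp memB I_def w_def fst_conv snd_conv by (simp only:)
    qed
    also have "\<dots> = 2 * \<epsilon> * card (V \<inter> (B \<alpha> \<union> B \<beta>))"
      using finV by (simp only: sum.If_cases Collect_mem_eq) simp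
    also have "\<dots> \<le> 2 * \<epsilon> * 2"
    proof -
      have "card (V \<inter> (B \<alpha> \<union> B \<beta>)) \<le> card (B \<alpha> \<union> B \<beta>)" using finV by (intro card_mono) (auto simp: B_def)
      also have "\<dots> \<le> card (B \<alpha>) + card (B \<beta>)" by (rule card_Un_le)
      also have "\<dots> \<le> 2" using cB[of \<alpha>] cB[of \<beta>] by simp
      finally show ?thesis using e(1) by (intro mult_left_mono) auto
    qed
    finally show ?thesis by (simp add: sum_subtractf)
  qed
  let ?n = "nat \<lfloor>U\<rfloor>"
  define T where "T q = {p::int. \<alpha> * real q < p \<and> p \<le> \<beta> * real q \<and> coprime p (int q)}" for q :: nat
  have finT: "finite (T q)" for q
    by (rule finite_subset[OF _ card_int_Ioc(1)[of "\<alpha> * real q" "\<beta> * real q"]]) (use rr in \<open>auto simp: T_def intro: mult_right_mono\<close>)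
  have wsum: "(\<Sum>v\<in>V. w v) = (\<Sum>q=1..?n. 2 * \<epsilon> / real q * real (card (T q)))"
  proof -
    have im: "{v\<in>V. \<alpha> * of_int (fst v) < of_int (snd v) \<and> of_int (snd v) \<le> \<beta> * of_int (fst v)} = (\<lambda>(q, p). (int q, p)) ` (SIGMA q:{1..?n}. T q)"
    proof (intro equalityI subsetI)
      fix v assume v: "v \<in> {v\<in>V. \<alpha> * of_int (fst v) < of_int (snd v) \<and> of_int (snd v) \<le> \<beta> * of_int (fst v)}"
      obtain q p where qp: "v = (q, p)" by (cases v)
      have q: "1 \<le> q" "of_int q \<le> U" using v unfolding qp V_def by auto
      then have "nat q \<in> {1..?n}" "int (nat q) = q" by (auto simp: le_floor_iff nat_mono Suc_le_eq)
      moreover have "p \<in> T (nat q)" using v q unfolding qp T_def V_def by (auto simp: coprime_commute)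
      ultimately show "v \<in> (\<lambda>(q, p). (int q, p)) ` (SIGMA q:{1..?n}. T q)"
        unfolding qp by (intro image_eqI[of _ _ "(nat q, p)"]) auto
    next
      fix v assume "v \<in> (\<lambda>(q, p). (int q, p)) ` (SIGMA q:{1..?n}. T q)"
      then obtain q p where qp: "v = (int q, p)" "q \<in> {1..?n}" "p \<in> T q" by auto
      have "real q \<le> real ?n" using qp(2) by simp
      also have "\<dots> \<le> U" using U by (intro of_nat_floor) auto
      finally have qU: "real q \<le> U" .
      have "0 \<le> \<alpha> * real q" "\<beta> * real q \<le> 1 * real q" using rr mult_right_mono[OF rr(3), of "real q"] by auto
      then have "\<bar>p\<bar> \<le> int q + 1" using qp(3) unfolding T_def by auto
      then show "v \<in> {v\<in>V. \<alpha> * of_int (fst v) < of_int (snd v) \<and> of_int (snd v) \<le> \<beta> * of_int (fst v)}"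
        using qp qU unfolding T_def V_def by (auto simp: coprime_commute)
    qed
    have "(\<Sum>v\<in>V. w v) = (\<Sum>v\<in>{v\<in>V. \<alpha> * of_int (fst v) < of_int (snd v) \<and> of_int (snd v) \<le> \<beta> * of_int (fst v)}. 2 * \<epsilon> / real_of_int (fst v))"
      unfolding w_def by (rule sum.inter_filter[OF finV, symmetric])
    also have "\<dots> = (\<Sum>(q, p)\<in>(SIGMA q:{1..?n}. T q). 2 * \<epsilon> / real q)"
      unfolding im by (subst sum.reindex) (auto simp: inj_on_def case_prod_unfold)
    also have "\<dots> = (\<Sum>q=1..?n. \<Sum>p\<in>T q. 2 * \<epsilon> / real q)" using finT by (intro sum.Sigma[symmetric]) auto
    finally show ?thesis by (simp add: mult.commute)
  qed
  have "\<bar>(\<Sum>v\<in>V. w v) - 2 * \<epsilon> * (\<beta> - \<alpha>) * (\<Sum>q=1..?n. totient q / real q)\<bar> \<le> 16 * \<epsilon> * sqrt U"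
  proof -
    have "(\<Sum>v\<in>V. w v) - 2 * \<epsilon> * (\<beta> - \<alpha>) * (\<Sum>q=1..?n. totient q / real q)
        = (\<Sum>q=1..?n. 2 * \<epsilon> / real q * (real (card (T q)) - (\<beta> - \<alpha>) * totient q))"
      unfolding wsum sum_distrib_left sum_subtractf[symmetric]
      by (rule sum.cong) (simp_all add: field_simps)
    also have "\<bar>\<dots>\<bar> \<le> (\<Sum>q=1..?n. 8 * \<epsilon> * (1 / sqrt q))"
    proof (rule order.trans[OF sum_abs], rule sum_mono)
      fix q assume q: "q \<in> {1..?n}"
      have "\<bar>real (card (T q)) - (\<beta> * real q - \<alpha> * real q) * (totient q / q)\<bar> \<le> 4 * sqrt q"
        unfolding T_def using q rr by (intro coprime_count) (auto intro: mult_right_mono)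
      also have "(\<beta> * real q - \<alpha> * real q) * (totient q / q) = (\<beta> - \<alpha>) * totient q" using q by (simp add: field_simps)
      finally have "2 * \<epsilon> / real q * \<bar>real (card (T q)) - (\<beta> - \<alpha>) * totient q\<bar> \<le> 2 * \<epsilon> / real q * (4 * sqrt q)"
        using e by (intro mult_left_mono) auto
      also have "\<dots> = 8 * \<epsilon> * (sqrt q / q)" by simp
      also have "sqrt q / q = 1 / sqrt q" using real_div_sqrt[of "real q"] q by (simp add: field_simps)
      finally show "\<bar>2 * \<epsilon> / real q * (real (card (T q)) - (\<beta> - \<alpha>) * totient q)\<bar> \<le> 8 * \<epsilon> * (1 / sqrt q)"
        using e by (simp add: abs_mult)
    qed
    also have "\<dots> = 8 * \<epsilon> * (\<Sum>q=1..?n. 1 / sqrt q)" by (rule sum_distrib_left[symmetric])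
    also have "\<dots> \<le> 8 * \<epsilon> * (2 * sqrt ?n)" using e sum_inverse_sqrt_le by (intro mult_left_mono) auto
    also have "\<dots> \<le> 8 * \<epsilon> * (2 * sqrt U)"
    proof -
      have "real ?n \<le> U" using U by (intro of_nat_floor) auto
      then show ?thesis using e by (intro mult_left_mono) auto
    qed
    finally show ?thesis by simp
  qed
  then show ?thesis unfolding mJ Qsum using Vsum by linarith
qed

text \<open>The length of the overlap of a Farey pair is \<open>\<epsilon>\<^sup>2\<close> times this kernel at \<open>(\<epsilon> * a, \<epsilon> * b)\<close>.\<close>

definition pair_kernel :: "real \<times> real \<Rightarrow> real" where
  "pair_kernel = (\<lambda>(x, y). max 0 (x + y - 1) / (x * y))"

text \<open>The kernel vanishes unless both arguments exceed \<open>1 - u\<close>; in this form it is visibly continuous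
up to the axes.\<close>

lemma pair_kernel_alt:
  assumes "u < 1" "x \<le> u" "y \<le> u"
  shows "pair_kernel (x, y) = max 0 (x + y - 1) / (max x (1 - u) * max y (1 - u))"
proof (cases "x + y \<le> 1")
  case False
  then have "max x (1 - u) = x" "max y (1 - u) = y" using assms by auto
  then show ?thesis unfolding pair_kernel_def by simp
qed (auto simp: pair_kernel_def)

lemma continuous_pair_kernel:
  assumes "u < 1" shows "continuous_on ({0..u} \<times> {0..u}) pair_kernel"
proof -
  have "continuous_on ({0..u} \<times> {0..u}) (\<lambda>z. max 0 (fst z + snd z - 1) / (max (fst z) (1 - u) * max (snd z) (1 - u)))"
    using assms by (intro continuous_intros) auto
  moreover have "max 0 (fst z + snd z - 1) / (max (fst z) (1 - u) * max (snd z) (1 - u)) = pair_kernel z" if "z \<in> {0..u} \<times> {0..u}" for z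
    using pair_kernel_alt[OF assms, of "fst z" "snd z"] that by (auto simp: mem_Times_iff)
  ultimately show ?thesis by (simp cong: continuous_on_cong)
qed

definition kernel_mass :: "real \<Rightarrow> real" where
  "kernel_mass u = (LINT z:{0<..u} \<times> {0<..u}|(lborel \<Otimes>\<^sub>M lborel). pair_kernel z)"

lemma finite_measure_scaled_box:
  fixes c :: real assumes "0 \<le> c"
  defines "\<nu> \<equiv> density (lborel \<Otimes>\<^sub>M lborel) (\<lambda>z::real \<times> real. ennreal (c * indicator ({0..1} \<times> {0..1}) z))"
  shows "finite_measure \<nu>" "sets \<nu> = sets borel"
    and "\<And>y z. y \<in> {0..1} \<Longrightarrow> z \<in> {0..1} \<Longrightarrow> measure \<nu> ({0<..y} \<times> {0<..z}) = c * y * z"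
    and "\<And>f u. 0 \<le> u \<Longrightarrow> u \<le> 1 \<Longrightarrow> f \<in> borel_measurable borel \<Longrightarrow> (LINT x:{0<..u} \<times> {0<..u}|\<nu>. f x) = c * (LINT x:{0<..u} \<times> {0<..u}|(lborel \<Otimes>\<^sub>M lborel). f x)"
proof -
  have S: "A \<times> B \<in> sets borel" if "A \<in> sets borel" "B \<in> sets borel" for A B :: "real set"
    using that by (rule borel_Times)
  have S': "A \<times> B \<in> sets (lborel \<Otimes>\<^sub>M lborel)" if "A \<in> sets borel" "B \<in> sets borel" for A B :: "real set"
    using that by auto
  show sets: "sets \<nu> = sets borel" unfolding \<nu>_def by (simp add: lborel_prod)
  have em: "emeasure \<nu> (A \<times> B) = ennreal c * (emeasure lborel A * emeasure lborel B)"
    if "A \<in> sets borel" "B \<in> sets borel" "A \<subseteq> {0..1}" "B \<subseteq> {0..1}" for A B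
  proof -
    have "emeasure \<nu> (A \<times> B) = (\<integral>\<^sup>+z. ennreal (c * indicator ({0..1} \<times> {0..1}) z) * indicator (A \<times> B) z \<partial>(lborel \<Otimes>\<^sub>M lborel))"
      unfolding \<nu>_def using S' that by (intro emeasure_density) auto
    also have "\<dots> = (\<integral>\<^sup>+z. ennreal c * indicator (A \<times> B) z \<partial>(lborel \<Otimes>\<^sub>M lborel))"
      using that by (intro nn_integral_cong) (auto simp: indicator_def)
    also have "\<dots> = ennreal c * emeasure (lborel \<Otimes>\<^sub>M lborel) (A \<times> B)"
      using S' that by (intro nn_integral_cmult_indicator) auto
    also have "emeasure (lborel \<Otimes>\<^sub>M lborel) (A \<times> B) = emeasure lborel A * emeasure lborel B"
      using that by (intro lborel.emeasure_pair_measure_Times) auto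
    finally show ?thesis .
  qed
  show "measure \<nu> ({0<..y} \<times> {0<..z}) = c * y * z" if "y \<in> {0..1}" "z \<in> {0..1}" for y z
  proof -
    have "{0<..y} \<subseteq> {0..1}" "{0<..z} \<subseteq> {0..1}" using that by auto
    then have "emeasure \<nu> ({0<..y} \<times> {0<..z}) = ennreal c * (emeasure lborel {0<..y} * emeasure lborel {0<..z})"
      by (intro em) auto
    then show ?thesis using that assms(1) by (simp add: measure_def enn2real_mult)
  qed
  show "finite_measure \<nu>"
  proof (rule finite_measureI)
    have "emeasure \<nu> (space \<nu>) = (\<integral>\<^sup>+z. ennreal (c * indicator ({0..1::real} \<times> {0..1::real}) z) * indicator (space (lborel \<Otimes>\<^sub>M lborel)) z \<partial>(lborel \<Otimes>\<^sub>M lborel))"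
      unfolding \<nu>_def space_density by (rule emeasure_density[OF _ sets.top]) measurable
    also have "\<dots> = (\<integral>\<^sup>+z. ennreal (c * indicator ({0..1::real} \<times> {0..1::real}) z) \<partial>(lborel \<Otimes>\<^sub>M lborel))"
      by (intro nn_integral_cong) simp
    also have "\<dots> = (\<integral>\<^sup>+z. ennreal c * indicator ({0..1::real} \<times> {0..1::real}) z \<partial>(lborel \<Otimes>\<^sub>M lborel))"
      by (intro nn_integral_cong) (auto simp: indicator_def)
    also have "\<dots> = ennreal c * emeasure (lborel \<Otimes>\<^sub>M lborel) ({0..1::real} \<times> {0..1::real})"
      by (intro nn_integral_cmult_indicator) auto
    also have "emeasure (lborel \<Otimes>\<^sub>M lborel) ({0..1::real} \<times> {0..1::real}) = emeasure lborel {0..1::real} * emeasure lborel {0..1::real}"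
      by (intro lborel.emeasure_pair_measure_Times) auto
    finally show "emeasure \<nu> (space \<nu>) \<noteq> \<infinity>" by simp
  qed
  fix f :: "real \<times> real \<Rightarrow> real" and u :: real assume f: "f \<in> borel_measurable borel" and u: "0 \<le> u" "u \<le> 1"
  have [measurable]: "f \<in> borel_measurable (lborel \<Otimes>\<^sub>M lborel)" using f by (simp add: lborel_prod)
  have [measurable]: "({0<..u} \<times> {0<..u}) \<in> sets (lborel \<Otimes>\<^sub>M lborel)" "({0..1::real} \<times> {0..1::real}) \<in> sets (lborel \<Otimes>\<^sub>M lborel)" by auto
  have "(LINT x:{0<..u} \<times> {0<..u}|\<nu>. f x) = (\<integral>x. (c * indicator ({0..1} \<times> {0..1}) x) *\<^sub>R (indicator ({0<..u} \<times> {0<..u}) x *\<^sub>R f x) \<partial>(lborel \<Otimes>\<^sub>M lborel))"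
    unfolding \<nu>_def set_lebesgue_integral_def using assms by (intro integral_density) (auto intro!: AE_I2)
  also have "\<dots> = (\<integral>x. c * (indicator ({0<..u} \<times> {0<..u}) x *\<^sub>R f x) \<partial>(lborel \<Otimes>\<^sub>M lborel))"
    using u by (intro Bochner_Integration.integral_cong) (auto simp: indicator_def)
  finally show "(LINT x:{0<..u} \<times> {0<..u}|\<nu>. f x) = c * (LINT x:{0<..u} \<times> {0<..u}|(lborel \<Otimes>\<^sub>M lborel). f x)"
    unfolding set_lebesgue_integral_def by simp
qed

lemma pair_kernel_measurable: "pair_kernel \<in> borel_measurable borel"
  unfolding pair_kernel_def borel_prod[symmetric] by measurable

text \<open>The Farey pairs, scaled by \<open>1 / L\<close> and with mass \<open>1 / L\<^sup>2\<close> each, converge on rectangles to a multiple of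
Lebesgue measure by \<open>farey_pairs_equidistributed\<close>. The sum is an integral of the continuous
kernel against these point masses.\<close>

lemma pair_sum_limit:
  assumes r: "rat_interval \<alpha> \<beta> d" and u: "0 < u" "u < 1"
  shows "((\<lambda>L. (\<Sum>(a, b) \<in> {(a, b) \<in> coprime_box (u * L) (u * L). farey_in \<alpha> \<beta> a b}. pair_kernel (of_int a / L, of_int b / L)) / L\<^sup>2)
     \<longlongrightarrow> (\<beta> - \<alpha>) * (6 / pi\<^sup>2) * kernel_mass u) at_top"
proof -
  define c where "c = (\<beta> - \<alpha>) * (6 / pi\<^sup>2)"
  have c: "0 \<le> c" using r unfolding c_def rat_interval_def by auto
  define W where "W L = {(a, b) \<in> coprime_box (u * L) (u * L). farey_in \<alpha> \<beta> a b}" for L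
  define P where "P L = point_measure (W L) (\<lambda>_. ennreal (1 / L\<^sup>2))" for L :: real
  define s where "s L = (\<lambda>z::int \<times> int. (of_int (fst z) / L, of_int (snd z) / L))" for L :: real
  define \<mu> where "\<mu> L = distr (P L) borel (s L)" for L
  define \<nu> where "\<nu> = density (lborel \<Otimes>\<^sub>M lborel) (\<lambda>z::real \<times> real. ennreal (c * indicator ({0..1} \<times> {0..1}) z))"
  note \<nu> = finite_measure_scaled_box[OF c, folded \<nu>_def]
  have finW: "finite (W L)" for L
    unfolding W_def by (rule finite_subset[OF _ finite_coprime_box[of "u * L" "u * L"]]) auto
  have meas: "s L \<in> measurable (P L) borel" for L unfolding P_def by simp
  have fP: "finite_measure (P L)" for L
  proof (rule finite_measureI)
    show "emeasure (P L) (space (P L)) \<noteq> \<infinity>"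
      unfolding P_def using finW by (subst emeasure_point_measure_finite) (auto simp: space_point_measure ennreal_mult_eq_top_iff)
  qed
  have f\<mu>: "finite_measure (\<mu> L)" for L unfolding \<mu>_def using fP meas by (rule finite_measure.finite_measure_distr)
  have s\<mu>: "sets (\<mu> L) = sets borel" for L unfolding \<mu>_def by simp
  have int: "(\<integral>x. f x \<partial>\<mu> L) = (\<Sum>z\<in>W L. f (s L z)) / L\<^sup>2" if "f \<in> borel_measurable borel" for f :: "real \<times> real \<Rightarrow> real" and L
  proof -
    have "(\<integral>x. f x \<partial>\<mu> L) = (\<integral>z. f (s L z) \<partial>P L)" unfolding \<mu>_def using meas that by (rule integral_distr)
    also have "\<dots> = (\<Sum>z\<in>W L. (1 / L\<^sup>2) * f (s L z))" unfolding P_def using finW by (subst lebesgue_integral_point_measure_finite) auto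
    finally show ?thesis by (simp add: sum_divide_distrib)
  qed
  have "((\<lambda>L. LINT x:{0<..u} \<times> {0<..u}|\<mu> L. pair_kernel x) \<longlongrightarrow> (LINT x:{0<..u} \<times> {0<..u}|\<nu>. pair_kernel x)) at_top"
  proof (rule rectangle_weak_convergence[OF f\<mu> s\<mu> \<nu>(1,2) u(1) u(1) _ continuous_pair_kernel[OF u(2)]])
    fix y z assume yz: "y \<in> {0..u}" "z \<in> {0..u}"
    have "eventually (\<lambda>L. card {(a, b) \<in> coprime_box (y * L) (z * L). farey_in \<alpha> \<beta> a b} / L\<^sup>2 = measure (\<mu> L) ({0<..y} \<times> {0<..z})) at_top"
      using eventually_gt_at_top[of 0]
    proof eventually_elim
      case (elim L)
      have B: "{0<..y} \<times> {0<..z} \<in> sets borel" by (intro borel_Times) auto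
      have "measure (\<mu> L) ({0<..y} \<times> {0<..z}) = (\<integral>x. indicator ({0<..y} \<times> {0<..z}) x \<partial>\<mu> L)" using B s\<mu> by (simp add: \<mu>_def)
      also have "\<dots> = (\<Sum>v\<in>W L. indicator ({0<..y} \<times> {0<..z}) (s L v)) / L\<^sup>2" using B by (intro int) auto
      also have "(\<Sum>v\<in>W L. indicator ({0<..y} \<times> {0<..z}) (s L v)) = real (card {v\<in>W L. s L v \<in> {0<..y} \<times> {0<..z}})"
        unfolding indicator_def of_bool_def using finW by (simp add: sum.If_cases Int_def)
      also have "{v\<in>W L. s L v \<in> {0<..y} \<times> {0<..z}} = {(a, b) \<in> coprime_box (y * L) (z * L). farey_in \<alpha> \<beta> a b}"
      proof -
        have "y * L \<le> u * L" "z * L \<le> u * L" using yz elim by (auto intro: mult_right_mono)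
        then have le: "a \<le> u * L" if "a \<le> y * L \<or> a \<le> z * L" for a using that by linarith
        show ?thesis unfolding W_def s_def coprime_box_def using elim by (auto simp: pos_divide_le_eq intro: le)
      qed
      finally show ?case by simp
    qed
    moreover have "((\<lambda>L. card {(a, b) \<in> coprime_box (y * L) (z * L). farey_in \<alpha> \<beta> a b} / L\<^sup>2) \<longlongrightarrow> measure \<nu> ({0<..y} \<times> {0<..z})) at_top"
      using farey_pairs_equidistributed[OF r, of y z] \<nu>(3)[of y z] yz u unfolding c_def by (simp add: mult_ac)
    ultimately show "((\<lambda>L. measure (\<mu> L) ({0<..y} \<times> {0<..z})) \<longlongrightarrow> measure \<nu> ({0<..y} \<times> {0<..z})) at_top"
      by (rule Lim_transform_eventually[rotated])
  qed
  also have "(LINT x:{0<..u} \<times> {0<..u}|\<nu>. pair_kernel x) = c * kernel_mass u"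
    unfolding kernel_mass_def using u by (intro \<nu>(4) pair_kernel_measurable) auto
  finally have lim: "((\<lambda>L. LINT x:{0<..u} \<times> {0<..u}|\<mu> L. pair_kernel x) \<longlongrightarrow> c * kernel_mass u) at_top" .
  have "eventually (\<lambda>L. (LINT x:{0<..u} \<times> {0<..u}|\<mu> L. pair_kernel x) = (\<Sum>(a, b) \<in> W L. pair_kernel (of_int a / L, of_int b / L)) / L\<^sup>2) at_top"
    using eventually_gt_at_top[of 0]
  proof eventually_elim
    case (elim L)
    have "(\<lambda>x. indicator ({0<..u} \<times> {0<..u}) x *\<^sub>R pair_kernel x) \<in> borel_measurable borel"
      using pair_kernel_measurable by (intro borel_measurable_scaleR borel_measurable_indicator borel_Times) auto
    then have "(LINT x:{0<..u} \<times> {0<..u}|\<mu> L. pair_kernel x) = (\<Sum>z\<in>W L. indicator ({0<..u} \<times> {0<..u}) (s L z) *\<^sub>R pair_kernel (s L z)) / L\<^sup>2"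
      unfolding set_lebesgue_integral_def by (rule int)
    also have "(\<Sum>z\<in>W L. indicator ({0<..u} \<times> {0<..u}) (s L z) *\<^sub>R pair_kernel (s L z)) = (\<Sum>(a, b) \<in> W L. pair_kernel (of_int a / L, of_int b / L))"
      using elim by (intro sum.cong) (auto simp: W_def coprime_box_def s_def indicator_def pos_divide_le_eq)
    finally show ?case .
  qed
  from Lim_transform_eventually[OF lim this] show ?thesis unfolding W_def c_def .
qed

theorem near_rational_limit_rational:
  assumes r: "rat_interval \<alpha> \<beta> d" and u: "0 < u" "u < 1"
  shows "((\<lambda>L. measure lborel ({\<alpha><..<\<beta>} \<inter> near_rational (1 / L) (u * L))) \<longlongrightarrow> (\<beta> - \<alpha>) * (12 / pi\<^sup>2 * u - 6 / pi\<^sup>2 * kernel_mass u)) at_top"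
proof -
  define A where "A L = 2 * (\<beta> - \<alpha>) * ((\<Sum>q=1..nat \<lfloor>u * L\<rfloor>. totient q / real q) / L)
     - (\<Sum>(a, b) \<in> {(a, b) \<in> coprime_box (u * L) (u * L). farey_in \<alpha> \<beta> a b}. pair_kernel (of_int a / L, of_int b / L)) / L\<^sup>2" for L
  have "(A \<longlongrightarrow> 2 * (\<beta> - \<alpha>) * (6 / pi\<^sup>2 * u) - (\<beta> - \<alpha>) * (6 / pi\<^sup>2) * kernel_mass u) at_top"
    unfolding A_def by (intro tendsto_diff tendsto_mult tendsto_const totient_sum_scaled pair_sum_limit[OF r u]) (use u in simp)
  then have lim: "(A \<longlongrightarrow> (\<beta> - \<alpha>) * (12 / pi\<^sup>2 * u - 6 / pi\<^sup>2 * kernel_mass u)) at_top" by (simp add: algebra_simps)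
  have bnd: "eventually (\<lambda>L. norm (measure lborel ({\<alpha><..<\<beta>} \<inter> near_rational (1 / L) (u * L)) - A L) \<le> 4 / L + 16 * sqrt (u * L) / L) at_top"
    using eventually_gt_at_top[of "real_of_int d"] eventually_ge_at_top[of 1]
  proof eventually_elim
    case (elim L)
    have L: "0 < L" using elim by simp
    have "max 0 (1 / L * (of_int a + of_int b) - 1) / (of_int a * of_int b) = pair_kernel (of_int a / L, of_int b / L) / L\<^sup>2" for a b :: int
    proof -
      have "1 / L * (of_int a + of_int b) - 1 = of_int a / L + of_int b / L - 1" by (simp add: add_divide_distrib)
      then show ?thesis unfolding pair_kernel_def using L by (simp add: power2_eq_square)
    qed
    then have "(\<Sum>(a, b) \<in> {(a, b) \<in> coprime_box (u * L) (u * L). farey_in \<alpha> \<beta> a b}. max 0 (1 / L * (of_int a + of_int b) - 1) / (of_int a * of_int b))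
       = (\<Sum>(a, b) \<in> {(a, b) \<in> coprime_box (u * L) (u * L). farey_in \<alpha> \<beta> a b}. pair_kernel (of_int a / L, of_int b / L)) / L\<^sup>2"
      by (simp add: sum_divide_distrib case_prod_unfold)
    then have "2 * (1 / L) * (\<beta> - \<alpha>) * (\<Sum>q=1..nat \<lfloor>u * L\<rfloor>. totient q / real q)
      - (\<Sum>(a, b) \<in> {(a, b) \<in> coprime_box (u * L) (u * L). farey_in \<alpha> \<beta> a b}. max 0 (1 / L * (of_int a + of_int b) - 1) / (of_int a * of_int b)) = A L"
      unfolding A_def by simp
    then show ?case using near_rational_measure_formula[OF r, of "1 / L" "u * L"] elim L u by (simp add: field_simps)
  qed
  have "((\<lambda>L. 4 / L + 16 * sqrt (u * L) / L) \<longlongrightarrow> 0) at_top" using u by real_asymp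
  then have "((\<lambda>L. measure lborel ({\<alpha><..<\<beta>} \<inter> near_rational (1 / L) (u * L)) - A L) \<longlongrightarrow> 0) at_top"
    by (rule Lim_null_comparison[OF bnd])
  from tendsto_add[OF this lim] show ?thesis by simp
qed

section \<open>The limit distribution\<close>

lemma set_integrable_bounded:
  fixes f :: "'a \<Rightarrow> real"
  assumes "S \<in> sets M" "emeasure M S < \<infinity>" "f \<in> borel_measurable M" "\<And>x. x \<in> S \<Longrightarrow> \<bar>f x\<bar> \<le> B"
  shows "set_integrable M S f"
proof (rule set_integrable_bound[of M S "\<lambda>_. \<bar>B\<bar>"])
  show "set_integrable M S (\<lambda>_. \<bar>B\<bar>)" using assms by (simp add: set_integrable_def)
  show "set_borel_measurable M S f" using assms unfolding set_borel_measurable_def by measurable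
  show "AE x in M. x \<in> S \<longrightarrow> norm (f x) \<le> norm \<bar>B\<bar>" using assms(4) by (intro AE_I2) force
qed

lemma bounded_borel_fmeasurable:
  fixes A :: "real set"
  assumes "A \<in> sets borel" "A \<subseteq> {a..b}" shows "A \<in> fmeasurable lborel"
proof (rule fmeasurableI2[OF _ assms(2)])
  show "{a..b} \<in> fmeasurable lborel" by (auto simp: fmeasurable_def emeasure_lborel_Icc_eq)
qed (use assms in simp)

text \<open>The integral of \<open>pair_kernel\<close> over a slice, see \<open>kernel_slice\<close>. At \<open>y = 1\<close> the factor \<open>1 - y\<close>
removes the default value of \<open>ln 0\<close>.\<close>

definition gap_kernel :: "real \<Rightarrow> real" where
  "gap_kernel y = (if y \<le> 1 / 2 then 0 else (2 * y - 1) / y - (1 - y) / y * (ln y - ln (1 - y)))"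

definition limit_density :: "real \<Rightarrow> real" where
  "limit_density y = 12 / pi\<^sup>2 * (1 - gap_kernel y)"

lemma gap_kernel_measurable [measurable]: "gap_kernel \<in> borel_measurable borel"
  unfolding gap_kernel_def by measurable

lemma limit_density_measurable [measurable]: "limit_density \<in> borel_measurable borel"
  unfolding limit_density_def by measurable

lemma kernel_slice:
  assumes y: "0 < y" "y < 1"
  shows "(LBINT x:{0<..y}. pair_kernel (x, y)) = gap_kernel y"
proof (cases "y \<le> 1 / 2")
  case True
  have "(LBINT x:{0<..y}. pair_kernel (x, y)) = (LBINT x:{0<..y}. 0)"
    using True by (intro set_lebesgue_integral_cong) (auto simp: pair_kernel_def)
  then show ?thesis using True by (simp add: gap_kernel_def)
next
  case False
  have "(LBINT x:{0<..y}. pair_kernel (x, y)) = (\<integral>x. indicator {1 - y..y} x *\<^sub>R ((x + y - 1) / (x * y)) \<partial>lborel)"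
    unfolding set_lebesgue_integral_def using y False
    by (intro Bochner_Integration.integral_cong) (auto simp: pair_kernel_def indicator_def)
  also have "\<dots> = (y - (1 - y) * ln y) / y - ((1 - y) - (1 - y) * ln (1 - y)) / y"
  proof (rule integral_FTC_atLeastAtMost)
    show "1 - y \<le> y" using False by simp
    fix x assume x: "1 - y \<le> x" "x \<le> y"
    have x0: "0 < x" using x y by simp
    have "((\<lambda>x. (x - (1 - y) * ln x) / y) has_real_derivative ((1 - (1 - y) * (1 / x)) / y)) (at x within {1 - y..y})"
      using x0 y by (auto intro!: derivative_eq_intros simp: field_simps)
    moreover have "(1 - (1 - y) * (1 / x)) / y = (x + y - 1) / (x * y)" using x0 y by (simp add: field_simps)
    ultimately show "((\<lambda>x. (x - (1 - y) * ln x) / y) has_vector_derivative (x + y - 1) / (x * y)) (at x within {1 - y..y})"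
      by (simp add: has_real_derivative_iff_has_vector_derivative)
  next
    show "continuous_on {1 - y..y} (\<lambda>x. (x + y - 1) / (x * y))" using y by (intro continuous_intros) auto
  qed
  also have "\<dots> = gap_kernel y" using False y unfolding gap_kernel_def by (simp add: field_simps)
  finally show ?thesis .
qed

lemma gap_kernel_bounds:
  assumes "0 < y" "y \<le> 1" shows "0 \<le> gap_kernel y" "gap_kernel y \<le> 1"
proof -
  show "gap_kernel y \<le> 1"
  proof (cases "y \<le> 1 / 2 \<or> y = 1")
    case False
    then have "ln (1 - y) \<le> ln y" using assms by simp
    then have "0 \<le> (1 - y) / y * (ln y - ln (1 - y))" using assms by (intro mult_nonneg_nonneg) auto
    moreover have "(2 * y - 1) / y \<le> 1" using assms by (simp add: field_simps)
    ultimately show ?thesis unfolding gap_kernel_def by auto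
  qed (auto simp: gap_kernel_def)
  show "0 \<le> gap_kernel y"
  proof (cases "y = 1")
    case False
    then have "0 \<le> (LBINT x:{0<..y}. pair_kernel (x, y))" using assms
      unfolding set_lebesgue_integral_def by (intro integral_nonneg_AE AE_I2) (auto simp: indicator_def pair_kernel_def)
    then show ?thesis using kernel_slice[of y] assms False by simp
  qed (simp add: gap_kernel_def)
qed

lemma limit_density_bounds:
  assumes "0 < y" "y \<le> 1" shows "0 \<le> limit_density y" "limit_density y \<le> 12 / pi\<^sup>2"
  using gap_kernel_bounds[OF assms] unfolding limit_density_def by (auto simp: field_simps)

lemma set_integrable_gap_kernel:
  assumes "S \<in> sets borel" "S \<subseteq> {0<..1}" shows "set_integrable lborel S gap_kernel"
proof (rule set_integrable_bounded[of _ _ _ 1])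
  have "emeasure lborel S \<le> emeasure lborel {0<..1::real}" using assms by (intro emeasure_mono) auto
  then show "emeasure lborel S < \<infinity>" by (simp add: order.strict_trans1)
  show "\<And>x. x \<in> S \<Longrightarrow> \<bar>gap_kernel x\<bar> \<le> 1" using assms gap_kernel_bounds by (force simp: abs_le_iff)
qed (use assms in auto)

lemma set_integrable_limit_density:
  assumes "S \<in> sets borel" "S \<subseteq> {0<..1}" shows "set_integrable lborel S limit_density"
proof (rule set_integrable_bounded[of _ _ _ "12 / pi\<^sup>2"])
  have "emeasure lborel S \<le> emeasure lborel {0<..1::real}" using assms by (intro emeasure_mono) auto
  then show "emeasure lborel S < \<infinity>" by (simp add: order.strict_trans1)
  fix x assume "x \<in> S"
  then have "0 < x" "x \<le> 1" using assms by auto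
  from limit_density_bounds[OF this] show "\<bar>limit_density x\<bar> \<le> 12 / pi\<^sup>2" by simp
qed (use assms in auto)

text \<open>The kernel is symmetric, so each of the two triangles of the square contributes the same.\<close>

lemma kernel_mass_eq:
  assumes u: "0 < u" "u < 1"
  shows "kernel_mass u = 2 * (LBINT y:{0<..u}. gap_kernel y)"
proof -
  define f where "f z = indicator ({0<..u} \<times> {0<..u}) z *\<^sub>R pair_kernel z" for z :: "real \<times> real"
  define f1 where "f1 z = (if fst z \<le> snd z then f z else 0)" for z
  define f2 where "f2 z = (if snd z < fst z then f z else 0)" for z
  have [measurable]: "pair_kernel \<in> borel_measurable (lborel \<Otimes>\<^sub>M lborel)"
    using pair_kernel_measurable by (simp add: lborel_prod)
  have B: "({0<..u} \<times> {0<..u}) \<in> sets (lborel \<Otimes>\<^sub>M lborel)" by auto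
  have f: "integrable (lborel \<Otimes>\<^sub>M lborel) f"
  proof -
    have "emeasure (lborel \<Otimes>\<^sub>M lborel) ({0<..u} \<times> {0<..u}) = emeasure lborel {0<..u} * emeasure lborel {0<..u}"
      by (intro lborel.emeasure_pair_measure_Times) auto
    then have "emeasure (lborel \<Otimes>\<^sub>M lborel) ({0<..u} \<times> {0<..u}) < \<infinity>" using u by (simp add: ennreal_mult_less_top)
    moreover have "\<bar>pair_kernel z\<bar> \<le> 1 / ((1 - u) * (1 - u))" if z: "z \<in> {0<..u} \<times> {0<..u}" for z
    proof -
      obtain x y where xy: "z = (x, y)" by (cases z)
      have "pair_kernel z = max 0 (x + y - 1) / (max x (1 - u) * max y (1 - u))"
        unfolding xy using z xy u by (intro pair_kernel_alt) auto
      moreover have "max 0 (x + y - 1) / (max x (1 - u) * max y (1 - u)) \<le> 1 / ((1 - u) * (1 - u))"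
        using z u unfolding xy by (intro frac_le mult_mono mult_pos_pos) auto
      moreover have "0 \<le> max 0 (x + y - 1) / (max x (1 - u) * max y (1 - u))" using u by (intro divide_nonneg_nonneg mult_nonneg_nonneg) auto
      ultimately show ?thesis by linarith
    qed
    ultimately have "set_integrable (lborel \<Otimes>\<^sub>M lborel) ({0<..u} \<times> {0<..u}) pair_kernel"
      using B by (intro set_integrable_bounded[of _ _ _ "1 / ((1 - u) * (1 - u))"]) auto
    then show ?thesis unfolding set_integrable_def f_def .
  qed
  have fm[measurable]: "f \<in> borel_measurable (lborel \<Otimes>\<^sub>M lborel)" using f by auto
  have [measurable]: "f1 \<in> borel_measurable (lborel \<Otimes>\<^sub>M lborel)" "f2 \<in> borel_measurable (lborel \<Otimes>\<^sub>M lborel)"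
    unfolding f1_def f2_def by measurable
  have f1: "integrable (lborel \<Otimes>\<^sub>M lborel) f1"
    by (rule Bochner_Integration.integrable_bound[OF f]) (auto simp: f1_def)
  have f2: "integrable (lborel \<Otimes>\<^sub>M lborel) f2"
    by (rule Bochner_Integration.integrable_bound[OF f]) (auto simp: f2_def)
  have "kernel_mass u = integral\<^sup>L (lborel \<Otimes>\<^sub>M lborel) f" unfolding kernel_mass_def set_lebesgue_integral_def f_def ..
  also have "\<dots> = (\<integral>z. f1 z + f2 z \<partial>(lborel \<Otimes>\<^sub>M lborel))" by (intro Bochner_Integration.integral_cong) (auto simp: f1_def f2_def)
  also have "\<dots> = integral\<^sup>L (lborel \<Otimes>\<^sub>M lborel) f1 + integral\<^sup>L (lborel \<Otimes>\<^sub>M lborel) f2"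
    using f1 f2 by (rule Bochner_Integration.integral_add)
  also have "integral\<^sup>L (lborel \<Otimes>\<^sub>M lborel) f1 = (\<integral>y. (\<integral>x. f1 (x, y) \<partial>lborel) \<partial>lborel)"
    using lborel_pair.integral_snd[of "\<lambda>x y. f1 (x, y)"] f1 by (simp add: case_prod_unfold)
  also have "(\<lambda>y. \<integral>x. f1 (x, y) \<partial>lborel) = (\<lambda>y. indicator {0<..u} y *\<^sub>R gap_kernel y)"
  proof
    fix y
    show "(\<integral>x. f1 (x, y) \<partial>lborel) = indicator {0<..u} y *\<^sub>R gap_kernel y"
    proof (cases "y \<in> {0<..u}")
      case True
      have "(\<integral>x. f1 (x, y) \<partial>lborel) = (\<integral>x. indicator {0<..y} x *\<^sub>R pair_kernel (x, y) \<partial>lborel)"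
        using True by (intro Bochner_Integration.integral_cong) (auto simp: f1_def f_def indicator_def)
      then show ?thesis using kernel_slice[of y] True u unfolding set_lebesgue_integral_def by simp
    next
      case False
      then have "(\<lambda>x. f1 (x, y)) = (\<lambda>x. 0)" by (auto simp: f1_def f_def indicator_def fun_eq_iff)
      then show ?thesis using False by simp
    qed
  qed
  also have "integral\<^sup>L (lborel \<Otimes>\<^sub>M lborel) f2 = (\<integral>x. (\<integral>y. f2 (x, y) \<partial>lborel) \<partial>lborel)"
    using lborel_pair.integral_fst[of "\<lambda>x y. f2 (x, y)"] f2 by (simp add: case_prod_unfold)
  also have "(\<lambda>x. \<integral>y. f2 (x, y) \<partial>lborel) = (\<lambda>x. indicator {0<..u} x *\<^sub>R gap_kernel x)"
  proof
    fix x
    show "(\<integral>y. f2 (x, y) \<partial>lborel) = indicator {0<..u} x *\<^sub>R gap_kernel x"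
    proof (cases "x \<in> {0<..u}")
      case True
      have [measurable]: "(\<lambda>y. pair_kernel (y, x)) \<in> borel_measurable lborel" unfolding pair_kernel_def prod.case by measurable
      have "(\<integral>y. f2 (x, y) \<partial>lborel) = (\<integral>y. indicator {0<..<x} y *\<^sub>R pair_kernel (y, x) \<partial>lborel)"
        using True by (intro Bochner_Integration.integral_cong) (auto simp: f2_def f_def indicator_def pair_kernel_def add.commute mult.commute)
      also have "\<dots> = (\<integral>y. indicator {0<..x} y *\<^sub>R pair_kernel (y, x) \<partial>lborel)"
      proof (rule integral_cong_AE)
        show "AE y in lborel. indicator {0<..<x} y *\<^sub>R pair_kernel (y, x) = indicator {0<..x} y *\<^sub>R pair_kernel (y, x)"
          using AE_lborel_singleton[of x] by eventually_elim (auto simp: indicator_def)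
      qed measurable
      finally show ?thesis using kernel_slice[of x] True u unfolding set_lebesgue_integral_def by simp
    next
      case False
      then have "(\<lambda>y. f2 (x, y)) = (\<lambda>y. 0)" by (auto simp: f2_def f_def indicator_def fun_eq_iff)
      then show ?thesis using False by simp
    qed
  qed
  finally show ?thesis unfolding set_lebesgue_integral_def by simp
qed

text \<open>The limit, for \<open>t\<close> uniformly distributed on any subinterval of the unit interval, of the
probability that \<open>\<epsilon>\<close> times the least denominator is at most \<open>u\<close>.\<close>

definition limit_cdf :: "real \<Rightarrow> real" where
  "limit_cdf u = (LBINT y:{0<..u}. limit_density y)"

lemma limit_cdf_eq:
  assumes u: "0 < u" "u < 1"
  shows "12 / pi\<^sup>2 * u - 6 / pi\<^sup>2 * kernel_mass u = limit_cdf u"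
proof -
  have "set_integrable lborel {0<..u} gap_kernel" using u by (intro set_integrable_gap_kernel) auto
  moreover have "set_integrable lborel {0<..u} (\<lambda>_. 1::real)" using u by (simp add: set_integrable_def)
  ultimately have "limit_cdf u = 12 / pi\<^sup>2 * ((LBINT y:{0<..u}. 1) - (LBINT y:{0<..u}. gap_kernel y))"
    unfolding limit_cdf_def limit_density_def set_integral_mult_right by (subst set_integral_diff(2)) auto
  also have "(LBINT y:{0<..u}. (1::real)) = u" using u by (simp add: set_lebesgue_integral_def)
  finally show ?thesis unfolding kernel_mass_eq[OF u] by (simp add: right_diff_distrib)
qed

lemma limit_cdf_mono_lipschitz:
  assumes "0 \<le> u" "u \<le> v" "v \<le> 1"
  shows "limit_cdf u \<le> limit_cdf v" "limit_cdf v - limit_cdf u \<le> 12 / pi\<^sup>2 * (v - u)"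
proof -
  have i: "set_integrable lborel {0<..u} limit_density" "set_integrable lborel {u<..v} limit_density"
    using assms by (auto intro!: set_integrable_limit_density)
  have "{0<..v} = {0<..u} \<union> {u<..v}" using assms by auto
  then have eq: "limit_cdf v = limit_cdf u + (LBINT y:{u<..v}. limit_density y)"
    unfolding limit_cdf_def using i by (simp add: set_integral_Un)
  have "0 \<le> (LBINT y:{u<..v}. limit_density y)"
    unfolding set_lebesgue_integral_def using assms limit_density_bounds(1) by (intro integral_nonneg_AE AE_I2) (auto simp: indicator_def)
  then show "limit_cdf u \<le> limit_cdf v" using eq by simp
  have "(LBINT y:{u<..v}. limit_density y) \<le> (LBINT y:{u<..v}. 12 / pi\<^sup>2)"
    using assms by (intro set_integral_mono i limit_density_bounds(2)) (auto simp: set_integrable_def)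
  also have "\<dots> = 12 / pi\<^sup>2 * (v - u)" using assms by (simp add: set_lebesgue_integral_def)
  finally show "limit_cdf v - limit_cdf u \<le> 12 / pi\<^sup>2 * (v - u)" using eq by simp
qed

lemma near_rational_limit_rational_cdf:
  assumes "rat_interval \<alpha> \<beta> d" "0 < u" "u < 1"
  shows "((\<lambda>L. measure lborel ({\<alpha><..<\<beta>} \<inter> near_rational (1 / L) (u * L))) \<longlongrightarrow> (\<beta> - \<alpha>) * limit_cdf u) at_top"
  using near_rational_limit_rational[OF assms] unfolding limit_cdf_eq[OF assms(2,3)] .

text \<open>Dirichlet's theorem with \<open>N = \<lfloor>u * L\<rfloor>\<close> provides some \<open>q \<le> N\<close> with \<open>\<bar>q * t - p\<bar> < 1 / N\<close>. If \<open>t\<close> is not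
covered, this distance also exceeds \<open>1 / L\<close>, which confines \<open>t\<close> to two intervals of length
\<open>(1 / N - 1 / L) / q\<close> near \<open>p / q\<close>. As \<open>N / L\<close> is close to \<open>u\<close>, their total length is small for \<open>u\<close> close
to \<open>1\<close>.\<close>

lemma uncovered_measure_bound:
  assumes u: "0 < u" "u < 1" and L: "1 \<le> u * L"
  shows "1 - measure lborel ({0<..<1} \<inter> near_rational (1 / L) (u * L)) \<le> 4 * (1 - u) + 4 / L"
proof -
  let ?N = "near_rational (1 / L) (u * L)"
  define N where "N = nat \<lfloor>u * L\<rfloor>"
  have L0: "0 < L" using L u by (metis zero_less_mult_pos less_le_trans zero_less_one)
  have N: "1 \<le> N" "real N \<le> u * L" "u * L - 1 \<le> real N" unfolding N_def using L by linarith+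
  have uL: "u * L < L" using u L0 by simp
  have NL: "real N < L" using N uL by simp
  define w where "w = 1 / real N - 1 / L"
  have w: "0 \<le> w" unfolding w_def using N NL L0 by (simp add: field_simps)
  define A where "A = (\<lambda>(q, p). {(of_int p - 1 / real N) / of_int q..(of_int p - 1 / L) / real_of_int q} \<union> {(of_int p + 1 / L) / of_int q..(of_int p + 1 / real N) / real_of_int q})"
  define P where "P = (SIGMA q:{1..int N}. {0..q})"
  have "{0<..<1} - ?N \<subseteq> (\<Union>z\<in>P. A z)"
  proof
    fix t assume t: "t \<in> {0<..<1} - ?N"
    have "0 < N" using N by simp
    from Dirichlet_approx[OF this, of t]
    obtain p q where pq: "0 < q" "q \<le> int N" "\<bar>of_int q * t - of_int p\<bar> < 1 / real N" by blast
    have "of_int q \<le> u * L" using pq(2) N(2) by linarith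
    then have far: "1 / L < \<bar>of_int q * t - of_int p\<bar>"
    proof -
      have "1 \<le> q" using pq(1) by simp
      then have "\<not> \<bar>of_int q * t - of_int p\<bar> \<le> 1 / L"
        using t \<open>of_int q \<le> u * L\<close> unfolding near_rational_def by blast
      then show ?thesis by simp
    qed
    have "0 < of_int q * t" "of_int q * t < of_int q * 1" using t pq by (auto intro!: mult_strict_left_mono)
    moreover have "1 / real N \<le> 1" using N by simp
    ultimately have "0 \<le> p" "p \<le> q" using pq(3) by linarith+
    then have "(q, p) \<in> P" using pq unfolding P_def by auto
    moreover have "t \<in> A (q, p)" using far pq unfolding A_def by (auto simp: field_simps abs_if split: if_splits)
    ultimately show "t \<in> (\<Union>z\<in>P. A z)" by blast
  qed
  then have "measure lborel ({0<..<1} - ?N) \<le> measure lborel (\<Union>z\<in>P. A z)"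
  proof (rule measure_mono_fmeasurable)
    show "{0<..<1} - ?N \<in> sets lborel" using near_rational_borel by auto
    have Icc: "{x..y} \<in> fmeasurable lborel" for x y :: real
      by (auto simp: fmeasurable_def emeasure_lborel_Icc_eq)
    have "A z \<in> fmeasurable lborel" for z
      unfolding A_def case_prod_unfold by (intro fmeasurable.Un Icc)
    moreover have "finite P" unfolding P_def by simp
    ultimately show "(\<Union>z\<in>P. A z) \<in> fmeasurable lborel" by (intro fmeasurable.finite_UN) auto
  qed
  also have "\<dots> \<le> (\<Sum>z\<in>P. measure lborel (A z))"
    by (rule measure_UNION_le) (auto simp: P_def A_def)
  also have "\<dots> \<le> (\<Sum>(q, p)\<in>P. 2 * w / of_int q)"
  proof (rule sum_mono)
    fix z assume z: "z \<in> P"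
    obtain q p where qp: "z = (q, p)" by (cases z)
    have q: "0 < real_of_int q" using z unfolding qp P_def by auto
    have len: "measure lborel {a..b} = max 0 (b - a)" for a b :: real by (auto simp: max_def)
    have "(of_int p - 1 / L) / of_int q - (of_int p - 1 / real N) / of_int q = w / of_int q"
      "(of_int p + 1 / real N) / of_int q - (of_int p + 1 / L) / of_int q = w / of_int q"
      unfolding w_def diff_divide_distrib[symmetric] by (auto simp: algebra_simps)
    moreover have "0 \<le> w / of_int q" using w q by simp
    moreover have "measure lborel (A z) \<le> measure lborel {(of_int p - 1 / real N) / of_int q..(of_int p - 1 / L) / real_of_int q} + measure lborel {(of_int p + 1 / L) / of_int q..(of_int p + 1 / real N) / real_of_int q}"
      unfolding A_def qp prod.case by (rule measure_Un_le) auto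
    ultimately show "measure lborel (A z) \<le> (case z of (q, p) \<Rightarrow> 2 * w / of_int q)" unfolding len qp by simp
  qed
  also have "\<dots> = (\<Sum>q\<in>{1..int N}. \<Sum>p\<in>{0..q}. 2 * w / of_int q)" unfolding P_def by (rule sum.Sigma[symmetric]) auto
  also have "\<dots> \<le> (\<Sum>q\<in>{1..int N}. 4 * w)"
  proof (rule sum_mono)
    fix q assume q: "q \<in> {1..int N}"
    have "(\<Sum>p\<in>{0..q}. 2 * w / of_int q) = 2 * w * ((of_int q + 1) / of_int q)" using q by simp
    also have "\<dots> \<le> 2 * w * 2" using q w by (intro mult_left_mono) (auto simp: field_simps)
    finally show "(\<Sum>p\<in>{0..q}. 2 * w / of_int q) \<le> 4 * w" by simp
  qed
  also have "\<dots> = 4 * (1 - real N / L)" using N unfolding w_def by (simp add: field_simps)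
  also have "\<dots> \<le> 4 * (1 - (u * L - 1) / L)" using N L0 by (intro mult_left_mono diff_left_mono divide_right_mono) auto
  also have "\<dots> = 4 * (1 - u) + 4 / L" using L0 by (simp add: field_simps)
  finally have "measure lborel ({0<..<1} - ?N) \<le> 4 * (1 - u) + 4 / L" .
  moreover have "measure lborel ({0<..<1::real}) = measure lborel ({0<..<1} \<inter> ?N) + measure lborel ({0<..<1} - ?N)"
  proof -
    have fm: "{0<..<1} \<inter> ?N \<in> fmeasurable lborel" "{0<..<1} - ?N \<in> fmeasurable lborel"
      by (rule bounded_borel_fmeasurable[of _ 0 1]; use near_rational_borel in auto)+
    have "measure lborel (({0<..<1} \<inter> ?N) \<union> ({0<..<1} - ?N)) = measure lborel ({0<..<1} \<inter> ?N) + measure lborel ({0<..<1} - ?N)"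
    proof -
      have "({0<..<1} - ?N) - ({0<..<1} \<inter> ?N) = {0<..<1} - ?N" by blast
      then show ?thesis using measure_Un2[OF fm] by simp
    qed
    then show ?thesis by (simp add: Int_Diff_Un)
  qed
  ultimately show ?thesis by simp
qed

text \<open>Evaluating the integral of \<open>limit_density\<close> leads to special values of the dilogarithm. It is
easier to let \<open>u\<close> tend to \<open>1\<close> in \<open>uncovered_measure_bound\<close>: no mass is lost, so the total mass of
the limit is \<open>1\<close>.\<close>

lemma limit_cdf_1: "limit_cdf 1 = 1"
proof -
  have r: "rat_interval 0 1 1" unfolding rat_interval_def by simp
  have b: "1 - 4 * (1 - u) \<le> limit_cdf u \<and> limit_cdf u \<le> 1" if u: "0 < u" "u < 1" for u
  proof
    have lim: "((\<lambda>L. measure lborel ({0<..<1} \<inter> near_rational (1 / L) (u * L))) \<longlongrightarrow> limit_cdf u) at_top"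
      using near_rational_limit_rational_cdf[OF r u] by simp
    have "measure lborel ({0<..<1} \<inter> near_rational (1 / L) (u * L)) \<le> 1" for L
    proof -
      have "measure lborel ({0<..<1} \<inter> near_rational (1 / L) (u * L)) \<le> measure lborel {0<..<1::real}"
        using near_rational_borel by (intro measure_mono_fmeasurable) (auto simp: fmeasurable_def)
      then show ?thesis by simp
    qed
    then show "limit_cdf u \<le> 1" by (intro tendsto_upperbound[OF lim]) auto
    have "((\<lambda>L. 1 - 4 * (1 - u) - 4 / L) \<longlongrightarrow> 1 - 4 * (1 - u)) at_top" by real_asymp
    moreover have "eventually (\<lambda>L. 1 - 4 * (1 - u) - 4 / L \<le> measure lborel ({0<..<1} \<inter> near_rational (1 / L) (u * L))) at_top"
      using eventually_ge_at_top[of "1 / u"]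
    proof eventually_elim
      case (elim L)
      then have "1 \<le> u * L" using u by (simp add: field_simps)
      from uncovered_measure_bound[OF u this] show ?case by linarith
    qed
    ultimately show "1 - 4 * (1 - u) \<le> limit_cdf u" using lim by (intro tendsto_le[OF _ lim]) auto
  qed
  have "eventually (\<lambda>u::real. 0 < u \<and> u < 1) (at_left 1)"
    by (intro eventually_conj eventually_at_left_real[of 0 1, simplified] | auto simp: eventually_at_left_field intro: exI[of _ 0])+
  note ev = this
  have lim: "(limit_cdf \<longlongrightarrow> limit_cdf 1) (at_left 1)"
  proof (rule LIM_zero_cancel, rule Lim_null_comparison)
    show "((\<lambda>u. 12 / pi\<^sup>2 * (1 - u)) \<longlongrightarrow> 0) (at_left 1)" by (auto intro!: tendsto_eq_intros)
    show "eventually (\<lambda>u. norm (limit_cdf u - limit_cdf 1) \<le> 12 / pi\<^sup>2 * (1 - u)) (at_left 1)"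
      using ev
    proof eventually_elim
      case (elim u)
      then show ?case using limit_cdf_mono_lipschitz[of u 1] by auto
    qed
  qed
  have "((\<lambda>u::real. 1 - 4 * (1 - u)) \<longlongrightarrow> 1 - 4 * (1 - 1)) (at_left 1)" by (intro tendsto_intros)
  then have lo: "((\<lambda>u::real. 1 - 4 * (1 - u)) \<longlongrightarrow> 1) (at_left 1)" by simp
  have "(limit_cdf \<longlongrightarrow> 1) (at_left 1)"
    by (rule tendsto_sandwich[OF _ _ lo tendsto_const]; rule eventually_mono[OF ev]) (use b in auto)
  then show ?thesis using lim tendsto_unique[of "at_left (1::real)"] by (simp add: trivial_limit_at_left_real)
qed

text \<open>Rounding the endpoints outwards to multiples of \<open>1 / d\<close> changes the measure by at most \<open>2 / d\<close>.\<close>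

theorem near_rational_limit:
  assumes ab: "0 \<le> a" "a < b" "b \<le> 1" and u: "0 < u" "u < 1"
  shows "((\<lambda>L. measure lborel ({a<..<b} \<inter> near_rational (1 / L) (u * L))) \<longlongrightarrow> (b - a) * limit_cdf u) at_top"
proof (rule tendstoI)
  fix e :: real assume e: "e > 0"
  obtain d0 :: nat where d0: "8 / e < real d0" using reals_Archimedean2 by blast
  define d where "d = int (Suc d0)"
  have d: "d > 0" "8 / e < d" unfolding d_def using d0 by auto
  have de: "2 / d < e / 4" using d e by (simp add: field_simps)
  define \<alpha> \<beta> where "\<alpha> = of_int \<lfloor>a * d\<rfloor> / real_of_int d" and "\<beta> = of_int \<lceil>b * d\<rceil> / real_of_int d"
  have dr: "0 < real_of_int d" using d by simp
  have al: "\<alpha> \<le> a" "a - 1 / d \<le> \<alpha>"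
  proof -
    have "of_int \<lfloor>a * d\<rfloor> \<le> a * d" "a * d - 1 \<le> of_int \<lfloor>a * d\<rfloor>" by linarith+
    from divide_right_mono[OF this(1), of d] divide_right_mono[OF this(2), of d]
    show "\<alpha> \<le> a" "a - 1 / d \<le> \<alpha>" unfolding \<alpha>_def using dr by (auto simp: diff_divide_distrib)
  qed
  have be: "b \<le> \<beta>" "\<beta> \<le> b + 1 / d"
  proof -
    have "b * d \<le> of_int \<lceil>b * d\<rceil>" "of_int \<lceil>b * d\<rceil> \<le> b * d + 1" by linarith+
    from divide_right_mono[OF this(1), of d] divide_right_mono[OF this(2), of d]
    show "b \<le> \<beta>" "\<beta> \<le> b + 1 / d" unfolding \<beta>_def using dr by (auto simp: add_divide_distrib)
  qed
  have "0 \<le> \<lfloor>a * d\<rfloor>" using ab d by simp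
  then have a0: "0 \<le> \<alpha>" unfolding \<alpha>_def using dr by simp
  have "b * d \<le> 1 * real_of_int d" using ab dr by (intro mult_right_mono) auto
  then have "\<lceil>b * d\<rceil> \<le> d" by (simp add: ceiling_le_iff)
  then have b1: "\<beta> \<le> 1" unfolding \<beta>_def using dr by simp
  have r: "rat_interval \<alpha> \<beta> d" unfolding rat_interval_def
    using a0 b1 al be ab d by (auto simp: \<alpha>_def \<beta>_def)
  let ?m = "\<lambda>a b L. measure lborel ({a<..<b} \<inter> near_rational (1 / L) (u * L))"
  have 1: "eventually (\<lambda>L. dist (?m \<alpha> \<beta> L) ((\<beta> - \<alpha>) * limit_cdf u) < e / 4) at_top"
    using near_rational_limit_rational_cdf[OF r u] e by (intro tendstoD) auto
  have diff: "\<bar>?m \<alpha> \<beta> L - ?m a b L\<bar> \<le> 2 / d" for L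
  proof -
    let ?N = "near_rational (1 / L) (u * L)"
    have fm: "{x<..<y} \<inter> ?N \<in> fmeasurable lborel" for x y
      by (rule bounded_borel_fmeasurable[of _ x y]; use near_rational_borel in auto)
    have "?m a b L \<le> ?m \<alpha> \<beta> L"
    proof (rule measure_mono_fmeasurable[OF _ fmeasurableD[OF fm] fm])
      show "{a<..<b} \<inter> ?N \<subseteq> {\<alpha><..<\<beta>} \<inter> ?N" using al be by auto
    qed
    moreover have "?m \<alpha> \<beta> L \<le> measure lborel ({a<..<b} \<inter> ?N \<union> ({\<alpha>..a} \<union> {b..\<beta>}))"
    proof (rule measure_mono_fmeasurable[OF _ fmeasurableD[OF fm]])
      show "{\<alpha><..<\<beta>} \<inter> ?N \<subseteq> {a<..<b} \<inter> ?N \<union> ({\<alpha>..a} \<union> {b..\<beta>})" by auto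
      show "{a<..<b} \<inter> ?N \<union> ({\<alpha>..a} \<union> {b..\<beta>}) \<in> fmeasurable lborel"
        by (intro fmeasurable.Un fm) (auto simp: fmeasurable_def emeasure_lborel_Icc_eq)
    qed
    moreover have "\<dots> \<le> ?m a b L + (measure lborel {\<alpha>..a} + measure lborel {b..\<beta>})"
      by (rule order.trans[OF measure_Un_le], rule fmeasurableD[OF fm], simp, rule add_left_mono, rule measure_Un_le) simp_all
    moreover have "measure lborel {\<alpha>..a} + measure lborel {b..\<beta>} \<le> 2 / d" using al be by simp
    ultimately show ?thesis by linarith
  qed
  have H: "0 \<le> limit_cdf u" "limit_cdf u \<le> 1"
  proof -
    have "limit_cdf 0 = 0" unfolding limit_cdf_def set_lebesgue_integral_def by simp
    then show "0 \<le> limit_cdf u" "limit_cdf u \<le> 1"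
      using limit_cdf_mono_lipschitz(1)[of 0 u] limit_cdf_mono_lipschitz(1)[of u 1] limit_cdf_1 u by auto
  qed
  have "\<bar>(\<beta> - \<alpha>) * limit_cdf u - (b - a) * limit_cdf u\<bar> \<le> 2 / d"
  proof -
    have "\<bar>((\<beta> - \<alpha>) - (b - a)) * limit_cdf u\<bar> \<le> (2 / d) * 1"
      unfolding abs_mult using al be H dr by (intro mult_mono) auto
    then show ?thesis by (simp add: left_diff_distrib)
  qed
  note 2 = this
  show "eventually (\<lambda>L. dist (?m a b L) ((b - a) * limit_cdf u) < e) at_top"
    using 1
  proof eventually_elim
    case (elim L)
    then show ?case using diff[of L] 2 de unfolding dist_real_def by linarith
  qed
qed

section \<open>Moments of the limit distribution\<close>

lemma log_term_bounds:
  fixes x :: real assumes "0 < x" "x \<le> 1 / 2"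
  shows "0 \<le> ln (1 - x) - ln x" "x * (ln (1 - x) - ln x) \<le> 1"
proof -
  show "0 \<le> ln (1 - x) - ln x" using assms by simp
  have "ln (1 / x) \<le> 1 / x - 1" using assms by (intro ln_le_minus_one) auto
  then have "- ln x \<le> 1 / x - 1" using assms by (simp add: ln_div)
  moreover have "ln (1 - x) \<le> 0" using assms by simp
  ultimately have "ln (1 - x) - ln x \<le> 1 / x" by linarith
  then have "x * (ln (1 - x) - ln x) \<le> x * (1 / x)" using assms by (intro mult_left_mono) auto
  then show "x * (ln (1 - x) - ln x) \<le> 1" using assms by simp
qed

lemma power_quotient_bounds:
  fixes x :: real assumes "0 \<le> x" "x \<le> 1" "1 \<le> n"
  shows "0 \<le> (1 - (1 - x) ^ n) / n" "(1 - (1 - x) ^ n) / n \<le> x"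
proof -
  have "(1 - x) ^ n \<le> 1" using assms by (intro power_le_one) auto
  then show "0 \<le> (1 - (1 - x) ^ n) / n" by simp
  have "1 + real n * (- x) \<le> (1 + - x) ^ n" using assms by (intro Bernoulli_inequality) auto
  then show "(1 - (1 - x) ^ n) / n \<le> x" using assms by (simp add: field_simps)
qed

text \<open>Integration by parts with \<open>B' = x * (1 - x) ^ (n - 1)\<close> and \<open>(ln x - ln (1 - x))' = 1 / (x * (1 - x))\<close>
trades the logarithm of the density for the quotients in \<open>c_moment\<close>. The boundary terms vanish:
at \<open>1 / 2\<close> the logarithms cancel, and at \<open>0\<close> one has \<open>\<bar>B x\<bar> \<le> x\<close>.\<close>

lemma moment_by_parts:
  assumes n: "1 \<le> n"
  defines "B \<equiv> \<lambda>x::real. (1 - (1 - x) ^ n) / real n - (1 - (1 - x) ^ (n + 1)) / (real n + 1)"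
  defines "Q \<equiv> \<lambda>x::real. (1 - (1 - x) ^ n) / (real n * x * (1 - x)) - (1 - (1 - x) ^ (n + 1)) / ((real n + 1) * x * (1 - x))"
    and "P \<equiv> \<lambda>x::real. x * (1 - x) ^ (n - 1) * (ln (1 - x) - ln x)"
  shows "set_integrable lborel {0..1/2} Q" "set_integrable lborel {0..1/2} P" "(LBINT x:{0..1/2}. Q x) = (LBINT x:{0..1/2}. P x)"
proof -
  have B: "\<bar>B x\<bar> \<le> x" if "0 \<le> x" "x \<le> 1" for x
    using power_quotient_bounds[OF that n] power_quotient_bounds[OF that, of "n + 1"] unfolding B_def by (auto simp: add.commute)
  have QB: "Q x = B x / (x * (1 - x))" for x unfolding Q_def B_def by (simp add: diff_divide_distrib mult.assoc)
  have [measurable]: "Q \<in> borel_measurable borel" "P \<in> borel_measurable borel" unfolding Q_def P_def by measurable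
  have "{0..1/2::real} \<in> fmeasurable lborel" by (rule bounded_borel_fmeasurable[of _ 0 1]) auto
  then have fin: "emeasure lborel {0..1/2::real} < \<infinity>" unfolding fmeasurable_def by blast
  show iQ: "set_integrable lborel {0..1/2} Q"
  proof (rule set_integrable_bounded[of _ _ _ 2])
    fix x :: real assume x: "x \<in> {0..1/2}"
    show "\<bar>Q x\<bar> \<le> 2"
    proof (cases "x = 0")
      case False
      then have "x > 0" using x by simp
      have "\<bar>Q x\<bar> = \<bar>B x\<bar> / (x * (1 - x))" unfolding QB using x by (simp add: abs_mult)
      also have "\<dots> \<le> x / (x * (1 - x))" using x B by (intro divide_right_mono) auto
      also have "\<dots> = 1 / (1 - x)" using \<open>x > 0\<close> by simp
      also have "\<dots> \<le> 2" using x by (simp add: field_simps)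
      finally show ?thesis .
    qed (simp add: Q_def)
  qed (simp, rule fin, simp)
  show iP: "set_integrable lborel {0..1/2} P"
  proof (rule set_integrable_bounded[of _ _ _ 1])
    fix x :: real assume x: "x \<in> {0..1/2}"
    show "\<bar>P x\<bar> \<le> 1"
    proof (cases "x = 0")
      case False
      then have b: "0 \<le> ln (1 - x) - ln x" "x * (ln (1 - x) - ln x) \<le> 1" using log_term_bounds[of x] x by auto
      have p: "0 \<le> (1 - x) ^ (n - 1)" "(1 - x) ^ (n - 1) \<le> 1" using x by (auto intro: power_le_one)
      have "P x = (x * (ln (1 - x) - ln x)) * (1 - x) ^ (n - 1)" unfolding P_def by simp
      moreover have "0 \<le> (x * (ln (1 - x) - ln x)) * (1 - x) ^ (n - 1)" using b p x by (intro mult_nonneg_nonneg) auto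
      moreover have "(x * (ln (1 - x) - ln x)) * (1 - x) ^ (n - 1) \<le> 1 * 1" using b p x by (intro mult_mono) auto
      ultimately show ?thesis by simp
    qed (simp add: P_def)
  qed (simp, rule fin, simp)
  define F where "F x = B x * (ln x - ln (1 - x))" for x
  have "((\<lambda>x. Q x - P x) has_integral (F (1/2) - F 0)) {0..1/2}"
  proof (rule fundamental_theorem_of_calculus_interior)
    fix x :: real assume x: "x \<in> {0<..<1/2}"
    have "((\<lambda>x. (1 - x) ^ Suc m) has_real_derivative - (real (Suc m) * (1 - x) ^ m)) (at x)" for m
    proof -
      have "((\<lambda>x. 1 - x) has_real_derivative - 1) (at x)" by (auto intro!: derivative_eq_intros)
      from DERIV_power[OF this, of "Suc m"] show ?thesis by (simp add: mult.commute)
    qed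
    from this[of "n - 1"] this[of n] have d: "((\<lambda>x. (1 - x) ^ n) has_real_derivative - (real n * (1 - x) ^ (n - 1))) (at x)"
      "((\<lambda>x. (1 - x) ^ (n + 1)) has_real_derivative - ((real n + 1) * (1 - x) ^ n)) (at x)" using n by (auto simp: algebra_simps)
    have "(B has_real_derivative (real n * (1 - x) ^ (n - 1)) / real n - ((real n + 1) * (1 - x) ^ n) / (real n + 1)) (at x)"
      using DERIV_diff[OF DERIV_cdivide[OF DERIV_diff[OF DERIV_const d(1), of 1], of "real n"]
          DERIV_cdivide[OF DERIV_diff[OF DERIV_const d(2), of 1], of "real n + 1"]]
      unfolding B_def by simp
    moreover have "(real n * (1 - x) ^ (n - 1)) / real n - ((real n + 1) * (1 - x) ^ n) / (real n + 1) = x * (1 - x) ^ (n - 1)"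
    proof -
      have "(1 - x) ^ n = (1 - x) * (1 - x) ^ (n - 1)" using n by (metis power_eq_if not_one_le_zero)
      then have "(1 - x) ^ (n - 1) - (1 - x) ^ n = x * (1 - x) ^ (n - 1)" by (simp add: algebra_simps)
      moreover have "(real n * (1 - x) ^ (n - 1)) / real n = (1 - x) ^ (n - 1)" using n by simp
      moreover have "((real n + 1) * (1 - x) ^ n) / (real n + 1) = (1 - x) ^ n"
        by (rule nonzero_mult_div_cancel_left) simp
      ultimately show ?thesis by simp
    qed
    ultimately have dB: "(B has_real_derivative x * (1 - x) ^ (n - 1)) (at x)" by simp
    have dl: "((\<lambda>x. ln x - ln (1 - x)) has_real_derivative 1 / x + 1 / (1 - x)) (at x)"
      using x by (auto intro!: derivative_eq_intros)
    have "(F has_real_derivative x * (1 - x) ^ (n - 1) * (ln x - ln (1 - x)) + (1 / x + 1 / (1 - x)) * B x) (at x)"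
      unfolding F_def using DERIV_mult[OF dB dl] by simp
    moreover have "(1 / x + 1 / (1 - x)) * B x = Q x" unfolding QB using x by (simp add: field_simps)
    moreover have "x * (1 - x) ^ (n - 1) * (ln x - ln (1 - x)) = - P x" unfolding P_def by (simp add: algebra_simps)
    ultimately show "(F has_vector_derivative Q x - P x) (at x)"
      by (simp add: has_real_derivative_iff_has_vector_derivative[symmetric])
  next
    show "continuous_on {0..1/2} F"
      unfolding continuous_on_eq_continuous_within
    proof
      fix x :: real assume x: "x \<in> {0..1/2}"
      show "continuous (at x within {0..1/2}) F"
      proof (cases "x = 0")
        case False
        then have x: "0 < x" "x < 1" using x by auto
        have "isCont B x" unfolding B_def using n by (intro continuous_intros) auto
        then have "isCont F x" unfolding F_def using x by (intro continuous_intros) auto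
        then show ?thesis by (rule continuous_at_imp_continuous_at_within)
      next
        case True
        have F0: "F 0 = 0" unfolding F_def B_def by simp
        have "(F \<longlongrightarrow> 0) (at 0 within {0..1/2})"
        proof (rule Lim_null_comparison)
          have "((\<lambda>x::real. x * (ln (1 - x) - ln x)) \<longlongrightarrow> 0) (at_right 0)" by real_asymp
          then show "((\<lambda>x::real. x * (ln (1 - x) - ln x)) \<longlongrightarrow> 0) (at 0 within {0..1/2})"
            by (simp add: at_within_Icc_at_right)
          show "eventually (\<lambda>x. norm (F x) \<le> x * (ln (1 - x) - ln x)) (at 0 within {0..1/2})"
            unfolding eventually_at_filter
          proof (rule always_eventually, intro allI impI)
            fix x :: real assume x: "x \<noteq> 0" "x \<in> {0..1/2}"
            have "norm (F x) = \<bar>B x\<bar> * (ln (1 - x) - ln x)" unfolding F_def using log_term_bounds(1)[of x] x by (simp add: abs_mult)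
            also have "\<dots> \<le> x * (ln (1 - x) - ln x)" using B[of x] x log_term_bounds(1)[of x] by (intro mult_right_mono) auto
            finally show "norm (F x) \<le> x * (ln (1 - x) - ln x)" .
          qed
        qed
        then show ?thesis unfolding True continuous_within F0 .
      qed
    qed
  qed simp
  moreover have "F (1/2) = 0" "F 0 = 0" unfolding F_def B_def by simp_all
  ultimately have "integral {0..1/2} (\<lambda>x. Q x - P x) = 0" by (simp add: integral_unique)
  moreover have "set_integrable lborel {0..1/2} (\<lambda>x. Q x - P x)" using iQ iP by (rule set_integral_diff)
  ultimately have "(LBINT x:{0..1/2}. Q x - P x) = 0" by (simp add: set_borel_integral_eq_integral(2))
  then show "(LBINT x:{0..1/2}. Q x) = (LBINT x:{0..1/2}. P x)" using set_integral_diff(2)[OF iQ iP] by simp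
qed

lemma set_integral_cong_AE_lborel:
  fixes f :: "real \<Rightarrow> real"
  assumes "f \<in> borel_measurable borel" "A \<in> sets borel" "B \<in> sets borel" "finite S" "\<And>x. x \<notin> S \<Longrightarrow> x \<in> A \<longleftrightarrow> x \<in> B"
  shows "(LBINT x:A. f x) = (LBINT x:B. f x)"
proof (rule set_integral_cong_set)
  show "set_borel_measurable lborel B f" "set_borel_measurable lborel A f" using assms unfolding set_borel_measurable_def by auto
  have "AE x in lborel. x \<notin> S" using finite_imp_null_set_lborel[OF assms(4)] by (rule AE_not_in)
  then show "AE x in lborel. x \<in> B \<longleftrightarrow> x \<in> A" by eventually_elim (use assms in auto)
qed

text \<open>The density is constant up to \<open>1 / 2\<close>. On the upper half the substitution \<open>y = 1 - x\<close> produces the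
summand with \<open>(1 - x) ^ (n - 1)\<close> and the logarithmic integral of \<open>moment_by_parts\<close>.\<close>

lemma limit_moment:
  assumes n: "1 \<le> n"
  shows "(LBINT y:{0<..1}. y ^ n * limit_density y) = c_moment n"
proof -
  define G where "G y = y ^ (n - 1) * (1 - y) * (1 + ln y - ln (1 - y))" for y :: real
  define P where "P x = x * (1 - x) ^ (n - 1) * (ln (1 - x) - ln x)" for x :: real
  define Q where "Q x = (1 - (1 - x) ^ n) / (real n * x * (1 - x)) - (1 - (1 - x) ^ (n + 1)) / ((real n + 1) * x * (1 - x))" for x :: real
  note PQ = moment_by_parts[OF n, folded P_def Q_def]
  have [measurable]: "G \<in> borel_measurable borel" unfolding G_def by measurable
  have pn: "y ^ n = y * y ^ (n - 1)" for y :: real using n by (metis power_eq_if not_one_le_zero)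
  have ci: "set_integrable lborel {0..1/2} f" if "continuous_on {0..1/2} f" for f :: "real \<Rightarrow> real"
    using that by (intro borel_integrable_atLeastAtMost') auto
  have int: "set_integrable lborel S (\<lambda>y. y ^ n * limit_density y)" if "S \<in> sets borel" "S \<subseteq> {0<..1}" for S
  proof (rule set_integrable_bounded[of _ _ _ "12 / pi\<^sup>2"])
    show "emeasure lborel S < \<infinity>" using bounded_borel_fmeasurable[of S 0 1] that by (force simp: fmeasurable_def)
    fix x assume "x \<in> S"
    then have x: "0 < x" "x \<le> 1" using that by auto
    have "x ^ n * limit_density x \<le> 1 * (12 / pi\<^sup>2)" using limit_density_bounds[OF x] x by (intro mult_mono power_le_one) auto
    moreover have "0 \<le> x ^ n * limit_density x" using limit_density_bounds[OF x] x by auto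
    ultimately show "\<bar>x ^ n * limit_density x\<bar> \<le> 12 / pi\<^sup>2" by simp
  qed (use that in auto)
  have "{0<..1} = {0<..1/2} \<union> {1/2<..1::real}" by auto
  then have "(LBINT y:{0<..1}. y ^ n * limit_density y) = (LBINT y:{0<..1/2}. y ^ n * limit_density y) + (LBINT y:{1/2<..1}. y ^ n * limit_density y)"
    by (simp only:) (rule set_integral_Un, auto intro!: int)
  also have "(LBINT y:{0<..1/2}. y ^ n * limit_density y) = (LBINT y:{0<..1/2}. 12 / pi\<^sup>2 * y ^ n)"
    by (intro set_lebesgue_integral_cong) (auto simp: limit_density_def gap_kernel_def)
  also have "\<dots> = (LBINT y:{0..1/2}. 12 / pi\<^sup>2 * y ^ n)"
    by (rule set_integral_cong_AE_lborel[of _ _ _ "{0}"]) auto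
  also have "(LBINT y:{1/2<..1}. y ^ n * limit_density y) = (LBINT y:{1/2<..1}. 12 / pi\<^sup>2 * G y)"
  proof (intro set_lebesgue_integral_cong allI impI)
    fix y :: real assume y: "y \<in> {1/2<..1}"
    have "1 - gap_kernel y = (1 - y) / y * (1 + ln y - ln (1 - y))"
      unfolding gap_kernel_def using y by (simp add: field_simps)
    then have "y ^ n * limit_density y = 12 / pi\<^sup>2 * (y * y ^ (n - 1) * ((1 - y) / y * (1 + ln y - ln (1 - y))))"
      unfolding limit_density_def pn by simp
    also have "\<dots> = 12 / pi\<^sup>2 * G y" unfolding G_def using y by simp
    finally show "y ^ n * limit_density y = 12 / pi\<^sup>2 * G y" .
  qed auto
  also have "\<dots> = (LBINT x:{0..<1/2}. 12 / pi\<^sup>2 * G (1 - x))"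
  proof -
    have "(LBINT y:{1/2<..1}. 12 / pi\<^sup>2 * G y) = (\<integral>x. indicator {1/2<..1} (1 + - 1 * x) *\<^sub>R (12 / pi\<^sup>2 * G (1 + - 1 * x)) \<partial>lborel)"
      unfolding set_lebesgue_integral_def by (subst lborel_integral_real_affine[of "-1" _ 1]) auto
    also have "\<dots> = (LBINT x:{0..<1/2}. 12 / pi\<^sup>2 * G (1 - x))"
      unfolding set_lebesgue_integral_def by (intro Bochner_Integration.integral_cong) (auto simp: indicator_def)
    finally show ?thesis .
  qed
  also have "\<dots> = (LBINT x:{0..1/2}. 12 / pi\<^sup>2 * G (1 - x))"
    by (rule set_integral_cong_AE_lborel[of _ _ _ "{1/2}"]) auto
  also have "(LBINT y:{0..1/2}. 12 / pi\<^sup>2 * y ^ n) + (LBINT x:{0..1/2}. 12 / pi\<^sup>2 * G (1 - x))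
     = 12 / pi\<^sup>2 * ((LBINT x:{0..1/2}. x * (x ^ (n - 1) + (1 - x) ^ (n - 1))) + (LBINT x:{0..1/2}. P x))"
  proof -
    have "G (1 - x) = x * (1 - x) ^ (n - 1) + P x" for x unfolding G_def P_def by (simp add: algebra_simps)
    then have "(LBINT x:{0..1/2}. G (1 - x)) = (LBINT x:{0..1/2}. x * (1 - x) ^ (n - 1)) + (LBINT x:{0..1/2}. P x)"
      using PQ(2) by (simp add: set_integral_add(2) ci continuous_intros)
    moreover have "(LBINT x:{0..1/2::real}. x * (x ^ (n - 1) + (1 - x) ^ (n - 1))) = (LBINT x:{0..1/2::real}. x ^ n) + (LBINT x:{0..1/2}. x * (1 - x) ^ (n - 1))"
      unfolding pn distrib_left by (rule set_integral_add(2); intro ci continuous_intros)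
    ultimately show ?thesis unfolding set_integral_mult_right by (simp add: distrib_left)
  qed
  also have "\<dots> = 12 / pi\<^sup>2 * (LBINT x:{0..1/2}. x * (x ^ (n - 1) + (1 - x) ^ (n - 1)) + Q x)"
    unfolding PQ(3)[symmetric] using PQ(1) by (subst set_integral_add(2)) (auto intro!: ci continuous_intros)
  finally show ?thesis unfolding c_moment_def Q_def by (simp add: add_diff_eq)
qed

section \<open>Hitting times and least denominators\<close>

text \<open>For \<open>0 < \<epsilon>\<close> Dirichlet's theorem provides such a \<open>q\<close>.\<close>

definition min_denominator :: "real \<Rightarrow> real \<Rightarrow> nat" where
  "min_denominator \<epsilon> t = (LEAST q::nat. 1 \<le> q \<and> (\<exists>p::int. \<bar>real q * t - of_int p\<bar> \<le> \<epsilon>))"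

lemma min_denominator_props:
  assumes e: "0 < \<epsilon>"
  shows "1 \<le> min_denominator \<epsilon> t" "\<exists>p::int. \<bar>real (min_denominator \<epsilon> t) * t - of_int p\<bar> \<le> \<epsilon>"
    "\<epsilon> * min_denominator \<epsilon> t \<le> 1 + \<epsilon>"
    and "\<And>q p::int. 1 \<le> q \<Longrightarrow> \<bar>of_int q * t - of_int p\<bar> \<le> \<epsilon> \<Longrightarrow> int (min_denominator \<epsilon> t) \<le> q"
proof -
  let ?Q = "\<lambda>q::nat. 1 \<le> q \<and> (\<exists>p::int. \<bar>real q * t - of_int p\<bar> \<le> \<epsilon>)"
  define N where "N = nat \<lceil>1 / \<epsilon>\<rceil>"
  have N: "1 / \<epsilon> \<le> real N" "real N \<le> 1 / \<epsilon> + 1" unfolding N_def using e by (auto intro: real_nat_ceiling_ge)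
  have "0 < 1 / \<epsilon>" using e by simp
  then have N0: "0 < N" using N by (cases N) auto
  have least: "min_denominator \<epsilon> t \<le> nat q" if "1 \<le> q" "\<bar>of_int q * t - of_int p\<bar> \<le> \<epsilon>" for q p :: int
    unfolding min_denominator_def using that by (intro Least_le) auto
  from Dirichlet_approx[OF N0, of t] obtain p q where pq: "0 < q" "q \<le> int N" "\<bar>of_int q * t - of_int p\<bar> < 1 / real N" by blast
  have "1 / real N \<le> 1 / (1 / \<epsilon>)" using N(1) N0 e by (intro divide_left_mono mult_pos_pos) auto
  then have qe: "\<bar>of_int q * t - of_int p\<bar> \<le> \<epsilon>" using pq(3) by simp
  then have "?Q (nat q)" using pq(1) by auto
  then have "?Q (min_denominator \<epsilon> t)" unfolding min_denominator_def by (rule LeastI)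
  then show "1 \<le> min_denominator \<epsilon> t" "\<exists>p::int. \<bar>real (min_denominator \<epsilon> t) * t - of_int p\<bar> \<le> \<epsilon>" by auto
  have "min_denominator \<epsilon> t \<le> N" using least[OF _ qe] pq by simp
  then have "real (min_denominator \<epsilon> t) \<le> 1 / \<epsilon> + 1" using N(2) by linarith
  then have "\<epsilon> * real (min_denominator \<epsilon> t) \<le> \<epsilon> * (1 / \<epsilon> + 1)" using e by (intro mult_left_mono) auto
  then show "\<epsilon> * min_denominator \<epsilon> t \<le> 1 + \<epsilon>" using e by (simp add: distrib_left)
  show "int (min_denominator \<epsilon> t) \<le> q" if "1 \<le> q" "\<bar>of_int q * t - of_int p\<bar> \<le> \<epsilon>" for q p :: int
    using least[OF that] that by linarith
qed

lemma near_rational_iff_min_denominator: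
  fixes \<epsilon> U t :: real
  assumes "0 < \<epsilon>" shows "t \<in> near_rational \<epsilon> U \<longleftrightarrow> min_denominator \<epsilon> t \<le> U"
proof
  assume "t \<in> near_rational \<epsilon> U"
  then obtain q p :: int where q: "1 \<le> q" "of_int q \<le> U" "\<bar>of_int q * t - of_int p\<bar> \<le> \<epsilon>" unfolding near_rational_def by blast
  have "int (min_denominator \<epsilon> t) \<le> q" using min_denominator_props(4)[OF assms q(1,3)] .
  then have "real_of_int (int (min_denominator \<epsilon> t)) \<le> of_int q" by (simp only: of_int_le_iff)
  then show "min_denominator \<epsilon> t \<le> U" using q(2) by simp
next
  assume U: "min_denominator \<epsilon> t \<le> U"
  obtain p :: int where "\<bar>real (min_denominator \<epsilon> t) * t - of_int p\<bar> \<le> \<epsilon>" using min_denominator_props(2)[OF assms] by blast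
  then show "t \<in> near_rational \<epsilon> U" unfolding near_rational_def
    using U min_denominator_props(1)[OF assms, of t] by (intro CollectI exI[of _ "int (min_denominator \<epsilon> t)"] exI[of _ p]) auto
qed

text \<open>The trajectory is followed by its first coordinate. The hypotheses say that a hit near \<open>(m, n)\<close>
amounts to the approximation \<open>\<bar>m * tan \<omega> - n\<bar> \<le> \<epsilon>'\<close> and takes place within \<open>\<epsilon>\<close> of the abscissa
\<open>m\<close>; the first hit then belongs to the least possible \<open>m\<close>, up to \<open>\<epsilon>\<close>.\<close>

lemma hitting_time_min_denominator:
  assumes c: "0 < cos \<omega>" and e: "0 < \<epsilon>'"
    and hit: "\<And>\<tau> m n. 0 < \<tau> \<Longrightarrow> (m, n) \<noteq> (0, 0) \<Longrightarrow> (\<tau> * cos \<omega> - of_int m, \<tau> * sin \<omega> - of_int n) \<in> K \<Longrightarrow>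
      1 \<le> m \<and> \<bar>\<tau> * cos \<omega> - of_int m\<bar> \<le> \<epsilon> \<and> \<bar>of_int m * tan \<omega> - of_int n\<bar> \<le> \<epsilon>'"
    and exists_hit: "\<And>q p. 1 \<le> q \<Longrightarrow> \<bar>of_int q * tan \<omega> - of_int p\<bar> \<le> \<epsilon>' \<Longrightarrow>
      \<exists>\<tau>>0. (\<tau> * cos \<omega> - of_int q, \<tau> * sin \<omega> - of_int p) \<in> K"
  shows "\<bar>hitting_time K \<omega> * cos \<omega> - min_denominator \<epsilon>' (tan \<omega>)\<bar> \<le> \<epsilon>"
proof -
  let ?q = "min_denominator \<epsilon>' (tan \<omega>)"
  define H where "H = {\<tau>. \<tau> > 0 \<and> (\<tau> * cos \<omega>, \<tau> * sin \<omega>) \<in> {p + z |p z. p \<in> K \<and> z \<in> lattice_star}}"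
  have mem: "\<tau> \<in> H \<longleftrightarrow> 0 < \<tau> \<and> (\<exists>m n. (m, n) \<noteq> (0, 0) \<and> (\<tau> * cos \<omega> - of_int m, \<tau> * sin \<omega> - of_int n) \<in> K)" for \<tau>
  proof
    assume "\<tau> \<in> H"
    then obtain p z where pz: "0 < \<tau>" "(\<tau> * cos \<omega>, \<tau> * sin \<omega>) = p + z" "p \<in> K" "z \<in> lattice_star" unfolding H_def by auto
    have z: "z \<in> range (\<lambda>(m::int, n::int). (of_int m, of_int n))" "z \<noteq> (0, 0)"
      using pz(4) unfolding lattice_star_def by blast+
    then obtain m n :: int where mn: "z = (of_int m, of_int n)" by auto
    have mn0: "(m, n) \<noteq> (0, 0)" using z(2) mn by auto
    have "p = (\<tau> * cos \<omega> - of_int m, \<tau> * sin \<omega> - of_int n)" using pz(2) unfolding mn by (cases p) auto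
    then show "0 < \<tau> \<and> (\<exists>m n. (m, n) \<noteq> (0, 0) \<and> (\<tau> * cos \<omega> - of_int m, \<tau> * sin \<omega> - of_int n) \<in> K)" using pz mn0 by blast
  next
    assume "0 < \<tau> \<and> (\<exists>m n. (m, n) \<noteq> (0, 0) \<and> (\<tau> * cos \<omega> - of_int m, \<tau> * sin \<omega> - of_int n) \<in> K)"
    then obtain m n :: int where mn: "0 < \<tau>" "(m, n) \<noteq> (0, 0)" "(\<tau> * cos \<omega> - of_int m, \<tau> * sin \<omega> - of_int n) \<in> K" by blast
    have "(of_int m, of_int n) \<in> lattice_star" using mn(2) unfolding lattice_star_def by auto
    moreover have "(\<tau> * cos \<omega>, \<tau> * sin \<omega>) = (\<tau> * cos \<omega> - of_int m, \<tau> * sin \<omega> - of_int n) + (of_int m, of_int n)" by simp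
    ultimately show "\<tau> \<in> H" unfolding H_def using mn by blast
  qed
  have T: "hitting_time K \<omega> = Inf H" unfolding hitting_time_def H_def ..
  have bdd: "bdd_below H" unfolding H_def by (rule bdd_belowI[of _ 0]) auto
  obtain p :: int where p: "\<bar>real ?q * tan \<omega> - of_int p\<bar> \<le> \<epsilon>'" using min_denominator_props(2)[OF e] by blast
  have q1: "1 \<le> int ?q" using min_denominator_props(1)[OF e, of "tan \<omega>"] by linarith
  then obtain \<tau> where \<tau>: "0 < \<tau>" "(\<tau> * cos \<omega> - of_int (int ?q), \<tau> * sin \<omega> - of_int p) \<in> K"
    using exists_hit[of "int ?q" p] p by auto
  have \<tau>H: "\<tau> \<in> H" unfolding mem using \<tau> q1 by (intro conjI exI[of _ "int ?q"] exI[of _ p]) auto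
  have "\<bar>\<tau> * cos \<omega> - of_int (int ?q)\<bar> \<le> \<epsilon>" using hit[OF \<tau>(1) _ \<tau>(2)] q1 by auto
  moreover have "Inf H * cos \<omega> \<le> \<tau> * cos \<omega>" using cInf_lower[OF \<tau>H bdd] c by (intro mult_right_mono) auto
  ultimately have up: "Inf H * cos \<omega> \<le> ?q + \<epsilon>" by simp
  have "(?q - \<epsilon>) / cos \<omega> \<le> Inf H"
  proof (rule cInf_greatest)
    fix \<tau> assume "\<tau> \<in> H"
    then obtain m n where mn: "0 < \<tau>" "(m, n) \<noteq> (0, 0)" "(\<tau> * cos \<omega> - of_int m, \<tau> * sin \<omega> - of_int n) \<in> K" unfolding mem by blast
    have h: "1 \<le> m" "\<bar>\<tau> * cos \<omega> - of_int m\<bar> \<le> \<epsilon>" "\<bar>of_int m * tan \<omega> - of_int n\<bar> \<le> \<epsilon>'" using hit[OF mn] by auto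
    have "int ?q \<le> m" using min_denominator_props(4)[OF e h(1,3)] .
    then have "real ?q \<le> of_int m" by linarith
    then show "(?q - \<epsilon>) / cos \<omega> \<le> \<tau>" using h(2) c by (simp add: pos_divide_le_eq)
  qed (use \<tau>H in auto)
  then have "?q - \<epsilon> \<le> Inf H * cos \<omega>" using c by (simp add: pos_divide_le_eq)
  then show ?thesis unfolding T using up by linarith
qed

lemma direction_bounds:
  assumes w: "\<omega> \<in> {0..pi/4}"
  shows "0 < cos \<omega>" "0 \<le> tan \<omega>" "tan \<omega> \<le> 1" "sin \<omega> = tan \<omega> * cos \<omega>" "(cos \<omega>)\<^sup>2 * (1 + (tan \<omega>)\<^sup>2) = 1"
proof -
  have wb: "0 \<le> \<omega>" "\<omega> \<le> pi / 4" using w by auto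
  have "- (pi / 2) < \<omega>" "\<omega> < pi / 2" using wb pi_gt_zero by linarith+
  then show c: "0 < cos \<omega>" by (rule cos_gt_zero_pi)
  have "0 \<le> sin \<omega>" using wb pi_gt_zero by (intro sin_ge_zero) linarith+
  then show "0 \<le> tan \<omega>" unfolding tan_def using c by simp
  show "tan \<omega> \<le> 1" using wb pi_gt_zero tan_mono_le[of \<omega> "pi/4"] tan_45 by linarith
  show s: "sin \<omega> = tan \<omega> * cos \<omega>" using c by (simp add: tan_def)
  have "(cos \<omega>)\<^sup>2 * (1 + (tan \<omega>)\<^sup>2) = (cos \<omega>)\<^sup>2 + (sin \<omega>)\<^sup>2" unfolding s by (simp add: algebra_simps power_mult_distrib)
  then show "(cos \<omega>)\<^sup>2 * (1 + (tan \<omega>)\<^sup>2) = 1" by simp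
qed

text \<open>The slope is at most \<open>1\<close>. A trajectory that meets the horizontal arm at \<open>(m, n)\<close> therefore passes
\<open>(m, n)\<close> at a vertical distance of at most \<open>\<epsilon>\<close>, that is, it also meets the vertical arm: only
the vertical arms matter.\<close>

lemma cross_time_approx:
  assumes w: "\<omega> \<in> {0..pi/4}" and e: "0 < \<epsilon>" "\<epsilon> < 1 / 2"
  shows "\<bar>cross_time \<epsilon> \<omega> * cos \<omega> - min_denominator \<epsilon> (tan \<omega>)\<bar> \<le> \<epsilon>"
  unfolding cross_time_def
proof (rule hitting_time_min_denominator)
  note d = direction_bounds[OF w]
  show "0 < cos \<omega>" "0 < \<epsilon>" using d e by auto
  fix \<tau> :: real and m n :: int
  assume \<tau>: "0 < \<tau>" and mn: "(m, n) \<noteq> (0, 0)" and K: "(\<tau> * cos \<omega> - of_int m, \<tau> * sin \<omega> - of_int n) \<in> cross_scatterer \<epsilon>"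
  define x where "x = \<tau> * cos \<omega>"
  have x: "0 < x" unfolding x_def using \<tau> d by simp
  have y: "\<tau> * sin \<omega> = tan \<omega> * x" unfolding x_def d(4) by simp
  have K': "(x = of_int m \<and> \<bar>tan \<omega> * x - of_int n\<bar> \<le> \<epsilon>) \<or> (tan \<omega> * x = of_int n \<and> \<bar>x - of_int m\<bar> \<le> \<epsilon>)"
    using K unfolding y x_def[symmetric] cross_scatterer_def by auto
  then show "1 \<le> m \<and> \<bar>\<tau> * cos \<omega> - of_int m\<bar> \<le> \<epsilon> \<and> \<bar>of_int m * tan \<omega> - of_int n\<bar> \<le> \<epsilon>"
    unfolding x_def[symmetric]
  proof
    assume "x = of_int m \<and> \<bar>tan \<omega> * x - of_int n\<bar> \<le> \<epsilon>"
    then show "1 \<le> m \<and> \<bar>x - of_int m\<bar> \<le> \<epsilon> \<and> \<bar>of_int m * tan \<omega> - of_int n\<bar> \<le> \<epsilon>" using x e by (auto simp: mult.commute)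
  next
    assume a: "tan \<omega> * x = of_int n \<and> \<bar>x - of_int m\<bar> \<le> \<epsilon>"
    have "1 \<le> m"
    proof (rule ccontr)
      assume "\<not> 1 \<le> m"
      then have m: "real_of_int m \<le> 0" by simp
      then have "x \<le> \<epsilon>" using a by linarith
      have n: "real_of_int n = tan \<omega> * x" using a by simp
      have "tan \<omega> * x \<le> 1 * x" using d(3) x by (intro mult_right_mono) simp_all
      moreover have "0 \<le> tan \<omega> * x" using d(2) x by simp
      ultimately have "real_of_int n < 1" "0 \<le> real_of_int n" using n \<open>x \<le> \<epsilon>\<close> e by linarith+
      then have "n = 0" by linarith
      moreover have "- 1 < real_of_int m" using a x e by linarith
      then have "m = 0" using m by linarith
      ultimately show False using mn by simp
    qed
    moreover have "\<bar>of_int m * tan \<omega> - of_int n\<bar> \<le> \<epsilon>"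
    proof -
      have "of_int m * tan \<omega> - of_int n = tan \<omega> * (of_int m - x)" using a by (simp add: algebra_simps)
      also have "\<bar>\<dots>\<bar> \<le> 1 * \<epsilon>" unfolding abs_mult using d a by (intro mult_mono) auto
      finally show ?thesis by simp
    qed
    ultimately show "1 \<le> m \<and> \<bar>x - of_int m\<bar> \<le> \<epsilon> \<and> \<bar>of_int m * tan \<omega> - of_int n\<bar> \<le> \<epsilon>" using a by blast
  qed
next
  note d = direction_bounds[OF w]
  fix q p :: int assume q: "1 \<le> q" "\<bar>of_int q * tan \<omega> - of_int p\<bar> \<le> \<epsilon>"
  have "of_int q / cos \<omega> * sin \<omega> = of_int q * tan \<omega>" by (simp add: tan_def)
  then show "\<exists>\<tau>>0. (\<tau> * cos \<omega> - of_int q, \<tau> * sin \<omega> - of_int p) \<in> cross_scatterer \<epsilon>"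
    using q d unfolding cross_scatterer_def by (intro exI[of _ "of_int q / cos \<omega>"]) (auto simp: abs_le_iff)
qed

text \<open>The point \<open>(m, n)\<close> has the distance \<open>cos \<omega> * \<bar>m * tan \<omega> - n\<bar>\<close> from the line of the trajectory, so
a disc of radius \<open>\<epsilon>\<close> acts like a vertical arm of length \<open>\<epsilon> / cos \<omega>\<close>.\<close>

lemma circular_time_approx:
  assumes w: "\<omega> \<in> {0..pi/4}" and e: "0 < \<epsilon>" "\<epsilon> < 1 / 2"
  shows "\<bar>circular_time \<epsilon> \<omega> * cos \<omega> - min_denominator (\<epsilon> / cos \<omega>) (tan \<omega>)\<bar> \<le> \<epsilon>"
  unfolding circular_time_def
proof (rule hitting_time_min_denominator)
  note d = direction_bounds[OF w]
  show "0 < cos \<omega>" "0 < \<epsilon> / cos \<omega>" using d e by auto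
  fix \<tau> :: real and m n :: int
  assume \<tau>: "0 < \<tau>" and mn: "(m, n) \<noteq> (0, 0)" and K: "(\<tau> * cos \<omega> - of_int m, \<tau> * sin \<omega> - of_int n) \<in> circular_scatterer \<epsilon>"
  define x where "x = \<tau> * cos \<omega>"
  have x: "0 < x" unfolding x_def using \<tau> d by simp
  have y: "\<tau> * sin \<omega> = tan \<omega> * x" unfolding x_def d(4) by simp
  have K': "(x - of_int m)\<^sup>2 + (tan \<omega> * x - of_int n)\<^sup>2 = \<epsilon>\<^sup>2"
    using K unfolding y x_def[symmetric] circular_scatterer_def by auto
  have xm: "\<bar>x - of_int m\<bar> \<le> \<epsilon>" and yn: "\<bar>tan \<omega> * x - of_int n\<bar> \<le> \<epsilon>"
  proof -
    have "(x - of_int m)\<^sup>2 \<le> \<epsilon>\<^sup>2" "(tan \<omega> * x - of_int n)\<^sup>2 \<le> \<epsilon>\<^sup>2" using K' zero_le_power2[of "x - of_int m"] zero_le_power2[of "tan \<omega> * x - of_int n"] by linarith+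
    then have "\<bar>x - of_int m\<bar> \<le> \<bar>\<epsilon>\<bar>" "\<bar>tan \<omega> * x - of_int n\<bar> \<le> \<bar>\<epsilon>\<bar>" by (simp_all only: abs_le_square_iff)
    then show "\<bar>x - of_int m\<bar> \<le> \<epsilon>" "\<bar>tan \<omega> * x - of_int n\<bar> \<le> \<epsilon>" using e(1) by simp_all
  qed
  have "1 \<le> m"
  proof (rule ccontr)
    assume "\<not> 1 \<le> m"
    then have m: "real_of_int m \<le> 0" by simp
    then have xe: "x \<le> \<epsilon>" using xm by linarith
    have "tan \<omega> * x \<le> 1 * x" "0 \<le> tan \<omega> * x" using d x by (auto intro: mult_right_mono)
    then have "real_of_int n < 1" "-1 < real_of_int n" using yn xe e by linarith+
    then have "n = 0" by linarith
    moreover have "- 1 < real_of_int m" using xm x e by linarith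
    then have "m = 0" using m by linarith
    ultimately show False using mn by simp
  qed
  moreover have "\<bar>of_int m * tan \<omega> - of_int n\<bar> \<le> \<epsilon> / cos \<omega>"
  proof -
    define v z where "v = of_int m - x" and "z = tan \<omega> * x - of_int n"
    have "of_int m * tan \<omega> - of_int n = tan \<omega> * v + z" unfolding v_def z_def by (simp add: algebra_simps)
    \<comment> \<open>The inequality of Cauchy and Schwarz.\<close>
    moreover have "(tan \<omega> * v + z)\<^sup>2 \<le> (1 + (tan \<omega>)\<^sup>2) * (v\<^sup>2 + z\<^sup>2)"
    proof -
      have "(1 + (tan \<omega>)\<^sup>2) * (v\<^sup>2 + z\<^sup>2) - (tan \<omega> * v + z)\<^sup>2 = (v - tan \<omega> * z)\<^sup>2"
        by (simp add: power2_eq_square algebra_simps)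
      then show ?thesis by (metis zero_le_power2 diff_ge_0_iff_ge)
    qed
    moreover have "v\<^sup>2 + z\<^sup>2 = \<epsilon>\<^sup>2" using K' unfolding v_def z_def by (simp add: power2_commute)
    moreover have "1 + (tan \<omega>)\<^sup>2 = 1 / (cos \<omega>)\<^sup>2" using d by (simp add: field_simps)
    ultimately have "(of_int m * tan \<omega> - of_int n)\<^sup>2 \<le> (\<epsilon> / cos \<omega>)\<^sup>2" by (simp add: power_divide)
    then have "\<bar>of_int m * tan \<omega> - of_int n\<bar> \<le> \<bar>\<epsilon> / cos \<omega>\<bar>" by (simp only: abs_le_square_iff)
    moreover have "\<bar>\<epsilon> / cos \<omega>\<bar> = \<epsilon> / cos \<omega>" using e(1) d(1) by simp
    ultimately show ?thesis by simp
  qed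
  ultimately show "1 \<le> m \<and> \<bar>\<tau> * cos \<omega> - of_int m\<bar> \<le> \<epsilon> \<and> \<bar>of_int m * tan \<omega> - of_int n\<bar> \<le> \<epsilon> / cos \<omega>"
    using xm unfolding x_def by blast
next
  note d = direction_bounds[OF w]
  fix q p :: int assume q: "1 \<le> q" "\<bar>of_int q * tan \<omega> - of_int p\<bar> \<le> \<epsilon> / cos \<omega>"
  define c s where "c = cos \<omega>" and "s = sin \<omega>"
  have cs: "c\<^sup>2 + s\<^sup>2 = 1" unfolding c_def s_def by simp
  have c0: "0 < c" "0 \<le> s" "s = tan \<omega> * c" using d unfolding c_def s_def by auto
  have t1: "0 \<le> tan \<omega>" using d by simp
  have "(1 + (tan \<omega>)\<^sup>2) \<le> 2" using d power_le_one[of "tan \<omega>" 2] by simp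
  then have "1 \<le> c\<^sup>2 * 2" using d(5) mult_left_mono[of "1 + (tan \<omega>)\<^sup>2" 2 "c\<^sup>2"] unfolding c_def by simp
  then have "(1 / 2)\<^sup>2 \<le> c\<^sup>2" by (simp add: power2_eq_square)
  then have c12: "1 / 2 \<le> c" using c0 by (intro power2_le_imp_le[of "1/2" c]) auto
  have "0 \<le> of_int q * tan \<omega>" using q t1 by simp
  moreover have "\<epsilon> / c < 1" using e c12 by (simp add: pos_divide_less_eq)
  ultimately have "- 1 < real_of_int p" using q unfolding c_def by linarith
  then have "-1 < p" by linarith
  then have p0: "0 \<le> real_of_int p" by simp
  \<comment> \<open>\<open>\<tau>0\<close> is the time of closest approach to \<open>(q, p)\<close> and \<open>\<delta>\<close> the signed distance then; the circle is left at time \<open>\<tau>0 + r\<close>.\<close>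
  define \<tau>0 where "\<tau>0 = of_int q * c + of_int p * s"
  define \<delta> where "\<delta> = of_int q * s - of_int p * c"
  have "0 < \<tau>0" unfolding \<tau>0_def using q c0 p0 by (intro add_pos_nonneg) auto
  have "\<delta> = c * (of_int q * tan \<omega> - of_int p)" unfolding \<delta>_def c0(3) by (simp add: algebra_simps)
  then have "\<bar>\<delta>\<bar> = c * \<bar>of_int q * tan \<omega> - of_int p\<bar>" using c0 by (simp add: abs_mult)
  also have "\<dots> \<le> c * (\<epsilon> / c)" using q c0 unfolding c_def by (intro mult_left_mono) auto
  finally have "\<bar>\<delta>\<bar> \<le> \<epsilon>" using c0 by simp
  then have "\<delta>\<^sup>2 \<le> \<epsilon>\<^sup>2" using e abs_le_square_iff[of \<delta> \<epsilon>] by simp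
  define r where "r = sqrt (\<epsilon>\<^sup>2 - \<delta>\<^sup>2)"
  have r: "0 \<le> r" "r\<^sup>2 = \<epsilon>\<^sup>2 - \<delta>\<^sup>2" unfolding r_def using \<open>\<delta>\<^sup>2 \<le> \<epsilon>\<^sup>2\<close> by auto
  have "((\<tau>0 + r) * c - of_int q)\<^sup>2 + ((\<tau>0 + r) * s - of_int p)\<^sup>2 = \<epsilon>\<^sup>2"
  proof -
    have 1: "(\<tau>0 + r) * c - of_int q = r * c - \<delta> * s + of_int q * (c\<^sup>2 + s\<^sup>2 - 1)"
      unfolding \<tau>0_def \<delta>_def by (simp add: algebra_simps power2_eq_square)
    have 2: "(\<tau>0 + r) * s - of_int p = r * s + \<delta> * c + of_int p * (c\<^sup>2 + s\<^sup>2 - 1)"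
      unfolding \<tau>0_def \<delta>_def by (simp add: algebra_simps power2_eq_square)
    have "((\<tau>0 + r) * c - of_int q)\<^sup>2 + ((\<tau>0 + r) * s - of_int p)\<^sup>2 = (r * c - \<delta> * s)\<^sup>2 + (r * s + \<delta> * c)\<^sup>2"
      unfolding 1 2 cs by simp
    also have "\<dots> = (r\<^sup>2 + \<delta>\<^sup>2) * (c\<^sup>2 + s\<^sup>2)" by (simp add: power2_eq_square algebra_simps)
    finally show ?thesis unfolding cs r(2) by simp
  qed
  then show "\<exists>\<tau>>0. (\<tau> * cos \<omega> - of_int q, \<tau> * sin \<omega> - of_int p) \<in> circular_scatterer \<epsilon>"
    using \<open>0 < \<tau>0\<close> r(1) unfolding circular_scatterer_def c_def[symmetric] s_def[symmetric]
    by (intro exI[of _ "\<tau>0 + r"]) auto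
qed

lemma card_crossings:
  fixes g T :: real assumes "0 \<le> g" "0 < T"
  shows "\<bar>real (card {k::int. k \<noteq> 0 \<and> (\<exists>t. 0 < t \<and> t < T \<and> t * g = of_int k)}) - T * g\<bar> \<le> 1"
proof (cases "g = 0")
  case False
  then have g: "0 < g" using assms by simp
  have "{k::int. k \<noteq> 0 \<and> (\<exists>t. 0 < t \<and> t < T \<and> t * g = of_int k)} = {1..\<lceil>T * g\<rceil> - 1}"
  proof (intro equalityI subsetI)
    fix k :: int assume "k \<in> {k. k \<noteq> 0 \<and> (\<exists>t. 0 < t \<and> t < T \<and> t * g = of_int k)}"
    then obtain t where t: "0 < t" "t < T" "t * g = of_int k" by auto
    have "0 < real_of_int k" "real_of_int k < T * g" unfolding t(3)[symmetric] using t(1,2) g by auto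
    then have "0 < k" "k < \<lceil>T * g\<rceil>" by (auto simp: less_ceiling_iff)
    then show "k \<in> {1..\<lceil>T * g\<rceil> - 1}" by simp
  next
    fix k assume "k \<in> {1..\<lceil>T * g\<rceil> - 1}"
    then have k: "1 \<le> k" "k < \<lceil>T * g\<rceil>" by auto
    then have "of_int k < T * g" by (simp add: less_ceiling_iff)
    then show "k \<in> {k. k \<noteq> 0 \<and> (\<exists>t. 0 < t \<and> t < T \<and> t * g = of_int k)}"
      using k g by (auto intro!: exI[of _ "of_int k / g"] simp: pos_divide_less_eq)
  qed
  moreover have "0 < T * g" using assms g by simp
  then have "1 \<le> \<lceil>T * g\<rceil>" by (simp add: one_le_ceiling)
  then have "real (card {1..\<lceil>T * g\<rceil> - 1}) = of_int \<lceil>T * g\<rceil> - 1" by simp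
  ultimately show ?thesis by (simp only:) linarith
next
  case True
  then have none: "{k::int. k \<noteq> 0 \<and> (\<exists>t. 0 < t \<and> t < T \<and> t * g = of_int k)} = {}" by auto
  show ?thesis unfolding none using True by simp
qed

text \<open>The trajectory crosses about \<open>T * cos \<omega>\<close> vertical and \<open>T * sin \<omega> = tan \<omega> * (T * cos \<omega>)\<close> horizontal
lines.\<close>

lemma reflections_approx:
  assumes w: "\<omega> \<in> {0..pi/4}" and e: "0 < \<epsilon>" "\<epsilon> < 1 / 2" and q: "1 \<le> q" and T: "\<bar>T * cos \<omega> - real q\<bar> \<le> \<epsilon>"
  shows "\<bar>\<epsilon> * real (reflections T \<omega>) - (1 + tan \<omega>) * (\<epsilon> * real q)\<bar> \<le> 3 * \<epsilon>"
proof -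
  note d = direction_bounds[OF w]
  have "0 < T * cos \<omega>" using T q e by linarith
  then have T0: "0 < T" using d by (simp add: zero_less_mult_iff)
  have s0: "0 \<le> sin \<omega>" unfolding d(4) using d by simp
  define x where "x = T * cos \<omega>"
  have 1: "\<bar>real (reflections T \<omega>) - (x + tan \<omega> * x)\<bar> \<le> 2"
    using card_crossings[OF less_imp_le[OF d(1)] T0] card_crossings[OF s0 T0]
    unfolding reflections_def of_nat_add x_def d(4) by (simp add: mult_ac)
  have "\<bar>(1 + tan \<omega>) * (x - real q)\<bar> \<le> 2 * (1 / 2)" unfolding abs_mult using d T e unfolding x_def by (intro mult_mono) auto
  then have "\<bar>real (reflections T \<omega>) - (1 + tan \<omega>) * real q\<bar> \<le> 3" using 1 by (simp add: algebra_simps)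
  then have "\<epsilon> * \<bar>real (reflections T \<omega>) - (1 + tan \<omega>) * real q\<bar> \<le> \<epsilon> * 3" using e by (intro mult_left_mono) auto
  moreover have "\<epsilon> * \<bar>real (reflections T \<omega>) - (1 + tan \<omega>) * real q\<bar> = \<bar>\<epsilon> * (real (reflections T \<omega>) - (1 + tan \<omega>) * real q)\<bar>"
    using e by (simp add: abs_mult)
  moreover have "\<epsilon> * (real (reflections T \<omega>) - (1 + tan \<omega>) * real q) = \<epsilon> * real (reflections T \<omega>) - (1 + tan \<omega>) * (\<epsilon> * real q)"
    by (simp add: algebra_simps)
  ultimately show ?thesis by simp
qed

section \<open>Least denominators with variable aperture\<close>

text \<open>\<open>\<kappa> t\<close> is the ratio of the admissible error \<open>\<bar>q * t - p\<bar>\<close> to \<open>\<epsilon>\<close> at slope \<open>t\<close>: the constant \<open>1\<close> for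
crosses and \<open>sqrt (1 + t\<^sup>2) = 1 / cos \<omega>\<close> for discs. Monotonicity and the Lipschitz bound allow one
to freeze \<open>\<kappa>\<close> on short intervals.\<close>

definition aperture :: "(real \<Rightarrow> real) \<Rightarrow> bool" where
  "aperture \<kappa> \<longleftrightarrow> \<kappa> \<in> borel_measurable borel \<and> (\<forall>t. 1 \<le> \<kappa> t) \<and> (\<forall>c d. 0 \<le> c \<longrightarrow> c \<le> d \<longrightarrow> \<kappa> c \<le> \<kappa> d \<and> \<kappa> d \<le> \<kappa> c + (d - c))"

lemma aperture_1: "aperture (\<lambda>_. 1)" unfolding aperture_def by auto

lemma aperture_sqrt: "aperture (\<lambda>t. sqrt (1 + t\<^sup>2))"
  unfolding aperture_def
proof (intro conjI allI impI)
  fix c d :: real assume c: "0 \<le> c" "c \<le> d"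
  have "c\<^sup>2 \<le> d\<^sup>2" using c by (intro power_mono) auto
  then show "sqrt (1 + c\<^sup>2) \<le> sqrt (1 + d\<^sup>2)" by simp
  have cs: "c \<le> sqrt (1 + c\<^sup>2)" using real_sqrt_le_mono[of "c\<^sup>2" "1 + c\<^sup>2"] c by simp
  have "(d - c) * c \<le> (d - c) * sqrt (1 + c\<^sup>2)" using c cs by (intro mult_left_mono) auto
  moreover have "(sqrt (1 + c\<^sup>2) + (d - c))\<^sup>2 = (1 + c\<^sup>2) + 2 * ((d - c) * sqrt (1 + c\<^sup>2)) + (d - c)\<^sup>2"
    by (simp add: power2_sum)
  moreover have "1 + d\<^sup>2 = (1 + c\<^sup>2) + 2 * ((d - c) * c) + (d - c)\<^sup>2" by (simp add: power2_eq_square algebra_simps)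
  ultimately have "1 + d\<^sup>2 \<le> (sqrt (1 + c\<^sup>2) + (d - c))\<^sup>2" by linarith
  then show "sqrt (1 + d\<^sup>2) \<le> sqrt (1 + c\<^sup>2) + (d - c)" using c by (intro real_le_lsqrt) auto
qed auto

definition scaled_denominator :: "(real \<Rightarrow> real) \<Rightarrow> real \<Rightarrow> real \<Rightarrow> real" where
  "scaled_denominator \<kappa> L t = \<kappa> t / L * min_denominator (\<kappa> t / L) t"

lemma scaled_denominator_le_iff:
  assumes "aperture \<kappa>" "0 < L"
  shows "scaled_denominator \<kappa> L t \<le> u \<longleftrightarrow> t \<in> near_rational (\<kappa> t / L) (u * L / \<kappa> t)"
proof -
  have k: "1 \<le> \<kappa> t" using assms unfolding aperture_def by blast
  then have "0 < \<kappa> t / L" using assms by simp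
  from near_rational_iff_min_denominator[OF this] show ?thesis
    unfolding scaled_denominator_def using k assms by (simp add: field_simps)
qed

lemma scaled_denominator_bounds:
  assumes "aperture \<kappa>" "0 < L"
  shows "0 < scaled_denominator \<kappa> L t" "scaled_denominator \<kappa> L t \<le> 1 + \<kappa> t / L"
proof -
  have "1 \<le> \<kappa> t" using assms unfolding aperture_def by blast
  then have e: "0 < \<kappa> t / L" using assms by simp
  show "0 < scaled_denominator \<kappa> L t" "scaled_denominator \<kappa> L t \<le> 1 + \<kappa> t / L"
    unfolding scaled_denominator_def using min_denominator_props(1,3)[OF e, of t] e
    by (auto intro!: mult_pos_pos simp del: times_divide_eq_left)
qed

lemma scaled_denominator_measurable:
  assumes k: "aperture \<kappa>" and L: "0 < L"
  shows "scaled_denominator \<kappa> L \<in> borel_measurable borel"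
proof (rule borel_measurable_iff_le[THEN iffD2], rule allI)
  fix u
  have [measurable]: "\<kappa> \<in> borel_measurable borel" using k unfolding aperture_def by blast
  have "{t \<in> space borel. scaled_denominator \<kappa> L t \<le> u}
     = (\<Union>q\<in>{q::int. 1 \<le> q}. \<Union>p::int. {t. of_int q \<le> u * L / \<kappa> t \<and> \<bar>of_int q * t - of_int p\<bar> \<le> \<kappa> t / L})"
    unfolding scaled_denominator_le_iff[OF k L] near_rational_def by auto
  moreover have "{t. of_int q \<le> u * L / \<kappa> t \<and> \<bar>of_int q * t - of_int p\<bar> \<le> \<kappa> t / L} \<in> sets borel" for q p :: int
    by measurable
  ultimately show "{t \<in> space borel. scaled_denominator \<kappa> L t \<le> u} \<in> sets borel"
    by (auto intro!: sets.countable_UN'' sets.countable_UN)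
qed

lemma near_rational_mono: "\<epsilon> \<le> \<epsilon>' \<Longrightarrow> U \<le> U' \<Longrightarrow> near_rational \<epsilon> U \<subseteq> near_rational \<epsilon>' U'"
  unfolding near_rational_def by (auto intro: order.trans)

text \<open>\<open>near_rational_limit\<close> with \<open>L / k1\<close> for \<open>L\<close>.\<close>

lemma near_rational_limit_scaled:
  assumes ab: "0 \<le> a" "a < b" "b \<le> 1" and u: "0 < u" and k: "0 < k1" "0 < k2" "u * k1 / k2 < 1"
  shows "((\<lambda>L. measure lborel ({a<..<b} \<inter> near_rational (k1 / L) (u * L / k2))) \<longlongrightarrow> (b - a) * limit_cdf (u * k1 / k2)) at_top"
proof -
  have "0 < u * k1 / k2" using u k by simp
  note lim = near_rational_limit[OF ab this k(3)]
  have "filterlim (\<lambda>L. L / k1) at_top at_top" using k(1) by real_asymp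
  from filterlim_compose[OF lim this] show ?thesis using k by (simp add: field_simps)
qed

text \<open>On a short interval the aperture lies between its values \<open>k1\<close> and \<open>k2\<close> at the endpoints, and the
event lies between two sets \<open>near_rational\<close> with constant parameters. These have the scaled
thresholds \<open>u * k1 / k2\<close> and \<open>u * k2 / k1\<close>, which differ from \<open>u\<close> by at most \<open>d - c\<close>; the Lipschitz
constant of \<open>limit_cdf\<close> is at most \<open>2\<close>.\<close>

lemma scaled_denominator_piece:
  assumes k: "aperture \<kappa>" and cd: "0 \<le> c" "c < d" "d \<le> 1" and u: "0 < u" "u * (1 + (d - c)) < 1" and \<delta>: "0 < \<delta>"
  shows "eventually (\<lambda>L. \<bar>measure lborel ({c<..d} \<inter> {t. scaled_denominator \<kappa> L t \<le> u}) - (d - c) * limit_cdf u\<bar> \<le> (d - c) * (2 * (d - c)) + \<delta>) at_top"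
proof -
  define k1 k2 where "k1 = \<kappa> c" and "k2 = \<kappa> d"
  have kk: "1 \<le> k1" "k1 \<le> k2" "k2 \<le> k1 + (d - c)" and kt: "\<And>t. t \<in> {c<..d} \<Longrightarrow> k1 \<le> \<kappa> t \<and> \<kappa> t \<le> k2"
    using k cd unfolding aperture_def k1_def k2_def by auto
  have u1: "u < 1"
  proof -
    have "u * 1 \<le> u * (1 + (d - c))" using u cd by (intro mult_left_mono) auto
    then show ?thesis using u(2) by linarith
  qed
  have pi: "12 / pi\<^sup>2 \<le> 2"
  proof -
    have "3\<^sup>2 \<le> pi\<^sup>2" using pi_gt3 by (intro power_mono) auto
    then show ?thesis by (simp add: field_simps)
  qed
  have r2: "k2 / k1 \<le> 1 + (d - c)"
  proof -
    have "k2 \<le> k1 + (d - c) * 1" using kk by simp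
    also have "\<dots> \<le> k1 + (d - c) * k1" using kk cd by (intro add_left_mono mult_left_mono) auto
    finally show ?thesis using kk by (simp add: field_simps)
  qed
  have up1: "u * k2 / k1 < 1" "u \<le> u * k2 / k1" "u * k2 / k1 - u \<le> d - c"
  proof -
    have "u * (k2 / k1) \<le> u * (1 + (d - c))" using r2 u by (intro mult_left_mono) auto
    then show "u * k2 / k1 < 1" using u by simp
    have "u * 1 \<le> u * (k2 / k1)" using u kk by (intro mult_left_mono) auto
    then show "u \<le> u * k2 / k1" by simp
    have "u * (k2 / k1 - 1) \<le> 1 * (d - c)" using u u1 r2 kk by (intro mult_mono) auto
    then show "u * k2 / k1 - u \<le> d - c" by (simp add: right_diff_distrib)
  qed
  have lo1: "u * k1 / k2 \<le> u" "u - u * k1 / k2 \<le> d - c" "0 < u * k1 / k2"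
  proof -
    have "u * (k1 / k2) \<le> u * 1" using u kk by (intro mult_left_mono) auto
    then show "u * k1 / k2 \<le> u" by simp
    have "1 - k1 / k2 = (k2 - k1) / k2" using kk by (simp add: field_simps)
    also have "\<dots> \<le> (k2 - k1) / 1" using kk by (intro divide_left_mono) auto
    finally have "1 - k1 / k2 \<le> d - c" using kk by simp
    then have "u * (1 - k1 / k2) \<le> 1 * (d - c)" using u u1 kk by (intro mult_mono) auto
    then show "u - u * k1 / k2 \<le> d - c" by (simp add: right_diff_distrib)
    show "0 < u * k1 / k2" using u kk by simp
  qed
  have U: "limit_cdf (u * k2 / k1) \<le> limit_cdf u + 2 * (d - c)"
  proof -
    have "limit_cdf (u * k2 / k1) - limit_cdf u \<le> 12 / pi\<^sup>2 * (u * k2 / k1 - u)"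
      using up1 u by (intro limit_cdf_mono_lipschitz) auto
    also have "\<dots> \<le> 2 * (d - c)" using pi up1 by (intro mult_mono) auto
    finally show ?thesis by simp
  qed
  have Lo: "limit_cdf u - 2 * (d - c) \<le> limit_cdf (u * k1 / k2)"
  proof -
    have "limit_cdf u - limit_cdf (u * k1 / k2) \<le> 12 / pi\<^sup>2 * (u - u * k1 / k2)"
      using lo1 u1 by (intro limit_cdf_mono_lipschitz) auto
    also have "\<dots> \<le> 2 * (d - c)" using pi lo1 by (intro mult_mono) auto
    finally show ?thesis by simp
  qed
  let ?up = "\<lambda>L. measure lborel ({c<..<d} \<inter> near_rational (k2 / L) (u * L / k1))"
  let ?lo = "\<lambda>L. measure lborel ({c<..<d} \<inter> near_rational (k1 / L) (u * L / k2))"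
  have "(?up \<longlongrightarrow> (d - c) * limit_cdf (u * k2 / k1)) at_top" using kk up1 by (intro near_rational_limit_scaled cd u) auto
  then have e1: "eventually (\<lambda>L. dist (?up L) ((d - c) * limit_cdf (u * k2 / k1)) < \<delta>) at_top" using \<delta> by (intro tendstoD)
  have "(?lo \<longlongrightarrow> (d - c) * limit_cdf (u * k1 / k2)) at_top" using kk lo1(1) u1 by (intro near_rational_limit_scaled cd u; linarith)
  then have e2: "eventually (\<lambda>L. dist (?lo L) ((d - c) * limit_cdf (u * k1 / k2)) < \<delta>) at_top" using \<delta> by (intro tendstoD)
  show ?thesis using e1 e2 eventually_gt_at_top[of 0]
  proof eventually_elim
    case (elim L)
    let ?S = "{t. scaled_denominator \<kappa> L t \<le> u}"
    have S: "?S \<in> sets borel"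
    proof -
      have [measurable]: "scaled_denominator \<kappa> L \<in> borel_measurable borel" using scaled_denominator_measurable[OF k elim(3)] .
      show ?thesis by measurable
    qed
    have fm: "{c<..d} \<inter> ?S \<in> fmeasurable lborel" "{c<..<d} \<inter> ?S \<in> fmeasurable lborel"
      by (rule bounded_borel_fmeasurable[of _ c d]; use S in auto)+
    have fn: "{c<..<d} \<inter> near_rational x y \<in> fmeasurable lborel" for x y
      by (rule bounded_borel_fmeasurable[of _ c d]; use near_rational_borel in auto)
    have eq: "measure lborel ({c<..d} \<inter> ?S) = measure lborel ({c<..<d} \<inter> ?S)"
    proof (rule measure_eq_AE)
      show "AE t in lborel. t \<in> {c<..d} \<inter> ?S \<longleftrightarrow> t \<in> {c<..<d} \<inter> ?S" using AE_lborel_singleton[of d] by eventually_elim auto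
    qed (use fm in auto)
    have S_iff: "t \<in> ?S \<longleftrightarrow> t \<in> near_rational (\<kappa> t / L) (u * L / \<kappa> t)" for t
      using scaled_denominator_le_iff[OF k elim(3), of t u] by simp
    have "{c<..<d} \<inter> ?S \<subseteq> {c<..<d} \<inter> near_rational (k2 / L) (u * L / k1)"
    proof
      fix t assume t: "t \<in> {c<..<d} \<inter> ?S"
      have "near_rational (\<kappa> t / L) (u * L / \<kappa> t) \<subseteq> near_rational (k2 / L) (u * L / k1)"
        using kt[of t] t kk u elim(3) by (intro near_rational_mono divide_right_mono divide_left_mono) auto
      then show "t \<in> {c<..<d} \<inter> near_rational (k2 / L) (u * L / k1)" using t S_iff by blast
    qed
    then have a: "measure lborel ({c<..<d} \<inter> ?S) \<le> ?up L" by (rule measure_mono_fmeasurable[OF _ fmeasurableD[OF fm(2)] fn])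
    have "{c<..<d} \<inter> near_rational (k1 / L) (u * L / k2) \<subseteq> {c<..<d} \<inter> ?S"
    proof
      fix t assume t: "t \<in> {c<..<d} \<inter> near_rational (k1 / L) (u * L / k2)"
      have "near_rational (k1 / L) (u * L / k2) \<subseteq> near_rational (\<kappa> t / L) (u * L / \<kappa> t)"
        using kt[of t] t kk u elim(3) by (intro near_rational_mono divide_right_mono divide_left_mono) auto
      then show "t \<in> {c<..<d} \<inter> ?S" using t S_iff by blast
    qed
    then have b: "?lo L \<le> measure lborel ({c<..<d} \<inter> ?S)" by (rule measure_mono_fmeasurable[OF _ fmeasurableD[OF fn] fm(2)])
    have "(d - c) * limit_cdf (u * k2 / k1) \<le> (d - c) * (limit_cdf u + 2 * (d - c))" using U cd by (intro mult_left_mono) auto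
    moreover have "(d - c) * (limit_cdf u - 2 * (d - c)) \<le> (d - c) * limit_cdf (u * k1 / k2)" using Lo cd by (intro mult_left_mono) auto
    ultimately show ?case using a b elim unfolding eq dist_real_def by (simp add: algebra_simps)
  qed
qed

text \<open>On \<open>n\<close> pieces of length \<open>h \<le> 1 / n\<close> the errors \<open>2 * h\<^sup>2\<close> add up to at most \<open>2 / n\<close>.\<close>

lemma scaled_denominator_limit:
  assumes k: "aperture \<kappa>" and ab: "0 \<le> a" "a \<le> b" "b \<le> 1" and u: "0 < u" "u < 1"
  shows "((\<lambda>L. measure lborel ({a<..b} \<inter> {t. scaled_denominator \<kappa> L t \<le> u})) \<longlongrightarrow> (b - a) * limit_cdf u) at_top"
proof (cases "a = b")
  case False
  then have ab': "a < b" using ab by simp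
  show ?thesis
  proof (rule tendstoI)
    fix e :: real assume e: "0 < e"
    have "((\<lambda>n. u * (1 + 1 / real n)) \<longlongrightarrow> u * (1 + 0)) sequentially" by (intro tendsto_intros lim_1_over_n)
    then have "eventually (\<lambda>n. u * (1 + 1 / real n) < 1) sequentially" using u by (intro order_tendstoD) auto
    moreover have "eventually (\<lambda>n. 2 / real n < e / 2) sequentially"
    proof -
      have "((\<lambda>n. 2 / real n) \<longlongrightarrow> 0) sequentially" by real_asymp
      then show ?thesis using e by (intro order_tendstoD) auto
    qed
    ultimately have "eventually (\<lambda>n. u * (1 + 1 / real n) < 1 \<and> 2 / real n < e / 2 \<and> 0 < n) sequentially"
      using eventually_gt_at_top[of 0] by eventually_elim auto
    then obtain n where n: "u * (1 + 1 / real n) < 1" "2 / real n < e / 2" "0 < n"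
      unfolding eventually_sequentially by blast
    define h where "h = (b - a) / n"
    have nr: "0 < real n" using n by simp
    have h: "0 < h" "h \<le> 1 / n" unfolding h_def using ab ab' nr by (auto intro: divide_right_mono)
    define p where "p j = a + real j * h" for j
    have pn: "p n = b" "p 0 = a" unfolding p_def h_def using n by auto
    have ps: "p (Suc j) - p j = h" for j unfolding p_def by (simp add: algebra_simps)
    have pm: "mono p" unfolding p_def using h by (auto intro!: monoI mult_right_mono)
    let ?m = "\<lambda>c d L. measure lborel ({c<..d} \<inter> {t. scaled_denominator \<kappa> L t \<le> u})"
    have "eventually (\<lambda>L. \<forall>j\<in>{..<n}. \<bar>?m (p j) (p (Suc j)) L - h * limit_cdf u\<bar> \<le> h * (2 * h) + e / (2 * n)) at_top"
    proof (rule eventually_ball_finite, simp, rule ballI)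
      fix j assume j: "j \<in> {..<n}"
      have "p 0 \<le> p j" "p (Suc j) \<le> p n" using j pm by (auto intro: monoD)
      moreover have "u * (1 + h) \<le> u * (1 + 1 / real n)" using h u by (intro mult_left_mono) auto
      moreover from this have "u * (1 + h) < 1" using n(1) by linarith
      ultimately show "eventually (\<lambda>L. \<bar>?m (p j) (p (Suc j)) L - h * limit_cdf u\<bar> \<le> h * (2 * h) + e / (2 * n)) at_top"
        using scaled_denominator_piece[OF k, of "p j" "p (Suc j)" u "e / (2 * n)"] ps[of j] h n e ab u pn nr by simp
    qed
    then show "eventually (\<lambda>L. dist (?m a b L) ((b - a) * limit_cdf u) < e) at_top"
      using eventually_gt_at_top[of 0]
    proof eventually_elim
      case (elim L)
      let ?S = "{t. scaled_denominator \<kappa> L t \<le> u}"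
      have S: "?S \<in> sets borel"
      proof -
        have [measurable]: "scaled_denominator \<kappa> L \<in> borel_measurable borel" using scaled_denominator_measurable[OF k elim(2)] .
        show ?thesis by measurable
      qed
      have fm: "{c<..d} \<inter> ?S \<in> fmeasurable lborel" for c d
        by (rule bounded_borel_fmeasurable[of _ c d]; use S in auto)
      have add: "?m a (p (Suc j)) L - ?m a (p j) L = ?m (p j) (p (Suc j)) L" for j
      proof -
        have le: "a \<le> p j" "p j \<le> p (Suc j)" using pm pn by (auto intro: monoD simp flip: pn(2))
        have 1: "{a<..p (Suc j)} \<inter> ?S = ({a<..p j} \<inter> ?S) \<union> ({p j<..p (Suc j)} \<inter> ?S)" using le by auto
        have 2: "({p j<..p (Suc j)} \<inter> ?S) - ({a<..p j} \<inter> ?S) = {p j<..p (Suc j)} \<inter> ?S" by auto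
        show ?thesis unfolding 1 using measure_Un2[OF fm fm, of a "p j" "p j" "p (Suc j)"] unfolding 2 by simp
      qed
      have "?m a b L = (\<Sum>j<n. ?m (p j) (p (Suc j)) L)"
        using sum_lessThan_telescope[of "\<lambda>j. ?m a (p j) L" n] unfolding add pn by simp
      moreover have "(b - a) * limit_cdf u = (\<Sum>j<n. h * limit_cdf u)" unfolding h_def using n by simp
      ultimately have "\<bar>?m a b L - (b - a) * limit_cdf u\<bar> \<le> (\<Sum>j<n. h * (2 * h) + e / (2 * n))"
        unfolding sum_subtractf[symmetric] using elim(1)
        by (simp only: sum_subtractf[symmetric]) (rule order.trans[OF sum_abs], rule sum_mono, auto)
      also have "\<dots> = (n * h) * (2 * h) + e / 2" using n by (simp add: field_simps)
      also have "\<dots> \<le> 1 * (2 / n) + e / 2"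
      proof (intro add_right_mono mult_mono)
        show "real n * h \<le> 1" unfolding h_def using n ab by simp
        show "2 * h \<le> 2 / n" using h by simp
      qed (use h in auto)
      also have "\<dots> < e" using n by simp
      finally show ?case by (simp add: dist_real_def)
    qed
  qed
qed simp

section \<open>Joint convergence of slope and denominator\<close>

definition limit_law :: "real measure" where
  "limit_law = density lborel (\<lambda>u. ennreal (indicator {0<..1} u * limit_density u))"

lemma sets_limit_law [simp, measurable_cong]: "sets limit_law = sets borel"
  unfolding limit_law_def by simp

lemma space_limit_law [simp]: "space limit_law = UNIV"
  unfolding limit_law_def by simp

lemma limit_density_indicator_nonneg: "0 \<le> indicator {0<..1} u * limit_density u"
  using limit_density_bounds(1)[of u] by (auto simp: indicator_def)

lemma integral_limit_law:
  assumes "f \<in> borel_measurable borel"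
  shows "integral\<^sup>L limit_law f = (LBINT u:{0<..1}. f u * limit_density u)"
proof -
  have "integral\<^sup>L limit_law f = (\<integral>u. (indicator {0<..1} u * limit_density u) *\<^sub>R f u \<partial>lborel)"
    unfolding limit_law_def using assms limit_density_indicator_nonneg by (intro integral_density) auto
  then show ?thesis unfolding set_lebesgue_integral_def by (simp add: mult.assoc mult.commute[of "f _"])
qed

lemma emeasure_limit_law:
  assumes S: "S \<in> sets borel"
  shows "emeasure limit_law S = ennreal (LBINT u:S \<inter> {0<..1}. limit_density u)"
proof -
  have "emeasure limit_law S = (\<integral>\<^sup>+u. ennreal (indicator {0<..1} u * limit_density u) * indicator S u \<partial>lborel)"
    unfolding limit_law_def using S by (intro emeasure_density) auto
  also have "\<dots> = (\<integral>\<^sup>+u. ennreal (indicator (S \<inter> {0<..1}) u *\<^sub>R limit_density u) \<partial>lborel)"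
    by (intro nn_integral_cong) (auto simp: indicator_def)
  also have "\<dots> = ennreal (LBINT u:S \<inter> {0<..1}. limit_density u)"
    unfolding set_lebesgue_integral_def
  proof (rule nn_integral_eq_integral)
    show "integrable lborel (\<lambda>u. indicator (S \<inter> {0<..1}) u *\<^sub>R limit_density u)"
      using set_integrable_limit_density[of "S \<inter> {0<..1}"] S unfolding set_integrable_def by auto
    show "AE u in lborel. 0 \<le> indicator (S \<inter> {0<..1}) u *\<^sub>R limit_density u"
      using limit_density_bounds(1) by (intro AE_I2) (auto simp: indicator_def)
  qed
  finally show ?thesis .
qed

lemma limit_cdf_nonneg: "0 \<le> z \<Longrightarrow> z \<le> 1 \<Longrightarrow> 0 \<le> limit_cdf z"
  unfolding limit_cdf_def set_lebesgue_integral_def using limit_density_bounds(1)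
  by (intro integral_nonneg_AE AE_I2) (auto simp: indicator_def)

lemma measure_limit_law_Ioc:
  assumes "0 \<le> z" "z \<le> 1" shows "measure limit_law {0<..z} = limit_cdf z"
proof -
  have "{0<..z} \<inter> {0<..1} = {0<..z}" using assms by auto
  then show ?thesis unfolding measure_def using emeasure_limit_law[of "{0<..z}"] limit_cdf_nonneg[OF assms]
    by (simp add: limit_cdf_def)
qed

lemma prob_space_limit_law: "prob_space limit_law"
proof
  have "emeasure limit_law (space limit_law) = ennreal (limit_cdf 1)"
    unfolding space_limit_law using emeasure_limit_law[of UNIV] by (simp add: limit_cdf_def)
  then show "emeasure limit_law (space limit_law) = 1" by (simp add: limit_cdf_1)
qed

lemma measure_limit_law_UNIV [simp]: "measure limit_law UNIV = 1"
  using prob_space.prob_space[OF prob_space_limit_law] by simp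

lemma AE_limit_law: "AE u in limit_law. u \<in> {0<..1}"
proof -
  interpret prob_space limit_law by (rule prob_space_limit_law)
  have "prob {0<..1} = 1" using measure_limit_law_Ioc[of 1] limit_cdf_1 by simp
  then show ?thesis by (rule prob_eq_1[THEN iffD1, rotated]) simp
qed

lemma pair_limit_law_integral:
  fixes P :: "real measure" and f :: "real \<times> real \<Rightarrow> real"
  assumes P: "finite_measure P" "sets P = sets borel" and f: "f \<in> borel_measurable borel"
    and B: "AE x in P. \<forall>u\<in>{0<..1}. \<bar>f (x, u)\<bar> \<le> B"
  shows "integrable (P \<Otimes>\<^sub>M limit_law) f"
    and "integral\<^sup>L (P \<Otimes>\<^sub>M limit_law) f = (\<integral>x. (LBINT u:{0<..1}. f (x, u) * limit_density u) \<partial>P)"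
proof -
  interpret P: finite_measure P by fact
  interpret D: prob_space limit_law by (rule prob_space_limit_law)
  interpret PD: pair_sigma_finite P limit_law ..
  have sets: "sets (P \<Otimes>\<^sub>M limit_law) = sets borel"
    using sets_pair_measure_cong[OF P(2) sets_limit_law] by (simp only: borel_prod)
  have [measurable]: "f \<in> borel_measurable (P \<Otimes>\<^sub>M limit_law)"
    using f measurable_cong_sets[OF sets refl] by blast
  have spP: "space P = UNIV" using sets_eq_imp_space_eq[OF P(2)] by simp
  have fm: "(\<lambda>u. f (x, u)) \<in> borel_measurable borel" for x
    using f unfolding borel_prod[symmetric] by measurable
  have fin: "finite_measure (P \<Otimes>\<^sub>M limit_law)"
    by (rule finite_measure_pair_measure) (unfold_locales)
  show int: "integrable (P \<Otimes>\<^sub>M limit_law) f"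
  proof (rule PD.Fubini_integrable)
    show "f \<in> borel_measurable (P \<Otimes>\<^sub>M limit_law)" by measurable
    have ae: "AE x in P. AE u in limit_law. \<bar>f (x, u)\<bar> \<le> B"
      using B
    proof eventually_elim
      case (elim x)
      show ?case using AE_limit_law by eventually_elim (use elim in auto)
    qed
    have fml: "(\<lambda>u. f (x, u)) \<in> borel_measurable limit_law" for x using fm[of x] by simp
    show "AE x in P. integrable limit_law (\<lambda>u. f (x, u))"
      using ae by eventually_elim (rule D.integrable_const_bound, auto intro: fml)
    show "integrable P (\<lambda>x. \<integral>u. norm (f (x, u)) \<partial>limit_law)"
    proof (rule P.integrable_const_bound)
      show "AE x in P. norm (\<integral>u. norm (f (x, u)) \<partial>limit_law) \<le> \<bar>B\<bar>"
        using ae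
      proof eventually_elim
        case (elim x)
        have "(\<integral>u. norm (f (x, u)) \<partial>limit_law) \<le> (\<integral>u. \<bar>B\<bar> \<partial>limit_law)"
          using elim fml by (intro integral_mono_AE D.integrable_const_bound[of _ "\<bar>B\<bar>"]) (auto elim!: eventually_mono)
        then show ?case by simp
      qed
    qed measurable
  qed
  show "integral\<^sup>L (P \<Otimes>\<^sub>M limit_law) f = (\<integral>x. (LBINT u:{0<..1}. f (x, u) * limit_density u) \<partial>P)"
    unfolding PD.integral_fst'[OF int, symmetric] using fm by (simp add: integral_limit_law)
qed

lemma arctan_substitution:
  fixes F :: "real \<Rightarrow> real"
  assumes i: "0 \<le> i0" "i0 \<le> i1" "i1 \<le> pi / 4" and F: "F \<in> borel_measurable borel" "\<And>\<omega>. \<omega> \<in> {i0..i1} \<Longrightarrow> \<bar>F \<omega>\<bar> \<le> B"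
  shows "(LBINT \<omega>:{i0..i1}. F \<omega>) = (LBINT t:{tan i0..tan i1}. F (arctan t) / (1 + t\<^sup>2))"
    and "set_integrable lborel {tan i0..tan i1} (\<lambda>t. F (arctan t) / (1 + t\<^sup>2))"
proof -
  have b: "- (pi / 2) < i0" "i0 < pi / 2" "- (pi / 2) < i1" "i1 < pi / 2" using i pi_gt_zero by linarith+
  have at: "arctan (tan i0) = i0" "arctan (tan i1) = i1" using b by (auto intro: arctan_tan)
  have le: "tan i0 \<le> tan i1" using i b by (intro tan_mono_le) auto
  have "set_integrable lborel {i0..i1} F"
    by (rule set_integrable_bounded[of _ _ _ B]) (use F in \<open>auto simp: emeasure_lborel_Icc_eq\<close>)
  then have int: "set_integrable lborel {arctan (tan i0)..arctan (tan i1)} F" unfolding at .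
  have d: "(arctan has_real_derivative inverse (1 + t\<^sup>2)) (at t)" for t by (rule DERIV_arctan)
  have c: "continuous_on {tan i0..tan i1} (\<lambda>t::real. inverse (1 + t\<^sup>2))"
    by (intro continuous_intros) (auto simp: add_nonneg_eq_0_iff)
  note sub = integral_substitution[OF int d c _ le]
  show "(LBINT \<omega>:{i0..i1}. F \<omega>) = (LBINT t:{tan i0..tan i1}. F (arctan t) / (1 + t\<^sup>2))"
    using sub(2) unfolding at set_lebesgue_integral_def by (simp add: field_simps)
  show "set_integrable lborel {tan i0..tan i1} (\<lambda>t. F (arctan t) / (1 + t\<^sup>2))"
    using sub(1) by (simp add: field_simps)
qed

lemma set_integral_diff_bound:
  fixes f g :: "real \<Rightarrow> real"
  assumes "set_integrable lborel {a..b} f" "set_integrable lborel {a..b} g" "a \<le> b" "\<And>x. x \<in> {a..b} \<Longrightarrow> \<bar>f x - g x\<bar> \<le> \<delta>"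
  shows "\<bar>(LBINT x:{a..b}. f x) - (LBINT x:{a..b}. g x)\<bar> \<le> \<delta> * (b - a)"
proof -
  have i: "set_integrable lborel {a..b} (\<lambda>x. f x - g x)" by (intro set_integral_diff assms)
  have "\<bar>(LBINT x:{a..b}. f x) - (LBINT x:{a..b}. g x)\<bar> = \<bar>LBINT x:{a..b}. f x - g x\<bar>"
    by (simp add: set_integral_diff(2)[OF assms(1,2)])
  also have "\<dots> \<le> (LBINT x:{a..b}. \<bar>f x - g x\<bar>)"
    unfolding set_lebesgue_integral_def by (rule order.trans[OF integral_abs_bound]) (simp add: abs_mult)
  also have "\<dots> \<le> (LBINT x:{a..b}. \<delta>)"
    using assms i by (intro set_integral_mono set_integrable_abs) (auto simp: set_integrable_def)
  also have "\<dots> = \<delta> * (b - a)" using assms by (simp add: set_lebesgue_integral_def)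
  finally show ?thesis .
qed

text \<open>The pair of the slope and the scaled denominator converges to a pair of independent variables: on
rectangles this is \<open>scaled_denominator_limit\<close>. Truncation at \<open>1\<close> keeps the second variable in the
compact interval on which \<open>\<Psi>\<close> is uniformly continuous; the limit law lives there anyway.\<close>

lemma joint_limit:
  fixes \<Psi> :: "real \<times> real \<Rightarrow> real"
  assumes k: "aperture \<kappa>" and ab: "0 \<le> a" "a < b" "b \<le> 1" and cont: "continuous_on ({a..b} \<times> {0..1}) \<Psi>" and m: "\<Psi> \<in> borel_measurable borel"
  shows "((\<lambda>L. LBINT t:{a..b}. \<Psi> (t, min (scaled_denominator \<kappa> L t) 1)) \<longlongrightarrow> (LBINT t:{a..b}. LBINT u:{0<..1}. \<Psi> (t, u) * limit_density u)) at_top"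
proof -
  let ?R = "{a<..b} \<times> {0<..1::real}"
  \<comment> \<open>Replacing \<open>L\<close> by \<open>max L 1\<close> makes \<open>Z L\<close> measurable and positive for every index.\<close>
  define Z where "Z L t = min (scaled_denominator \<kappa> (max L 1) t) 1" for L t
  have [measurable]: "Z L \<in> borel_measurable borel" for L
    unfolding Z_def using scaled_denominator_measurable[OF k, of "max L 1"] by measurable
  have Z: "0 < Z L t" "Z L t \<le> 1" for L t unfolding Z_def using scaled_denominator_bounds(1)[OF k, of "max L 1" t] by auto
  define A where "A = density lborel (\<lambda>t. ennreal (indicator {a<..b} t))"
  have sA [simp, measurable_cong]: "sets A = sets borel" unfolding A_def by simp
  have spA: "space A = UNIV" unfolding A_def by simp
  have emA: "emeasure A S = emeasure lborel (S \<inter> {a<..b})" if "S \<in> sets borel" for S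
  proof -
    have "emeasure A S = (\<integral>\<^sup>+t. ennreal (indicator {a<..b} t) * indicator S t \<partial>lborel)"
      unfolding A_def using that by (intro emeasure_density) auto
    also have "\<dots> = (\<integral>\<^sup>+t. indicator (S \<inter> {a<..b}) t \<partial>lborel)" by (intro nn_integral_cong) (auto simp: indicator_def)
    also have "\<dots> = emeasure lborel (S \<inter> {a<..b})" using that by (intro nn_integral_indicator) auto
    finally show ?thesis .
  qed
  have fA: "finite_measure A"
  proof (rule finite_measureI)
    have "emeasure A (space A) = emeasure lborel {a<..b}" unfolding spA using emA[of UNIV] by simp
    then show "emeasure A (space A) \<noteq> \<infinity>" using ab by simp
  qed
  have intA: "integral\<^sup>L A f = (LBINT t:{a<..b}. f t)" if "f \<in> borel_measurable borel" for f :: "real \<Rightarrow> real"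
    unfolding A_def set_lebesgue_integral_def using that by (intro integral_density) auto
  define \<mu> where "\<mu> L = distr A borel (\<lambda>t. (t, Z L t))" for L
  have mm: "(\<lambda>t. (t, Z L t)) \<in> measurable A borel" for L unfolding borel_prod[symmetric] by measurable
  have f\<mu>: "finite_measure (\<mu> L)" for L unfolding \<mu>_def using fA mm by (rule finite_measure.finite_measure_distr)
  interpret A: finite_measure A by fact
  interpret D: prob_space limit_law by (rule prob_space_limit_law)
  interpret AD: pair_sigma_finite A limit_law ..
  have fAD: "finite_measure (A \<Otimes>\<^sub>M limit_law)" by (rule finite_measure_pair_measure) (unfold_locales)
  have sAD: "sets (A \<Otimes>\<^sub>M limit_law) = sets borel"
    using sets_pair_measure_cong[OF sA sets_limit_law] by (simp only: borel_prod)
  have rect: "measure (A \<Otimes>\<^sub>M limit_law) ({a<..y} \<times> {0<..z}) = (y - a) * limit_cdf z" if "y \<in> {a..b}" "z \<in> {0..1}" for y z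
  proof -
    have "emeasure (A \<Otimes>\<^sub>M limit_law) ({a<..y} \<times> {0<..z}) = emeasure A {a<..y} * emeasure limit_law {0<..z}"
      by (intro D.emeasure_pair_measure_Times) auto
    also have "emeasure A {a<..y} = ennreal (y - a)"
    proof -
      have "{a<..y} \<inter> {a<..b} = {a<..y}" using that by auto
      then show ?thesis using emA[of "{a<..y}"] that by simp
    qed
    also have "emeasure limit_law {0<..z} = ennreal (limit_cdf z)"
      using measure_limit_law_Ioc[of z] that by (simp add: D.emeasure_eq_measure)
    finally show ?thesis using that limit_cdf_nonneg[of z] by (simp add: measure_def enn2real_mult)
  qed
  have lim: "((\<lambda>L. LINT x:?R|\<mu> L. \<Psi> x) \<longlongrightarrow> (LINT x:?R|(A \<Otimes>\<^sub>M limit_law). \<Psi> x)) at_top"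
  proof (rule rectangle_weak_convergence[OF f\<mu> _ fAD sAD ab(2) zero_less_one _ cont])
    show "sets (\<mu> L) = sets borel" for L unfolding \<mu>_def by simp
    fix y z :: real assume y: "y \<in> {a..b}" and z: "z \<in> {0..1}"
    have meas: "measure (\<mu> L) ({a<..y} \<times> {0<..z}) = measure lborel ({a<..y} \<inter> {t. Z L t \<le> z})" for L
    proof -
      have B: "{a<..y} \<times> {0<..z} \<in> sets borel" by (intro borel_Times) auto
      have "measure (\<mu> L) ({a<..y} \<times> {0<..z}) = measure A ((\<lambda>t. (t, Z L t)) -` ({a<..y} \<times> {0<..z}) \<inter> space A)"
        unfolding \<mu>_def using mm B by (rule measure_distr)
      also have "(\<lambda>t. (t, Z L t)) -` ({a<..y} \<times> {0<..z}) \<inter> space A = {a<..y} \<inter> {t. Z L t \<le> z}"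
        using Z(1)[of L] spA by auto
      also have "measure A ({a<..y} \<inter> {t. Z L t \<le> z}) = measure lborel (({a<..y} \<inter> {t. Z L t \<le> z}) \<inter> {a<..b})"
        unfolding measure_def by (subst emA) (simp_all, measurable)
      also have "({a<..y} \<inter> {t. Z L t \<le> z}) \<inter> {a<..b} = {a<..y} \<inter> {t. Z L t \<le> z}" using y by auto
      finally show ?thesis .
    qed
    show "((\<lambda>L. measure (\<mu> L) ({a<..y} \<times> {0<..z})) \<longlongrightarrow> measure (A \<Otimes>\<^sub>M limit_law) ({a<..y} \<times> {0<..z})) at_top"
      unfolding meas rect[OF y z]
    proof (cases "z = 0 \<or> z = 1")
      case True
      then show "((\<lambda>L. measure lborel ({a<..y} \<inter> {t. Z L t \<le> z})) \<longlongrightarrow> (y - a) * limit_cdf z) at_top"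
      proof
        assume 0: "z = 0"
        have "\<not> Z L t \<le> z" for L t using Z(1)[of L t] 0 by simp
        then have "{a<..y} \<inter> {t. Z L t \<le> z} = {}" for L by auto
        moreover have "limit_cdf z = 0" unfolding 0 limit_cdf_def set_lebesgue_integral_def by simp
        ultimately show ?thesis by simp
      next
        assume 1: "z = 1"
        have "{a<..y} \<inter> {t. Z L t \<le> z} = {a<..y}" for L using Z(2)[of L] 1 by auto
        then show ?thesis using y 1 limit_cdf_1 by simp
      qed
    next
      case False
      then have z1: "0 < z" "z < 1" using z by auto
      have "((\<lambda>L. measure lborel ({a<..y} \<inter> {t. scaled_denominator \<kappa> L t \<le> z})) \<longlongrightarrow> (y - a) * limit_cdf z) at_top"
        using y ab by (intro scaled_denominator_limit k z1) auto
      moreover have "eventually (\<lambda>L. measure lborel ({a<..y} \<inter> {t. scaled_denominator \<kappa> L t \<le> z}) = measure lborel ({a<..y} \<inter> {t. Z L t \<le> z})) at_top"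
        using eventually_ge_at_top[of 1]
      proof eventually_elim
        case (elim L)
        have "{t. scaled_denominator \<kappa> L t \<le> z} = {t. Z L t \<le> z}" unfolding Z_def using elim z1 by (auto simp: min_le_iff_disj max_absorb1)
        then show ?case by simp
      qed
      ultimately show "((\<lambda>L. measure lborel ({a<..y} \<inter> {t. Z L t \<le> z})) \<longlongrightarrow> (y - a) * limit_cdf z) at_top"
        by (rule Lim_transform_eventually)
    qed
  qed
  have Rm: "?R \<in> sets borel" by (intro borel_Times) auto
  define \<Phi> where "\<Phi> x = indicator ?R x *\<^sub>R \<Psi> x" for x
  have \<Phi>m: "\<Phi> \<in> borel_measurable borel" unfolding \<Phi>_def using Rm m by measurable
  have left: "(LINT x:?R|\<mu> L. \<Psi> x) = (LBINT t:{a..b}. \<Psi> (t, Z L t))" for L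
  proof -
    have [measurable]: "(\<lambda>t. \<Psi> (t, Z L t)) \<in> borel_measurable borel"
      using measurable_compose[OF _ m, of "\<lambda>t. (t, Z L t)" borel] mm[of L] measurable_cong_sets[OF sA refl] by blast
    have "(\<lambda>t. \<Phi> (t, Z L t)) \<in> borel_measurable borel"
      using measurable_compose[OF _ \<Phi>m, of "\<lambda>t. (t, Z L t)" borel] mm[of L] measurable_cong_sets[OF sA refl] by blast
    then have "(LINT x:?R|\<mu> L. \<Psi> x) = (LBINT t:{a<..b}. \<Phi> (t, Z L t))"
      unfolding set_lebesgue_integral_def \<Phi>_def[symmetric] \<mu>_def using integral_distr[OF mm \<Phi>m] intA
      by (simp add: set_lebesgue_integral_def)
    also have "\<dots> = (LBINT t:{a<..b}. \<Psi> (t, Z L t))"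
      using Z[of L] by (intro set_lebesgue_integral_cong) (auto simp: \<Phi>_def)
    also have "\<dots> = (LBINT t:{a..b}. \<Psi> (t, Z L t))"
      by (rule set_integral_cong_AE_lborel[of _ _ _ "{a}"]) (auto, measurable)
    finally show ?thesis .
  qed
  have right: "(LINT x:?R|(A \<Otimes>\<^sub>M limit_law). \<Psi> x) = (LBINT t:{a..b}. LBINT u:{0<..1}. \<Psi> (t, u) * limit_density u)"
  proof -
    have "compact ({a..b} \<times> {0..1::real})" by (intro compact_Times) auto
    then have "bounded (\<Psi> ` ({a..b} \<times> {0..1}))" using compact_continuous_image[OF cont] compact_imp_bounded by blast
    then obtain B where B: "\<And>x. x \<in> {a..b} \<times> {0..1} \<Longrightarrow> \<bar>\<Psi> x\<bar> \<le> B" unfolding bounded_iff by (auto simp: image_iff)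
    have "\<bar>\<Phi> (x, u)\<bar> \<le> \<bar>B\<bar>" for x u using B[of "(x, u)"] by (auto simp: \<Phi>_def indicator_def)
    then have "(LINT x:?R|(A \<Otimes>\<^sub>M limit_law). \<Psi> x) = (\<integral>t. (LBINT u:{0<..1}. \<Phi> (t, u) * limit_density u) \<partial>A)"
      unfolding set_lebesgue_integral_def[of "A \<Otimes>\<^sub>M limit_law"] \<Phi>_def[symmetric]
      by (intro pair_limit_law_integral(2)[OF fA sA \<Phi>m, of "\<bar>B\<bar>"]) auto
    also have "\<dots> = (LBINT t:{a<..b}. LBINT u:{0<..1}. \<Phi> (t, u) * limit_density u)"
      using \<Phi>m unfolding set_lebesgue_integral_def borel_prod[symmetric]
      by (subst intA) (auto simp: set_lebesgue_integral_def)
    also have "\<dots> = (LBINT t:{a<..b}. LBINT u:{0<..1}. \<Psi> (t, u) * limit_density u)"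
      by (intro set_lebesgue_integral_cong allI impI) (auto simp: \<Phi>_def)
    also have "\<dots> = (LBINT t:{a..b}. LBINT u:{0<..1}. \<Psi> (t, u) * limit_density u)"
      using m unfolding set_lebesgue_integral_def[of _ "{0<..1}"] borel_prod[symmetric]
      by (intro set_integral_cong_AE_lborel[of _ _ _ "{a}"]) auto
    finally show ?thesis .
  qed
  have "eventually (\<lambda>L. (LBINT t:{a..b}. \<Psi> (t, Z L t)) = (LBINT t:{a..b}. \<Psi> (t, min (scaled_denominator \<kappa> L t) 1))) at_top"
    using eventually_ge_at_top[of 1] by eventually_elim (simp add: Z_def max_absorb1)
  from Lim_transform_eventually[OF lim[unfolded left right] this] show ?thesis .
qed

lemma tan_measurable [measurable]: "(tan :: real \<Rightarrow> real) \<in> borel_measurable borel"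
proof -
  have [measurable]: "cos \<in> borel_measurable (borel :: real measure)" "sin \<in> borel_measurable (borel :: real measure)"
    by (auto intro!: borel_measurable_continuous_onI continuous_intros)
  show ?thesis unfolding tan_def[abs_def] by measurable
qed

text \<open>In the slope \<open>t = tan \<omega>\<close> the integral takes the form of \<open>joint_limit\<close>, the density \<open>1 / (1 + t\<^sup>2)\<close>
being absorbed in the test function.\<close>

theorem law_limit:
  fixes X :: "real \<Rightarrow> real \<Rightarrow> real"
  assumes k: "aperture \<kappa>" "\<And>t. t \<in> {0..1} \<Longrightarrow> \<kappa> t \<le> 2"
    and G: "continuous_on UNIV G" "\<And>t. t \<in> {0..1} \<Longrightarrow> 0 \<le> G t \<and> G t \<le> 2"
    and i: "0 \<le> i0" "i0 < i1" "i1 \<le> pi / 4"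
    and \<phi>: "continuous_on UNIV \<phi>" "bounded (range \<phi>)"
    and Xm: "\<And>\<epsilon>. X \<epsilon> \<in> borel_measurable borel"
    and X: "\<And>\<epsilon> \<omega>. 0 < \<epsilon> \<Longrightarrow> \<epsilon> < 1 / 2 \<Longrightarrow> \<omega> \<in> {i0..i1} \<Longrightarrow> \<bar>X \<epsilon> \<omega> - G (tan \<omega>) * scaled_denominator \<kappa> (1 / \<epsilon>) (tan \<omega>)\<bar> \<le> 3 * \<epsilon>"
  shows "((\<lambda>\<epsilon>. LBINT \<omega>:{i0..i1}. \<phi> (X \<epsilon> \<omega>)) \<longlongrightarrow> (LBINT \<omega>:{i0..i1}. LBINT u:{0<..1}. \<phi> (G (tan \<omega>) * u) * limit_density u)) (at_right (0::real))"
proof -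
  define a b where "a = tan i0" and "b = tan i1"
  have bd: "- (pi / 2) < i0" "i0 < pi / 2" "- (pi / 2) < i1" "i1 < pi / 2" using i pi_gt_zero by linarith+
  have w: "i0 \<in> {0..pi/4}" "i1 \<in> {0..pi/4}" using i by auto
  have ab: "0 \<le> a" "a < b" "b \<le> 1" unfolding a_def b_def
    using direction_bounds[OF w(1)] direction_bounds[OF w(2)] tan_monotone[of i0 i1] bd i by auto
  have at_in: "arctan t \<in> {i0..i1}" if "t \<in> {a..b}" for t
  proof -
    have "arctan a = i0" "arctan b = i1" unfolding a_def b_def using bd by (auto intro: arctan_tan)
    then show ?thesis using that arctan_monotone'[of a t] arctan_monotone'[of t b] by auto
  qed
  have Gm [measurable]: "G \<in> borel_measurable borel" using G(1) by (rule borel_measurable_continuous_onI)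
  have \<phi>m [measurable]: "\<phi> \<in> borel_measurable borel" using \<phi>(1) by (rule borel_measurable_continuous_onI)
  obtain B where B: "\<And>x. \<bar>\<phi> x\<bar> \<le> B" using \<phi>(2) unfolding bounded_iff by auto
  define \<Psi> where "\<Psi> = (\<lambda>x. \<phi> (G (fst x) * snd x) / (1 + (fst x)\<^sup>2))"
  have \<Psi>c: "continuous_on UNIV \<Psi>"
  proof -
    have "continuous_on UNIV (\<lambda>x::real\<times>real. G (fst x) * snd x)"
      by (intro continuous_intros continuous_on_compose2[OF G(1)]) auto
    from continuous_on_compose2[OF \<phi>(1) this]
    have "continuous_on UNIV (\<lambda>x::real\<times>real. \<phi> (G (fst x) * snd x))" by simp
    then show ?thesis unfolding \<Psi>_def
      by (intro continuous_on_divide) (auto simp: add_nonneg_eq_0_iff intro!: continuous_intros)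
  qed
  have \<Psi>m: "\<Psi> \<in> borel_measurable borel" using \<Psi>c by (rule borel_measurable_continuous_onI)
  define W where "W L = (LBINT t:{a..b}. \<Psi> (t, min (scaled_denominator \<kappa> L t) 1))" for L
  have W: "(W \<longlongrightarrow> (LBINT t:{a..b}. LBINT u:{0<..1}. \<Psi> (t, u) * limit_density u)) at_top"
    unfolding W_def by (intro joint_limit k(1) ab \<Psi>m continuous_on_subset[OF \<Psi>c]) auto
  have limit_eq: "(LBINT t:{a..b}. LBINT u:{0<..1}. \<Psi> (t, u) * limit_density u) = (LBINT \<omega>:{i0..i1}. LBINT u:{0<..1}. \<phi> (G (tan \<omega>) * u) * limit_density u)"
  proof -
    define F where "F \<omega> = (LBINT u:{0<..1}. \<phi> (G (tan \<omega>) * u) * limit_density u)" for \<omega>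
    have Fm: "F \<in> borel_measurable borel" unfolding F_def set_lebesgue_integral_def by measurable
    have FB: "\<bar>F \<omega>\<bar> \<le> \<bar>B\<bar>" for \<omega>
    proof -
      interpret D: prob_space limit_law by (rule prob_space_limit_law)
      have m: "(\<lambda>u. \<phi> (G (tan \<omega>) * u)) \<in> borel_measurable borel" by measurable
      have "F \<omega> = (\<integral>u. \<phi> (G (tan \<omega>) * u) \<partial>limit_law)" unfolding F_def using integral_limit_law[OF m] by simp
      also have "\<bar>\<dots>\<bar> \<le> (\<integral>u. \<bar>\<phi> (G (tan \<omega>) * u)\<bar> \<partial>limit_law)" by (rule integral_abs_bound)
      also have "\<dots> \<le> (\<integral>u. \<bar>B\<bar> \<partial>limit_law)"
        using m B by (intro integral_mono D.integrable_const_bound[of _ "\<bar>B\<bar>"]) (auto intro!: AE_I2 order.trans[OF B])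
      finally show ?thesis by simp
    qed
    have "(LBINT \<omega>:{i0..i1}. F \<omega>) = (LBINT t:{a..b}. F (arctan t) / (1 + t\<^sup>2))"
      unfolding a_def b_def using i Fm FB by (intro arctan_substitution(1)) auto
    also have "\<dots> = (LBINT t:{a..b}. LBINT u:{0<..1}. \<Psi> (t, u) * limit_density u)"
    proof (intro set_lebesgue_integral_cong allI impI)
      fix t
      have "(LBINT u:{0<..1}. \<Psi> (t, u) * limit_density u) = (LBINT u:{0<..1}. 1 / (1 + t\<^sup>2) * (\<phi> (G t * u) * limit_density u))"
        by (intro set_lebesgue_integral_cong) (auto simp: \<Psi>_def)
      then show "F (arctan t) / (1 + t\<^sup>2) = (LBINT u:{0<..1}. \<Psi> (t, u) * limit_density u)"
        unfolding F_def by (simp add: tan_arctan)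
    qed simp
    finally show ?thesis unfolding F_def by simp
  qed
  have inv: "filterlim (\<lambda>\<epsilon>::real. 1 / \<epsilon>) at_top (at_right 0)"
    using filterlim_inverse_at_top_right by (simp add: inverse_eq_divide)
  have lim: "((\<lambda>\<epsilon>. W (1 / \<epsilon>)) \<longlongrightarrow> (LBINT \<omega>:{i0..i1}. LBINT u:{0<..1}. \<phi> (G (tan \<omega>) * u) * limit_density u)) (at_right 0)"
    using filterlim_compose[OF W inv] unfolding limit_eq .
  have "((\<lambda>\<epsilon>. (LBINT \<omega>:{i0..i1}. \<phi> (X \<epsilon> \<omega>)) - W (1 / \<epsilon>)) \<longlongrightarrow> 0) (at_right (0::real))"
  proof (rule tendstoI)
    fix e :: real assume e: "e > 0"
    \<comment> \<open>\<open>X\<close> differs by at most \<open>3 * \<epsilon>\<close> from its main term, and the truncation at \<open>1\<close> costs \<open>4 * \<epsilon>\<close>; as the truncated value lies in \<open>{0..2}\<close> and \<open>7 * \<epsilon> < 4\<close>, both arguments of \<open>\<phi>\<close> stay in \<open>{-4..6}\<close>.\<close>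
    have "uniformly_continuous_on {-4..6} \<phi>"
      by (intro compact_uniformly_continuous continuous_on_subset[OF \<phi>(1)]) auto
    then obtain r where r: "r > 0" "\<And>x x'. x \<in> {-4..6} \<Longrightarrow> x' \<in> {-4..6} \<Longrightarrow> dist x' x < r \<Longrightarrow> dist (\<phi> x') (\<phi> x) < e / 2"
      unfolding uniformly_continuous_on_def using e by (metis half_gt_zero)
    have "eventually (\<lambda>\<epsilon>::real. 0 < \<epsilon> \<and> \<epsilon> < min (1 / 2) (r / 7)) (at_right 0)"
      using r(1) by (auto simp: eventually_at_right_field intro!: exI[of _ "min (1 / 2) (r / 7)"])
    then show "eventually (\<lambda>\<epsilon>. dist ((LBINT \<omega>:{i0..i1}. \<phi> (X \<epsilon> \<omega>)) - W (1 / \<epsilon>)) 0 < e) (at_right (0::real))"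
    proof eventually_elim
      case (elim \<epsilon>)
      then have \<epsilon>: "0 < \<epsilon>" "\<epsilon> < 1 / 2" "7 * \<epsilon> < r" by auto
      let ?Z = "\<lambda>t. min (scaled_denominator \<kappa> (1 / \<epsilon>) t) 1"
      have L0: "0 < 1 / \<epsilon>" using \<epsilon> by simp
      have [measurable]: "scaled_denominator \<kappa> (1 / \<epsilon>) \<in> borel_measurable borel" using scaled_denominator_measurable[OF k(1) L0] .
      have Fm: "(\<lambda>\<omega>. \<phi> (X \<epsilon> \<omega>)) \<in> borel_measurable borel" using Xm[of \<epsilon>] by measurable
      have 1: "(LBINT \<omega>:{i0..i1}. \<phi> (X \<epsilon> \<omega>)) = (LBINT t:{a..b}. \<phi> (X \<epsilon> (arctan t)) / (1 + t\<^sup>2))"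
        "set_integrable lborel {a..b} (\<lambda>t. \<phi> (X \<epsilon> (arctan t)) / (1 + t\<^sup>2))"
        unfolding a_def b_def using i Fm B by (intro arctan_substitution[of i0 i1 _ B]; auto)+
      have "(\<lambda>t. \<Psi> (t, ?Z t)) \<in> borel_measurable borel" unfolding \<Psi>_def by measurable
      moreover have "\<bar>\<Psi> x\<bar> \<le> \<bar>B\<bar>" for x
      proof -
        have "\<bar>\<Psi> x\<bar> = \<bar>\<phi> (G (fst x) * snd x)\<bar> / (1 + (fst x)\<^sup>2)" unfolding \<Psi>_def by (simp add: abs_divide)
        also have "\<dots> \<le> \<bar>B\<bar> / 1" using B by (intro frac_le) (auto intro: order.trans[OF B])
        finally show ?thesis by simp
      qed
      ultimately have 2: "set_integrable lborel {a..b} (\<lambda>t. \<Psi> (t, ?Z t))"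
        by (intro set_integrable_bounded[of _ _ _ "\<bar>B\<bar>"]) (auto simp: emeasure_lborel_Icc_eq)
      have "\<bar>(LBINT \<omega>:{i0..i1}. \<phi> (X \<epsilon> \<omega>)) - W (1 / \<epsilon>)\<bar> \<le> e / 2 * (b - a)"
        unfolding 1(1) W_def
      proof (rule set_integral_diff_bound[OF 1(2) 2 less_imp_le[OF ab(2)]])
        fix t assume t: "t \<in> {a..b}"
        have t01: "t \<in> {0..1}" using t ab by auto
        let ?S = "scaled_denominator \<kappa> (1 / \<epsilon>) t"
        have c1: "\<bar>X \<epsilon> (arctan t) - G t * ?S\<bar> \<le> 3 * \<epsilon>" using X[OF \<epsilon>(1,2) at_in[OF t]] by (simp add: tan_arctan)
        have S: "0 < ?S" "?S \<le> 1 + \<kappa> t / (1 / \<epsilon>)" using scaled_denominator_bounds[OF k(1) L0] by auto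
        have "\<kappa> t * \<epsilon> \<le> 2 * \<epsilon>" using k(2)[OF t01] \<epsilon> by (intro mult_right_mono) auto
        then have "?S \<le> 1 + 2 * \<epsilon>" using S(2) by simp
        then have "\<bar>?S - ?Z t\<bar> \<le> 2 * \<epsilon>" using \<epsilon> by (simp add: min_def)
        then have "\<bar>G t * (?S - ?Z t)\<bar> \<le> 2 * (2 * \<epsilon>)" unfolding abs_mult using G(2)[OF t01] by (intro mult_mono) auto
        then have c2: "\<bar>G t * ?S - G t * ?Z t\<bar> \<le> 4 * \<epsilon>" by (simp add: right_diff_distrib)
        have dist: "\<bar>X \<epsilon> (arctan t) - G t * ?Z t\<bar> \<le> 7 * \<epsilon>" using c1 c2 by linarith
        have Z01: "0 \<le> ?Z t" "?Z t \<le> 1" using S(1) by auto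
        have "0 \<le> G t * ?Z t" using G(2)[OF t01] Z01(1) by (intro mult_nonneg_nonneg) auto
        moreover have "G t * ?Z t \<le> 2 * 1" using G(2)[OF t01] Z01 by (intro mult_mono) auto
        ultimately have "0 \<le> G t * ?Z t" "G t * ?Z t \<le> 2" by linarith+
        then have mem: "G t * ?Z t \<in> {-4..6}" "X \<epsilon> (arctan t) \<in> {-4..6}" using dist \<epsilon> by auto
        have "\<bar>\<phi> (X \<epsilon> (arctan t)) - \<phi> (G t * ?Z t)\<bar> < e / 2"
          using r(2)[OF mem] dist \<epsilon> by (simp add: dist_real_def)
        then have "\<bar>\<phi> (X \<epsilon> (arctan t)) - \<phi> (G t * ?Z t)\<bar> / (1 + t\<^sup>2) \<le> (e / 2) / 1" using e by (intro frac_le) auto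
        then show "\<bar>\<phi> (X \<epsilon> (arctan t)) / (1 + t\<^sup>2) - \<Psi> (t, ?Z t)\<bar> \<le> e / 2"
          unfolding \<Psi>_def by (simp add: diff_divide_distrib[symmetric] abs_divide)
      qed
      also have "\<dots> \<le> e / 2 * 1" using e ab by (intro mult_left_mono) auto
      also have "\<dots> < e" using e by simp
      finally show ?case by simp
    qed
  qed
  from tendsto_add[OF this lim] show ?thesis by simp
qed

section \<open>Limit laws of the reflection numbers\<close>

lemma interval_endpoints:
  fixes I :: "real set"
  assumes I: "is_interval I" "I \<subseteq> {0..pi/4}" "0 < measure lborel I"
  obtains i0 i1 where "0 \<le> i0" "i0 < i1" "i1 \<le> pi / 4" "\<And>x. x \<notin> {i0, i1} \<Longrightarrow> x \<in> I \<longleftrightarrow> x \<in> {i0..i1}"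
    "measure lborel I = i1 - i0"
proof -
  have ne: "I \<noteq> {}" using I(3) by auto
  have bd: "bdd_below I" "bdd_above I" by (rule bdd_belowI[of _ 0], use I(2) in auto) (rule bdd_aboveI[of _ "pi/4"], use I(2) in auto)
  define i0 i1 where "i0 = Inf I" and "i1 = Sup I"
  have b: "i0 \<le> x \<and> x \<le> i1" if "x \<in> I" for x unfolding i0_def i1_def using that bd by (auto intro: cInf_lower cSup_upper)
  have "0 \<le> i0" unfolding i0_def by (rule cInf_greatest[OF ne]) (use I(2) in auto)
  moreover have "i1 \<le> pi / 4" unfolding i1_def by (rule cSup_least[OF ne]) (use I(2) in auto)
  ultimately have i: "0 \<le> i0" "i1 \<le> pi / 4" .
  have mem: "x \<in> I \<longleftrightarrow> x \<in> {i0..i1}" if x: "x \<notin> {i0, i1}" for x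
  proof
    assume "x \<in> {i0..i1}"
    then have "Inf I < x" "x < Sup I" using x unfolding i0_def i1_def by auto
    then obtain y z where "y \<in> I" "y < x" "z \<in> I" "x < z" using ne bd by (auto simp: cInf_less_iff less_cSup_iff)
    then show "x \<in> I" using I(1) unfolding is_interval_1 by (meson less_imp_le)
  qed (use b in auto)
  have Ib: "I \<in> sets borel" using I(1) by (rule real_interval_borel_measurable)
  have "i0 \<le> i1" using b ne by force
  have "measure lborel I = measure lborel {i0..i1}"
  proof (rule measure_eq_AE)
    have "AE x in lborel. x \<notin> {i0, i1}" using finite_imp_null_set_lborel[of "{i0, i1}"] by (intro AE_not_in) auto
    then show "AE x in lborel. x \<in> I \<longleftrightarrow> x \<in> {i0..i1}" by eventually_elim (rule mem)
  qed (use Ib in auto)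
  then have m: "measure lborel I = i1 - i0" using \<open>i0 \<le> i1\<close> by simp
  then have "i0 < i1" using I(3) by simp
  then show ?thesis using that[OF i(1) _ i(2) mem m] by blast
qed

text \<open>The law of \<open>g \<omega> * u\<close> for independent \<open>\<omega>\<close> and \<open>u\<close>, the former uniformly distributed on \<open>I\<close> and the
latter distributed according to \<open>limit_law\<close>. Independence makes the moments factorise.\<close>

definition mixture_law :: "real set \<Rightarrow> (real \<Rightarrow> real) \<Rightarrow> real measure" where
  "mixture_law I g = distr (uniform_measure lborel I \<Otimes>\<^sub>M limit_law) borel (\<lambda>x. g (fst x) * snd x)"

context
  fixes I :: "real set"
  assumes I: "is_interval I" "I \<subseteq> {0..pi/4}" "0 < measure lborel I"
begin

lemma interval_borel: "I \<in> sets borel"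
  using I(1) by (rule real_interval_borel_measurable)

lemma interval_emeasure: "emeasure lborel I = ennreal (measure lborel I)"
proof -
  have "emeasure lborel I \<le> emeasure lborel {0..pi/4}" using I(2) by (intro emeasure_mono) auto
  also have "\<dots> < \<infinity>" by (simp add: emeasure_lborel_Icc_eq)
  finally show ?thesis by (intro emeasure_eq_ennreal_measure) simp
qed

lemma prob_space_uniform_interval: "prob_space (uniform_measure lborel I)"
  using I(3) interval_emeasure by (intro prob_space_uniform_measure) auto

lemma integral_uniform_interval:
  fixes f :: "real \<Rightarrow> real"
  assumes f: "f \<in> borel_measurable borel"
  shows "integral\<^sup>L (uniform_measure lborel I) f = 1 / measure lborel I * (LBINT \<omega>:I. f \<omega>)"
proof -
  have d: "indicator I x / emeasure lborel I = ennreal (indicator I x / measure lborel I)" for x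
    unfolding interval_emeasure using I(3) by (auto simp: indicator_def divide_ennreal simp flip: ennreal_1)
  have "integral\<^sup>L (uniform_measure lborel I) f = (\<integral>\<omega>. (indicator I \<omega> / measure lborel I) *\<^sub>R f \<omega> \<partial>lborel)"
    unfolding uniform_measure_def d using f interval_borel by (intro integral_density) auto
  also have "\<dots> = (\<integral>\<omega>. (1 / measure lborel I) * (indicator I \<omega> *\<^sub>R f \<omega>) \<partial>lborel)"
    by (intro Bochner_Integration.integral_cong) auto
  finally show ?thesis unfolding set_lebesgue_integral_def by simp
qed

lemma AE_uniform_interval: "AE \<omega> in uniform_measure lborel I. \<omega> \<in> I"
  using I(3) interval_borel interval_emeasure by (subst AE_uniform_measure) auto

lemma real_distribution_mixture:
  assumes "g \<in> borel_measurable borel" shows "real_distribution (mixture_law I g)"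
proof -
  interpret U: prob_space "uniform_measure lborel I" by (rule prob_space_uniform_interval)
  interpret D: prob_space limit_law by (rule prob_space_limit_law)
  interpret P: pair_prob_space "uniform_measure lborel I" limit_law ..
  have "(\<lambda>x. g (fst x) * snd x) \<in> borel_measurable (uniform_measure lborel I \<Otimes>\<^sub>M limit_law)"
    using assms by measurable
  then interpret M: prob_space "mixture_law I g" unfolding mixture_law_def by (rule P.prob_space_distr)
  show ?thesis by standard (simp add: mixture_law_def)
qed

lemma integral_mixture:
  assumes g: "g \<in> borel_measurable borel" and f: "f \<in> borel_measurable borel"
    and B: "\<And>\<omega> u. \<omega> \<in> I \<Longrightarrow> u \<in> {0<..1} \<Longrightarrow> \<bar>f (g \<omega> * u)\<bar> \<le> B"
  shows "integral\<^sup>L (mixture_law I g) f = 1 / measure lborel I * (LBINT \<omega>:I. LBINT u:{0<..1}. f (g \<omega> * u) * limit_density u)"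
proof -
  interpret U: prob_space "uniform_measure lborel I" by (rule prob_space_uniform_interval)
  have [measurable]: "(\<lambda>x. g (fst x) * snd x) \<in> borel_measurable (uniform_measure lborel I \<Otimes>\<^sub>M limit_law)"
    using g by measurable
  have fm: "(\<lambda>x. f (g (fst x) * snd x)) \<in> borel_measurable borel"
    using f g unfolding borel_prod[symmetric] by measurable
  have "integral\<^sup>L (mixture_law I g) f = (\<integral>x. f (g (fst x) * snd x) \<partial>(uniform_measure lborel I \<Otimes>\<^sub>M limit_law))"
    unfolding mixture_law_def using f by (intro integral_distr) auto
  also have "\<dots> = (\<integral>\<omega>. (LBINT u:{0<..1}. f (g \<omega> * u) * limit_density u) \<partial>uniform_measure lborel I)"
  proof -
    have "AE \<omega> in uniform_measure lborel I. \<forall>u\<in>{0<..1}. \<bar>f (g \<omega> * u)\<bar> \<le> B"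
      using AE_uniform_interval by eventually_elim (use B in blast)
    then show ?thesis using pair_limit_law_integral(2)[OF U.finite_measure_axioms _ fm, of B] by simp
  qed
  also have "\<dots> = 1 / measure lborel I * (LBINT \<omega>:I. LBINT u:{0<..1}. f (g \<omega> * u) * limit_density u)"
  proof (rule integral_uniform_interval)
    note [measurable] = f g
    show "(\<lambda>\<omega>. LBINT u:{0<..1}. f (g \<omega> * u) * limit_density u) \<in> borel_measurable borel"
      unfolding set_lebesgue_integral_def by measurable
  qed
  finally show ?thesis .
qed

lemma mixture_concentrated:
  assumes g: "g \<in> borel_measurable borel" "\<And>\<omega>. \<omega> \<in> I \<Longrightarrow> 0 \<le> g \<omega> \<and> g \<omega> \<le> c"
  shows "measure (mixture_law I g) {0..c} = 1"
proof -
  have "measure (mixture_law I g) {0..c} = integral\<^sup>L (mixture_law I g) (indicator {0..c})"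
    by (simp add: mixture_law_def)
  also have "\<dots> = 1 / measure lborel I * (LBINT \<omega>:I. LBINT u:{0<..1}. indicator {0..c} (g \<omega> * u) * limit_density u)"
    by (intro integral_mixture[of _ _ 1] g(1)) (auto simp: indicator_def)
  also have "(LBINT \<omega>:I. LBINT u:{0<..1}. indicator {0..c} (g \<omega> * u) * limit_density u) = (LBINT \<omega>:I. 1)"
  proof (intro set_lebesgue_integral_cong allI impI)
    fix \<omega> assume w: "\<omega> \<in> I"
    have "(LBINT u:{0<..1}. indicator {0..c} (g \<omega> * u) * limit_density u) = (LBINT u:{0<..1}. limit_density u)"
    proof (intro set_lebesgue_integral_cong allI impI)
      fix u :: real assume u: "u \<in> {0<..1}"
      have "0 \<le> g \<omega> * u" "g \<omega> * u \<le> g \<omega> * 1" using g(2)[OF w] u by (simp, intro mult_left_mono) auto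
      then have "0 \<le> g \<omega> * u" "g \<omega> * u \<le> c" using g(2)[OF w] by linarith+
      then show "indicator {0..c} (g \<omega> * u) * limit_density u = limit_density u" by simp
    qed simp
    then show "(LBINT u:{0<..1}. indicator {0..c} (g \<omega> * u) * limit_density u) = 1"
      using limit_cdf_1 unfolding limit_cdf_def by simp
  qed (use interval_borel in simp)
  also have "(LBINT \<omega>:I. (1::real)) = measure lborel I"
    using interval_borel interval_emeasure by (simp add: set_lebesgue_integral_def)
  finally show ?thesis using I(3) by simp
qed

lemma mixture_moment:
  assumes g: "g \<in> borel_measurable borel" "\<And>\<omega>. \<omega> \<in> I \<Longrightarrow> 0 \<le> g \<omega> \<and> g \<omega> \<le> c" and n: "1 \<le> n"
  shows "(LINT t:{0..}|mixture_law I g. t ^ n) = c_moment n / measure lborel I * (LBINT x:I. g x ^ n)"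
proof -
  have "(LINT t:{0..}|mixture_law I g. t ^ n) = integral\<^sup>L (mixture_law I g) (\<lambda>t. indicator {0..} t *\<^sub>R t ^ n)"
    unfolding set_lebesgue_integral_def ..
  also have "\<dots> = 1 / measure lborel I * (LBINT \<omega>:I. LBINT u:{0<..1}. (indicator {0..} (g \<omega> * u) *\<^sub>R (g \<omega> * u) ^ n) * limit_density u)"
  proof (rule integral_mixture[OF g(1), of _ "c ^ n"])
    show "(\<lambda>t::real. indicator {0..} t *\<^sub>R t ^ n) \<in> borel_measurable borel" by measurable
    fix \<omega> u :: real assume w: "\<omega> \<in> I" and u: "u \<in> {0<..1}"
    have "0 \<le> g \<omega> * u" "g \<omega> * u \<le> g \<omega> * 1" using g(2)[OF w] u by (simp, intro mult_left_mono) auto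
    then have "0 \<le> g \<omega> * u" "g \<omega> * u \<le> c" using g(2)[OF w] by linarith+
    then have "(g \<omega> * u) ^ n \<le> c ^ n" "0 \<le> (g \<omega> * u) ^ n" using power_mono[of "g \<omega> * u" c n] by simp_all
    then show "\<bar>indicator {0..} (g \<omega> * u) *\<^sub>R (g \<omega> * u) ^ n\<bar> \<le> c ^ n"
      using \<open>0 \<le> g \<omega> * u\<close> by (simp only: indicator_simps atLeast_iff scaleR_one abs_of_nonneg)
  qed
  also have "(LBINT \<omega>:I. LBINT u:{0<..1}. (indicator {0..} (g \<omega> * u) *\<^sub>R (g \<omega> * u) ^ n) * limit_density u) = (LBINT \<omega>:I. c_moment n * g \<omega> ^ n)"
  proof (intro set_lebesgue_integral_cong allI impI)
    fix \<omega> assume w: "\<omega> \<in> I"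
    have "(LBINT u:{0<..1}. (indicator {0..} (g \<omega> * u) *\<^sub>R (g \<omega> * u) ^ n) * limit_density u) = (LBINT u:{0<..1}. g \<omega> ^ n * (u ^ n * limit_density u))"
    proof (intro set_lebesgue_integral_cong allI impI)
      fix u :: real assume u: "u \<in> {0<..1}"
      have "0 \<le> g \<omega> * u" using g(2)[OF w] u by auto
      then show "(indicator {0..} (g \<omega> * u) *\<^sub>R (g \<omega> * u) ^ n) * limit_density u = g \<omega> ^ n * (u ^ n * limit_density u)"
        by (simp add: power_mult_distrib)
    qed simp
    then show "(LBINT u:{0<..1}. (indicator {0..} (g \<omega> * u) *\<^sub>R (g \<omega> * u) ^ n) * limit_density u) = c_moment n * g \<omega> ^ n"
      using limit_moment[OF n] by simp
  qed (use interval_borel in simp)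
  finally show ?thesis by simp
qed

text \<open>The two scatterers differ only in the aperture \<open>\<kappa>\<close> and in the factor \<open>G\<close> that converts the scaled
denominator into \<open>\<epsilon>\<close> times the number of reflections.\<close>

lemma weak_convergence_to_mixture:
  fixes R :: "real \<Rightarrow> real \<Rightarrow> nat" and law :: "real \<Rightarrow> real measure"
  assumes k: "aperture \<kappa>" "\<And>t. t \<in> {0..1} \<Longrightarrow> \<kappa> t \<le> 2"
    and G: "continuous_on UNIV G" "\<And>t. t \<in> {0..1} \<Longrightarrow> 0 \<le> G t \<and> G t \<le> 2"
    and g: "g \<in> borel_measurable borel" "\<And>\<omega>. \<omega> \<in> {0..pi/4} \<Longrightarrow> g \<omega> = G (tan \<omega>)"
    and R: "\<And>\<epsilon>. (\<lambda>\<omega>. \<epsilon> * real (R \<epsilon> \<omega>)) \<in> borel_measurable borel"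
    and approx: "\<And>\<epsilon> \<omega>. 0 < \<epsilon> \<Longrightarrow> \<epsilon> < 1 / 2 \<Longrightarrow> \<omega> \<in> {0..pi/4} \<Longrightarrow>
      \<bar>\<epsilon> * real (R \<epsilon> \<omega>) - G (tan \<omega>) * scaled_denominator \<kappa> (1 / \<epsilon>) (tan \<omega>)\<bar> \<le> 3 * \<epsilon>"
    and law: "\<And>\<epsilon> f. 0 \<le> \<epsilon> \<Longrightarrow> f \<in> borel_measurable borel \<Longrightarrow>
      integral\<^sup>L (law \<epsilon>) f = 1 / measure lborel I * (LBINT \<omega>:I. f (\<epsilon> * real (R \<epsilon> \<omega>)))"
  shows "weakly_converges law (mixture_law I g) (at_right 0)"
  unfolding weakly_converges_def
proof (intro allI impI, elim conjE)
  fix f :: "real \<Rightarrow> real" assume f: "continuous_on UNIV f" "bounded (range f)"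
  obtain i0 i1 where i: "0 \<le> i0" "i0 < i1" "i1 \<le> pi / 4" and mem: "\<And>x. x \<notin> {i0, i1} \<Longrightarrow> x \<in> I \<longleftrightarrow> x \<in> {i0..i1}"
    by (rule interval_endpoints[OF I]) (rule that; assumption)
  have fm: "f \<in> borel_measurable borel" using f(1) by (rule borel_measurable_continuous_onI)
  have change: "(LBINT \<omega>:I. h \<omega>) = (LBINT \<omega>:{i0..i1}. h \<omega>)" if "h \<in> borel_measurable borel" for h :: "real \<Rightarrow> real"
    using that interval_borel mem by (intro set_integral_cong_AE_lborel[of _ _ _ "{i0, i1}"]) auto
  have lim: "((\<lambda>\<epsilon>. LBINT \<omega>:{i0..i1}. f (\<epsilon> * real (R \<epsilon> \<omega>))) \<longlongrightarrow> (LBINT \<omega>:{i0..i1}. LBINT u:{0<..1}. f (G (tan \<omega>) * u) * limit_density u)) (at_right 0)"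
    by (rule law_limit[OF k G i f R]) (use approx i in auto)
  obtain B where B: "\<And>x. \<bar>f x\<bar> \<le> B" using f(2) unfolding bounded_iff by auto
  have "(LBINT \<omega>:{i0..i1}. LBINT u:{0<..1}. f (G (tan \<omega>) * u) * limit_density u) = (LBINT \<omega>:{i0..i1}. LBINT u:{0<..1}. f (g \<omega> * u) * limit_density u)"
    using g(2) i by (intro set_lebesgue_integral_cong) auto
  also have "\<dots> = (LBINT \<omega>:I. LBINT u:{0<..1}. f (g \<omega> * u) * limit_density u)"
  proof (rule change[symmetric])
    note [measurable] = fm g(1)
    show "(\<lambda>\<omega>. LBINT u:{0<..1}. f (g \<omega> * u) * limit_density u) \<in> borel_measurable borel"
      unfolding set_lebesgue_integral_def by measurable
  qed
  finally have "integral\<^sup>L (mixture_law I g) f = 1 / measure lborel I * (LBINT \<omega>:{i0..i1}. LBINT u:{0<..1}. f (G (tan \<omega>) * u) * limit_density u)"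
    using integral_mixture[OF g(1) fm, of B] B by simp
  then have lim2: "((\<lambda>\<epsilon>. 1 / measure lborel I * (LBINT \<omega>:{i0..i1}. f (\<epsilon> * real (R \<epsilon> \<omega>)))) \<longlongrightarrow> integral\<^sup>L (mixture_law I g) f) (at_right 0)"
    using tendsto_mult[OF tendsto_const lim, of "1 / measure lborel I"] by simp
  have "eventually (\<lambda>\<epsilon>. 1 / measure lborel I * (LBINT \<omega>:{i0..i1}. f (\<epsilon> * real (R \<epsilon> \<omega>))) = integral\<^sup>L (law \<epsilon>) f) (at_right 0)"
    using eventually_at_right_less[of 0]
  proof eventually_elim
    case (elim \<epsilon>)
    have "(\<lambda>\<omega>. f (\<epsilon> * real (R \<epsilon> \<omega>))) \<in> borel_measurable borel" using fm R[of \<epsilon>] by measurable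
    from change[OF this] show ?case using law[of \<epsilon> f] elim fm by simp
  qed
  from Lim_transform_eventually[OF lim2 this] show "((\<lambda>\<epsilon>. integral\<^sup>L (law \<epsilon>) f) \<longlongrightarrow> integral\<^sup>L (mixture_law I g) f) (at_right 0)" .
qed

lemma cross_law_converges: "weakly_converges (cross_law I) (mixture_law I (\<lambda>\<omega>. 1 + tan \<omega>)) (at_right 0)"
proof (rule weak_convergence_to_mixture[where \<kappa> = "\<lambda>_. 1" and G = "\<lambda>t. 1 + t" and R = cross_reflections])
  show "(\<lambda>\<omega>. \<epsilon> * real (cross_reflections \<epsilon> \<omega>)) \<in> borel_measurable borel" for \<epsilon>
  proof -
    have [measurable]: "cross_reflections \<epsilon> \<in> measurable borel (count_space UNIV)"
      using reflections_measurable[OF closed_cross_scatterer[of \<epsilon>]] by (simp add: cross_reflections_def[abs_def] cross_time_def)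
    show ?thesis by measurable
  qed
  fix \<epsilon> \<omega> :: real assume e: "0 < \<epsilon>" "\<epsilon> < 1 / 2" and w: "\<omega> \<in> {0..pi/4}"
  show "\<bar>\<epsilon> * real (cross_reflections \<epsilon> \<omega>) - (1 + tan \<omega>) * scaled_denominator (\<lambda>_. 1) (1 / \<epsilon>) (tan \<omega>)\<bar> \<le> 3 * \<epsilon>"
    using reflections_approx[OF w e min_denominator_props(1)[OF e(1)] cross_time_approx[OF w e]]
    unfolding cross_reflections_def scaled_denominator_def by simp
qed (use cross_law_properties(3)[OF I] in \<open>auto intro!: aperture_1 continuous_intros\<close>)

lemma circular_law_converges: "weakly_converges (circular_law I) (mixture_law I (\<lambda>\<omega>. sin \<omega> + cos \<omega>)) (at_right 0)"
proof (rule weak_convergence_to_mixture[where \<kappa> = "\<lambda>t. sqrt (1 + t\<^sup>2)" and G = "\<lambda>t. (1 + t) / sqrt (1 + t\<^sup>2)" and R = circular_reflections])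
  have kap: "sqrt (1 + (tan \<omega>)\<^sup>2) = 1 / cos \<omega>" if "\<omega> \<in> {0..pi/4}" for \<omega>
  proof -
    note d = direction_bounds[OF that]
    have "1 + (tan \<omega>)\<^sup>2 = (1 / cos \<omega>)\<^sup>2" using d by (simp add: field_simps)
    then show ?thesis using d by simp
  qed
  show "(\<lambda>\<omega>. \<epsilon> * real (circular_reflections \<epsilon> \<omega>)) \<in> borel_measurable borel" for \<epsilon>
  proof -
    have [measurable]: "circular_reflections \<epsilon> \<in> measurable borel (count_space UNIV)"
      using reflections_measurable[OF closed_circular_scatterer[of \<epsilon>]] by (simp add: circular_reflections_def[abs_def] circular_time_def)
    show ?thesis by measurable
  qed
  fix \<epsilon> \<omega> :: real assume e: "0 < \<epsilon>" "\<epsilon> < 1 / 2" and w: "\<omega> \<in> {0..pi/4}"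
  note d = direction_bounds[OF w]
  have ec: "0 < \<epsilon> / cos \<omega>" using e d by simp
  have "(1 + tan \<omega>) / sqrt (1 + (tan \<omega>)\<^sup>2) * scaled_denominator (\<lambda>t. sqrt (1 + t\<^sup>2)) (1 / \<epsilon>) (tan \<omega>)
      = (1 + tan \<omega>) * (\<epsilon> * min_denominator (\<epsilon> / cos \<omega>) (tan \<omega>))"
    unfolding scaled_denominator_def kap[OF w] using d by simp
  then show "\<bar>\<epsilon> * real (circular_reflections \<epsilon> \<omega>) - (1 + tan \<omega>) / sqrt (1 + (tan \<omega>)\<^sup>2) * scaled_denominator (\<lambda>t. sqrt (1 + t\<^sup>2)) (1 / \<epsilon>) (tan \<omega>)\<bar> \<le> 3 * \<epsilon>"
    using reflections_approx[OF w e min_denominator_props(1)[OF ec] circular_time_approx[OF w e]]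
    unfolding circular_reflections_def by simp
next
  show "continuous_on UNIV (\<lambda>t::real. (1 + t) / sqrt (1 + t\<^sup>2))"
    by (intro continuous_intros) (auto simp: add_nonneg_eq_0_iff)
  fix t :: real assume t: "t \<in> {0..1}"
  have "t\<^sup>2 \<le> 1" using t by (intro power_le_one) auto
  then have "sqrt (1 + t\<^sup>2) \<le> sqrt 4" by (intro real_sqrt_le_mono) auto
  then show "sqrt (1 + t\<^sup>2) \<le> 2" by simp
  have "1 \<le> sqrt (1 + t\<^sup>2)" by simp
  then have "(1 + t) / sqrt (1 + t\<^sup>2) \<le> 2 / 1" using t by (intro frac_le) auto
  then show "0 \<le> (1 + t) / sqrt (1 + t\<^sup>2) \<and> (1 + t) / sqrt (1 + t\<^sup>2) \<le> 2" using t by simp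
next
  fix \<omega> :: real assume w: "\<omega> \<in> {0..pi/4}"
  note d = direction_bounds[OF w]
  have "1 + (tan \<omega>)\<^sup>2 = (1 / cos \<omega>)\<^sup>2" using d by (simp add: field_simps)
  then have "sqrt (1 + (tan \<omega>)\<^sup>2) = 1 / cos \<omega>" using d by simp
  then show "sin \<omega> + cos \<omega> = (1 + tan \<omega>) / sqrt (1 + (tan \<omega>)\<^sup>2)" using d by (simp add: algebra_simps)
next
  show "(\<lambda>\<omega>::real. sin \<omega> + cos \<omega>) \<in> borel_measurable borel"
    by (intro borel_measurable_continuous_onI continuous_intros)
qed (use circular_law_properties(3)[OF I] in \<open>auto intro!: aperture_sqrt\<close>)

end

lemma sin_plus_cos_bounds:
  assumes "\<omega> \<in> {0..pi/4}" shows "0 \<le> sin \<omega> + cos \<omega>" "sin \<omega> + cos \<omega> \<le> sqrt 2"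
proof -
  note d = direction_bounds[OF assms]
  show "0 \<le> sin \<omega> + cos \<omega>" unfolding d(4) using d by simp
  have "(sin \<omega> + cos \<omega>)\<^sup>2 + (sin \<omega> - cos \<omega>)\<^sup>2 = 2 * ((sin \<omega>)\<^sup>2 + (cos \<omega>)\<^sup>2)" by (simp add: power2_eq_square algebra_simps)
  then have "(sin \<omega> + cos \<omega>)\<^sup>2 + (sin \<omega> - cos \<omega>)\<^sup>2 = 2" by simp
  then have "(sin \<omega> + cos \<omega>)\<^sup>2 \<le> 2" using zero_le_power2[of "sin \<omega> - cos \<omega>"] by linarith
  then show "sin \<omega> + cos \<omega> \<le> sqrt 2" by (rule real_le_rsqrt)
qed

text \<open>\<open>tan (2 * \<omega>) \<le> 1\<close> and the formula for the double angle give \<open>2 * t \<le> 1 - t\<^sup>2\<close> for \<open>t = tan \<omega>\<close>, that is,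
\<open>(1 + t)\<^sup>2 \<le> 2\<close>.\<close>

lemma one_plus_tan_le_sqrt2:
  assumes w: "\<omega> \<in> {0..pi/8}" shows "1 + tan \<omega> \<le> sqrt 2"
proof -
  have wb: "0 \<le> \<omega>" "\<omega> \<le> pi / 8" using w by auto
  have "\<omega> \<le> pi / 4" using wb pi_gt_zero by linarith
  then have 1: "\<omega> \<in> {0..pi/4}" "2 * \<omega> \<in> {0..pi/4}" using wb by simp_all
  note d = direction_bounds[OF 1(1)] and d2 = direction_bounds[OF 1(2)]
  have "\<omega> < pi / 4" using wb pi_gt_zero by linarith
  moreover have "- (pi / 2) < \<omega>" "pi / 4 < pi / 2" using wb pi_gt_zero by linarith+
  ultimately have t1: "tan \<omega> < 1" using tan_monotone[of \<omega> "pi / 4"] tan_45 by simp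
  have "tan (2 * \<omega>) = 2 * tan \<omega> / (1 - (tan \<omega>)\<^sup>2)" using d d2 by (intro tan_double) auto
  moreover have pos: "0 < 1 - (tan \<omega>)\<^sup>2" using t1 d by (simp add: power_less_one_iff abs_square_less_1)
  ultimately have "2 * tan \<omega> \<le> 1 - (tan \<omega>)\<^sup>2" using d2(3) by (simp only: pos_divide_le_eq) simp
  then have "(1 + tan \<omega>)\<^sup>2 \<le> 2" by (simp add: power2_eq_square algebra_simps)
  then show ?thesis by (rule real_le_rsqrt)
qed

theorem corollary1p6:
  fixes I :: "real set"
  assumes "is_interval I" and "I \<subseteq> {0..pi/4}" and "0 < measure lborel I"
  shows "\<exists>\<nu>circ \<nu>cross :: real measure.
    real_distribution \<nu>circ \<and> measure \<nu>circ {0..sqrt 2} = 1 \<and>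
    real_distribution \<nu>cross \<and> measure \<nu>cross {0..2} = 1 \<and>
    (I \<subseteq> {0..pi/8} \<longrightarrow> measure \<nu>cross {0..sqrt 2} = 1) \<and>
    weakly_converges (circular_law I) \<nu>circ (at_right 0) \<and>
    weakly_converges (cross_law I) \<nu>cross (at_right 0) \<and>
    (\<forall>n\<ge>1.
      (LINT t:{0..}|\<nu>circ. t ^ n)
        = c_moment n / measure lborel I * (LBINT x:I. (sin x + cos x) ^ n) \<and>
      (LINT t:{0..}|\<nu>cross. t ^ n)
        = c_moment n / measure lborel I * (LBINT x:I. (1 + tan x) ^ n))"
proof -
  have m1: "(\<lambda>\<omega>::real. sin \<omega> + cos \<omega>) \<in> borel_measurable borel"
    by (intro borel_measurable_continuous_onI continuous_intros)
  have m2: "(\<lambda>\<omega>::real. 1 + tan \<omega>) \<in> borel_measurable borel" by measurable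
  have b1: "0 \<le> sin \<omega> + cos \<omega> \<and> sin \<omega> + cos \<omega> \<le> sqrt 2" if "\<omega> \<in> I" for \<omega>
    using sin_plus_cos_bounds[of \<omega>] that assms(2) by auto
  have b2: "0 \<le> 1 + tan \<omega> \<and> 1 + tan \<omega> \<le> 2" if "\<omega> \<in> I" for \<omega>
  proof -
    have "\<omega> \<in> {0..pi/4}" using that assms(2) by blast
    from direction_bounds(2,3)[OF this] show ?thesis by simp
  qed
  have b3: "0 \<le> 1 + tan \<omega> \<and> 1 + tan \<omega> \<le> sqrt 2" if "\<omega> \<in> I" "I \<subseteq> {0..pi/8}" for \<omega>
    using one_plus_tan_le_sqrt2[of \<omega>] b2[OF that(1)] that by auto
  show ?thesis
  proof (rule exI[of _ "mixture_law I (\<lambda>\<omega>. sin \<omega> + cos \<omega>)"], rule exI[of _ "mixture_law I (\<lambda>\<omega>. 1 + tan \<omega>)"], intro conjI allI impI)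
    show "real_distribution (mixture_law I (\<lambda>\<omega>. sin \<omega> + cos \<omega>))" "real_distribution (mixture_law I (\<lambda>\<omega>. 1 + tan \<omega>))"
      by (rule real_distribution_mixture[OF assms]; fact)+
    show "measure (mixture_law I (\<lambda>\<omega>. sin \<omega> + cos \<omega>)) {0..sqrt 2} = 1"
      by (rule mixture_concentrated[OF assms m1 b1])
    show "measure (mixture_law I (\<lambda>\<omega>. 1 + tan \<omega>)) {0..2} = 1"
      by (rule mixture_concentrated[OF assms m2 b2])
    show "measure (mixture_law I (\<lambda>\<omega>. 1 + tan \<omega>)) {0..sqrt 2} = 1" if "I \<subseteq> {0..pi/8}"
      by (rule mixture_concentrated[OF assms m2 b3[OF _ that]])
    show "weakly_converges (circular_law I) (mixture_law I (\<lambda>\<omega>. sin \<omega> + cos \<omega>)) (at_right 0)"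
      by (rule circular_law_converges[OF assms])
    show "weakly_converges (cross_law I) (mixture_law I (\<lambda>\<omega>. 1 + tan \<omega>)) (at_right 0)"
      by (rule cross_law_converges[OF assms])
    fix n :: nat assume n: "1 \<le> n"
    show "(LINT t:{0..}|mixture_law I (\<lambda>\<omega>. sin \<omega> + cos \<omega>). t ^ n) = c_moment n / measure lborel I * (LBINT x:I. (sin x + cos x) ^ n)"
      by (rule mixture_moment[OF assms m1 b1 n])
    show "(LINT t:{0..}|mixture_law I (\<lambda>\<omega>. 1 + tan \<omega>). t ^ n) = c_moment n / measure lborel I * (LBINT x:I. (1 + tan x) ^ n)"
      by (rule mixture_moment[OF assms m2 b2 n])
  qed
qed

end
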